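(* Let $L>0$, $c\in\mathbb{R}$, let $\beta\in L^\infty(0,L)$ be real-valued, and consider the control system $\dot{\mathcal X}(t)=\mathcal A\mathcal X(t)+\mathcal Bu(t)$, $\mathcal X=(y,z,\partial_tz)^\top$, associated with the wave--heat cascade $$\partial_t y=\partial_{xx}y+c\,y+\beta(x)z,\quad \partial_{tt}z=\partial_{xx}z\ \text{ on }(0,L),\qquad y(t,0)=y(t,L)=0,\ z(t,0)=0,\ \partial_xz(t,L)=u(t).$$ Assume that $\gamma_n\ne0$ for every $n\in\mathbb N^*$ and let $T>2L$. Then the semigroup $T_0(t)$ generated by $\mathcal A$ restricts to a bounded operator on $V$ for every $t\ge0$. However, for any fixed $t\in(0,T)$, there exist $\mathcal X_0,\mathcal X_1\in V$ such that the HUM trajectory steering $\mathcal X_0$ to $\mathcal X_1$ in time $T$ is not in $V$ at time $t$.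
   Context: All function spaces are complex-valued. $H^1_{(0)}(0,L)=\{g\in H^1(0,L): g(0)=0\}$. $\mathcal H=L^2(0,L)\times H^1_{(0)}(0,L)\times L^2(0,L)$ with inner product $\langle(f_1,g_1,h_1),(f_2,g_2,h_2)\rangle=\int_0^L(f_1\overline{f_2}+g_1'\overline{g_2'}+h_1\overline{h_2})\,dx$. Operator: $\mathcal A(f,g,h)=(f''+cf+\beta g,\ h,\ g'')$ on $D(\mathcal A)=\{(f,g,h)\in H^2\times H^2\times H^1: f(0)=f(L)=g(0)=g'(L)=h(0)=0\}$; it generates a $C_0$-semigroup $T_0(t)$ on $\mathcal H$, and $D(\mathcal A^* )=D(\mathcal A)$. $\mathcal B\in L(\mathbb C,D(\mathcal A^* )')$ is defined by transposition through $\mathcal B^*(\psi_1,\psi_2,\psi_3)^\top=\psi_3(L)$ on $D(\mathcal A^* )$; it is admissible, so that for $\mathcal X_0\in\mathcal H$, $u\in L^2(0,T)$ the mild solution $\mathcal X(t)=T_0(t)\mathcal X_0+\int_0^tT_0(t-s)\mathcal Bu(s)\,ds$ belongs to $\mathcal H$ for all $t\in[0,T]$. Eigenstructure: the eigenvalues of $\mathcal A$ are $\lambda_{1,n}=c-\frac{n^2\pi^2}{L^2}$ ($n\in\mathbb N^*=\{1,2,\dots\}$) and $\lambda_{2,m}=i\frac{(2m+1)\pi}{2L}$ ($m\in\mathbb Z$), with eigenvectors $\phi_{1,n}=(\sqrt{2/L}\sin(n\pi x/L),0,0)$ and $\phi_{2,m}=(\phi^1_{2,m},\phi^2_{2,m},\phi^3_{2,m})$,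 where $\phi^2_{2,m}(x)=\frac{2\sqrt L}{|2m+1|\pi}\sinh(\lambda_{2,m}x)$, $\phi^3_{2,m}=\lambda_{2,m}\phi^2_{2,m}$, and $\phi^1_{2,m}\in H^2(0,L)$ is the unique solution of $(\lambda_{2,m}-c)\phi^1_{2,m}-(\phi^1_{2,m})''=\beta\phi^2_{2,m}$, $\phi^1_{2,m}(0)=\phi^1_{2,m}(L)=0$. The family $\{\phi_{1,n}\}\cup\{\phi_{2,m}\}$ is a Riesz basis of $\mathcal H$. Coupling coefficients: $\gamma_n=\int_0^L\beta(s)\sin(\frac{n\pi}{L}s)\sinh(\lambda_{1,n}s)\,ds$ if $\lambda_{1,n}\ne0$, and $\gamma_n=\int_0^L\beta(s)\sin(\frac{n\pi}{L}s)\,s\,ds$ if $\lambda_{1,n}=0$. Space $V$: with $\nu=\frac{2\pi^2}{L}(1+\frac TL)$, $V$ is the Hilbert space of $\sum_{n\ge1}a_n\phi_{1,n}+\sum_{m\in\mathbb Z}b_m\phi_{2,m}$ ($a_n,b_m\in\mathbb C$) with squared norm $\sum_{n\ge1}\frac{n^4}{\gamma_n^2}e^{\nu n^2}|a_n|^2+\sum_{m\in\mathbb Z}|b_m|^2<\infty$; $V\subset\mathcal H$ continuously and densely. Under the assumptions, any $\mathcal X_0\in V$ can be steered to any $\mathcal X_1\in V$ in time $T$ by some $u\in L^2(0,T)$. The HUM trajectory steering $\mathcal X_0$ to $\mathcal X_1$ in time $T$ is the trajectory starting at $\mathcal X_0$ generated by the (unique) control of minimal $L^2(0,T)$ norm among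 all controls steering $\mathcal X_0$ to $\mathcal X_1$ in time $T$. *)

theory Defs
  imports "HOL-Analysis.Analysis" "HOL-Library.Function_Algebras"
begin

text \<open>
  Elements of \<open>L\<^sup>2(0,L)\<close> are represented by functions, two of them being identified when they
  agree almost everywhere; elements of \<open>H\<^sup>1(0,L)\<close> and \<open>H\<^sup>2(0,L)\<close> are represented by their
  continuous representative on \<open>[0,L]\<close>, so that boundary values are plain evaluations.
  Values outside \<open>[0,L]\<close> are irrelevant.
\<close>

definition L2 :: "real \<Rightarrow> (real \<Rightarrow> complex) set" where
  "L2 L = {f. f \<in> borel_measurable (lebesgue_on {0..L}) \<and>
              integrable (lebesgue_on {0..L}) (\<lambda>x. (cmod (f x))\<^sup>2)}"

definition L2_norm :: "real \<Rightarrow> (real \<Rightarrow> complex) \<Rightarrow> real" where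
  "L2_norm L f = sqrt (LINT x|lebesgue_on {0..L}. (cmod (f x))\<^sup>2)"

definition Linfty :: "real \<Rightarrow> (real \<Rightarrow> real) set" where
  "Linfty L = {b. b \<in> borel_measurable (lebesgue_on {0..L}) \<and>
                  (\<exists>M. AE x in lebesgue_on {0..L}. \<bar>b x\<bar> \<le> M)}"

text \<open>
  In dimension one, \<open>g\<close> has weak derivative \<open>d \<in> L\<^sup>2(0,L)\<close> iff (the continuous representative of)
  \<open>g\<close> is a primitive of \<open>d\<close>. Such a \<open>d\<close> is unique up to a null set.
\<close>

definition has_weak_deriv :: "real \<Rightarrow> (real \<Rightarrow> complex) \<Rightarrow> (real \<Rightarrow> complex) \<Rightarrow> bool" where
  "has_weak_deriv L g d \<longleftrightarrow>
     d \<in> L2 L \<and> (\<forall>x\<in>{0..L}. g x = g 0 + (LINT s|lebesgue_on {0..x}. d s))"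

definition weak_deriv :: "real \<Rightarrow> (real \<Rightarrow> complex) \<Rightarrow> (real \<Rightarrow> complex)" where
  "weak_deriv L g = (SOME d. has_weak_deriv L g d)"

definition H1 :: "real \<Rightarrow> (real \<Rightarrow> complex) set" where
  "H1 L = {g. \<exists>d. has_weak_deriv L g d}"

definition H1_0 :: "real \<Rightarrow> (real \<Rightarrow> complex) set" where
  "H1_0 L = {g \<in> H1 L. g 0 = 0}"

definition H2 :: "real \<Rightarrow> (real \<Rightarrow> complex) set" where
  "H2 L = {g. \<exists>d\<in>H1 L. has_weak_deriv L g d}"

definition weak_deriv2 :: "real \<Rightarrow> (real \<Rightarrow> complex) \<Rightarrow> (real \<Rightarrow> complex)" where
  "weak_deriv2 L g = (SOME e. \<exists>d. has_weak_deriv L g d \<and> has_weak_deriv L d e)"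

type_synonym state = "(real \<Rightarrow> complex) \<times> (real \<Rightarrow> complex) \<times> (real \<Rightarrow> complex)"

definition smul :: "complex \<Rightarrow> state \<Rightarrow> state" where
  "smul a = (\<lambda>(f, g, h). (\<lambda>x. a * f x, \<lambda>x. a * g x, \<lambda>x. a * h x))"

definition HH :: "real \<Rightarrow> state set" where
  "HH L = L2 L \<times> H1_0 L \<times> L2 L"

definition ip :: "real \<Rightarrow> state \<Rightarrow> state \<Rightarrow> complex" where
  "ip L = (\<lambda>(f1, g1, h1) (f2, g2, h2).
     LINT x|lebesgue_on {0..L}. f1 x * cnj (f2 x)
        + weak_deriv L g1 x * cnj (weak_deriv L g2 x) + h1 x * cnj (h2 x))"

definition Hnorm :: "real \<Rightarrow> state \<Rightarrow> real" where
  "Hnorm L X = sqrt (Re (ip L X X))"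

text \<open>Equality of states as elements of the Hilbert space, i.e. of the represented classes.\<close>

definition Heq :: "real \<Rightarrow> state \<Rightarrow> state \<Rightarrow> bool" where
  "Heq L X Y \<longleftrightarrow> Hnorm L (X - Y) = 0"

text \<open>
  For \<open>g \<in> H\<^sup>2(0,L)\<close>, which is of class \<open>C\<^sup>1\<close> on \<open>[0,L]\<close>, the trace \<open>g'(L)\<close> is the one-sided
  classical derivative.
\<close>

definition dom_A :: "real \<Rightarrow> state set" where
  "dom_A L = {(f, g, h). f \<in> H2 L \<and> g \<in> H2 L \<and> h \<in> H1 L \<and> f 0 = 0 \<and> f L = 0 \<and> g 0 = 0 \<and>
                vector_derivative g (at L within {0..L}) = 0 \<and> h 0 = 0}"

definition op_A :: "real \<Rightarrow> real \<Rightarrow> (real \<Rightarrow> real) \<Rightarrow> state \<Rightarrow> state" where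
  "op_A L c \<beta> = (\<lambda>(f, g, h).
     (\<lambda>x. weak_deriv2 L f x + of_real c * f x + of_real (\<beta> x) * g x, h, weak_deriv2 L g))"

definition C0_semigroup :: "real \<Rightarrow> (real \<Rightarrow> state \<Rightarrow> state) \<Rightarrow> bool" where
  "C0_semigroup L S \<longleftrightarrow>
     (\<forall>t\<ge>0. \<forall>X\<in>HH L. S t X \<in> HH L) \<and>
     (\<forall>t\<ge>0. \<forall>X\<in>HH L. \<forall>Y\<in>HH L. \<forall>a b.
        Heq L (S t (smul a X + smul b Y)) (smul a (S t X) + smul b (S t Y))) \<and>
     (\<forall>t\<ge>0. \<exists>M. \<forall>X\<in>HH L. Hnorm L (S t X) \<le> M * Hnorm L X) \<and>
     (\<forall>X\<in>HH L. Heq L (S 0 X) X) \<and>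
     (\<forall>s\<ge>0. \<forall>t\<ge>0. \<forall>X\<in>HH L. Heq L (S (s + t) X) (S s (S t X))) \<and>
     (\<forall>X\<in>HH L. ((\<lambda>t. Hnorm L (S t X - X)) \<longlongrightarrow> 0) (at_right 0))"

text \<open>
  The graph of the infinitesimal generator of \<open>S\<close> is the graph of the operator \<open>A\<close>
  with domain \<open>D\<close>, up to the identification of representatives.
\<close>

definition has_generator ::
  "real \<Rightarrow> (real \<Rightarrow> state \<Rightarrow> state) \<Rightarrow> state set \<Rightarrow> (state \<Rightarrow> state) \<Rightarrow> bool" where
  "has_generator L S D A \<longleftrightarrow>
     (\<forall>X\<in>HH L. \<forall>Y\<in>HH L.
        ((\<lambda>t. Hnorm L (smul (of_real (1 / t)) (S t X - X) - Y)) \<longlongrightarrow> 0) (at_right 0)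
        \<longleftrightarrow> (\<exists>X'\<in>D. Heq L X X' \<and> Heq L Y (A X')))"

definition generates ::
  "real \<Rightarrow> state set \<Rightarrow> (state \<Rightarrow> state) \<Rightarrow> (real \<Rightarrow> state \<Rightarrow> state) \<Rightarrow> bool" where
  "generates L D A S \<longleftrightarrow> C0_semigroup L S \<and> has_generator L S D A"

definition adj :: "real \<Rightarrow> (state \<Rightarrow> state) \<Rightarrow> state \<Rightarrow> state" where
  "adj L R Y = (SOME Z. Z \<in> HH L \<and> (\<forall>X\<in>HH L. ip L (R X) Y = ip L X Z))"

text \<open>
  \<open>B_star\<close> is the trace at \<open>L\<close> of the third component, taken on its continuous representative
  (adjoint semigroup orbits are only known up to null sets).
\<close>

definition B_star :: "real \<Rightarrow> state \<Rightarrow> complex" where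
  "B_star L X =
     (THE v. \<exists>h\<in>H1 L. (AE x in lebesgue_on {0..L}. h x = snd (snd X) x) \<and> v = h L)"

text \<open>
  \<open>mild_solution L S X0 u t X\<close>: the mild solution at time \<open>t\<close>, an element of \<open>D(A*)'\<close> given by
  \<open>S(t) X0\<close> plus the integral of \<open>S(t-s) B u(s)\<close> over \<open>[0,t]\<close>, is the element \<open>X\<close> of the state
  space. Both sides are tested against \<open>D(A*)\<close>, which equals \<open>D(A)\<close>, with
  \<open>\<langle>S(t-s) B v, \<psi>\<rangle> = v \<cdot> cnj (B* S(t-s)* \<psi>)\<close>.
\<close>

definition mild_solution ::
  "real \<Rightarrow> (real \<Rightarrow> state \<Rightarrow> state) \<Rightarrow> state \<Rightarrow> (real \<Rightarrow> complex) \<Rightarrow> real \<Rightarrow> state \<Rightarrow> bool" where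
  "mild_solution L S X0 u t X \<longleftrightarrow>
     X \<in> HH L \<and>
     (\<forall>\<psi>\<in>dom_A L. ip L X \<psi> = ip L (S t X0) \<psi>
        + (LINT s|lebesgue_on {0..t}. u s * cnj (B_star L (adj L (S (t - s)) \<psi>))))"

definition steers ::
  "real \<Rightarrow> (real \<Rightarrow> state \<Rightarrow> state) \<Rightarrow> real \<Rightarrow> state \<Rightarrow> state \<Rightarrow> (real \<Rightarrow> complex) \<Rightarrow> bool" where
  "steers L S T X0 X1 u \<longleftrightarrow> u \<in> L2 T \<and> mild_solution L S X0 u T X1"

definition HUM_control ::
  "real \<Rightarrow> (real \<Rightarrow> state \<Rightarrow> state) \<Rightarrow> real \<Rightarrow> state \<Rightarrow> state \<Rightarrow> (real \<Rightarrow> complex) \<Rightarrow> bool" where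
  "HUM_control L S T X0 X1 u \<longleftrightarrow>
     steers L S T X0 X1 u \<and> (\<forall>v. steers L S T X0 X1 v \<longrightarrow> L2_norm T u \<le> L2_norm T v)"

definition HUM_trajectory_at ::
  "real \<Rightarrow> (real \<Rightarrow> state \<Rightarrow> state) \<Rightarrow> real \<Rightarrow> state \<Rightarrow> state \<Rightarrow> real \<Rightarrow> state \<Rightarrow> bool" where
  "HUM_trajectory_at L S T X0 X1 t X \<longleftrightarrow>
     (\<exists>u. HUM_control L S T X0 X1 u \<and> mild_solution L S X0 u t X)"

definition lam1 :: "real \<Rightarrow> real \<Rightarrow> nat \<Rightarrow> real" where
  "lam1 L c n = c - (real n)\<^sup>2 * pi\<^sup>2 / L\<^sup>2"

definition lam2 :: "real \<Rightarrow> int \<Rightarrow> complex" where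
  "lam2 L m = \<i> * of_real ((2 * real_of_int m + 1) * pi / (2 * L))"

definition phi1 :: "real \<Rightarrow> nat \<Rightarrow> state" where
  "phi1 L n = (\<lambda>x. of_real (sqrt (2 / L) * sin (real n * pi * x / L)), \<lambda>x. 0, \<lambda>x. 0)"

definition phi2_2 :: "real \<Rightarrow> int \<Rightarrow> real \<Rightarrow> complex" where
  "phi2_2 L m x =
     of_real (2 * sqrt L / (\<bar>2 * real_of_int m + 1\<bar> * pi)) * sinh (lam2 L m * of_real x)"

definition phi2_1 :: "real \<Rightarrow> real \<Rightarrow> (real \<Rightarrow> real) \<Rightarrow> int \<Rightarrow> real \<Rightarrow> complex" where
  "phi2_1 L c \<beta> m = (SOME f. f \<in> H2 L \<and> f 0 = 0 \<and> f L = 0 \<and>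
     (AE x in lebesgue_on {0..L}.
        (lam2 L m - of_real c) * f x - weak_deriv2 L f x = of_real (\<beta> x) * phi2_2 L m x))"

definition phi2 :: "real \<Rightarrow> real \<Rightarrow> (real \<Rightarrow> real) \<Rightarrow> int \<Rightarrow> state" where
  "phi2 L c \<beta> m = (phi2_1 L c \<beta> m, phi2_2 L m, \<lambda>x. lam2 L m * phi2_2 L m x)"

definition gam :: "real \<Rightarrow> real \<Rightarrow> (real \<Rightarrow> real) \<Rightarrow> nat \<Rightarrow> real" where
  "gam L c \<beta> n =
     (if lam1 L c n \<noteq> 0
      then LINT s|lebesgue_on {0..L}. \<beta> s * sin (real n * pi / L * s) * sinh (lam1 L c n * s)
      else LINT s|lebesgue_on {0..L}. \<beta> s * sin (real n * pi / L * s) * s)"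

definition nu :: "real \<Rightarrow> real \<Rightarrow> real" where
  "nu L T = 2 * pi\<^sup>2 / L * (1 + T / L)"

text \<open>\<open>Inl n\<close> indexes the parabolic mode \<open>n \<ge> 1\<close>, \<open>Inr m\<close> the hyperbolic mode \<open>m\<close>.\<close>

definition modes :: "(nat + int) set" where
  "modes = {1..} <+> UNIV"

definition phi :: "real \<Rightarrow> real \<Rightarrow> (real \<Rightarrow> real) \<Rightarrow> nat + int \<Rightarrow> state" where
  "phi L c \<beta> = case_sum (phi1 L) (phi2 L c \<beta>)"

definition V_weight :: "real \<Rightarrow> real \<Rightarrow> (real \<Rightarrow> real) \<Rightarrow> real \<Rightarrow> nat + int \<Rightarrow> real" where
  "V_weight L c \<beta> T =
     case_sum (\<lambda>n. real n ^ 4 / (gam L c \<beta> n)\<^sup>2 * exp (nu L T * (real n)\<^sup>2)) (\<lambda>m. 1)"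

definition has_expansion ::
  "real \<Rightarrow> real \<Rightarrow> (real \<Rightarrow> real) \<Rightarrow> state \<Rightarrow> (nat + int \<Rightarrow> complex) \<Rightarrow> bool" where
  "has_expansion L c \<beta> X a \<longleftrightarrow>
     ((\<lambda>F. Hnorm L (X - (\<Sum>j\<in>F. smul (a j) (phi L c \<beta> j)))) \<longlongrightarrow> 0)
       (finite_subsets_at_top modes)"

definition V :: "real \<Rightarrow> real \<Rightarrow> (real \<Rightarrow> real) \<Rightarrow> real \<Rightarrow> state set" where
  "V L c \<beta> T = {X \<in> HH L. \<exists>a. has_expansion L c \<beta> X a \<and>
     (\<lambda>j. V_weight L c \<beta> T j * (cmod (a j))\<^sup>2) summable_on modes}"

text \<open>
  The eigenvectors form a Riesz basis, so the coefficients of a state are unique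
  and the choice below is immaterial.
\<close>

definition coeffs_of ::
  "real \<Rightarrow> real \<Rightarrow> (real \<Rightarrow> real) \<Rightarrow> state \<Rightarrow> nat + int \<Rightarrow> complex" where
  "coeffs_of L c \<beta> X = (SOME a. has_expansion L c \<beta> X a)"

definition V_norm :: "real \<Rightarrow> real \<Rightarrow> (real \<Rightarrow> real) \<Rightarrow> real \<Rightarrow> state \<Rightarrow> real" where
  "V_norm L c \<beta> T X =
     sqrt (\<Sum>\<^sub>\<infinity>j\<in>modes. V_weight L c \<beta> T j * (cmod (coeffs_of L c \<beta> X j))\<^sup>2)"

end

theory Submission imports Defs "HOL-Complex_Analysis.Complex_Analysis" "HOL-Real_Asymp.Real_Asymp"
begin

text \<open>
  All coefficients of a state in the Riesz basis evolve by \<open>exp (\<lambda>\<^sub>j t)\<close> with \<open>Re \<lambda>\<^sub>j \<le> \<bar>c\<bar>\<close>, so the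
  semigroup preserves every weighted coefficient space.

  Started at \<open>0\<close>, the coefficient \<open>j\<close> at time \<open>t\<close> is a boundary trace times the moment
  \<open>\<integral>\<^sub>0\<^sup>t u(s) exp (\<lambda>\<^sub>j (t - s)) ds\<close>; in the parabolic modes the norm of \<open>V\<close> weighs this moment by
  \<open>exp (p\<^sub>n T)\<close>, \<open>p\<^sub>n = - \<lambda>\<^sub>1\<^sub>,\<^sub>n\<close>. A control that
  reaches \<open>V\<close> at time \<open>T\<close> is built in reversed time \<open>x = T - s\<close> as \<open>U(x) = w(x) - exp (- p\<^sub>N x)\<close>, where
  \<open>w(x + 2 L) = - w(x)\<close>: such a \<open>U\<close> lies in the closed span of the exponentials \<open>exp (\<lambda>\<^sub>j x)\<close>, whence it
  has minimal norm, since all trigonometric monomials of the antiperiodic \<open>w\<close> are hyperbolic modes. Moreover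
  \<open>U\<close> is a multiple of the alternating sum of the translates by \<open>2 L k\<close> of a function \<open>e\<close> that vanishes for \<open>x \<le> 0\<close>, equals
  \<open>exp (- p\<^sub>N x)\<close> for large \<open>x\<close>, and whose moments are of the size of \<open>exp (- p\<^sub>n T) / p\<^sub>n\<close> at time \<open>T\<close>; this
  function exists by flatness of the heat equation. At an intermediate time \<open>t\<close> the moments are asymptotic
  to \<open>U(T - t) / p\<^sub>n\<close>, without exponential decay, and \<open>U(T - t) \<noteq> 0\<close>.
\<close>

section \<open>Semi-inner product spaces on a carrier set\<close>

text \<open>A state is a triple of functions, so equality of states means that a seminorm vanishes;
  the Hilbert space arguments therefore run on a carrier set with a semi-inner product. The
  semigroup is accessible only through its generator. The unbounded input operator is written as
  \<open>lift1\<close> minus the operator applied to \<open>lift0\<close>, two states of finite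
  norm; expanding both in the eigenvectors turns every boundary trace of an adjoint orbit into a
  uniformly convergent exponential series.

  Antiperiodicity of \<open>w\<close>, with \<open>q = p_N\<close>, is the recurrence
  \<open>U(x + 2 L) + U(x) = - C exp(- q (x + 2 L))\<close> where \<open>C = 1 + exp(2 L q)\<close>;
  the alternating sum is its solution that starts from zero. The moments of \<open>e\<close> are
  small because each of them vanishes over the half-line: what has accumulated up to a late time Y
  is minus the tail after Y, where \<open>e\<close> is a pure exponential. Time T is thus special:
  there the moments start at the end where \<open>U\<close> is flat, whereas at time t they start at
  \<open>T - t\<close>, inside the support.\<close>

locale semi_inner =
  fixes H :: "'a::ab_group_add set" and sm :: "complex \<Rightarrow> 'a \<Rightarrow> 'a" and ip :: "'a \<Rightarrow> 'a \<Rightarrow> complex"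
  assumes zero_closed: "0 \<in> H"
    and add_closed: "X \<in> H \<Longrightarrow> Y \<in> H \<Longrightarrow> X + Y \<in> H"
    and sm_closed: "X \<in> H \<Longrightarrow> sm a X \<in> H"
    and sm_m1: "sm (- 1) X = - X"
    and sm_sm: "sm a (sm b X) = sm (a * b) X"
    and sm_one: "sm 1 X = X"
    and sm_dist: "sm a (X + Y) = sm a X + sm a Y"
    and sm_add: "sm (a + b) X = sm a X + sm b X"
    and ip_add: "X \<in> H \<Longrightarrow> Y \<in> H \<Longrightarrow> Z \<in> H \<Longrightarrow> ip (X + Y) Z = ip X Z + ip Y Z"
    and ip_sm: "X \<in> H \<Longrightarrow> Y \<in> H \<Longrightarrow> ip (sm a X) Y = a * ip X Y"
    and ip_cnj: "X \<in> H \<Longrightarrow> Y \<in> H \<Longrightarrow> ip Y X = cnj (ip X Y)"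
    and ip_pos: "X \<in> H \<Longrightarrow> 0 \<le> Re (ip X X)"
begin

definition nrm :: "'a \<Rightarrow> real" where "nrm X = sqrt (Re (ip X X))"

lemma uminus_closed: "X \<in> H \<Longrightarrow> - X \<in> H"
  using sm_closed sm_m1 by metis

lemma diff_closed: "X \<in> H \<Longrightarrow> Y \<in> H \<Longrightarrow> X - Y \<in> H"
  by (metis uminus_closed add_closed add_uminus_conv_diff)

lemma ip_minus: "X \<in> H \<Longrightarrow> Y \<in> H \<Longrightarrow> ip (- X) Y = - ip X Y"
  using ip_sm[of X Y "-1"] by (simp add: sm_m1)

lemma ip_diff: "X \<in> H \<Longrightarrow> Y \<in> H \<Longrightarrow> Z \<in> H \<Longrightarrow> ip (X - Y) Z = ip X Z - ip Y Z"
  using ip_add[of X "- Y" Z] by (simp add: ip_minus uminus_closed)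

lemma ip_zero: "X \<in> H \<Longrightarrow> ip 0 X = 0"
  using ip_diff[of X X X] by simp

lemma ip_add_right: "X \<in> H \<Longrightarrow> Y \<in> H \<Longrightarrow> Z \<in> H \<Longrightarrow> ip Z (X + Y) = ip Z X + ip Z Y"
  by (metis add_closed complex_cnj_add ip_add ip_cnj)

lemma ip_diff_right: "X \<in> H \<Longrightarrow> Y \<in> H \<Longrightarrow> Z \<in> H \<Longrightarrow> ip Z (X - Y) = ip Z X - ip Z Y"
  by (metis diff_closed complex_cnj_diff ip_diff ip_cnj)

lemma ip_sm_right: "X \<in> H \<Longrightarrow> Y \<in> H \<Longrightarrow> ip X (sm a Y) = cnj a * ip X Y"
  by (metis complex_cnj_mult ip_cnj ip_sm sm_closed)

lemma ip_zero_right: "X \<in> H \<Longrightarrow> ip X 0 = 0"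
  by (metis complex_cnj_zero ip_cnj ip_zero zero_closed)

lemma nrm_nonneg: "X \<in> H \<Longrightarrow> 0 \<le> nrm X" by (simp add: nrm_def ip_pos)

lemma nrm_zero: "nrm 0 = 0" by (simp add: nrm_def ip_zero zero_closed)

lemma nrm_sq: "X \<in> H \<Longrightarrow> (nrm X)\<^sup>2 = Re (ip X X)" by (simp add: nrm_def ip_pos)

lemma ip_self: "X \<in> H \<Longrightarrow> ip X X = of_real ((nrm X)\<^sup>2)"
  using ip_cnj[of X X] by (simp add: nrm_sq complex_eq_iff)

lemma nrm_sq_add: "X \<in> H \<Longrightarrow> Y \<in> H \<Longrightarrow> (nrm (X + Y))\<^sup>2 = (nrm X)\<^sup>2 + (nrm Y)\<^sup>2 + 2 * Re (ip X Y)"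
  using ip_cnj[of X Y] by (simp add: nrm_sq add_closed ip_add ip_add_right)

lemma nrm_sq_diff: "X \<in> H \<Longrightarrow> Y \<in> H \<Longrightarrow> (nrm (X - Y))\<^sup>2 = (nrm X)\<^sup>2 + (nrm Y)\<^sup>2 - 2 * Re (ip X Y)"
  using ip_cnj[of X Y] by (simp add: nrm_sq diff_closed ip_diff ip_diff_right)

lemma nrm_sm: "X \<in> H \<Longrightarrow> nrm (sm a X) = cmod a * nrm X"
proof -
  assume X: "X \<in> H"
  have "ip (sm a X) (sm a X) = (a * cnj a) * ip X X"
    using X by (simp add: sm_closed ip_sm ip_sm_right)
  also have "\<dots> = of_real ((cmod a)\<^sup>2 * (nrm X)\<^sup>2)"
    using X by (simp add: ip_self flip: complex_norm_square)
  finally have "(nrm (sm a X))\<^sup>2 = (cmod a * nrm X)\<^sup>2"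
    using X by (simp only: nrm_sq sm_closed) (simp add: power_mult_distrib nrm_sq)
  then show ?thesis using X by (simp add: nrm_nonneg sm_closed)
qed

lemma nrm_minus: "X \<in> H \<Longrightarrow> nrm (- X) = nrm X"
  using nrm_sm[of X "-1"] by (simp add: sm_m1)

lemma nrm_diff_commute: "X \<in> H \<Longrightarrow> Y \<in> H \<Longrightarrow> nrm (X - Y) = nrm (Y - X)"
  using nrm_minus[of "X - Y"] by (simp add: diff_closed)

lemma cauchy_schwarz:
  assumes X: "X \<in> H" and Y: "Y \<in> H"
  shows "cmod (ip X Y) \<le> nrm X * nrm Y"
proof (cases "ip X Y = 0")
  case True
  then show ?thesis using X Y by (simp add: nrm_nonneg)
next
  case False
  define P where "P = (cmod (ip X Y))\<^sup>2"
  have P: "P > 0" using False by (simp add: P_def)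
  have main: "0 \<le> (nrm X)\<^sup>2 + s\<^sup>2 * P * (nrm Y)\<^sup>2 - 2 * s * P" for s :: real
  proof -
    have "Re (ip X (sm (of_real s * ip X Y) Y)) = s * P"
    proof -
      have "ip X (sm (of_real s * ip X Y) Y) = of_real s * (ip X Y * cnj (ip X Y))"
        using X Y by (simp add: ip_sm_right)
      also have "\<dots> = of_real (s * P)" unfolding P_def by (simp only: complex_norm_square of_real_mult)
      finally show ?thesis by simp
    qed
    moreover have "(nrm (sm (of_real s * ip X Y) Y))\<^sup>2 = s\<^sup>2 * P * (nrm Y)\<^sup>2"
      using Y by (simp add: nrm_sm P_def norm_mult power_mult_distrib)
    moreover have "0 \<le> (nrm (X - sm (of_real s * ip X Y) Y))\<^sup>2" by simp
    ultimately show ?thesis using nrm_sq_diff[OF X sm_closed[OF Y]] by simp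
  qed
  \<comment> \<open>The form need not be definite, so \<open>nrm Y = 0\<close> has to be refuted: in
    that case the expression in \<open>main\<close> is affine in s with slope \<open>- 2 * P\<close>
    and becomes negative for large s.\<close>
  have Y0: "(nrm Y)\<^sup>2 > 0"
  proof (rule ccontr)
    assume "\<not> (nrm Y)\<^sup>2 > 0"
    then have "nrm Y = 0" by simp
    then have "0 \<le> (nrm X)\<^sup>2 - 2 * (((nrm X)\<^sup>2 + 1) / (2 * P)) * P" using main[of "((nrm X)\<^sup>2 + 1) / (2 * P)"] by simp
    then show False using P by (simp add: field_simps)
  qed
  have "0 \<le> (nrm X)\<^sup>2 + (1 / (nrm Y)\<^sup>2)\<^sup>2 * P * (nrm Y)\<^sup>2 - 2 * (1 / (nrm Y)\<^sup>2) * P"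
    by (rule main)
  also have "\<dots> = (nrm X)\<^sup>2 - P / (nrm Y)\<^sup>2" using Y0 by (simp add: field_simps power2_eq_square)
  finally have "P \<le> (nrm X * nrm Y)\<^sup>2" using Y0 by (simp add: field_simps power_mult_distrib)
  then show ?thesis using X Y by (simp add: P_def nrm_nonneg power2_le_iff_abs_le)
qed

lemma nrm_triangle:
  assumes X: "X \<in> H" and Y: "Y \<in> H"
  shows "nrm (X + Y) \<le> nrm X + nrm Y"
proof -
  have "(nrm (X + Y))\<^sup>2 \<le> (nrm X + nrm Y)\<^sup>2"
    using nrm_sq_add[OF X Y] cauchy_schwarz[OF X Y] complex_Re_le_cmod[of "ip X Y"]
    by (simp add: power2_sum)
  then show ?thesis by (rule power2_le_imp_le) (use X Y in \<open>simp add: nrm_nonneg\<close>)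
qed

lemma nrm_triangle_diff:
  "X \<in> H \<Longrightarrow> Y \<in> H \<Longrightarrow> nrm (X - Y) \<le> nrm X + nrm Y"
  using nrm_triangle[of X "- Y"] by (simp add: uminus_closed nrm_minus)

lemma nrm_triangle3:
  "X \<in> H \<Longrightarrow> Y \<in> H \<Longrightarrow> Z \<in> H \<Longrightarrow> nrm (X - Z) \<le> nrm (X - Y) + nrm (Y - Z)"
  using nrm_triangle[of "X - Y" "Y - Z"] by (simp add: diff_closed)

lemma nrm_diff_triangle:
  "X \<in> H \<Longrightarrow> Y \<in> H \<Longrightarrow> nrm X \<le> nrm Y + nrm (X - Y)"
  using nrm_triangle[of Y "X - Y"] by (simp add: diff_closed)

lemma ip_cong0: "X \<in> H \<Longrightarrow> X' \<in> H \<Longrightarrow> Y \<in> H \<Longrightarrow> nrm (X - X') = 0 \<Longrightarrow> ip X Y = ip X' Y"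
  using cauchy_schwarz[of "X - X'" Y] by (simp add: diff_closed ip_diff)

lemma ip_cong0_right: "X \<in> H \<Longrightarrow> X' \<in> H \<Longrightarrow> Y \<in> H \<Longrightarrow> nrm (X - X') = 0 \<Longrightarrow> ip Y X = ip Y X'"
  using cauchy_schwarz[of Y "X - X'"] by (simp add: diff_closed ip_diff_right)

lemma nrm_cong0: "X \<in> H \<Longrightarrow> X' \<in> H \<Longrightarrow> nrm (X - X') = 0 \<Longrightarrow> nrm X = nrm X'"
  using ip_cong0[of X X' X] ip_cong0_right[of X X' X'] by (simp add: nrm_def)

lemma sum_closed: "(\<And>j. j \<in> F \<Longrightarrow> f j \<in> H) \<Longrightarrow> (\<Sum>j\<in>F. f j) \<in> H"
  by (induction F rule: infinite_finite_induct) (auto simp: zero_closed add_closed)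

lemma ip_sum: "(\<And>j. j \<in> F \<Longrightarrow> f j \<in> H) \<Longrightarrow> Y \<in> H \<Longrightarrow> ip (\<Sum>j\<in>F. f j) Y = (\<Sum>j\<in>F. ip (f j) Y)"
  by (induction F rule: infinite_finite_induct) (auto simp: ip_zero ip_add sum_closed)

lemma ip_sum_right: "(\<And>j. j \<in> F \<Longrightarrow> f j \<in> H) \<Longrightarrow> Y \<in> H \<Longrightarrow> ip Y (\<Sum>j\<in>F. f j) = (\<Sum>j\<in>F. ip Y (f j))"
  by (induction F rule: infinite_finite_induct) (auto simp: ip_zero_right ip_add_right sum_closed)

lemma nrm_sum: "(\<And>j. j \<in> F \<Longrightarrow> f j \<in> H) \<Longrightarrow> nrm (\<Sum>j\<in>F. f j) \<le> (\<Sum>j\<in>F. nrm (f j))"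
proof (induction F rule: infinite_finite_induct)
  case (insert x F)
  then show ?case using nrm_triangle[of "f x" "\<Sum>j\<in>F. f j"] by (auto simp: sum_closed)
qed (auto simp: nrm_zero)

end

section \<open>Completeness: Riesz representation and uniform boundedness\<close>

locale semi_hilbert = semi_inner +
  assumes complete: "(\<And>n. x n \<in> H) \<Longrightarrow> (\<And>e. e > 0 \<Longrightarrow> \<exists>N. \<forall>m\<ge>N. \<forall>n\<ge>N. nrm (x m - x n) < e)
      \<Longrightarrow> \<exists>l\<in>H. (\<lambda>n. nrm (x n - l)) \<longlonglongrightarrow> 0"
begin

text \<open>The representing vector is found as a minimiser of the energy \<open>J\<close>. This
  direct method needs neither kernels nor orthogonal complements and so works unchanged for a
  seminorm.\<close>

lemma riesz:
  assumes Fadd: "\<And>X Y. X \<in> H \<Longrightarrow> Y \<in> H \<Longrightarrow> F (X + Y) = F X + F Y"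
    and Fsm: "\<And>X a. X \<in> H \<Longrightarrow> F (sm a X) = a * F X"
    and Fbd: "\<And>X. X \<in> H \<Longrightarrow> cmod (F X) \<le> M * nrm X"
  shows "\<exists>Z\<in>H. \<forall>X\<in>H. F X = ip X Z"
proof -
  have Fdiff: "F (X - Y) = F X - F Y" if "X \<in> H" "Y \<in> H" for X Y
    using that Fadd[of X "sm (-1) Y"] Fsm[of Y "-1"] uminus_closed[of Y] by (simp add: sm_m1)
  define J where "J X = (nrm X)\<^sup>2 - 2 * Re (F X)" for X
  have Jlow: "J X \<ge> - M\<^sup>2" if "X \<in> H" for X
  proof -
    have "Re (F X) \<le> M * nrm X" using Fbd[OF that] complex_Re_le_cmod[of "F X"] by linarith
    moreover have "0 \<le> (nrm X - M)\<^sup>2" by simp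
    ultimately show ?thesis by (simp add: J_def power2_diff algebra_simps)
  qed
  define d where "d = Inf (J ` H)"
  have bdd: "bdd_below (J ` H)" by (rule bdd_belowI[of _ "- M\<^sup>2"]) (use Jlow in auto)
  have dle: "d \<le> J X" if "X \<in> H" for X unfolding d_def using bdd that by (simp add: cInf_lower)
  have "\<exists>X\<in>H. J X < d + 1 / real (Suc n)" for n
  proof -
    have "\<exists>y\<in>J ` H. y < d + 1 / real (Suc n)"
      by (rule cInf_lessD) (use zero_closed in \<open>auto simp: d_def\<close>)
    then show ?thesis by auto
  qed
  then obtain x where xH: "\<And>n. x n \<in> H" and xJ: "\<And>n. J (x n) < d + 1 / real (Suc n)" by metis
  \<comment> \<open>Parallelogram identity: since the midpoint has energy at least d, two
    near-minimisers are close to each other, so minimising sequences are Cauchy.\<close>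
  have par: "(nrm (X - Y))\<^sup>2 \<le> 2 * (J X + J Y - 2 * d)" if "X \<in> H" "Y \<in> H" for X Y
  proof -
    let ?Z = "sm (1/2) (X + Y)"
    have Z: "?Z \<in> H" using that by (simp add: sm_closed add_closed)
    have "J ?Z = ((nrm X)\<^sup>2 + (nrm Y)\<^sup>2 + 2 * Re (ip X Y)) / 4 - (Re (F X) + Re (F Y))"
      using that by (simp add: J_def nrm_sm add_closed power_mult_distrib Fsm Fadd)
        (simp add: nrm_sq_add power_divide field_simps)
    moreover have "d \<le> A / 4 - B \<Longrightarrow> 4 * d \<le> A - 4 * B" for A B :: real by simp
    ultimately have "4 * d \<le> (nrm X)\<^sup>2 + (nrm Y)\<^sup>2 + 2 * Re (ip X Y) - 4 * (Re (F X) + Re (F Y))"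
      using dle[OF Z] by metis
    then show ?thesis using nrm_sq_diff[OF that] by (simp add: J_def algebra_simps)
  qed
  have "\<exists>Z\<in>H. (\<lambda>n. nrm (x n - Z)) \<longlonglongrightarrow> 0"
  proof (rule complete[OF xH])
    fix e :: real assume e: "e > 0"
    obtain N where N: "4 / real (Suc N) < e\<^sup>2"
    proof -
      obtain N where "4 / e\<^sup>2 < real N" using reals_Archimedean2 by blast
      then have "4 < e\<^sup>2 * real N" using e by (simp add: field_simps)
      also have "\<dots> \<le> e\<^sup>2 * real (Suc N)" by (intro mult_left_mono) auto
      finally have "4 / real (Suc N) < e\<^sup>2" by (simp add: field_simps)
      then show ?thesis using that by blast
    qed
    show "\<exists>N. \<forall>m\<ge>N. \<forall>n\<ge>N. nrm (x m - x n) < e"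
    proof (intro exI[of _ N] allI impI)
      fix m n assume "m \<ge> N" "n \<ge> N"
      then have "1 / real (Suc m) \<le> 1 / real (Suc N)" "1 / real (Suc n) \<le> 1 / real (Suc N)"
        by (auto simp: frac_le)
      then have "J (x m) + J (x n) - 2 * d < 2 / real (Suc N)"
        using xJ[of m] xJ[of n] by simp
      then have "(nrm (x m - x n))\<^sup>2 < e\<^sup>2" using par[OF xH[of m] xH[of n]] N by simp
      then show "nrm (x m - x n) < e" using e by (simp add: power2_less_imp_less)
    qed
  qed
  then obtain Z where Z: "Z \<in> H" and lim: "(\<lambda>n. nrm (x n - Z)) \<longlonglongrightarrow> 0" by blast
  have JZ: "J Z \<le> d"
  proof -
    have "J Z \<le> d + 1 / real (Suc n) + (nrm (x n - Z))\<^sup>2 + 2 * nrm (x n - Z) * nrm Z + 2 * (M * nrm (x n - Z))" for n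
    proof -
      have a: "J (x n) = J Z + (nrm (x n - Z))\<^sup>2 + 2 * Re (ip (x n - Z) Z) - 2 * Re (F (x n - Z))"
        using nrm_sq_add[of "x n - Z" Z] xH Z by (simp add: J_def diff_closed Fdiff)
      have b: "- (nrm (x n - Z) * nrm Z) \<le> Re (ip (x n - Z) Z)"
        using cauchy_schwarz[of "x n - Z" Z] xH Z abs_Re_le_cmod[of "ip (x n - Z) Z"] by (simp add: diff_closed)
      have c: "Re (F (x n - Z)) \<le> M * nrm (x n - Z)"
        using Fbd[of "x n - Z"] xH Z complex_Re_le_cmod[of "F (x n - Z)"] by (simp add: diff_closed)
      have "0 \<le> (nrm (x n - Z))\<^sup>2" by simp
      with a b c xJ[of n] show ?thesis by linarith
    qed
    moreover have "(\<lambda>n. d + 1 / real (Suc n) + (nrm (x n - Z))\<^sup>2 + 2 * nrm (x n - Z) * nrm Z + 2 * (M * nrm (x n - Z)))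
        \<longlonglongrightarrow> d + 0 + 0\<^sup>2 + 2 * 0 * nrm Z + 2 * (M * 0)"
      by (intro tendsto_intros lim LIMSEQ_Suc lim_1_over_n)
    ultimately show ?thesis using LIMSEQ_le_const[of _ d "J Z"] by auto
  qed
  have "F X = ip X Z" if X: "X \<in> H" for X
  proof (rule ccontr)
    assume ne: "F X \<noteq> ip X Z"
    define w where "w = ip X Z - F X"
    have w: "(cmod w)\<^sup>2 > 0" using ne by (simp add: w_def)
    \<comment> \<open>Varying \<open>Z\<close> in the direction X with coefficient
      \<open>- s * cnj w\<close> changes the energy by this expression; its linear term is negative,
      so minimality fails for small s unless w vanishes.\<close>
    have ineq: "0 \<le> s\<^sup>2 * (cmod w)\<^sup>2 * (nrm X)\<^sup>2 - 2 * s * (cmod w)\<^sup>2" for s :: real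
    proof -
      let ?a = "- of_real s * cnj w"
      have cl: "Z + sm ?a X \<in> H" using X Z by (simp add: add_closed sm_closed)
      have i: "Re (ip Z (sm ?a X)) - Re (F (sm ?a X)) = - s * (cmod w)\<^sup>2"
      proof -
        have "Re (ip Z (sm ?a X)) = Re (ip (sm ?a X) Z)" using X Z ip_cnj[of "sm ?a X" Z] by (simp add: sm_closed)
        then have "Re (ip Z (sm ?a X)) - Re (F (sm ?a X)) = Re (?a * w)"
          using X Z by (simp add: ip_sm Fsm w_def algebra_simps)
        also have "?a * w = of_real (- s * (cmod w)\<^sup>2)"
          by (simp only: of_real_mult complex_norm_square of_real_minus) (simp add: mult.commute)
        also have "Re \<dots> = - s * (cmod w)\<^sup>2" by (rule Re_complex_of_real)
        finally show ?thesis .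
      qed
      have ii: "(nrm (sm ?a X))\<^sup>2 = s\<^sup>2 * (cmod w)\<^sup>2 * (nrm X)\<^sup>2"
        using X by (simp add: nrm_sm norm_mult power_mult_distrib)
      have "J Z \<le> J (Z + sm ?a X)" using JZ dle[OF cl] by simp
      then show ?thesis using i ii X Z
        by (simp add: J_def nrm_sq_add sm_closed Fadd algebra_simps)
    qed
    define s where "s = 1 / ((nrm X)\<^sup>2 + 1)"
    have s: "s > 0" "s * (nrm X)\<^sup>2 < 1" by (auto simp: s_def field_simps add_pos_nonneg)
    have "s * (cmod w)\<^sup>2 * (s * (nrm X)\<^sup>2 - 2) \<ge> 0"
      using ineq[of s] by (simp add: algebra_simps power2_eq_square)
    moreover have "s * (cmod w)\<^sup>2 * (s * (nrm X)\<^sup>2 - 2) < 0"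
      using s w by (intro mult_pos_neg mult_pos_pos) auto
    ultimately show False by simp
  qed
  then show ?thesis using Z by blast
qed

text \<open>The gliding-hump argument for the uniform boundedness principle, which avoids Baire's theorem.\<close>

lemma unbounded_point:
  fixes p :: "nat \<Rightarrow> 'a \<Rightarrow> real"
  assumes padd: "\<And>k X Y. X \<in> H \<Longrightarrow> Y \<in> H \<Longrightarrow> p k (X + Y) \<le> p k X + p k Y"
    and psm: "\<And>k X a. X \<in> H \<Longrightarrow> p k (sm a X) = cmod a * p k X"
    and pbd: "\<And>k. \<exists>M. \<forall>X\<in>H. p k X \<le> M * nrm X"
    and punb: "\<And>k. \<exists>X\<in>H. p k X > 4 ^ k * nrm X"
  shows "\<exists>X\<in>H. \<forall>k. p k X \<ge> 1/6 * (4/3) ^ k"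
proof -
  have ppos: "p k X \<ge> 0" if X: "X \<in> H" for k X
  proof -
    have "p k (X + sm (-1) X) \<le> p k X + p k (sm (-1) X)" by (rule padd) (use X in \<open>auto simp: sm_closed\<close>)
    moreover have "p k (sm (-1) X) = p k X" using psm[OF X, of k "-1"] by simp
    moreover have "p k 0 = 0"
    proof -
      have "sm 0 0 = 0" using sm_add[of 1 "-1" 0] by (simp add: sm_one sm_m1)
      then show ?thesis using psm[OF zero_closed, of k 0] by simp
    qed
    ultimately show ?thesis by (simp add: sm_m1)
  qed
  define N where "N k = Sup {p k X |X. X \<in> H \<and> nrm X \<le> 1}" for k
  have bdd: "bdd_above {p k X |X. X \<in> H \<and> nrm X \<le> 1}" for k
  proof -
    obtain M where M: "\<forall>X\<in>H. p k X \<le> M * nrm X" using pbd by blast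
    show ?thesis
    proof (rule bdd_aboveI[of _ "\<bar>M\<bar>"], clarify)
      fix X assume "X \<in> H" "nrm X \<le> 1"
      have "p k X \<le> M * nrm X" using M \<open>X \<in> H\<close> by auto
      also have "\<dots> \<le> \<bar>M\<bar> * 1" by (rule mult_mono) (use \<open>nrm X \<le> 1\<close> \<open>X \<in> H\<close> in \<open>auto simp: nrm_nonneg\<close>)
      finally show "p k X \<le> \<bar>M\<bar>" by simp
    qed
  qed
  have pN: "p k X \<le> N k * nrm X" if X: "X \<in> H" for k X
  proof (cases "nrm X = 0")
    case True
    then show ?thesis using pbd[of k] X by auto
  next
    case False
    then have pos: "nrm X > 0" using nrm_nonneg[OF X] by simp
    let ?Y = "sm (of_real (1 / nrm X)) X"
    have "?Y \<in> H" "nrm ?Y \<le> 1" using X pos by (auto simp: sm_closed nrm_sm norm_divide)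
    then have "p k ?Y \<le> N k" unfolding N_def using bdd by (intro cSup_upper) auto
    then have "1 / nrm X * p k X \<le> N k"
      using psm[OF X, of k "of_real (1 / nrm X)"] pos by (simp add: norm_divide)
    then show ?thesis using pos by (simp add: field_simps)
  qed
  have Ngt: "N k > 4 ^ k" for k
  proof -
    obtain X where X: "X \<in> H" "p k X > 4 ^ k * nrm X" using punb by blast
    have "nrm X \<noteq> 0"
    proof
      assume "nrm X = 0" then show False using X pN[OF X(1), of k] by simp
    qed
    then have "nrm X > 0" using nrm_nonneg[OF X(1)] by simp
    then show ?thesis using X pN[OF X(1), of k] by (smt (verit) mult_right_le_imp_le)
  qed
  have near: "\<exists>X\<in>H. nrm X \<le> r \<and> p k X \<ge> 2/3 * N k * r" if r: "r > 0" for k r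
  proof -
    have "\<exists>y\<in>{p k X |X. X \<in> H \<and> nrm X \<le> 1}. 2/3 * N k < y"
    proof (rule less_cSupD)
      show "{p k X |X. X \<in> H \<and> nrm X \<le> 1} \<noteq> {}" using zero_closed nrm_zero by force
      have "0 < N k" using Ngt[of k] by (smt (verit) zero_less_power)
      then show "2/3 * N k < Sup {p k X |X. X \<in> H \<and> nrm X \<le> 1}" by (simp add: N_def)
    qed
    then obtain X where X: "X \<in> H" "nrm X \<le> 1" "2/3 * N k < p k X" by blast
    then have "nrm (sm (of_real r) X) \<le> r" "p k (sm (of_real r) X) \<ge> 2/3 * N k * r"
      using r by (auto simp: nrm_sm psm mult.commute)
    then show ?thesis using X(1) sm_closed by blast
  qed
  \<comment> \<open>X is half the difference of \<open>x + X\<close> and \<open>x - X\<close>, so at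
    least one of these two points has a value not below \<open>p k X\<close>, whatever x is.\<close>
  have step: "\<exists>y. y \<in> H \<and> nrm (y - x) \<le> (1/3) ^ k \<and> p k y \<ge> 2/3 * N k * (1/3) ^ k" if x: "x \<in> H" for x k
  proof -
    obtain X where X: "X \<in> H" "nrm X \<le> (1/3) ^ k" "p k X \<ge> 2/3 * N k * (1/3)^k"
      using near[of "(1/3)^k" k] by auto
    have XX: "X = sm (1/2) ((x + X) + sm (-1) (x - X))"
    proof -
      have "sm (1/2) (X + X) = X"
        using sm_add[of 1 1 X] sm_sm[of "1/2" 2 X] by (simp add: sm_one)
      then show ?thesis by (simp add: sm_m1 algebra_simps)
    qed
    have cl: "x + X \<in> H" "x - X \<in> H" using x X by (auto simp: add_closed diff_closed)
    have "p k X = 1/2 * p k ((x + X) + sm (-1) (x - X))"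
      by (subst XX, subst psm) (auto simp: cl add_closed sm_closed)
    also have "\<dots> \<le> 1/2 * (p k (x + X) + p k (x - X))"
      using padd[OF cl(1) sm_closed[OF cl(2), of "-1"], of k] psm[OF cl(2), of k "-1"] by simp
    finally have half: "p k X \<le> 1/2 * (p k (x + X) + p k (x - X))" .
    have "p k X \<le> p k (x + X) \<or> p k X \<le> p k (x - X)"
    proof (rule ccontr)
      assume "\<not> ?thesis"
      then show False using half by auto
    qed
    then show ?thesis
    proof
      assume "p k X \<le> p k (x + X)"
      then show ?thesis using X cl by (intro exI[of _ "x + X"]) auto
    next
      assume "p k X \<le> p k (x - X)"
      then show ?thesis using X cl by (intro exI[of _ "x - X"]) (auto simp: nrm_minus)
    qed
  qed
  \<comment> \<open>Steps of length 3^-k leave the limit within half of 3^-k of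
    \<open>x (Suc k)\<close>. Of the gain 2/3 N k 3^-k the later steps can destroy at most 1/2 N k
    3^-k; the remaining sixth grows like (4/3)^k because \<open>N k\<close> exceeds 4^k.\<close>
  define x where "x = rec_nat 0 (\<lambda>k x. SOME y. y \<in> H \<and> nrm (y - x) \<le> (1/3) ^ k \<and> p k y \<ge> 2/3 * N k * (1/3) ^ k)"
  have xSuc: "x (Suc k) = (SOME y. y \<in> H \<and> nrm (y - x k) \<le> (1/3) ^ k \<and> p k y \<ge> 2/3 * N k * (1/3) ^ k)" for k
    by (simp add: x_def)
  have xH: "x k \<in> H" for k
  proof (induction k)
    case 0
    then show ?case by (simp add: x_def zero_closed)
  next
    case (Suc k)
    show ?case using someI_ex[OF step[OF Suc, of k]] by (simp add: xSuc)
  qed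
  have xs: "nrm (x (Suc k) - x k) \<le> (1/3) ^ k" "p k (x (Suc k)) \<ge> 2/3 * N k * (1/3) ^ k" for k
    using someI_ex[OF step[OF xH, of k k]] by (simp_all add: xSuc)
  have dist: "nrm (x (k + i) - x k) \<le> 3/2 * (1/3) ^ k" for k i
  proof -
    have "nrm (x (k + i) - x k) \<le> (\<Sum>j<i. (1/3) ^ (k + j))"
    proof (induction i)
      case 0
      then show ?case by (simp add: nrm_zero)
    next
      case (Suc i)
      have "nrm (x (k + Suc i) - x k) \<le> nrm (x (Suc (k + i)) - x (k + i)) + nrm (x (k + i) - x k)"
        using nrm_triangle3[of "x (Suc (k + i))" "x (k + i)" "x k"] xH by simp
      then show ?case using Suc xs(1)[of "k + i"] by simp
    qed
    also have "\<dots> = (1/3) ^ k * (\<Sum>j<i. (1/3) ^ j)" by (simp add: power_add sum_distrib_left)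
    also have "\<dots> \<le> (1/3) ^ k * (3/2)"
    proof -
      have "(\<Sum>j<i. (1/3::real) ^ j) = 3/2 * (1 - (1/3) ^ i)" by (induction i) (simp_all add: algebra_simps)
      then show ?thesis by (intro mult_left_mono) auto
    qed
    finally show ?thesis by simp
  qed
  have "\<exists>l\<in>H. (\<lambda>n. nrm (x n - l)) \<longlonglongrightarrow> 0"
  proof (rule complete[OF xH])
    fix e :: real assume e: "e > 0"
    obtain k where k: "(1/3::real) ^ k < e / 3" using real_arch_pow_inv[of "e/3" "1/3"] e by auto
    show "\<exists>N. \<forall>m\<ge>N. \<forall>n\<ge>N. nrm (x m - x n) < e"
    proof (intro exI[of _ k] allI impI)
      fix m n assume "m \<ge> k" "n \<ge> k"
      then obtain i j where ij: "m = k + i" "n = k + j" using le_Suc_ex by blast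
      have "nrm (x m - x n) \<le> nrm (x m - x k) + nrm (x n - x k)"
        using nrm_triangle3[OF xH[of m] xH[of k] xH[of n]] nrm_diff_commute[OF xH xH, of n k] by simp
      then show "nrm (x m - x n) < e" using dist[of k i] dist[of k j] k ij by simp
    qed
  qed
  then obtain l where l: "l \<in> H" and lim: "(\<lambda>n. nrm (x n - l)) \<longlonglongrightarrow> 0" by blast
  have "p k l \<ge> 1/6 * (4/3) ^ k" for k
  proof -
    have "nrm (x (Suc k) - l) \<le> 3/2 * (1/3) ^ Suc k + nrm (x (Suc k + i) - l)" for i
      using nrm_triangle3[of "x (Suc k)" "x (Suc k + i)" l] dist[of "Suc k" i] xH l
        nrm_diff_commute[of "x (Suc k + i)" "x (Suc k)"] by simp
    moreover have "(\<lambda>i. 3/2 * (1/3) ^ Suc k + nrm (x (Suc k + i) - l)) \<longlonglongrightarrow> 3/2 * (1/3) ^ Suc k + 0"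
      by (intro tendsto_intros) (use LIMSEQ_ignore_initial_segment[OF lim, of "Suc k"] in \<open>simp add: add.commute\<close>)
    ultimately have n: "nrm (x (Suc k) - l) \<le> 1/2 * (1/3) ^ k"
      using LIMSEQ_le_const[of _ _ "nrm (x (Suc k) - l)"] by fastforce
    have "p k (x (Suc k)) \<le> p k l + p k (x (Suc k) - l)"
      using padd[of l "x (Suc k) - l" k] l xH by (simp add: diff_closed)
    moreover have "p k (x (Suc k) - l) \<le> N k * (1/2 * (1/3) ^ k)"
      using pN[of "x (Suc k) - l" k] n l xH Ngt[of k]
      by (smt (verit) diff_closed mult_left_mono zero_less_power)
    ultimately have "p k l \<ge> 1/6 * (N k * (1/3) ^ k)" using xs(2)[of k] by simp
    moreover have "N k * (1/3) ^ k \<ge> 4 ^ k * (1/3) ^ k"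
      using Ngt[of k] by (intro mult_right_mono) auto
    moreover have "(4::real) ^ k * (1/3) ^ k = (4/3) ^ k" by (simp flip: power_mult_distrib)
    ultimately show ?thesis by simp
  qed
  then show ?thesis using l by blast
qed

end

section \<open>Strongly continuous semigroups on representatives\<close>

locale semi_semigroup = semi_hilbert +
  fixes S :: "real \<Rightarrow> 'a \<Rightarrow> 'a"
  assumes S_closed: "t \<ge> 0 \<Longrightarrow> X \<in> H \<Longrightarrow> S t X \<in> H"
    and S_lin: "t \<ge> 0 \<Longrightarrow> X \<in> H \<Longrightarrow> Y \<in> H \<Longrightarrow>
      nrm (S t (sm a X + sm b Y) - (sm a (S t X) + sm b (S t Y))) = 0"
    and S_bd: "t \<ge> 0 \<Longrightarrow> \<exists>M. \<forall>X\<in>H. nrm (S t X) \<le> M * nrm X"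
    and S_0: "X \<in> H \<Longrightarrow> nrm (S 0 X - X) = 0"
    and S_plus: "s \<ge> 0 \<Longrightarrow> t \<ge> 0 \<Longrightarrow> X \<in> H \<Longrightarrow> nrm (S (s + t) X - S s (S t X)) = 0"
    and S_cont: "X \<in> H \<Longrightarrow> ((\<lambda>t. nrm (S t X - X)) \<longlongrightarrow> 0) (at_right 0)"
begin

text \<open>Equality of the represented classes. The semigroup laws hold only in this sense, so each
  algebraic manipulation of orbits below needs a congruence rule.\<close>

definition eqv :: "'a \<Rightarrow> 'a \<Rightarrow> bool" where "eqv X Y \<longleftrightarrow> nrm (X - Y) = 0"

lemma eqv_refl: "eqv X X" by (simp add: eqv_def nrm_zero)

lemma eqv_sym: "X \<in> H \<Longrightarrow> Y \<in> H \<Longrightarrow> eqv X Y \<Longrightarrow> eqv Y X"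
  by (simp add: eqv_def nrm_diff_commute)

lemma eqv_trans: "X \<in> H \<Longrightarrow> Y \<in> H \<Longrightarrow> Z \<in> H \<Longrightarrow> eqv X Y \<Longrightarrow> eqv Y Z \<Longrightarrow> eqv X Z"
  using nrm_triangle3[of X Y Z] nrm_nonneg[of "X - Z"] by (simp add: eqv_def diff_closed)

lemma eqv_add:
  assumes "X \<in> H" "X' \<in> H" "Y \<in> H" "Y' \<in> H" "eqv X X'" "eqv Y Y'"
  shows "eqv (X + Y) (X' + Y')"
proof -
  have e: "X + Y - (X' + Y') = (X - X') + (Y - Y')" by simp
  have "nrm (X + Y - (X' + Y')) \<le> nrm (X - X') + nrm (Y - Y')"
    unfolding e using assms by (intro nrm_triangle diff_closed)
  then show ?thesis using assms nrm_nonneg[of "X + Y - (X' + Y')"] by (simp add: eqv_def diff_closed add_closed)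
qed

lemma sm_diff: "sm a (X - Y) = sm a X - sm a Y"
  using sm_dist[of a "X - Y" Y] by (simp add: algebra_simps)

lemma sm_0: "sm 0 X = 0"
  using sm_add[of 0 0 X] by simp

lemma eqv_sm: "X \<in> H \<Longrightarrow> Y \<in> H \<Longrightarrow> eqv X Y \<Longrightarrow> eqv (sm a X) (sm a Y)"
  by (simp add: eqv_def diff_closed nrm_sm flip: sm_diff)

lemma eqv_diff:
  assumes "X \<in> H" "X' \<in> H" "Y \<in> H" "Y' \<in> H" "eqv X X'" "eqv Y Y'"
  shows "eqv (X - Y) (X' - Y')"
  using eqv_add[OF assms(1,2) uminus_closed[OF assms(3)] uminus_closed[OF assms(4)] assms(5)]
    eqv_sm[OF assms(3,4,6), of "-1"] by (simp add: sm_m1)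

lemma S_sm: "t \<ge> 0 \<Longrightarrow> X \<in> H \<Longrightarrow> eqv (S t (sm a X)) (sm a (S t X))"
  using S_lin[of t X 0 a 0] by (simp add: eqv_def zero_closed sm_0)

lemma S_add: "t \<ge> 0 \<Longrightarrow> X \<in> H \<Longrightarrow> Y \<in> H \<Longrightarrow> eqv (S t (X + Y)) (S t X + S t Y)"
  using S_lin[of t X Y 1 1] by (simp add: eqv_def sm_one)

lemma S_diff: "t \<ge> 0 \<Longrightarrow> X \<in> H \<Longrightarrow> Y \<in> H \<Longrightarrow> eqv (S t (X - Y)) (S t X - S t Y)"
  using S_lin[of t X Y 1 "-1"] by (simp add: eqv_def sm_one sm_m1)

lemma S_zero: "t \<ge> 0 \<Longrightarrow> eqv (S t 0) 0"
  using S_sm[of t 0 0] by (simp add: sm_0 zero_closed)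

lemma S_sum:
  assumes "t \<ge> 0" "\<And>j. j \<in> F \<Longrightarrow> f j \<in> H"
  shows "eqv (S t (\<Sum>j\<in>F. f j)) (\<Sum>j\<in>F. S t (f j))"
  using assms
proof (induction F rule: infinite_finite_induct)
  case (insert x F)
  have 1: "eqv (S t (f x + (\<Sum>j\<in>F. f j))) (S t (f x) + S t (\<Sum>j\<in>F. f j))"
    using insert by (intro S_add sum_closed) auto
  have 2: "eqv (S t (f x) + S t (\<Sum>j\<in>F. f j)) (S t (f x) + (\<Sum>j\<in>F. S t (f j)))"
    using insert by (intro eqv_add eqv_refl S_closed sum_closed) auto
  have "eqv (S t (f x + (\<Sum>j\<in>F. f j))) (S t (f x) + (\<Sum>j\<in>F. S t (f j)))"
    by (rule eqv_trans[OF _ _ _ 1 2]) (use insert in \<open>auto intro!: S_closed add_closed sum_closed\<close>)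
  then show ?case using insert by simp
qed (auto simp: S_zero)

lemma eqv_sum:
  assumes "\<And>j. j \<in> F \<Longrightarrow> f j \<in> H" "\<And>j. j \<in> F \<Longrightarrow> g j \<in> H" "\<And>j. j \<in> F \<Longrightarrow> eqv (f j) (g j)"
  shows "eqv (\<Sum>j\<in>F. f j) (\<Sum>j\<in>F. g j)"
  using assms
proof (induction F rule: infinite_finite_induct)
  case (insert x F)
  then show ?case by (auto intro!: eqv_add sum_closed)
qed (auto simp: eqv_refl)

lemma eqv_nrm: "X \<in> H \<Longrightarrow> Y \<in> H \<Longrightarrow> eqv X Y \<Longrightarrow> nrm X = nrm Y"
  using nrm_cong0 by (simp add: eqv_def)

text \<open>If no bound held on any interval to the right of 0, times tending to 0 would exist along
  which the operators exceed 4^k. The gliding hump then yields one vector with an unbounded orbit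
  along these times, against strong continuity at 0.\<close>

lemma locally_bounded: "\<exists>d>0. \<exists>M\<ge>1. \<forall>t\<in>{0..d}. \<forall>X\<in>H. nrm (S t X) \<le> M * nrm X"
proof -
  have "\<exists>k. \<forall>t\<in>{0<..1 / real (Suc k)}. \<forall>X\<in>H. nrm (S t X) \<le> 4 ^ k * nrm X"
  proof (rule ccontr)
    assume "\<not> ?thesis"
    then have "\<forall>k. \<exists>t\<in>{0<..1 / real (Suc k)}. \<exists>X\<in>H. nrm (S t X) > 4 ^ k * nrm X"
      by (meson linorder_not_le)
    then obtain t where t: "\<And>k. t k \<in> {0<..1 / real (Suc k)}"
      and tX: "\<And>k. \<exists>X\<in>H. nrm (S (t k) X) > 4 ^ k * nrm X" by metis
    have t0: "t k \<ge> 0" for k using t[of k] by auto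
    have "\<exists>X\<in>H. \<forall>k. nrm (S (t k) X) \<ge> 1/6 * (4/3) ^ k"
    proof (rule unbounded_point)
      show "nrm (S (t k) (X + Y)) \<le> nrm (S (t k) X) + nrm (S (t k) Y)" if "X \<in> H" "Y \<in> H" for k X Y
        using eqv_nrm[OF _ _ S_add[OF t0 that]] that t0
        by (simp add: S_closed add_closed nrm_triangle)
      show "nrm (S (t k) (sm a X)) = cmod a * nrm (S (t k) X)" if "X \<in> H" for k X a
        using eqv_nrm[OF _ _ S_sm[OF t0 that]] that t0
        by (simp add: S_closed sm_closed nrm_sm)
      show "\<exists>M. \<forall>X\<in>H. nrm (S (t k) X) \<le> M * nrm X" for k by (rule S_bd[OF t0])
      show "\<exists>X\<in>H. 4 ^ k * nrm X < nrm (S (t k) X)" for k by (rule tX)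
    qed
    then obtain X where X: "X \<in> H" and big: "\<And>k. nrm (S (t k) X) \<ge> 1/6 * (4/3) ^ k" by blast
    have "t \<longlonglongrightarrow> 0"
      by (rule tendsto_sandwich[OF _ _ tendsto_const[of 0] LIMSEQ_Suc[OF lim_1_over_n]])
        (use t in \<open>auto intro!: always_eventually simp: less_imp_le\<close>)
    then have "filterlim t (at_right 0) sequentially"
      unfolding filterlim_at using t by (auto intro!: always_eventually) (metis less_irrefl)
    from filterlim_compose[OF S_cont[OF X] this]
    have "(\<lambda>k. nrm (S (t k) X - X)) \<longlonglongrightarrow> 0" .
    then have "\<forall>\<^sub>F k in sequentially. nrm (S (t k) X - X) < 1" by (rule order_tendstoD) simp
    moreover have "filterlim (\<lambda>k. 1/6 * (4/3) ^ k :: real) at_top sequentially"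
      by real_asymp
    then have "\<forall>\<^sub>F k in sequentially. 1/6 * (4/3) ^ k > nrm X + 1"
      unfolding filterlim_at_top_dense by blast
    ultimately have "\<forall>\<^sub>F k in sequentially. False"
    proof eventually_elim
      case (elim k)
      have "nrm (S (t k) X) \<le> nrm X + nrm (S (t k) X - X)"
        by (rule nrm_diff_triangle) (use X t0 in \<open>auto simp: S_closed\<close>)
      then show ?case using elim big[of k] by linarith
    qed
    then show False by simp
  qed
  then obtain k where k: "\<And>t X. t \<in> {0<..1 / real (Suc k)} \<Longrightarrow> X \<in> H \<Longrightarrow> nrm (S t X) \<le> 4 ^ k * nrm X" by blast
  have "\<forall>t\<in>{0..1 / real (Suc k)}. \<forall>X\<in>H. nrm (S t X) \<le> 4 ^ k * nrm X"
  proof (intro ballI)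
    fix t X assume t: "t \<in> {0..1 / real (Suc k)}" and X: "X \<in> H"
    show "nrm (S t X) \<le> 4 ^ k * nrm X"
    proof (cases "t = 0")
      case True
      have "nrm (S 0 X) = nrm X" by (rule nrm_cong0) (use X S_0 in \<open>auto simp: S_closed\<close>)
      moreover have "1 * nrm X \<le> 4 ^ k * nrm X" by (rule mult_right_mono) (use X in \<open>auto simp: nrm_nonneg\<close>)
      ultimately show ?thesis using True by simp
    next
      case False
      then show ?thesis using k[of t X] t X by auto
    qed
  qed
  moreover have "(1::real) \<le> 4 ^ k" "0 < 1 / real (Suc k)" by auto
  ultimately show ?thesis by blast
qed

lemma bounded_on_interval: "\<exists>M\<ge>1. \<forall>t\<in>{0..T}. \<forall>X\<in>H. nrm (S t X) \<le> M * nrm X"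
proof -
  obtain d M where d: "d > 0" and M: "M \<ge> 1"
    and bd: "\<And>t X. t \<in> {0..d} \<Longrightarrow> X \<in> H \<Longrightarrow> nrm (S t X) \<le> M * nrm X" using locally_bounded by blast
  have iter: "nrm (S (real n * h) X) \<le> M ^ n * nrm X" if h: "h \<in> {0..d}" and X: "X \<in> H" for n h X
  proof (induction n)
    case 0
    have "nrm (S 0 X) = nrm X" by (rule nrm_cong0) (use X S_0 in \<open>auto simp: S_closed\<close>)
    then show ?case by simp
  next
    case (Suc n)
    have cl: "S (real n * h) X \<in> H" "S (h + real n * h) X \<in> H" "S h (S (real n * h) X) \<in> H"
      using h X by (auto intro!: S_closed)
    have "nrm (S (h + real n * h) X) = nrm (S h (S (real n * h) X))"
      by (rule nrm_cong0) (use cl h X S_plus[of h "real n * h" X] in auto)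
    also have "\<dots> \<le> M * nrm (S (real n * h) X)" by (rule bd[OF h cl(1)])
    also have "\<dots> \<le> M * (M ^ n * nrm X)" using Suc M by (intro mult_left_mono) auto
    finally show ?case by (simp add: algebra_simps)
  qed
  obtain n where n: "real n > max 0 T / d" using reals_Archimedean2 by blast
  have n0: "n > 0" using n d by (metis divide_nonneg_pos gr0I max.cobounded1 not_less of_nat_0)
  show ?thesis
  proof (intro exI[of _ "M ^ n"] conjI ballI)
    fix t X assume t: "t \<in> {0..T}" and X: "X \<in> H"
    have "t / real n \<in> {0..d}" using t n n0 d by (auto simp: field_simps)
    from iter[OF this X, of n] show "nrm (S t X) \<le> M ^ n * nrm X" using n0 by simp
  qed (use M in simp)
qed

text \<open>Telescoping: \<open>S(t) - e\<^bsup>\<mu>t\<^esup>\<close> on an eigenvector is a sum of \<open>n\<close> terms of size \<open>o(t/n)\<close>.\<close>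

lemma S_eigenvector:
  assumes X: "X \<in> H" and t: "t \<ge> 0"
    and gen: "((\<lambda>t. nrm (sm (of_real (1 / t)) (S t X - X) - sm \<mu> X)) \<longlongrightarrow> 0) (at_right 0)"
  shows "eqv (S t X) (sm (exp (\<mu> * of_real t)) X)"
proof (cases "t = 0")
  case True
  then show ?thesis using S_0[OF X] by (simp add: eqv_def sm_one)
next
  case False
  with t have t: "t > 0" by simp
  obtain M where M: "M \<ge> 1" and bd: "\<And>s Y. s \<in> {0..t} \<Longrightarrow> Y \<in> H \<Longrightarrow> nrm (S s Y) \<le> M * nrm Y"
    using bounded_on_interval by meson
  define r where "r h = nrm (S h X - sm (exp (\<mu> * of_real h)) X)" for h
  define K where "K h = exp (cmod \<mu> * h)" for h
  have K: "cmod (exp (\<mu> * of_real h)) \<le> K h" if "h \<ge> 0" for h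
    using complex_Re_le_cmod[of "\<mu> * of_real h"] that by (simp add: K_def norm_mult)
  have K1: "K h \<ge> 1" if "h \<ge> 0" for h using that by (simp add: K_def)
  have rcl: "h \<ge> 0 \<Longrightarrow> S h X - sm (exp (\<mu> * of_real h)) X \<in> H" for h
    using X by (intro diff_closed S_closed sm_closed)
  \<comment> \<open>Writing E s for the scalar exponential, \<open>S (n h + h) - E (n h + h) = S (n
    h) (S h - E h) + E h (S (n h) - E (n h))\<close>: each step adds at most \<open>M * r h\<close>,
    and earlier errors are amplified by at most \<open>K h\<close>.\<close>
  have tel: "r (real n * h) \<le> real n * (M * K h ^ n * r h)" if h: "h \<in> {0..t}" and nh: "real n * h \<le> t" for n h
    using nh
  proof (induction n)
    case 0
    then show ?case using S_0[OF X] by (simp add: r_def sm_one)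
  next
    case (Suc n)
    have h0: "h \<ge> 0" using h by simp
    have nt: "real n * h \<in> {0..t}" using Suc.prems h0 by (auto simp: algebra_simps)
    then have n0: "0 \<le> real n * h" and nh0: "0 \<le> real n * h + h" using h0 by auto
    let ?E = "\<lambda>s. exp (\<mu> * of_real s)" and ?D = "\<lambda>s. S s X - sm (exp (\<mu> * of_real s)) X"
    have sumeq: "real (Suc n) * h = real n * h + h" by (simp add: algebra_simps)
    have E: "?E (real n * h + h) = ?E h * ?E (real n * h)" by (simp add: exp_add algebra_simps)
    have Sn: "S (real n * h) Y \<in> H" if "Y \<in> H" for Y using nt that by (intro S_closed) auto
    have Sh: "S h X \<in> H" using h0 X by (intro S_closed) auto
    have EX: "sm (?E h) X \<in> H" and Snh: "S (real n * h + h) X \<in> H"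
      and ESn: "sm (?E h) (S (real n * h) X) \<in> H" and DH: "?D h \<in> H" and Dn: "?D (real n * h) \<in> H"
      using X Sn[OF X] h0 n0 nh0 by (simp_all add: S_closed sm_closed diff_closed)
    have e1: "eqv (S (real n * h + h) X) (S (real n * h) (S h X))"
      unfolding eqv_def by (rule S_plus[OF n0 h0 X])
    have e2: "eqv (S (real n * h) (?D h)) (S (real n * h) (S h X) - S (real n * h) (sm (?E h) X))"
      by (rule S_diff[OF n0 Sh EX])
    have e3: "eqv (S (real n * h) (sm (?E h) X)) (sm (?E h) (S (real n * h) X))"
      by (rule S_sm[OF n0 X])
    have e4: "eqv (S (real n * h) (?D h)) (S (real n * h + h) X - sm (?E h) (S (real n * h) X))"
    proof (rule eqv_trans[OF _ _ _ e2])
      show "eqv (S (real n * h) (S h X) - S (real n * h) (sm (?E h) X)) (S (real n * h + h) X - sm (?E h) (S (real n * h) X))"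
        by (rule eqv_diff[OF Sn[OF Sh] Snh Sn[OF EX] ESn eqv_sym[OF Snh Sn[OF Sh] e1] e3])
    qed (use Sn[OF Sh] Sn[OF EX] Sn[OF DH] Snh ESn diff_closed in blast)+
    have eq: "?D (real n * h + h) = (S (real n * h + h) X - sm (?E h) (S (real n * h) X)) + sm (?E h) (?D (real n * h))"
      by (simp only: sm_diff sm_sm E) simp
    have "r (real (Suc n) * h) = nrm (?D (real n * h + h))" unfolding r_def sumeq ..
    also have "\<dots> \<le> nrm (S (real n * h + h) X - sm (?E h) (S (real n * h) X)) + nrm (sm (?E h) (?D (real n * h)))"
      unfolding eq by (rule nrm_triangle[OF diff_closed[OF Snh ESn] sm_closed[OF Dn]])
    also have "nrm (S (real n * h + h) X - sm (?E h) (S (real n * h) X)) = nrm (S (real n * h) (?D h))"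
      by (rule eqv_nrm[OF _ _ eqv_sym[OF _ _ e4]]) (use Sn[OF DH] Snh ESn diff_closed in blast)+
    also have "\<dots> \<le> M * r h" unfolding r_def by (rule bd[OF nt DH])
    also have "nrm (sm (?E h) (?D (real n * h))) = cmod (?E h) * r (real n * h)"
      unfolding r_def by (rule nrm_sm[OF Dn])
    also have "\<dots> \<le> K h * (real n * (M * K h ^ n * r h))"
    proof (rule mult_mono)
      show "r (real n * h) \<le> real n * (M * K h ^ n * r h)" using Suc.IH nt by auto
      show "0 \<le> r (real n * h)" unfolding r_def by (rule nrm_nonneg[OF Dn])
    qed (use K K1 h0 in \<open>auto simp: K_def\<close>)
    also have "M * r h \<le> M * (K h * K h ^ n) * r h"
    proof -
      have "1 \<le> K h ^ Suc n" using K1 h0 by (intro one_le_power) auto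
      then have "M * 1 \<le> M * (K h * K h ^ n)" using M by (intro mult_left_mono) auto
      moreover have "r h \<ge> 0" unfolding r_def using rcl h0 by (intro nrm_nonneg)
      ultimately show ?thesis using mult_right_mono[of "M * 1" "M * (K h * K h ^ n)" "r h"] by simp
    qed
    finally show ?case by (simp add: algebra_simps)
  qed
  \<comment> \<open>Both \<open>S h X\<close> and the scalar exponential have derivative
    \<open>sm \<mu> X\<close> at 0; \<open>?g\<close> collects the errors of the two difference
    quotients and tends to 0.\<close>
  let ?g = "\<lambda>h. nrm (sm (of_real (1 / h)) (S h X - X) - sm \<mu> X)
      + cmod ((exp (\<mu> * of_real h) - 1) / of_real h - \<mu>) * nrm X"
  have rg: "r h \<le> h * ?g h" if h: "h > 0" for h
  proof -
    have cl: "S h X \<in> H" "sm (of_real (1 / h)) (S h X - X) - sm \<mu> X \<in> H"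
      "sm ((exp (\<mu> * of_real h) - 1) / of_real h - \<mu>) X \<in> H"
      using h X by (auto intro!: S_closed sm_closed diff_closed)
    have "S h X - sm (exp (\<mu> * of_real h)) X = sm (of_real h) ((sm (of_real (1 / h)) (S h X - X) - sm \<mu> X)
        - sm ((exp (\<mu> * of_real h) - 1) / of_real h - \<mu>) X)"
    proof -
      have e: "of_real h * ((exp (\<mu> * of_real h) - 1) / of_real h - \<mu>) = exp (\<mu> * of_real h) - 1 - of_real h * \<mu>"
        using h by (simp add: field_simps)
      have "sm (exp (\<mu> * of_real h)) X = sm (exp (\<mu> * of_real h) - 1 - of_real h * \<mu>) X + sm 1 X + sm (of_real h * \<mu>) X"
        by (simp flip: sm_add)
      then show ?thesis unfolding sm_diff sm_sm e using h by (simp add: sm_one)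
    qed
    then have "r h = cmod (of_real h) * nrm ((sm (of_real (1 / h)) (S h X - X) - sm \<mu> X)
        - sm ((exp (\<mu> * of_real h) - 1) / of_real h - \<mu>) X)"
      unfolding r_def using cl by (simp only: nrm_sm diff_closed)
    also have "\<dots> \<le> h * ?g h"
      using h nrm_triangle_diff[OF cl(2,3)] X by (simp add: nrm_sm)
    finally show ?thesis .
  qed
  have lim: "(?g \<longlongrightarrow> 0 + 0 * nrm X) (at_right 0)"
  proof (intro tendsto_add gen tendsto_mult tendsto_const)
    have "((\<lambda>z. exp (\<mu> * z)) has_field_derivative \<mu>) (at 0)"
      by (auto intro!: derivative_eq_intros)
    then have "((\<lambda>z. (exp (\<mu> * z) - 1) / z) \<longlongrightarrow> \<mu>) (at 0)" by (simp add: has_field_derivative_iff)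
    moreover have "filterlim (\<lambda>h. complex_of_real h) (at 0) (at_right 0)"
      unfolding filterlim_at by (auto intro!: tendsto_eq_intros eventually_at_rightI[of 0 1])
    ultimately have "((\<lambda>h. (exp (\<mu> * of_real h) - 1) / complex_of_real h) \<longlongrightarrow> \<mu>) (at_right 0)"
      by (rule filterlim_compose)
    then show "((\<lambda>h. cmod ((exp (\<mu> * of_real h) - 1) / of_real h - \<mu>)) \<longlongrightarrow> 0) (at_right 0)"
      using tendsto_norm_zero LIM_zero by blast
  qed
  have seq: "filterlim (\<lambda>n. t / real (Suc n)) (at_right 0) sequentially"
    using t tendsto_mult[OF tendsto_const[of t] LIMSEQ_Suc[OF lim_1_over_n]]
    by (auto simp: filterlim_at intro!: always_eventually)
  have glim: "(\<lambda>n. M * K t * t * ?g (t / real (Suc n))) \<longlonglongrightarrow> M * K t * t * (0 + 0 * nrm X)"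
    by (rule tendsto_mult[OF tendsto_const filterlim_compose[OF lim seq]])
  \<comment> \<open>With step \<open>t / Suc n\<close>, the \<open>Suc n\<close> errors of size step
    times \<open>?g\<close> add up to t times \<open>?g\<close>, which vanishes in the
    limit.\<close>
  have "r t \<le> M * K t * t * ?g (t / real (Suc n))" for n
  proof -
    let ?h = "t / real (Suc n)"
    have h: "?h \<in> {0..t}" "?h > 0" "real (Suc n) * ?h = t" using t by (auto simp: field_simps)
    have "K ?h ^ Suc n = exp (cmod \<mu> * (real (Suc n) * ?h))"
      unfolding K_def exp_of_nat_mult[symmetric] by (simp only: ac_simps)
    then have Kn: "K ?h ^ Suc n = K t" by (simp only: h(3) K_def)
    have "r t \<le> real (Suc n) * (M * K ?h ^ Suc n * r ?h)" using tel[OF h(1), of "Suc n"] unfolding h(3) by simp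
    also have "\<dots> = real (Suc n) * M * K t * r ?h" by (simp only: Kn mult.assoc)
    also have "\<dots> \<le> real (Suc n) * M * K t * (?h * ?g ?h)"
      using rg[OF h(2)] M by (intro mult_left_mono) (auto simp: K_def)
    also have "\<dots> = M * K t * (real (Suc n) * ?h) * ?g ?h" by (simp only: ac_simps)
    finally show ?thesis by (simp only: h(3))
  qed
  then have "r t \<le> 0" using LIMSEQ_le_const[OF glim, of "r t"] by auto
  moreover have "r t \<ge> 0" unfolding r_def using rcl t by (intro nrm_nonneg) auto
  ultimately show ?thesis by (simp add: r_def eqv_def)
qed

end

section \<open>Square integrable functions and weak derivatives\<close>

abbreviation mI :: "real \<Rightarrow> real measure" where "mI L \<equiv> lebesgue_on {0..L}"

lemma finite_mI: "finite_measure (mI L)"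
  by (simp add: finite_measure_lebesgue_on)

lemma sigma_finite_mI: "sigma_finite_measure (mI L)"
  by (rule finite_measure.axioms(1)[OF finite_mI])

lemma mI_subinterval:
  assumes "0 \<le> x" "x \<le> L"
  shows "mI x = restrict_space (mI L) {0..x}"
proof -
  have "{0..L} \<inter> {0..x} = {0..x}" using assms by auto
  then show ?thesis by (subst restrict_restrict_space) (simp_all del: Int_atLeastAtMost)
qed

lemma measurable_id_mI: "(\<lambda>x. x) \<in> borel_measurable (mI L)"
  by (simp add: continuous_imp_measurable_on_sets_lebesgue)

lemma continuous_measurable_mI:
  fixes f :: "real \<Rightarrow> 'b::euclidean_space"
  assumes "continuous_on {0..L} f"
  shows "f \<in> borel_measurable (mI L)"
  using assms by (simp add: continuous_imp_measurable_on_sets_lebesgue)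

lemma integrable_mI_sub:
  fixes f :: "real \<Rightarrow> 'b::{banach, second_countable_topology}"
  assumes "0 \<le> x" "x \<le> L" "integrable (mI L) f"
  shows "integrable (mI x) f"
  unfolding mI_subinterval[OF assms(1,2)]
  by (subst integrable_restrict_space) (use assms in \<open>auto simp: sets_restrict_space_iff intro!: integrable_mult_indicator\<close>)

lemma integral_mI_sub:
  fixes f :: "real \<Rightarrow> 'b::{banach, second_countable_topology}"
  assumes "0 \<le> x" "x \<le> L"
  shows "integral\<^sup>L (mI x) f = (LINT s|mI L. indicat_real {0..x} s *\<^sub>R f s)"
  unfolding mI_subinterval[OF assms(1,2)]
  by (subst integral_restrict_space) (use assms in \<open>auto simp: sets_restrict_space_iff\<close>)

lemma integral_mI_HK:
  fixes f :: "real \<Rightarrow> complex"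
  assumes "integrable (mI L) f" shows "integral\<^sup>L (mI L) f = integral {0..L} f"
  using assms by (simp add: lebesgue_integral_eq_integral)

lemma integrable_mI_HK:
  fixes f :: "real \<Rightarrow> complex"
  assumes "integrable (mI L) f" shows "f integrable_on {0..L}"
  using has_integral_integral_lebesgue_on[OF assms] by (auto simp: integrable_on_def)

lemma integrable_continuous_mI:
  fixes f :: "real \<Rightarrow> 'b::euclidean_space"
  assumes "continuous_on {0..L} f" shows "integrable (mI L) f"
  using assms by (rule continuous_imp_integrable_real)

lemma L2_measurable: "f \<in> L2 L \<Longrightarrow> f \<in> borel_measurable (mI L)"
  by (simp add: L2_def)

lemma L2_sq_integrable: "f \<in> L2 L \<Longrightarrow> integrable (mI L) (\<lambda>x. (cmod (f x))\<^sup>2)"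
  by (simp add: L2_def)

lemma abs_mult_le_add_squares: "\<bar>a * b\<bar> \<le> a\<^sup>2 + b\<^sup>2" for a b :: real
proof -
  have "0 \<le> (\<bar>a\<bar> - \<bar>b\<bar>)\<^sup>2" by simp
  then have "2 * (\<bar>a\<bar> * \<bar>b\<bar>) \<le> a\<^sup>2 + b\<^sup>2" by (simp add: power2_diff)
  moreover have "0 \<le> \<bar>a\<bar> * \<bar>b\<bar>" by simp
  ultimately show ?thesis by (simp only: abs_mult)
qed

lemma L2_mult_integrable:
  assumes f: "f \<in> L2 L" and g: "g \<in> L2 L"
  shows "integrable (mI L) (\<lambda>x. f x * g x)"
proof (rule Bochner_Integration.integrable_bound)
  show "integrable (mI L) (\<lambda>x. (cmod (f x))\<^sup>2 + (cmod (g x))\<^sup>2)"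
    using f g by (simp add: L2_def)
  show "(\<lambda>x. f x * g x) \<in> borel_measurable (mI L)"
    using f g by (auto simp: L2_def)
  show "AE x in mI L. norm (f x * g x) \<le> norm ((cmod (f x))\<^sup>2 + (cmod (g x))\<^sup>2)"
    using abs_mult_le_add_squares[of "cmod (f _)" "cmod (g _)"] by (simp add: norm_mult)
qed

lemma L2_cnj: "f \<in> L2 L \<Longrightarrow> (\<lambda>x. cnj (f x)) \<in> L2 L"
  by (simp add: L2_def measurable_compose[OF _ borel_measurable_continuous_onI[OF continuous_on_cnj[OF continuous_on_id]]])

lemma L2_continuous:
  fixes f :: "real \<Rightarrow> complex"
  assumes "continuous_on {0..L} f" shows "f \<in> L2 L"
  using assms by (auto simp: L2_def intro!: continuous_measurable_mI integrable_continuous_mI continuous_intros)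

lemma L2_const [simp]: "(\<lambda>x. a) \<in> L2 L"
  by (rule L2_continuous) simp

lemma L2_integrable: "f \<in> L2 L \<Longrightarrow> integrable (mI L) f"
  using L2_mult_integrable[of f L "\<lambda>x. 1"] by simp

lemma L2_cmult: "f \<in> L2 L \<Longrightarrow> (\<lambda>x. a * f x) \<in> L2 L"
  by (auto simp: L2_def norm_mult power_mult_distrib)

lemma L2_mult_bounded:
  fixes b :: "real \<Rightarrow> complex"
  assumes f: "f \<in> L2 L" and b: "b \<in> borel_measurable (mI L)" "AE x in mI L. cmod (b x) \<le> M"
  shows "(\<lambda>x. b x * f x) \<in> L2 L"
proof -
  have "integrable (mI L) (\<lambda>x. (cmod (b x * f x))\<^sup>2)"
  proof (rule Bochner_Integration.integrable_bound)
    show "integrable (mI L) (\<lambda>x. M\<^sup>2 * (cmod (f x))\<^sup>2)" using f by (simp add: L2_def)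
    show "AE x in mI L. norm ((cmod (b x * f x))\<^sup>2) \<le> norm (M\<^sup>2 * (cmod (f x))\<^sup>2)"
      using b(2)
    proof eventually_elim
      case (elim x)
      then have "(cmod (b x))\<^sup>2 \<le> M\<^sup>2" by (simp add: power_mono)
      then show ?case by (simp add: norm_mult power_mult_distrib mult_right_mono)
    qed
  qed (use f b in \<open>auto simp: L2_def\<close>)
  then show ?thesis using f b by (auto simp: L2_def)
qed

lemma L2_mult_continuous:
  assumes "f \<in> L2 L" "continuous_on {0..L} b"
  shows "(\<lambda>x. b x * f x) \<in> L2 L"
proof -
  have "bounded (b ` {0..L})" using assms by (intro compact_imp_bounded compact_continuous_image) auto
  then obtain M where M: "\<And>x. x \<in> {0..L} \<Longrightarrow> cmod (b x) \<le> M" unfolding bounded_iff by blast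
  show ?thesis
    by (rule L2_mult_bounded[OF assms(1) continuous_measurable_mI[OF assms(2)], of M])
      (use M in \<open>auto intro!: AE_I2\<close>)
qed

lemma L2_add:
  assumes f: "f \<in> L2 L" and g: "g \<in> L2 L"
  shows "(\<lambda>x. f x + g x) \<in> L2 L"
proof -
  have "integrable (mI L) (\<lambda>x. (cmod (f x + g x))\<^sup>2)"
  proof (rule Bochner_Integration.integrable_bound)
    show "integrable (mI L) (\<lambda>x. 2 * ((cmod (f x))\<^sup>2 + (cmod (g x))\<^sup>2))"
      using f g by (simp add: L2_def)
    have "(cmod (a + b))\<^sup>2 \<le> 2 * ((cmod a)\<^sup>2 + (cmod b)\<^sup>2)" for a b
    proof -
      have "(cmod (a + b))\<^sup>2 \<le> (cmod a + cmod b)\<^sup>2" by (simp add: norm_triangle_ineq power_mono)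
      then show ?thesis using sum_squares_bound[of "cmod a" "cmod b"] by (simp add: power2_sum)
    qed
    then show "AE x in mI L. norm ((cmod (f x + g x))\<^sup>2) \<le> norm (2 * ((cmod (f x))\<^sup>2 + (cmod (g x))\<^sup>2))"
      by simp
  qed (use f g in \<open>auto simp: L2_def\<close>)
  then show ?thesis using f g by (auto simp: L2_def)
qed

lemma L2_uminus: "f \<in> L2 L \<Longrightarrow> (\<lambda>x. - f x) \<in> L2 L"
  using L2_cmult[of f L "-1"] by simp

lemma L2_diff: "f \<in> L2 L \<Longrightarrow> g \<in> L2 L \<Longrightarrow> (\<lambda>x. f x - g x) \<in> L2 L"
  using L2_add[of f L "\<lambda>x. - g x"] L2_uminus[of g L] by simp

lemma L2_sub: "0 \<le> x \<Longrightarrow> x \<le> L \<Longrightarrow> f \<in> L2 L \<Longrightarrow> f \<in> L2 x"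
  by (auto simp: L2_def intro: integrable_mI_sub measurable_restrict_mono[of f lebesgue "{0..L}"])

definition l2ip :: "real \<Rightarrow> (real \<Rightarrow> complex) \<Rightarrow> (real \<Rightarrow> complex) \<Rightarrow> complex" where
  "l2ip L f g = (LINT x|mI L. f x * cnj (g x))"

lemma l2ip_integrable: "f \<in> L2 L \<Longrightarrow> g \<in> L2 L \<Longrightarrow> integrable (mI L) (\<lambda>x. f x * cnj (g x))"
  by (intro L2_mult_integrable L2_cnj)

lemma l2ip_add: "f \<in> L2 L \<Longrightarrow> g \<in> L2 L \<Longrightarrow> h \<in> L2 L \<Longrightarrow> l2ip L (\<lambda>x. f x + g x) h = l2ip L f h + l2ip L g h"
  by (simp add: l2ip_def l2ip_integrable distrib_right)

lemma l2ip_cmult: "l2ip L (\<lambda>x. a * f x) h = a * l2ip L f h"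
  by (simp add: l2ip_def mult.assoc)

lemma l2ip_cnj: "l2ip L g f = cnj (l2ip L f g)"
proof -
  have "cnj (l2ip L f g) = (LINT x|mI L. cnj (f x * cnj (g x)))"
    unfolding l2ip_def by (rule Bochner_Integration.integral_cnj[symmetric])
  also have "\<dots> = l2ip L g f" unfolding l2ip_def by (rule Bochner_Integration.integral_cong) (auto simp: mult.commute)
  finally show ?thesis by simp
qed

lemma l2ip_self: "f \<in> L2 L \<Longrightarrow> l2ip L f f = of_real (LINT x|mI L. (cmod (f x))\<^sup>2)"
  by (simp add: l2ip_def flip: complex_norm_square integral_complex_of_real)

lemma l2ip_cong_AE:
  assumes "f \<in> L2 L" "f' \<in> L2 L" "g \<in> L2 L" "g' \<in> L2 L" "AE x in mI L. f x = f' x" "AE x in mI L. g x = g' x"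
  shows "l2ip L f g = l2ip L f' g'"
  unfolding l2ip_def
proof (rule integral_cong_AE)
  show "AE x in mI L. f x * cnj (g x) = f' x * cnj (g' x)" using assms(5,6) by eventually_elim simp
qed (use assms l2ip_integrable in \<open>auto dest: borel_measurable_integrable\<close>)

text \<open>On a finite measure space a mean square Cauchy sequence is also Cauchy in L^1, so a
  subsequence converges almost everywhere; Fatou's lemma then transfers the Cauchy bounds to this
  limit.\<close>

lemma L2_complete:
  fixes s :: "nat \<Rightarrow> real \<Rightarrow> complex"
  assumes s: "\<And>n. s n \<in> L2 L"
    and C: "\<And>e. e > 0 \<Longrightarrow> \<exists>N. \<forall>m\<ge>N. \<forall>n\<ge>N. (LINT x|mI L. (cmod (s m x - s n x))\<^sup>2) < e"
  shows "\<exists>f\<in>L2 L. (\<lambda>n. LINT x|mI L. (cmod (s n x - f x))\<^sup>2) \<longlonglongrightarrow> 0"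
proof -
  have int1: "integrable (mI L) (s n)" for n using s L2_integrable by auto
  have meas[measurable]: "s n \<in> borel_measurable (mI L)" for n using s L2_measurable by auto
  let ?V = "measure (mI L) {0..L}"
  have cauchy1: "\<exists>N. \<forall>i\<ge>N. \<forall>j\<ge>N. (LINT x|mI L. norm (s i x - s j x)) < e" if e: "e > 0" for e
  proof -
    define d where "d = e / (1 + ?V)"
    have V: "?V \<ge> 0" by simp
    then have d: "d > 0" using e by (simp add: d_def add_pos_nonneg)
    obtain N where N: "\<And>m n. m \<ge> N \<Longrightarrow> n \<ge> N \<Longrightarrow> (LINT x|mI L. (cmod (s m x - s n x))\<^sup>2) < d * d"
      using C[of "d * d"] d by auto
    have "(LINT x|mI L. norm (s i x - s j x)) < e" if "i \<ge> N" "j \<ge> N" for i j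
    proof -
      have D: "(\<lambda>x. s i x - s j x) \<in> L2 L" by (intro L2_diff s)
      have "(LINT x|mI L. norm (s i x - s j x)) \<le> (LINT x|mI L. (cmod (s i x - s j x))\<^sup>2 / d + d)"
      proof (rule integral_mono)
        show "integrable (mI L) (\<lambda>x. cmod (s i x - s j x))" using L2_integrable[OF D] by simp
        show "integrable (mI L) (\<lambda>x. (cmod (s i x - s j x))\<^sup>2 / d + d)"
          using L2_sq_integrable[OF D] finite_measure.integrable_const[OF finite_mI] by simp
        fix x
        \<comment> \<open>A weighted form of Young's inequality; with
          \<open>d = e / (1 + ?V)\<close> the two resulting terms stay below d and
          \<open>?V * d\<close>, which sum to e.\<close>
        have "c \<le> c\<^sup>2 / d + d" if "c \<ge> 0" for c
        proof -
          have "c * d \<le> c\<^sup>2 + d * d" using abs_mult_le_add_squares[of c d] that d by (simp add: power2_eq_square)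
          then show ?thesis using d by (simp add: field_simps)
        qed
        then show "cmod (s i x - s j x) \<le> (cmod (s i x - s j x))\<^sup>2 / d + d" by simp
      qed
      also have "\<dots> = (LINT x|mI L. (cmod (s i x - s j x))\<^sup>2) / d + ?V * d"
        using L2_sq_integrable[OF D] finite_measure.integrable_const[OF finite_mI]
        by (simp add: integral_add)
      also have "\<dots> < d * d / d + ?V * d"
        using divide_strict_right_mono[OF N[OF that] d] by simp
      also have "\<dots> = d * (1 + ?V)" using d by (simp add: algebra_simps)
      also have "\<dots> = e" unfolding d_def using V by (simp add: add_nonneg_eq_0_iff)
      finally show ?thesis .
    qed
    then show ?thesis by blast
  qed
  from cauchy_L1_AE_cauchy_subseq[OF int1 cauchy1]
  obtain r where r: "strict_mono r" and rC: "AE x in mI L. Cauchy (\<lambda>i. s (r i) x)" by auto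
  define f where "f x = lim (\<lambda>i. s (r i) x)" for x
  have fm[measurable]: "f \<in> borel_measurable (mI L)" unfolding f_def by measurable
  have lim: "AE x in mI L. (\<lambda>i. s (r i) x) \<longlonglongrightarrow> f x"
    using rC by eventually_elim (simp add: f_def Cauchy_convergent_iff convergent_LIMSEQ_iff)
  have bound: "(\<integral>\<^sup>+x. ennreal ((cmod (s n x - f x))\<^sup>2) \<partial>mI L) \<le> ennreal e"
    if N: "\<And>m n. m \<ge> N \<Longrightarrow> n \<ge> N \<Longrightarrow> (LINT x|mI L. (cmod (s m x - s n x))\<^sup>2) < e" and n: "n \<ge> N" for e N n
  proof -
    have "(\<integral>\<^sup>+x. ennreal ((cmod (s n x - f x))\<^sup>2) \<partial>mI L) = (\<integral>\<^sup>+x. liminf (\<lambda>i. ennreal ((cmod (s n x - s (r i) x))\<^sup>2)) \<partial>mI L)"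
    proof (rule nn_integral_cong_AE)
      show "AE x in mI L. ennreal ((cmod (s n x - f x))\<^sup>2) = liminf (\<lambda>i. ennreal ((cmod (s n x - s (r i) x))\<^sup>2))"
        using lim
      proof eventually_elim
        case (elim x)
        have "(\<lambda>i. ennreal ((cmod (s n x - s (r i) x))\<^sup>2)) \<longlonglongrightarrow> ennreal ((cmod (s n x - f x))\<^sup>2)"
          by (intro tendsto_ennrealI tendsto_intros elim)
        then show ?case by (rule lim_imp_Liminf[OF trivial_limit_sequentially, symmetric])
      qed
    qed
    also have "\<dots> \<le> liminf (\<lambda>i. \<integral>\<^sup>+x. ennreal ((cmod (s n x - s (r i) x))\<^sup>2) \<partial>mI L)"
      by (rule nn_integral_liminf) measurable
    also have "\<dots> \<le> ennreal e"
    proof (rule Liminf_le)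
      have "\<forall>\<^sub>F i in sequentially. i \<ge> N" by (rule eventually_ge_at_top)
      then show "\<forall>\<^sub>F i in sequentially. (\<integral>\<^sup>+x. ennreal ((cmod (s n x - s (r i) x))\<^sup>2) \<partial>mI L) \<le> ennreal e"
      proof eventually_elim
        case (elim i)
        then have ri: "r i \<ge> N" using seq_suble[OF r, of i] by simp
        have "(\<integral>\<^sup>+x. ennreal ((cmod (s n x - s (r i) x))\<^sup>2) \<partial>mI L) = ennreal (LINT x|mI L. (cmod (s n x - s (r i) x))\<^sup>2)"
          by (rule nn_integral_eq_integral[OF L2_sq_integrable[OF L2_diff[OF s s]]]) simp
        also have "\<dots> \<le> ennreal e" using N[OF n ri] by (intro ennreal_leI) simp
        finally show ?case .
      qed
    qed simp
    finally show ?thesis .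
  qed
  have sub: "(\<lambda>x. s n x - f x) \<in> L2 L" if N: "\<And>m n. m \<ge> N \<Longrightarrow> n \<ge> N \<Longrightarrow> (LINT x|mI L. (cmod (s m x - s n x))\<^sup>2) < e" and n: "n \<ge> N" for e N n
  proof -
    have "integrable (mI L) (\<lambda>x. (cmod (s n x - f x))\<^sup>2)"
      by (rule integrableI_bounded) (use bound[OF N n] in \<open>auto intro: order.strict_trans1\<close>)
    then show ?thesis by (simp add: L2_def)
  qed
  obtain N1 where N1: "\<And>m n. m \<ge> N1 \<Longrightarrow> n \<ge> N1 \<Longrightarrow> (LINT x|mI L. (cmod (s m x - s n x))\<^sup>2) < 1"
    using C[of 1] by auto
  have "(\<lambda>x. s N1 x - f x) \<in> L2 L" by (rule sub[OF N1 order_refl])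
  from L2_diff[OF s[of N1] this] have f: "f \<in> L2 L" by simp
  have "(\<lambda>n. LINT x|mI L. (cmod (s n x - f x))\<^sup>2) \<longlonglongrightarrow> 0"
  proof (rule LIMSEQ_I)
    fix e :: real assume e: "e > 0"
    obtain N where N: "\<And>m n. m \<ge> N \<Longrightarrow> n \<ge> N \<Longrightarrow> (LINT x|mI L. (cmod (s m x - s n x))\<^sup>2) < e / 2"
      using C[of "e / 2"] e by auto
    have "norm ((LINT x|mI L. (cmod (s n x - f x))\<^sup>2) - 0) < e" if n: "n \<ge> N" for n
    proof -
      have "ennreal (LINT x|mI L. (cmod (s n x - f x))\<^sup>2) \<le> ennreal (e / 2)"
        using bound[OF N n] nn_integral_eq_integral[OF L2_sq_integrable[OF sub[OF N n]]] by simp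
      then have "(LINT x|mI L. (cmod (s n x - f x))\<^sup>2) \<le> e / 2" using e by (simp add: ennreal_le_iff)
      moreover have "0 \<le> (LINT x|mI L. (cmod (s n x - f x))\<^sup>2)" by (simp add: integral_nonneg_AE)
      ultimately show ?thesis using e by simp
    qed
    then show "\<exists>no. \<forall>n\<ge>no. norm ((LINT x|mI L. (cmod (s n x - f x))\<^sup>2) - 0) < e" by blast
  qed
  with f show ?thesis by blast
qed

text \<open>Lebesgue differentiation: off a negligible set the value of d is the limit of its
  averages over \<open>[x, x + h]\<close>, and these averages are differences of vanishing
  primitives.\<close>

lemma AE_zero_of_primitive_zero:
  fixes d :: "real \<Rightarrow> complex"
  assumes d: "integrable (mI L) d" and z: "\<And>x. x \<in> {0..L} \<Longrightarrow> integral\<^sup>L (mI x) d = 0"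
  shows "AE x in mI L. d x = 0"
proof -
  let ?f = "\<lambda>x. if x \<in> {0..L} then d x else 0"
  have fi: "?f integrable_on UNIV"
    using integrable_mI_HK[OF d] by (simp only: Henstock_Kurzweil_Integration.integrable_restrict_UNIV)
  then have int: "?f integrable_on cbox a b" for a b
    by (rule integrable_on_subcbox) simp
  obtain N where N: "negligible N" and lim: "\<And>x e. x \<notin> N \<Longrightarrow> 0 < e \<Longrightarrow>
     \<exists>\<delta>>0. \<forall>h. 0 < h \<and> h < \<delta> \<longrightarrow> norm (integral (cbox x (x + h *\<^sub>R One)) ?f /\<^sub>R h ^ DIM(real) - ?f x) < e"
    using integrable_ccontinuous_explicit[of ?f] int by blast
  have zero: "integral {0..x} d = 0" if "x \<in> {0..L}" for x
    using z[OF that] integral_mI_HK[OF integrable_mI_sub[OF _ _ d, of x]] that by simp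
  have "d x = 0" if x: "0 \<le> x" "x < L" "x \<notin> N" for x
  proof (rule ccontr)
    assume "d x \<noteq> 0"
    then have "cmod (d x) > 0" by simp
    from lim[OF x(3) this] obtain \<delta> where \<delta>: "\<delta> > 0"
      and l: "\<And>h. 0 < h \<Longrightarrow> h < \<delta> \<Longrightarrow> norm (integral (cbox x (x + h *\<^sub>R One)) ?f /\<^sub>R h ^ DIM(real) - ?f x) < cmod (d x)" by blast
    define h where "h = min (\<delta> / 2) (L - x)"
    have h: "0 < h" "h < \<delta>" "x + h \<le> L" using \<delta> x by (auto simp: h_def min_def)
    have "integral (cbox x (x + h *\<^sub>R One)) ?f = integral {x..x + h} d"
      using x h by (auto intro!: integral_cong)
    moreover have "integral {0..x} d + integral {x..x + h} d = integral {0..x + h} d"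
      by (rule Henstock_Kurzweil_Integration.integral_combine)
        (use x h integrable_mI_HK[OF integrable_mI_sub[OF _ _ d, of "x + h"]] in auto)
    ultimately have "integral (cbox x (x + h *\<^sub>R One)) ?f = 0" using zero[of x] zero[of "x + h"] x h by simp
    with l[OF h(1,2)] x show False by simp
  qed
  then have "{x \<in> {0..L}. d x \<noteq> 0} \<subseteq> N \<union> {L}" by force
  moreover have "negligible (N \<union> {L})" using N by simp
  ultimately have "negligible {x \<in> {0..L}. d x \<noteq> 0}" using negligible_subset by blast
  then have "AE x in lebesgue. x \<in> {0..L} \<longrightarrow> d x = 0"
    by (intro AE_I'[of "{x \<in> {0..L}. d x \<noteq> 0}"]) (auto simp: negligible_iff_null_sets)
  then show ?thesis by (simp add: AE_restrict_space_iff)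
qed

lemma continuous_primitive:
  fixes e :: "real \<Rightarrow> complex"
  assumes e: "integrable (mI L) e" shows "continuous_on {0..L} (\<lambda>x. integral\<^sup>L (mI x) e)"
proof -
  have "continuous_on {0..L} (\<lambda>x. integral {0..x} e)"
    by (rule indefinite_integral_continuous_1[OF integrable_mI_HK[OF e]])
  then show ?thesis
    by (rule continuous_on_eq) (use integral_mI_HK[OF integrable_mI_sub[OF _ _ e]] in auto)
qed

text \<open>Fubini on the square, cut along the diagonal into the triangles \<open>y \<le> x\<close>
  and \<open>x < y\<close>. Derivatives are merely integrable here, so the classical fundamental
  theorem is not at hand.\<close>

lemma primitive_parts:
  fixes d e :: "real \<Rightarrow> complex"
  assumes L: "0 \<le> L" and d: "integrable (mI L) d" and e: "integrable (mI L) e"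
  shows "(LINT x|mI L. d x * integral\<^sup>L (mI x) e) + (LINT x|mI L. integral\<^sup>L (mI x) d * e x)
    = integral\<^sup>L (mI L) d * integral\<^sup>L (mI L) e"
proof -
  interpret S: sigma_finite_measure "mI L" by (rule sigma_finite_mI)
  interpret P: pair_sigma_finite "mI L" "mI L" ..
  let ?M = "mI L \<Otimes>\<^sub>M mI L"
  have [measurable]: "d \<in> borel_measurable (mI L)" "e \<in> borel_measurable (mI L)"
    using d e by (auto dest: borel_measurable_integrable)
  have [measurable]: "(\<lambda>p. fst p :: real) \<in> borel_measurable ?M" "(\<lambda>p. snd p :: real) \<in> borel_measurable ?M"
    using measurable_compose[OF measurable_fst measurable_id_mI] measurable_compose[OF measurable_snd measurable_id_mI]
    by auto
  have f: "integrable ?M (\<lambda>(x, y). d x * e y)"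
  proof (rule P.Fubini_integrable)
    have "(\<lambda>x. LINT y|mI L. norm (case (x, y) of (x, y) \<Rightarrow> d x * e y)) = (\<lambda>x. cmod (d x) * (LINT y|mI L. cmod (e y)))"
      by (simp add: norm_mult)
    then show "integrable (mI L) (\<lambda>x. LINT y|mI L. norm (case (x, y) of (x, y) \<Rightarrow> d x * e y))"
      using d by simp
  qed (use e in auto)
  let ?f1 = "\<lambda>(x, y). if y \<le> x then d x * e y else 0" and ?f2 = "\<lambda>(x, y). if x < y then d x * e y else 0"
  have f1: "integrable ?M ?f1"
    by (rule Bochner_Integration.integrable_bound[OF f]) (auto simp: case_prod_unfold)
  have f2: "integrable ?M ?f2"
    by (rule Bochner_Integration.integrable_bound[OF f]) (auto simp: case_prod_unfold)
  have "integral\<^sup>L ?M ?f1 = (LINT x|mI L. LINT y|mI L. (if y \<le> x then d x * e y else 0))"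
    using P.integral_fst'[OF f1] by simp
  also have "\<dots> = (LINT x|mI L. d x * integral\<^sup>L (mI x) e)"
  proof (rule Bochner_Integration.integral_cong[OF refl])
    fix x assume "x \<in> space (mI L)"
    then have x: "0 \<le> x" "x \<le> L" by auto
    have "(LINT y|mI L. (if y \<le> x then d x * e y else 0)) = (LINT y|mI L. d x * (indicat_real {0..x} y *\<^sub>R e y))"
      by (rule Bochner_Integration.integral_cong) auto
    also have "\<dots> = d x * integral\<^sup>L (mI x) e"
      unfolding integral_mI_sub[OF x] by (rule integral_mult_right_zero)
    finally show "(LINT y|mI L. (if y \<le> x then d x * e y else 0)) = d x * integral\<^sup>L (mI x) e" .
  qed
  finally have i1: "integral\<^sup>L ?M ?f1 = (LINT x|mI L. d x * integral\<^sup>L (mI x) e)" .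
  have "integral\<^sup>L ?M ?f2 = (LINT y|mI L. LINT x|mI L. (if x < y then d x * e y else 0))"
    using P.integral_snd[of "\<lambda>x y. if x < y then d x * e y else 0"] f2 by simp
  also have "\<dots> = (LINT y|mI L. integral\<^sup>L (mI y) d * e y)"
  proof (rule Bochner_Integration.integral_cong[OF refl])
    fix y assume "y \<in> space (mI L)"
    then have y: "0 \<le> y" "y \<le> L" by auto
    \<comment> \<open>The indicator of \<open>{0..y}\<close> includes the diagonal point that the
      strict triangle omits; it is a null set.\<close>
    have "AE x in lebesgue. x \<noteq> y" by (rule AE_I'[of "{y}"]) (auto simp flip: negligible_iff_null_sets)
    then have "AE x in mI L. x \<noteq> y" by (auto simp: AE_restrict_space_iff elim: eventually_mono)
    then have ae: "AE x in mI L. (if x < y then d x * e y else 0) = (indicat_real {0..y} x *\<^sub>R d x) * e y"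
      by (rule AE_mp[OF _ AE_I2]) (use y in auto)
    have "(LINT x|mI L. (if x < y then d x * e y else 0)) = (LINT x|mI L. (indicat_real {0..y} x *\<^sub>R d x) * e y)"
    proof (rule integral_cong_AE[OF _ _ ae])
      have [measurable]: "(\<lambda>x. x) \<in> borel_measurable (mI L)" by (rule measurable_id_mI)
      show "(\<lambda>x. if x < y then d x * e y else 0) \<in> borel_measurable (mI L)" by measurable
      have "{0..y} \<in> sets (mI L)" using y by (simp add: sets_restrict_space_iff)
      then show "(\<lambda>x. (indicat_real {0..y} x *\<^sub>R d x) * e y) \<in> borel_measurable (mI L)" by measurable
    qed
    also have "\<dots> = integral\<^sup>L (mI y) d * e y"
      unfolding integral_mI_sub[OF y] by (rule integral_mult_left_zero)
    finally show "(LINT x|mI L. (if x < y then d x * e y else 0)) = integral\<^sup>L (mI y) d * e y" .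
  qed
  finally have i2: "integral\<^sup>L ?M ?f2 = (LINT y|mI L. integral\<^sup>L (mI y) d * e y)" .
  have "(\<lambda>p. ?f1 p + ?f2 p) = (\<lambda>(x, y). d x * e y)" by auto
  then have "integral\<^sup>L ?M ?f1 + integral\<^sup>L ?M ?f2 = integral\<^sup>L ?M (\<lambda>(x, y). d x * e y)"
    using f1 f2 by (simp flip: Bochner_Integration.integral_add)
  also have "\<dots> = (LINT x|mI L. LINT y|mI L. d x * e y)" using P.integral_fst'[OF f] by simp
  also have "\<dots> = integral\<^sup>L (mI L) d * integral\<^sup>L (mI L) e" by simp
  finally show ?thesis unfolding i1 i2 .
qed

section \<open>Calculus of weak derivatives\<close>

lemma hwd_L2: "has_weak_deriv L g d \<Longrightarrow> d \<in> L2 L"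
  by (simp add: has_weak_deriv_def)

lemma hwd_eq: "has_weak_deriv L g d \<Longrightarrow> x \<in> {0..L} \<Longrightarrow> g x = g 0 + integral\<^sup>L (mI x) d"
  unfolding has_weak_deriv_def by blast

lemma hwd_continuous:
  assumes "has_weak_deriv L g d" shows "continuous_on {0..L} g"
  by (rule continuous_on_eq[OF continuous_on_add[OF continuous_on_const[of _ "g 0"]
        continuous_primitive[OF L2_integrable[OF hwd_L2[OF assms]]]]])
    (rule hwd_eq[OF assms, symmetric])

lemma hwd_in_L2: "has_weak_deriv L g d \<Longrightarrow> g \<in> L2 L"
  by (intro L2_continuous hwd_continuous)

lemma hwd_const: "has_weak_deriv L (\<lambda>x. a) (\<lambda>x. 0)"
  by (simp add: has_weak_deriv_def)

lemma hwd_add: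
  assumes "has_weak_deriv L g d" "has_weak_deriv L h e"
  shows "has_weak_deriv L (\<lambda>x. g x + h x) (\<lambda>x. d x + e x)"
  unfolding has_weak_deriv_def
proof (intro conjI ballI)
  show "(\<lambda>x. d x + e x) \<in> L2 L" using assms by (intro L2_add hwd_L2)
  fix x assume x: "x \<in> {0..L}"
  then have "integrable (mI x) d" "integrable (mI x) e"
    using L2_integrable[OF hwd_L2[OF assms(1)]] L2_integrable[OF hwd_L2[OF assms(2)]]
    by (auto intro: integrable_mI_sub)
  then show "g x + h x = g 0 + h 0 + (LINT s|mI x. d s + e s)"
    using hwd_eq[OF assms(1) x] hwd_eq[OF assms(2) x] by simp
qed

lemma hwd_cmult:
  assumes "has_weak_deriv L g d"
  shows "has_weak_deriv L (\<lambda>x. a * g x) (\<lambda>x. a * d x)"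
  unfolding has_weak_deriv_def
proof (intro conjI ballI)
  show "(\<lambda>x. a * d x) \<in> L2 L" by (rule L2_cmult[OF hwd_L2[OF assms]])
  fix x assume "x \<in> {0..L}"
  from hwd_eq[OF assms this] show "a * g x = a * g 0 + (LINT s|mI x. a * d s)" by (simp add: distrib_left)
qed

lemma hwd_diff:
  assumes "has_weak_deriv L g d" "has_weak_deriv L h e"
  shows "has_weak_deriv L (\<lambda>x. g x - h x) (\<lambda>x. d x - e x)"
  using hwd_add[OF assms(1) hwd_cmult[OF assms(2), of "-1"]] by simp

lemma hwd_cnj:
  assumes "has_weak_deriv L g d"
  shows "has_weak_deriv L (\<lambda>x. cnj (g x)) (\<lambda>x. cnj (d x))"
  unfolding has_weak_deriv_def
proof (intro conjI ballI)
  show "(\<lambda>x. cnj (d x)) \<in> L2 L" by (rule L2_cnj[OF hwd_L2[OF assms]])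
  fix x assume "x \<in> {0..L}"
  from hwd_eq[OF assms this] show "cnj (g x) = cnj (g 0) + (LINT s|mI x. cnj (d s))" by simp
qed

lemma hwd_cong:
  assumes "has_weak_deriv L g d" "\<And>x. x \<in> {0..L} \<Longrightarrow> g' x = g x" "d' \<in> L2 L" "AE x in mI L. d' x = d x"
  shows "has_weak_deriv L g' d'"
  unfolding has_weak_deriv_def
proof (intro conjI ballI)
  show "d' \<in> L2 L" by fact
  fix x assume x: "x \<in> {0..L}"
  have ae: "AE y in mI x. d' y = d y"
    using assms(4) x unfolding mI_subinterval[of x L, unfolded atLeastAtMost_iff]
    by (subst mI_subinterval[of x L]) (auto simp: AE_restrict_space_iff sets_restrict_space_iff)
  have "integral\<^sup>L (mI x) d' = integral\<^sup>L (mI x) d"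
    by (rule integral_cong_AE[OF _ _ ae]) (use x L2_sub[of x L] assms(3) hwd_L2[OF assms(1)] L2_measurable in auto)
  then show "g' x = g' 0 + integral\<^sup>L (mI x) d'"
    using hwd_eq[OF assms(1) x] assms(2) x by simp
qed

lemma hwd_AE_unique:
  assumes "has_weak_deriv L g d" "has_weak_deriv L g' d'" "\<And>x. x \<in> {0..L} \<Longrightarrow> g x = g' x"
  shows "AE x in mI L. d x = d' x"
proof -
  have D: "(\<lambda>x. d x - d' x) \<in> L2 L" using assms by (intro L2_diff hwd_L2)
  have "AE x in mI L. d x - d' x = 0"
  proof (rule AE_zero_of_primitive_zero[OF L2_integrable[OF D]])
    fix x assume x: "x \<in> {0..L}"
    have "has_weak_deriv L (\<lambda>x. g x - g' x) (\<lambda>x. d x - d' x)" by (rule hwd_diff[OF assms(1,2)])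
    from hwd_eq[OF this x] show "(LINT s|mI x. d s - d' s) = 0" using assms(3)[OF x] assms(3)[of 0] x by simp
  qed
  then show ?thesis by simp
qed

text \<open>Writing each factor as initial value plus primitive reduces the product rule on
  \<open>[0, x]\<close> to \<open>primitive_parts\<close>.\<close>

lemma hwd_mult:
  assumes g: "has_weak_deriv L g d" and h: "has_weak_deriv L h e"
  shows "has_weak_deriv L (\<lambda>x. g x * h x) (\<lambda>x. d x * h x + g x * e x)"
  unfolding has_weak_deriv_def
proof (intro conjI ballI)
  have dh: "(\<lambda>x. d x * h x) \<in> L2 L"
    using L2_mult_continuous[OF hwd_L2[OF g] hwd_continuous[OF h]] by (simp add: mult.commute)
  have ge: "(\<lambda>x. g x * e x) \<in> L2 L" by (rule L2_mult_continuous[OF hwd_L2[OF h] hwd_continuous[OF g]])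
  show "(\<lambda>x. d x * h x + g x * e x) \<in> L2 L" using dh ge by (rule L2_add)
  fix x assume x: "x \<in> {0..L}"
  have di: "integrable (mI x) d" and ei: "integrable (mI x) e"
    using x g h by (auto intro: integrable_mI_sub L2_integrable hwd_L2)
  have "(LINT s|mI x. d s * h s) = (LINT s|mI x. h 0 * d s + d s * integral\<^sup>L (mI s) e)"
  proof (rule Bochner_Integration.integral_cong[OF refl])
    fix s assume "s \<in> space (mI x)"
    then have "s \<in> {0..L}" using x by auto
    from hwd_eq[OF h this] show "d s * h s = h 0 * d s + d s * integral\<^sup>L (mI s) e" by (simp add: algebra_simps)
  qed
  moreover have "integrable (mI x) (\<lambda>s. d s * integral\<^sup>L (mI s) e)"
  proof -
    have "(\<lambda>s. integral\<^sup>L (mI s) e * d s) \<in> L2 L"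
      by (rule L2_mult_continuous[OF hwd_L2[OF g] continuous_primitive[OF L2_integrable[OF hwd_L2[OF h]]]])
    from integrable_mI_sub[OF _ _ L2_integrable[OF this], of x] x show ?thesis by (simp add: mult.commute)
  qed
  ultimately have 1: "(LINT s|mI x. d s * h s) = h 0 * integral\<^sup>L (mI x) d + (LINT s|mI x. d s * integral\<^sup>L (mI s) e)"
    using di by simp
  have "(LINT s|mI x. g s * e s) = (LINT s|mI x. g 0 * e s + integral\<^sup>L (mI s) d * e s)"
  proof (rule Bochner_Integration.integral_cong[OF refl])
    fix s assume "s \<in> space (mI x)"
    then have "s \<in> {0..L}" using x by auto
    from hwd_eq[OF g this] show "g s * e s = g 0 * e s + integral\<^sup>L (mI s) d * e s" by (simp add: algebra_simps)
  qed
  moreover have "integrable (mI x) (\<lambda>s. integral\<^sup>L (mI s) d * e s)"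
  proof -
    have "(\<lambda>s. integral\<^sup>L (mI s) d * e s) \<in> L2 L"
      by (rule L2_mult_continuous[OF hwd_L2[OF h] continuous_primitive[OF L2_integrable[OF hwd_L2[OF g]]]])
    from integrable_mI_sub[OF _ _ L2_integrable[OF this], of x] x show ?thesis by simp
  qed
  ultimately have 2: "(LINT s|mI x. g s * e s) = g 0 * integral\<^sup>L (mI x) e + (LINT s|mI x. integral\<^sup>L (mI s) d * e s)"
    using ei by simp
  have "(LINT s|mI x. d s * h s + g s * e s) = (LINT s|mI x. d s * h s) + (LINT s|mI x. g s * e s)"
    using integrable_mI_sub[OF _ _ L2_integrable[OF dh], of x] integrable_mI_sub[OF _ _ L2_integrable[OF ge], of x] x by simp
  also have "\<dots> = h 0 * integral\<^sup>L (mI x) d + g 0 * integral\<^sup>L (mI x) e + integral\<^sup>L (mI x) d * integral\<^sup>L (mI x) e"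
    unfolding 1 2 using primitive_parts[OF _ di ei] x by simp
  finally show "g x * h x = g 0 * h 0 + (LINT s|mI x. d s * h s + g s * e s)"
    using hwd_eq[OF g x] hwd_eq[OF h x] by (simp add: algebra_simps)
qed

lemma hwd_ibp:
  assumes L: "0 \<le> L" and g: "has_weak_deriv L g d" and h: "has_weak_deriv L h e"
  shows "(LINT x|mI L. d x * h x) = g L * h L - g 0 * h 0 - (LINT x|mI L. g x * e x)"
proof -
  have "(\<lambda>x. h x * d x) \<in> L2 L" "(\<lambda>x. g x * e x) \<in> L2 L"
    using L2_mult_continuous[OF hwd_L2[OF g] hwd_continuous[OF h]] L2_mult_continuous[OF hwd_L2[OF h] hwd_continuous[OF g]] by auto
  then have "integrable (mI L) (\<lambda>x. d x * h x)" "integrable (mI L) (\<lambda>x. g x * e x)"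
    by (auto simp: mult.commute dest: L2_integrable)
  then show ?thesis using hwd_eq[OF hwd_mult[OF g h], of L] L by (simp add: algebra_simps)
qed

lemma hwd_C1:
  assumes d: "continuous_on {0..L} d"
    and g: "\<And>x. x \<in> {0..L} \<Longrightarrow> (g has_vector_derivative d x) (at x within {0..L})"
  shows "has_weak_deriv L g d"
  unfolding has_weak_deriv_def
proof (intro conjI ballI)
  show "d \<in> L2 L" by (rule L2_continuous[OF d])
  fix x assume x: "x \<in> {0..L}"
  have "(d has_integral (g x - g 0)) {0..x}"
    by (rule fundamental_theorem_of_calculus)
      (use x in \<open>auto intro: has_vector_derivative_within_subset[OF g]\<close>)
  then show "g x = g 0 + integral\<^sup>L (mI x) d"
    using integral_mI_HK[OF integrable_mI_sub[OF _ _ integrable_continuous_mI[OF d], of x]] x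
    by (simp add: integral_unique)
qed

lemma hwd_C1':
  assumes "continuous_on {0..L} d" "\<And>x. (g has_vector_derivative d x) (at x)"
  shows "has_weak_deriv L g d"
  using assms by (intro hwd_C1) (auto intro: has_vector_derivative_at_within)

lemma hwd_primitive:
  assumes d: "d \<in> L2 L" shows "has_weak_deriv L (\<lambda>x. a + integral\<^sup>L (mI x) d) d"
proof -
  have "(LINT s|mI 0. d s) = (LINT s|lebesgue. indicat_real {0..0} s *\<^sub>R d s)"
    by (rule integral_restrict_space) simp
  also have "\<dots> = 0" by (rule integral_eq_zero_AE) (auto intro!: AE_I'[of "{0}"] simp flip: negligible_iff_null_sets)
  finally have "integral\<^sup>L (mI 0) d = 0" .
  then show ?thesis using d by (simp add: has_weak_deriv_def)
qed

lemma hwd_vector_derivative: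
  assumes g: "has_weak_deriv L g d" and d: "continuous_on {0..L} d" and x: "x \<in> {0..L}"
  shows "(g has_vector_derivative d x) (at x within {0..L})"
proof -
  have "((\<lambda>u. g 0 + integral {0..u} d) has_vector_derivative d x) (at x within {0..L})"
    using has_vector_derivative_add[OF has_vector_derivative_const integral_has_vector_derivative[OF d x]] by simp
  then show ?thesis
  proof (rule has_vector_derivative_transform[OF x, rotated])
    fix y assume y: "y \<in> {0..L}"
    show "g y = g 0 + integral {0..y} d"
      using hwd_eq[OF g y] integral_mI_HK[OF integrable_mI_sub[OF _ _ integrable_continuous_mI[OF d], of y]] y by simp
  qed
qed

text \<open>The difference vanishes almost everywhere, hence is a weak derivative of the zero
  function; being continuous, it is also its classical derivative, which is zero at every point
  because the interval is nondegenerate.\<close>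

lemma AE_eq_continuous:
  fixes f g :: "real \<Rightarrow> complex"
  assumes L: "L > 0" and f: "continuous_on {0..L} f" and g: "continuous_on {0..L} g"
    and ae: "AE x in mI L. f x = g x" and x: "x \<in> {0..L}"
  shows "f x = g x"
proof -
  let ?d = "\<lambda>x. f x - g x"
  have c: "continuous_on {0..L} ?d" by (intro continuous_intros f g)
  have hz: "has_weak_deriv L (\<lambda>x. 0) ?d"
    by (rule hwd_cong[OF hwd_const]) (use ae in \<open>auto intro: L2_continuous[OF c]\<close>)
  have "((\<lambda>x. 0::complex) has_vector_derivative ?d x) (at x within {0..L})"
    by (rule hwd_vector_derivative[OF hz c x])
  moreover have "((\<lambda>x. 0::complex) has_vector_derivative 0) (at x within {0..L})" by simp
  ultimately have "?d x = 0"
    using vector_derivative_unique_within_closed_interval[of 0 L x, unfolded cbox_interval, OF L x] by blast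
  then show ?thesis by simp
qed

lemma H1_weak_deriv: "g \<in> H1 L \<Longrightarrow> has_weak_deriv L g (weak_deriv L g)"
  unfolding H1_def weak_deriv_def using someI_ex[of "has_weak_deriv L g"] by auto

lemma hwd_H1: "has_weak_deriv L g d \<Longrightarrow> g \<in> H1 L"
  by (auto simp: H1_def)

lemma weak_deriv_AE: "has_weak_deriv L g d \<Longrightarrow> AE x in mI L. weak_deriv L g x = d x"
  by (rule hwd_AE_unique[OF H1_weak_deriv[OF hwd_H1]]) auto

lemma weak_deriv_L2: "g \<in> H1 L \<Longrightarrow> weak_deriv L g \<in> L2 L"
  by (rule hwd_L2[OF H1_weak_deriv])

lemma hwd_H2: "has_weak_deriv L g d \<Longrightarrow> has_weak_deriv L d e \<Longrightarrow> g \<in> H2 L"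
  by (auto simp: H2_def dest: hwd_H1)

lemma H2_obtain:
  assumes "g \<in> H2 L"
  obtains d where "has_weak_deriv L g d" "has_weak_deriv L d (weak_deriv2 L g)"
proof -
  obtain d e where "has_weak_deriv L g d" "has_weak_deriv L d e" using assms by (auto simp: H2_def H1_def)
  then have "\<exists>e d. has_weak_deriv L g d \<and> has_weak_deriv L d e" by blast
  from someI_ex[OF this] that show ?thesis unfolding weak_deriv2_def by blast
qed

lemma weak_deriv2_AE:
  assumes L: "L > 0" and g: "has_weak_deriv L g d" and d: "has_weak_deriv L d e"
  shows "AE x in mI L. weak_deriv2 L g x = e x"
proof -
  obtain d' where d': "has_weak_deriv L g d'" "has_weak_deriv L d' (weak_deriv2 L g)"
    using H2_obtain[OF hwd_H2[OF g d]] .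
  show ?thesis
    by (rule hwd_AE_unique[OF d'(2) d])
      (rule AE_eq_continuous[OF L hwd_continuous[OF d'(2)] hwd_continuous[OF d] hwd_AE_unique[OF d'(1) g]], auto)
qed

section \<open>The state space\<close>

lemma hwd_H1_0: "has_weak_deriv L g d \<Longrightarrow> g 0 = 0 \<Longrightarrow> g \<in> H1_0 L"
  by (auto simp: H1_0_def H1_def)

lemma HH_I: "f \<in> L2 L \<Longrightarrow> has_weak_deriv L g d \<Longrightarrow> g 0 = 0 \<Longrightarrow> h \<in> L2 L \<Longrightarrow> (f, g, h) \<in> HH L"
  by (simp add: HH_def hwd_H1_0)

lemma HH_D: "(f, g, h) \<in> HH L \<Longrightarrow> f \<in> L2 L \<and> g \<in> H1 L \<and> g 0 = 0 \<and> h \<in> L2 L"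
  by (simp add: HH_def H1_0_def)

lemma ip_expand:
  assumes "(f1, g1, h1) \<in> HH L" "(f2, g2, h2) \<in> HH L"
  shows "ip L (f1, g1, h1) (f2, g2, h2) = l2ip L f1 f2 + l2ip L (weak_deriv L g1) (weak_deriv L g2) + l2ip L h1 h2"
proof -
  have "integrable (mI L) (\<lambda>x. f1 x * cnj (f2 x))" "integrable (mI L) (\<lambda>x. h1 x * cnj (h2 x))"
    "integrable (mI L) (\<lambda>x. weak_deriv L g1 x * cnj (weak_deriv L g2 x))"
    using assms by (auto dest!: HH_D intro: l2ip_integrable weak_deriv_L2)
  then show ?thesis by (simp add: ip_def l2ip_def)
qed

text \<open>\<open>weak_deriv\<close> is an arbitrary choice among almost everywhere equal
  functions; this lets computations of inner products use whichever derivative is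
  convenient.\<close>

lemma ip_hwd:
  assumes f: "f1 \<in> L2 L" "f2 \<in> L2 L" and h: "h1 \<in> L2 L" "h2 \<in> L2 L"
    and g: "has_weak_deriv L g1 d1" "g1 0 = 0" "has_weak_deriv L g2 d2" "g2 0 = 0"
  shows "ip L (f1, g1, h1) (f2, g2, h2) = l2ip L f1 f2 + l2ip L d1 d2 + l2ip L h1 h2"
proof -
  have "l2ip L (weak_deriv L g1) (weak_deriv L g2) = l2ip L d1 d2"
    by (rule l2ip_cong_AE) (use g in \<open>auto intro: weak_deriv_L2 hwd_H1 hwd_L2 weak_deriv_AE\<close>)
  then show ?thesis by (subst ip_expand) (use assms in \<open>auto intro: HH_I\<close>)
qed

lemma smul_Pair [simp]: "smul a (f, g, h) = (\<lambda>x. a * f x, \<lambda>x. a * g x, \<lambda>x. a * h x)"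
  by (simp add: smul_def)

lemma plus_fun_eq: "f + g = (\<lambda>x. f x + g x)" for f g :: "real \<Rightarrow> complex" by (rule ext) simp

lemma minus_fun_eq: "f - g = (\<lambda>x. f x - g x)" for f g :: "real \<Rightarrow> complex" by (rule ext) simp

lemma HH_cases:
  assumes "X \<in> HH L"
  obtains f g h d where "X = (f, g, h)" "f \<in> L2 L" "has_weak_deriv L g d" "g 0 = 0" "h \<in> L2 L"
  using assms by (cases X) (auto dest: HH_D H1_weak_deriv)

lemma semi_inner_HH: "semi_inner (HH L) smul (ip L)"
proof
  show "0 \<in> HH L" by (simp add: zero_prod_def zero_fun_def HH_I[OF _ hwd_const])
next
  fix X Y assume X: "X \<in> HH L" and Y: "Y \<in> HH L"
  obtain f1 g1 h1 d1 where 1: "X = (f1, g1, h1)" "f1 \<in> L2 L" "has_weak_deriv L g1 d1" "g1 0 = 0" "h1 \<in> L2 L"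
    using X by (rule HH_cases)
  obtain f2 g2 h2 d2 where 2: "Y = (f2, g2, h2)" "f2 \<in> L2 L" "has_weak_deriv L g2 d2" "g2 0 = 0" "h2 \<in> L2 L"
    using Y by (rule HH_cases)
  show "X + Y \<in> HH L" unfolding 1(1) 2(1) plus_prod_def plus_fun_eq fst_conv snd_conv
    by (rule HH_I[OF L2_add hwd_add _ L2_add]) (use 1 2 in simp_all)
  show "ip L Y X = cnj (ip L X Y)"
    unfolding 1(1) 2(1) using 1 2 by (simp add: ip_hwd[OF _ _ _ _ 1(3,4) 2(3,4)] ip_hwd[OF _ _ _ _ 2(3,4) 1(3,4)])
      (simp flip: l2ip_cnj)
  fix Z assume Z: "Z \<in> HH L"
  obtain f3 g3 h3 d3 where 3: "Z = (f3, g3, h3)" "f3 \<in> L2 L" "has_weak_deriv L g3 d3" "g3 0 = 0" "h3 \<in> L2 L"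
    using Z by (rule HH_cases)
  have "ip L (X + Y) Z = l2ip L (\<lambda>x. f1 x + f2 x) f3 + l2ip L (\<lambda>x. d1 x + d2 x) d3 + l2ip L (\<lambda>x. h1 x + h2 x) h3"
    unfolding 1(1) 2(1) 3(1) plus_prod_def plus_fun_eq fst_conv snd_conv
    by (rule ip_hwd[OF L2_add _ L2_add _ hwd_add]) (use 1 2 3 in simp_all)
  also have "\<dots> = ip L X Z + ip L Y Z"
    unfolding 1(1) 2(1) 3(1) using 1 2 3 hwd_L2[OF 1(3)] hwd_L2[OF 2(3)] hwd_L2[OF 3(3)]
    by (simp add: ip_hwd[OF _ _ _ _ 1(3,4) 3(3,4)] ip_hwd[OF _ _ _ _ 2(3,4) 3(3,4)] l2ip_add)
  finally show "ip L (X + Y) Z = ip L X Z + ip L Y Z" .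
next
  fix X and a :: complex assume X: "X \<in> HH L"
  obtain f1 g1 h1 d1 where 1: "X = (f1, g1, h1)" "f1 \<in> L2 L" "has_weak_deriv L g1 d1" "g1 0 = 0" "h1 \<in> L2 L"
    using X by (rule HH_cases)
  show "smul a X \<in> HH L" unfolding 1(1) smul_Pair
    by (rule HH_I[OF L2_cmult hwd_cmult _ L2_cmult]) (use 1 in simp_all)
  show "0 \<le> Re (ip L X X)" unfolding 1(1)
    using 1 hwd_L2[OF 1(3)] by (simp add: ip_hwd[OF _ _ _ _ 1(3,4) 1(3,4)] l2ip_self integral_nonneg_AE)
  fix Y assume Y: "Y \<in> HH L"
  obtain f2 g2 h2 d2 where 2: "Y = (f2, g2, h2)" "f2 \<in> L2 L" "has_weak_deriv L g2 d2" "g2 0 = 0" "h2 \<in> L2 L"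
    using Y by (rule HH_cases)
  have "ip L (smul a X) Y = l2ip L (\<lambda>x. a * f1 x) f2 + l2ip L (\<lambda>x. a * d1 x) d2 + l2ip L (\<lambda>x. a * h1 x) h2"
    unfolding 1(1) 2(1) smul_Pair
    by (rule ip_hwd[OF L2_cmult _ L2_cmult _ hwd_cmult]) (use 1 2 in simp_all)
  then show "ip L (smul a X) Y = a * ip L X Y"
    unfolding 1(1) 2(1) using 1 2
    by (simp add: ip_hwd[OF _ _ _ _ 1(3,4) 2(3,4)] l2ip_cmult algebra_simps)
next
  fix a b and X Y :: state
  show "smul a (X + Y) = smul a X + smul a Y"
    by (simp add: smul_def plus_prod_def plus_fun_eq case_prod_unfold algebra_simps)
  show "smul (a + b) X = smul a X + smul b X"
    by (simp add: smul_def plus_prod_def plus_fun_eq case_prod_unfold algebra_simps)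
qed (auto simp: smul_def fun_eq_iff algebra_simps split: prod.splits)

lemma Hnorm_sq:
  assumes "f \<in> L2 L" "has_weak_deriv L g d" "g 0 = 0" "h \<in> L2 L"
  shows "(Hnorm L (f, g, h))\<^sup>2 = (LINT x|mI L. (cmod (f x))\<^sup>2) + (LINT x|mI L. (cmod (d x))\<^sup>2) + (LINT x|mI L. (cmod (h x))\<^sup>2)"
  using assms hwd_L2[OF assms(2)]
  by (simp add: Hnorm_def ip_hwd[OF _ _ _ _ assms(2,3) assms(2,3)] l2ip_self integral_nonneg_AE)

lemma Hnorm_diff_sq:
  assumes "f1 \<in> L2 L" "has_weak_deriv L g1 d1" "g1 0 = 0" "h1 \<in> L2 L"
    and "f2 \<in> L2 L" "has_weak_deriv L g2 d2" "g2 0 = 0" "h2 \<in> L2 L"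
  shows "(Hnorm L ((f1, g1, h1) - (f2, g2, h2)))\<^sup>2 = (LINT x|mI L. (cmod (f1 x - f2 x))\<^sup>2)
    + (LINT x|mI L. (cmod (d1 x - d2 x))\<^sup>2) + (LINT x|mI L. (cmod (h1 x - h2 x))\<^sup>2)"
  unfolding minus_prod_def minus_fun_eq fst_conv snd_conv
  by (rule Hnorm_sq[OF L2_diff hwd_diff _ L2_diff]) (use assms in simp_all)

lemma nrm_Hnorm: "semi_inner.nrm (ip L) = Hnorm L"
  using semi_inner_HH[of L] by (simp add: fun_eq_iff semi_inner.nrm_def Hnorm_def)

text \<open>The norm sees the middle component only through its derivative, so its limit is
  recovered as the primitive, starting at 0, of the limit of the derivatives.\<close>

lemma semi_hilbert_HH: "semi_hilbert (HH L) smul (ip L)"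
proof -
  interpret semi_inner "HH L" smul "ip L" by (rule semi_inner_HH)
  show ?thesis
  proof
    fix x :: "nat \<Rightarrow> state"
    assume xH: "\<And>n. x n \<in> HH L" and C: "\<And>e. e > 0 \<Longrightarrow> \<exists>N. \<forall>m\<ge>N. \<forall>n\<ge>N. nrm (x m - x n) < e"
    have "\<forall>n. \<exists>f g h d. x n = (f, g, h) \<and> f \<in> L2 L \<and> has_weak_deriv L g d \<and> g 0 = 0 \<and> h \<in> L2 L"
      using HH_cases[OF xH] by metis
    then obtain f g h d where x: "\<And>n. x n = (f n, g n, h n)" and f: "\<And>n. f n \<in> L2 L"
      and g: "\<And>n. has_weak_deriv L (g n) (d n)" "\<And>n. g n 0 = 0" and h: "\<And>n. h n \<in> L2 L" by metis
    have d: "d n \<in> L2 L" for n by (rule hwd_L2[OF g(1)])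
    have sq: "(nrm (x m - x n))\<^sup>2 = (LINT y|mI L. (cmod (f m y - f n y))\<^sup>2)
        + (LINT y|mI L. (cmod (d m y - d n y))\<^sup>2) + (LINT y|mI L. (cmod (h m y - h n y))\<^sup>2)" for m n
      unfolding x nrm_Hnorm by (rule Hnorm_diff_sq[OF f g h f g h])
    have pos: "0 \<le> (LINT y|mI L. (cmod (k y))\<^sup>2)" for k by (simp add: integral_nonneg_AE)
    have lt: "\<exists>N. \<forall>m\<ge>N. \<forall>n\<ge>N. (nrm (x m - x n))\<^sup>2 < e" if e: "e > 0" for e
    proof -
      obtain N where N: "\<forall>m\<ge>N. \<forall>n\<ge>N. nrm (x m - x n) < sqrt e" using C[of "sqrt e"] e by auto
      have "(nrm (x m - x n))\<^sup>2 < e" if "m \<ge> N" "n \<ge> N" for m n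
      proof -
        have "(nrm (x m - x n))\<^sup>2 < (sqrt e)\<^sup>2"
          using N that nrm_nonneg[OF diff_closed[OF xH xH]] by (intro power_strict_mono) auto
        then show ?thesis using e by simp
      qed
      then show ?thesis by blast
    qed
    have "\<exists>l\<in>L2 L. (\<lambda>n. LINT y|mI L. (cmod (f n y - l y))\<^sup>2) \<longlonglongrightarrow> 0"
    proof (rule L2_complete[OF f])
      fix e :: real assume "e > 0"
      from lt[OF this] show "\<exists>N. \<forall>m\<ge>N. \<forall>n\<ge>N. (LINT y|mI L. (cmod (f m y - f n y))\<^sup>2) < e"
        unfolding sq using pos by (meson add_increasing2 le_less_trans order_refl)
    qed
    moreover have "\<exists>l\<in>L2 L. (\<lambda>n. LINT y|mI L. (cmod (d n y - l y))\<^sup>2) \<longlonglongrightarrow> 0"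
    proof (rule L2_complete[OF d])
      fix e :: real assume "e > 0"
      from lt[OF this] show "\<exists>N. \<forall>m\<ge>N. \<forall>n\<ge>N. (LINT y|mI L. (cmod (d m y - d n y))\<^sup>2) < e"
        unfolding sq using pos by (meson add_increasing2 add_increasing le_less_trans order_refl)
    qed
    moreover have "\<exists>l\<in>L2 L. (\<lambda>n. LINT y|mI L. (cmod (h n y - l y))\<^sup>2) \<longlonglongrightarrow> 0"
    proof (rule L2_complete[OF h])
      fix e :: real assume "e > 0"
      from lt[OF this] show "\<exists>N. \<forall>m\<ge>N. \<forall>n\<ge>N. (LINT y|mI L. (cmod (h m y - h n y))\<^sup>2) < e"
        unfolding sq using pos by (meson add_increasing add_nonneg_nonneg le_less_trans order_refl)
    qed
    ultimately obtain lf ld lh where l: "lf \<in> L2 L" "ld \<in> L2 L" "lh \<in> L2 L"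
      and lim: "(\<lambda>n. LINT y|mI L. (cmod (f n y - lf y))\<^sup>2) \<longlonglongrightarrow> 0"
        "(\<lambda>n. LINT y|mI L. (cmod (d n y - ld y))\<^sup>2) \<longlonglongrightarrow> 0" "(\<lambda>n. LINT y|mI L. (cmod (h n y - lh y))\<^sup>2) \<longlonglongrightarrow> 0"
      by blast
    define lg where "lg y = (LINT s|mI y. ld s)" for y
    have lg: "has_weak_deriv L lg ld" using hwd_primitive[OF l(2), of 0] by (simp add: lg_def[abs_def])
    have lg0: "lg 0 = 0"
    proof -
      have "lg 0 = (LINT s|lebesgue. indicat_real {0..0} s *\<^sub>R ld s)"
        unfolding lg_def by (rule integral_restrict_space) simp
      also have "\<dots> = 0" by (rule integral_eq_zero_AE) (auto intro!: AE_I'[of "{0}"] simp flip: negligible_iff_null_sets)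
      finally show ?thesis .
    qed
    have "(\<lambda>n. (nrm (x n - (lf, lg, lh)))\<^sup>2) \<longlonglongrightarrow> 0 + 0 + 0"
      unfolding x nrm_Hnorm Hnorm_diff_sq[OF f g h l(1) lg lg0 l(3)] by (intro tendsto_add lim)
    then have "(\<lambda>n. sqrt ((nrm (x n - (lf, lg, lh)))\<^sup>2)) \<longlonglongrightarrow> sqrt 0" by (intro tendsto_real_sqrt) simp
    moreover have "sqrt ((nrm (x n - (lf, lg, lh)))\<^sup>2) = nrm (x n - (lf, lg, lh))" for n
      using nrm_nonneg[OF diff_closed[OF xH HH_I[OF l(1) lg lg0 l(3)]]] by simp
    ultimately have "(\<lambda>n. nrm (x n - (lf, lg, lh))) \<longlonglongrightarrow> 0" by simp
    then show "\<exists>l\<in>HH L. (\<lambda>n. nrm (x n - l)) \<longlonglongrightarrow> 0" using HH_I[OF l(1) lg lg0 l(3)] by blast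
  qed
qed

section \<open>A flat control function\<close>

text \<open>Bounds the exponent of the bump on the circle used in Cauchy's estimate. On that disc
  the square stays in a narrow sector about the positive axis, with real part at least y^2/2 and
  modulus at most 26/16 y^2; the constant 128/676 so obtained exceeds 1/6.\<close>

lemma Re_inverse_square_ge:
  fixes y :: real and \<zeta> :: complex
  assumes y: "y > 0" and z: "cmod \<zeta> \<le> y / 4"
  shows "Re (1 / (of_real y + \<zeta>)\<^sup>2) \<ge> 1 / (6 * y\<^sup>2)"
proof -
  let ?w = "of_real y + \<zeta>"
  define s t where "s = Re \<zeta>" and "t = Im \<zeta>"
  have s: "\<bar>s\<bar> \<le> y / 4" and t: "\<bar>t\<bar> \<le> y / 4"
    using z abs_Re_le_cmod[of \<zeta>] abs_Im_le_cmod[of \<zeta>] by (auto simp: s_def t_def)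
  have st: "s\<^sup>2 + t\<^sup>2 \<le> y\<^sup>2 / 16"
    using power_mono[OF z, of 2] by (simp add: cmod_power2 s_def t_def power_divide)
  define A where "A = (y + s)\<^sup>2 - t\<^sup>2"
  define B where "B = (y + s)\<^sup>2 + t\<^sup>2"
  have t2: "t\<^sup>2 \<le> y\<^sup>2 / 16" using st zero_le_power2[of s] by linarith
  have lo: "(3 * y / 4)\<^sup>2 \<le> (y + s)\<^sup>2" using s y by (intro power_mono) auto
  have up: "(y + s)\<^sup>2 \<le> (5 * y / 4)\<^sup>2" using s y by (intro power_mono) auto
  have A: "A \<ge> y\<^sup>2 / 2" using lo t2 by (simp add: A_def power_divide power_mult_distrib)
  have y2: "y\<^sup>2 > 0" using y by simp
  have B: "B \<le> 26 / 16 * y\<^sup>2" using up t2 by (simp add: B_def power_divide power_mult_distrib)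
  have Bpos: "B > 0"
  proof -
    have "B = A + 2 * t\<^sup>2" by (simp add: A_def B_def)
    moreover have "t\<^sup>2 \<ge> 0" by simp
    ultimately show ?thesis using A y2 by linarith
  qed
  have "Re (1 / ?w\<^sup>2) = A / B\<^sup>2"
  proof -
    have w: "1 / ?w\<^sup>2 = (cnj ?w)\<^sup>2 / of_real (B\<^sup>2)"
    proof -
      have wB: "?w * cnj ?w = of_real B"
        by (subst complex_mult_cnj) (simp add: B_def s_def t_def)
      then have "?w \<noteq> 0" using Bpos by auto
      moreover have "cnj ?w \<noteq> 0" using \<open>?w \<noteq> 0\<close> complex_cnj_zero_iff by blast
      ultimately show ?thesis unfolding wB[symmetric] of_real_power using \<open>?w \<noteq> 0\<close>
        by (simp add: power_mult_distrib)
    qed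
    show ?thesis unfolding w Re_divide_of_real by (simp add: A_def s_def t_def power2_eq_square)
  qed
  also have "A / B\<^sup>2 \<ge> (y\<^sup>2 / 2) / (26 / 16 * y\<^sup>2)\<^sup>2"
    using A B Bpos y2 by (intro frac_le power_mono) auto
  also have "(y\<^sup>2 / 2) / (26 / 16 * y\<^sup>2)\<^sup>2 = (128 / 676) / y\<^sup>2"
    using y2 by (simp add: field_simps power2_eq_square)
  also have "(128 / 676) / y\<^sup>2 \<ge> (1 / 6) / y\<^sup>2" using y2 by (intro divide_right_mono) auto
  finally show ?thesis by simp
qed

lemma power_le_exp_fact:
  fixes y :: real
  assumes "y \<ge> 0" shows "y ^ n \<le> fact n * exp y"
proof -
  have "y ^ n /\<^sub>R fact n \<le> (\<Sum>i. y ^ i /\<^sub>R fact i)"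
    using assms sums_summable[OF exp_converges[of y]] sum_le_suminf[of "\<lambda>i. y ^ i /\<^sub>R fact i" "{n}"] by simp
  also have "\<dots> = exp y" using exp_converges[of y] by (simp add: sums_iff)
  finally show ?thesis by (simp add: field_simps)
qed

text \<open>Used to differentiate the bump and its derivatives at the two end points, where the
  defining formula is singular.\<close>

lemma has_vector_derivative_zero_at_flat:
  fixes f :: "real \<Rightarrow> complex"
  assumes "\<And>x. cmod (f x) \<le> C * (x - a)\<^sup>2"
  shows "(f has_vector_derivative 0) (at a)"
  unfolding has_vector_derivative_def has_derivative_at
proof (intro conjI)
  have fa: "f a = 0" using assms[of a] by simp
  show "bounded_linear (\<lambda>x. x *\<^sub>R (0::complex))" by simp
  have lim: "(\<lambda>h. \<bar>C\<bar> * \<bar>h\<bar>) \<midarrow>0\<rightarrow> 0" by (auto intro!: tendsto_eq_intros)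
  have "norm (norm (f (a + h) - f a - h *\<^sub>R 0) / norm h) \<le> \<bar>C\<bar> * \<bar>h\<bar>" for h
  proof -
    have "cmod (f (a + h)) \<le> C * h\<^sup>2" using assms[of "a + h"] by simp
    also have "\<dots> \<le> \<bar>C\<bar> * h\<^sup>2" by (intro mult_right_mono) auto
    finally show ?thesis using fa by (cases "h = 0") (auto simp: field_simps power2_eq_square)
  qed
  then show "(\<lambda>h. norm (f (a + h) - f a - h *\<^sub>R 0) / norm h) \<midarrow>0\<rightarrow> 0"
    by (intro Lim_null_comparison[OF _ lim]) auto
qed

lemma continuous_on_of_vector_derivative:
  fixes f :: "real \<Rightarrow> complex"
  assumes "\<And>x. x \<in> S \<Longrightarrow> (f has_vector_derivative f' x) (at x within S)" shows "continuous_on S f"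
  using assms has_vector_derivative_continuous continuous_on_eq_continuous_within by blast

text \<open>This is n! to the power 3/2, the derivative growth of Gevrey order 3/2. An order below 2
  is what the flat series needs, since its denominators (2i+1)! grow like (i!)^2 up to geometric
  factors.\<close>

definition gev :: "nat \<Rightarrow> real" where "gev n = fact n * sqrt (fact n)"

lemma gev_pos: "gev n > 0" by (simp add: gev_def)

lemma gev_mono: "gev n \<le> gev (Suc n)"
  unfolding gev_def by (intro mult_mono) (auto simp del: fact_Suc intro!: fact_mono)

text \<open>The bump \<open>exp(-1/(x-a)\<^sup>2 - 1/(b-x)\<^sup>2)\<close> is of Gevrey order 3/2, by Cauchy's estimate on the disc of
  radius a quarter of the distance to the end points.\<close>

lemma gevrey_bump:
  fixes a b :: real
  assumes ab: "a < b"
  obtains B :: "nat \<Rightarrow> real \<Rightarrow> complex" where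
    "\<And>j x. x \<le> a \<or> b \<le> x \<Longrightarrow> B j x = 0"
    "\<And>j x. (B j has_vector_derivative B (Suc j) x) (at x)"
    "\<And>j x. cmod (B j x) \<le> 8 ^ j * gev j"
    "\<And>x. a < x \<Longrightarrow> x < b \<Longrightarrow> \<exists>r>0. B 0 x = of_real r"
proof -
  define \<Phi> where "\<Phi> z = exp (- (1 / (z - of_real a)\<^sup>2) - 1 / (of_real b - z)\<^sup>2)" for z :: complex
  define B where "B j x = (if a < x \<and> x < b then (deriv ^^ j) \<Phi> (of_real x) else 0)" for j :: nat and x :: real
  define \<Omega> where "\<Omega> = - {of_real a, of_real b :: complex}"
  have op: "open \<Omega>" by (auto simp: \<Omega>_def intro!: open_Compl finite_imp_closed)
  have hol: "\<Phi> holomorphic_on \<Omega>"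
    unfolding \<Phi>_def by (intro holomorphic_intros) (auto simp: \<Omega>_def)
  have est: "cmod (B j x) \<le> fact j * 4 ^ j * ((1 / d) ^ j * exp (- (1 / (6 * d\<^sup>2))))"
    if x: "a < x" "x < b" and d: "d = min (x - a) (b - x)" for j x d
  proof -
    have d0: "d > 0" using x d by auto
    have far: "x - a \<ge> d" "b - x \<ge> d" using d by auto
    have cb: "cball (of_real x) (d / 4) \<subseteq> \<Omega>"
    proof
      fix z :: complex assume z: "z \<in> cball (of_real x) (d / 4)"
      have "dist (of_real x :: complex) (of_real a) = x - a" "dist (of_real x :: complex) (of_real b) = b - x"
        using x by (simp_all add: dist_norm norm_of_real flip: of_real_diff)
      then show "z \<in> \<Omega>" using z far d0 by (auto simp: \<Omega>_def)
    qed
    have bd: "cmod (\<Phi> z) \<le> exp (- (1 / (6 * d\<^sup>2)))" if "cmod (of_real x - z) = d / 4" for z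
    proof -
      define \<zeta> where "\<zeta> = z - of_real x"
      have \<zeta>: "cmod \<zeta> = d / 4" using that by (simp add: \<zeta>_def norm_minus_commute)
      have ea: "z - of_real a = of_real (x - a) + \<zeta>" and eb: "of_real b - z = of_real (b - x) + (- \<zeta>)"
        by (auto simp: \<zeta>_def)
      have ra: "Re (1 / (z - of_real a)\<^sup>2) \<ge> 1 / (6 * (x - a)\<^sup>2)"
        unfolding ea using x \<zeta> far by (intro Re_inverse_square_ge) auto
      have rb: "Re (1 / (of_real b - z)\<^sup>2) \<ge> 1 / (6 * (b - x)\<^sup>2)"
        unfolding eb using x \<zeta> far by (intro Re_inverse_square_ge) auto
      have "1 / (6 * (x - a)\<^sup>2) + 1 / (6 * (b - x)\<^sup>2) \<ge> 1 / (6 * d\<^sup>2)"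
        using d by (auto simp: min_def)
      then have "Re (- (1 / (z - of_real a)\<^sup>2) - 1 / (of_real b - z)\<^sup>2) \<le> - (1 / (6 * d\<^sup>2))"
        using ra rb by simp
      then show ?thesis unfolding \<Phi>_def norm_exp_eq_Re by simp
    qed
    have "cmod ((deriv ^^ j) \<Phi> (of_real x)) \<le> fact j * exp (- (1 / (6 * d\<^sup>2))) / (d / 4) ^ j"
      by (rule Cauchy_inequality[OF holomorphic_on_subset[OF hol] holomorphic_on_imp_continuous_on[OF holomorphic_on_subset[OF hol cb]] _ bd])
        (use cb ball_subset_cball d0 in auto)
    then show ?thesis using x d0 by (simp add: B_def power_divide field_simps)
  qed
  \<comment> \<open>After squaring, this is \<open>y^k exp(-y) \<le> k!\<close> at
    \<open>y = 1/(3 d^2)\<close>. It contributes half a factorial; the full one comes from Cauchy's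
    inequality.\<close>
  have estp: "(1 / d) ^ k * exp (- (1 / (6 * d\<^sup>2))) \<le> 2 ^ k * sqrt (fact k)" if d: "d > 0" for k :: nat and d :: real
  proof -
    have "(exp (- (1 / (6 * d\<^sup>2))))\<^sup>2 = exp (- (1 / (3 * d\<^sup>2)))" by (simp flip: exp_double)
    moreover have "((1 / d) ^ k)\<^sup>2 = (1 / d\<^sup>2) ^ k"
      unfolding power_mult[symmetric] mult.commute[of k 2] unfolding power_mult by (simp add: power_divide)
    ultimately have "((1 / d) ^ k * exp (- (1 / (6 * d\<^sup>2))))\<^sup>2 = (1 / d\<^sup>2) ^ k * exp (- (1 / (3 * d\<^sup>2)))"
      by (simp only: power_mult_distrib)
    also have "\<dots> = 3 ^ k * ((1 / (3 * d\<^sup>2)) ^ k * exp (- (1 / (3 * d\<^sup>2))))"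
      by (simp add: power_divide power_mult_distrib)
    also have "\<dots> \<le> 3 ^ k * (fact k * exp (1 / (3 * d\<^sup>2)) * exp (- (1 / (3 * d\<^sup>2))))"
      by (intro mult_left_mono mult_right_mono power_le_exp_fact) auto
    also have "\<dots> = 3 ^ k * fact k" by (simp add: mult.assoc mult_exp_exp)
    also have "\<dots> \<le> 4 ^ k * fact k" by (intro mult_right_mono power_mono) auto
    also have "\<dots> = (2 ^ k * sqrt (fact k))\<^sup>2"
    proof -
      have "(2 ^ k)\<^sup>2 = (4::real) ^ k" unfolding power_mult[symmetric] mult.commute[of k 2] unfolding power_mult by simp
      then show ?thesis by (simp add: power_mult_distrib)
    qed
    finally show ?thesis by (rule power2_le_imp_le) simp
  qed
  have b1: "cmod (B j x) \<le> 8 ^ j * gev j" for j x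
  proof (cases "a < x \<and> x < b")
    case True
    define d where "d = min (x - a) (b - x)"
    have d0: "d > 0" using True by (auto simp: d_def)
    have "cmod (B j x) \<le> fact j * 4 ^ j * ((1 / d) ^ j * exp (- (1 / (6 * d\<^sup>2))))"
      using est[of x d j] True d_def by auto
    also have "\<dots> \<le> fact j * 4 ^ j * (2 ^ j * sqrt (fact j))"
      by (intro mult_left_mono estp[OF d0]) auto
    also have "\<dots> = 8 ^ j * gev j" by (simp add: gev_def flip: power_mult_distrib)
    finally show ?thesis .
  next
    case False
    then show ?thesis using gev_pos[of j] by (auto simp: B_def)
  qed
  \<comment> \<open>Applying \<open>estp\<close> with two additional powers of 1/d pays for the
    factor d^2, so that every derivative is flat at both end points.\<close>
  have b2: "cmod (B j x) \<le> (fact j * 4 ^ j * (2 ^ (j + 2) * sqrt (fact (j + 2)))) * (x - e)\<^sup>2" if "e = a \<or> e = b" for j x e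
  proof (cases "a < x \<and> x < b")
    case True
    define d where "d = min (x - a) (b - x)"
    have d0: "d > 0" using True by (auto simp: d_def)
    have "d\<^sup>2 \<le> \<bar>x - e\<bar>\<^sup>2" using that True by (intro power_mono) (auto simp: d_def)
    then have de: "d\<^sup>2 \<le> (x - e)\<^sup>2" by simp
    have "cmod (B j x) \<le> fact j * 4 ^ j * ((1 / d) ^ j * exp (- (1 / (6 * d\<^sup>2))))"
      using est[of x d j] True d_def by auto
    also have "\<dots> = fact j * 4 ^ j * ((1 / d) ^ (j + 2) * exp (- (1 / (6 * d\<^sup>2)))) * d\<^sup>2"
      using d0 by (simp add: power_add power2_eq_square)
    also have "\<dots> \<le> fact j * 4 ^ j * (2 ^ (j + 2) * sqrt (fact (j + 2))) * (x - e)\<^sup>2"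
      by (intro mult_mono mult_left_mono estp[OF d0] de) auto
    finally show ?thesis .
  next
    case False
    then show ?thesis by (auto simp: B_def)
  qed
  have der: "(B j has_vector_derivative B (Suc j) x) (at x)" for j x
  proof -
    consider "x = a \<or> x = b" | "a < x" "x < b" | "x < a" | "b < x" by linarith
    then show ?thesis
    proof cases
      case 1
      then have "B (Suc j) x = 0" by (auto simp: B_def)
      then show ?thesis using has_vector_derivative_zero_at_flat[OF b2[OF 1]] by simp
    next
      case 2
      have "of_real x \<in> \<Omega>" using 2 by (simp add: \<Omega>_def)
      then have "((deriv ^^ j) \<Phi> has_field_derivative (deriv ^^ Suc j) \<Phi> (of_real x)) (at (of_real x))"
        by (intro has_field_derivative_higher_deriv[OF hol op])
      then have "((\<lambda>x. (deriv ^^ j) \<Phi> (of_real x)) has_vector_derivative (deriv ^^ Suc j) \<Phi> (of_real x)) (at x)"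
        by (rule has_vector_derivative_real_field)
      then have "(B j has_vector_derivative (deriv ^^ Suc j) \<Phi> (of_real x)) (at x)"
        by (rule has_vector_derivative_transform_within_open[of _ _ _ "{a<..<b}"]) (use 2 in \<open>auto simp: B_def\<close>)
      then show ?thesis using 2 by (simp add: B_def)
    next
      case 3
      have "(B j has_vector_derivative 0) (at x)"
        by (rule has_vector_derivative_transform_within_open[of "\<lambda>x. 0" _ _ "{..<a}"]) (use 3 in \<open>auto simp: B_def\<close>)
      then show ?thesis using 3 by (simp add: B_def)
    next
      case 4
      have "(B j has_vector_derivative 0) (at x)"
        by (rule has_vector_derivative_transform_within_open[of "\<lambda>x. 0" _ _ "{b<..}"]) (use 4 in \<open>auto simp: B_def\<close>)
      then show ?thesis using 4 by (simp add: B_def)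
    qed
  qed
  have pos: "\<exists>r>0. B 0 x = of_real r" if "a < x" "x < b" for x
  proof -
    have "B 0 x = of_real (exp (- (1 / (x - a)\<^sup>2) - 1 / (b - x)\<^sup>2))"
      using that unfolding B_def \<Phi>_def exp_of_real[symmetric] by simp
    then show ?thesis by (intro exI[of _ "exp (- (1 / (x - a)\<^sup>2) - 1 / (b - x)\<^sup>2)"]) auto
  qed
  show ?thesis by (rule that[of B, OF _ der b1 pos]) (auto simp: B_def)
qed

lemma vector_derivative_series:
  fixes F F' :: "nat \<Rightarrow> real \<Rightarrow> complex"
  assumes d: "\<And>i x. (F i has_vector_derivative F' i x) (at x)"
    and s: "\<And>x. summable (\<lambda>i. F i x)" and M: "\<And>i x. cmod (F' i x) \<le> M i" "summable M"
  shows "((\<lambda>x. \<Sum>i. F i x) has_vector_derivative (\<Sum>i. F' i x)) (at x)"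
proof -
  have u: "uniform_limit UNIV (\<lambda>n x. \<Sum>i<n. F' i x) (\<lambda>x. \<Sum>i. F' i x) sequentially"
    by (rule Weierstrass_m_test[of UNIV F' M]) (use M in auto)
  have lim0: "(\<lambda>n. (\<lambda>n x. \<Sum>i<n. F i x) n 0) \<longlonglongrightarrow> (\<Sum>i. F i 0)" using s[of 0] by (simp add: summable_LIMSEQ)
  have "\<exists>g. \<forall>x\<in>UNIV. (\<lambda>n. \<Sum>i<n. F i x) \<longlonglongrightarrow> g x \<and> (g has_derivative (\<lambda>h. h *\<^sub>R (\<Sum>i. F' i x))) (at x within UNIV)"
  proof (rule has_derivative_sequence[of UNIV "\<lambda>n x. \<Sum>i<n. F i x"
      "\<lambda>n x h. h *\<^sub>R (\<Sum>i<n. F' i x)" "\<lambda>x h. h *\<^sub>R (\<Sum>i. F' i x)" 0 "\<Sum>i. F i 0", OF convex_UNIV _ _ UNIV_I lim0])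
    show "((\<lambda>x. \<Sum>i<n. F i x) has_derivative (\<lambda>h. h *\<^sub>R (\<Sum>i<n. F' i x))) (at x within UNIV)" for n x
      using has_vector_derivative_sum[of "{..<n}" F "\<lambda>i. F' i x" "at x"] d by (simp add: has_vector_derivative_def)
    fix e :: real assume "e > 0"
    with u have "\<forall>\<^sub>F n in sequentially. \<forall>x\<in>UNIV. dist (\<Sum>i<n. F' i x) (\<Sum>i. F' i x) < e"
      by (rule uniform_limitD)
    then show "\<forall>\<^sub>F n in sequentially. \<forall>x\<in>UNIV. \<forall>h. norm (h *\<^sub>R (\<Sum>i<n. F' i x) - h *\<^sub>R (\<Sum>i. F' i x)) \<le> e * norm h"
    proof eventually_elim
      case (elim n)
      have "norm (h *\<^sub>R (\<Sum>i<n. F' i x) - h *\<^sub>R (\<Sum>i. F' i x)) \<le> e * norm h" for x h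
      proof -
        have "norm (h *\<^sub>R (\<Sum>i<n. F' i x) - h *\<^sub>R (\<Sum>i. F' i x)) = \<bar>h\<bar> * dist (\<Sum>i<n. F' i x) (\<Sum>i. F' i x)"
          by (simp add: dist_norm flip: scaleR_diff_right)
        also have "\<dots> \<le> \<bar>h\<bar> * e" using elim by (intro mult_left_mono) (auto intro: less_imp_le)
        finally show ?thesis by (simp add: mult.commute)
      qed
      then show ?case by blast
    qed
  qed
  then obtain g where g: "\<And>x. (\<lambda>n. \<Sum>i<n. F i x) \<longlonglongrightarrow> g x"
    and gd: "(g has_derivative (\<lambda>h. h *\<^sub>R (\<Sum>i. F' i x))) (at x)" by auto
  have "g = (\<lambda>x. \<Sum>i. F i x)"
    using LIMSEQ_unique[OF g summable_LIMSEQ[OF s]] by auto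
  then show ?thesis using gd by (simp add: has_vector_derivative_def)
qed

text \<open>Compares the growth of derivatives with the denominators of the flat series. The
  binomial bound \<open>i! (i+1)! \<le> (2i+1)!\<close> leaves a surplus 1/sqrt(i!), which beats
  every geometric factor.\<close>

lemma gev_Suc_le_fact: "gev (Suc i) * sqrt (fact i) \<le> 2 ^ i * fact (2 * i + 1)"
proof -
  have "real (fact i * fact (Suc i)) \<le> real (fact (2 * i + 1))"
  proof -
    have "fact i * fact (Suc i) * (2 * i + 1 choose i) = (fact (2 * i + 1) :: nat)"
      using binomial_fact_lemma[of i "2 * i + 1"] by simp
    moreover have "(2 * i + 1 choose i) \<ge> 1" by (simp add: Suc_leI)
    ultimately show ?thesis by (metis mult.right_neutral mult_le_mono2 of_nat_le_iff)
  qed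
  then have f: "fact i * fact (Suc i) \<le> (fact (2 * i + 1) :: real)"
    by (simp only: of_nat_mult of_nat_fact)
  have "sqrt (real (Suc i)) \<le> 2 ^ i"
  proof (rule real_le_lsqrt)
    have "real (Suc i) \<le> 2 ^ i" by (induction i) auto
    also have "(2::real) ^ i \<le> (2 ^ i)\<^sup>2" by (simp add: self_le_power)
    finally show "real (Suc i) \<le> (2 ^ i)\<^sup>2" .
  qed auto
  have "gev (Suc i) * sqrt (fact i) = fact (Suc i) * (sqrt (real (Suc i)) * (sqrt (fact i) * sqrt (fact i)))"
    by (simp add: gev_def real_sqrt_mult)
  also have "\<dots> = (fact i * fact (Suc i)) * sqrt (real (Suc i))" by simp
  also have "\<dots> \<le> fact (2 * i + 1) * 2 ^ i" by (intro mult_mono f \<open>sqrt (real (Suc i)) \<le> 2 ^ i\<close>) auto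
  finally show ?thesis by (simp add: mult.commute)
qed

text \<open>The general term is the product of \<open>(1/2)^i\<close> and
  \<open>(2x)^i / sqrt(i!)\<close>; both factors have summable squares.\<close>

lemma summable_power_sqrt_fact:
  fixes x :: real
  assumes "x \<ge> 0" shows "summable (\<lambda>i. x ^ i / sqrt (fact i))"
proof (rule summable_comparison_test')
  show "summable (\<lambda>i. (1/4) ^ i + (4 * x\<^sup>2) ^ i /\<^sub>R fact i)"
    by (intro summable_add summable_exp_generic) auto
  fix i :: nat assume "i \<ge> 0"
  define u v where "u = (1/2 :: real) ^ i" and "v = (2 * x) ^ i / sqrt (fact i)"
  have "x ^ i / sqrt (fact i) = u * v" by (simp add: u_def v_def power_mult_distrib power_divide)
  also have "\<dots> \<le> u\<^sup>2 + v\<^sup>2"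
  proof -
    have "0 \<le> u * v" using assms by (simp add: u_def v_def)
    then show ?thesis using sum_squares_bound[of u v] by linarith
  qed
  also have "u\<^sup>2 = (1/4) ^ i"
  proof -
    have "((1/2) ^ i)\<^sup>2 = ((1/2)\<^sup>2 :: real) ^ i" unfolding power_mult[symmetric] mult.commute[of i 2] ..
    then show ?thesis by (simp add: u_def power_divide)
  qed
  also have "v\<^sup>2 = (4 * x\<^sup>2) ^ i /\<^sub>R fact i"
  proof -
    have "((2 * x) ^ i)\<^sup>2 = (4 * x\<^sup>2) ^ i"
      unfolding power_mult[symmetric] mult.commute[of i 2] unfolding power_mult by (simp add: power_mult_distrib)
    then show ?thesis by (simp only: v_def power_divide) (simp add: divide_inverse mult.commute)
  qed
  finally show "norm (x ^ i / sqrt (fact i)) \<le> (1/4) ^ i + (4 * x\<^sup>2) ^ i /\<^sub>R fact i" using assms by simp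
qed

lemma antiderivative_real_line:
  fixes f :: "real \<Rightarrow> complex"
  assumes f: "continuous_on UNIV f" and z: "\<And>x. x \<le> a \<Longrightarrow> f x = 0"
  obtains H where "\<And>x. (H has_vector_derivative f x) (at x)" "\<And>x. x \<le> a \<Longrightarrow> H x = 0"
proof -
  define H where "H x = integral {a..x} f" for x
  have H0: "H x = 0" if "x \<le> a" for x using that by (cases "x = a") (auto simp: H_def)
  have "(H has_vector_derivative f x) (at x)" for x
  proof (cases "x < a")
    case True
    have "(H has_vector_derivative 0) (at x)"
      by (rule has_vector_derivative_transform_within_open[of "\<lambda>x. 0" _ _ "{..<a}"]) (use True H0 in auto)
    then show ?thesis using z True by simp
  next
    case False
    have H: "integral {a - 1..y} f = H y" if "y \<ge> a - 1" for y
    proof (cases "y \<le> a")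
      case True
      have "integral {a - 1..y} f = integral {a - 1..y} (\<lambda>x. 0)"
        by (rule integral_cong) (use z True in auto)
      then show ?thesis using H0[OF True] by simp
    next
      case False
      have "integral {a - 1..a} f + integral {a..y} f = integral {a - 1..y} f"
        by (rule Henstock_Kurzweil_Integration.integral_combine)
          (use False that f in \<open>auto intro: integrable_continuous_interval continuous_on_subset\<close>)
      moreover have "integral {a - 1..a} f = integral {a - 1..a} (\<lambda>x. 0)"
        by (rule integral_cong) (use z in auto)
      ultimately show ?thesis by (simp add: H_def)
    qed
    have c: "continuous_on {a - 1..x + 1} f" using f continuous_on_subset by blast
    have "((\<lambda>u. integral {a - 1..u} f) has_vector_derivative f x) (at x within {a - 1..x + 1})"
      by (rule integral_has_vector_derivative[OF c]) (use False in auto)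
    then have "((\<lambda>u. integral {a - 1..u} f) has_vector_derivative f x) (at x)"
      using at_within_interior[of x "{a - 1..x + 1}"] False by (simp add: interior_atLeastAtMost_real)
    then show ?thesis
      by (rule has_vector_derivative_transform_within_open[of _ _ _ "{a - 1<..}"]) (use False H in auto)
  qed
  then show ?thesis using that H0 by blast
qed

text \<open>\<open>E\<close> is the flat output formula \<open>\<Sum> (-1)\<^sup>i L\<^bsup>2i+1\<^esup>/(2i+1)! G\<^bsup>(i)\<^esup>\<close> of boundary control for the heat equation on \<open>(0,L)\<close>:
  its symbol \<open>sin(L\<surd>z)/\<surd>z\<close> vanishes at the eigenvalues \<open>(n\<pi>/L)\<^sup>2\<close>.\<close>

lemma flat_function:
  fixes L a b \<rho> :: real
  assumes L: "L > 0" and a: "0 \<le> a" and ab: "a < b" and \<rho>: "\<rho> > 0"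
  obtains E E' :: "real \<Rightarrow> complex" where
    "\<And>x. x \<le> a \<Longrightarrow> E x = 0"
    "\<And>x. b \<le> x \<Longrightarrow> E x = of_real (exp (- \<rho> * x))"
    "\<And>x. (E has_vector_derivative E' x) (at x)" "continuous_on UNIV E'"
    "\<And>n Y. n \<ge> 1 \<Longrightarrow> b \<le> Y \<Longrightarrow>
      integral {0..Y} (\<lambda>x. of_real (exp (- (real n * pi / L)\<^sup>2 * x)) * E x)
        = - of_real (exp (- ((real n * pi / L)\<^sup>2 + \<rho>) * Y) / ((real n * pi / L)\<^sup>2 + \<rho>))"
proof -
  obtain B :: "nat \<Rightarrow> real \<Rightarrow> complex" where B0: "\<And>j x. x \<le> a \<or> b \<le> x \<Longrightarrow> B j x = 0"
    and Bd: "\<And>j x. (B j has_vector_derivative B (Suc j) x) (at x)"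
    and Bb: "\<And>j x. cmod (B j x) \<le> 8 ^ j * gev j"
    and Bp: "\<And>x. a < x \<Longrightarrow> x < b \<Longrightarrow> \<exists>r>0. B 0 x = of_real r"
    using gevrey_bump[OF ab] by metis
  have Bc: "continuous_on UNIV (B j)" for j
    using continuous_on_of_vector_derivative[of UNIV "B j"] Bd by auto
  define f where "f x = of_real (exp (\<rho> * x)) * B 0 x" for x
  have fc: "continuous_on UNIV f" unfolding f_def by (intro continuous_intros Bc)
  obtain H where Hd: "\<And>x. (H has_vector_derivative f x) (at x)" and H0: "\<And>x. x \<le> a \<Longrightarrow> H x = 0"
    using antiderivative_real_line[OF fc, of a] B0 by (auto simp: f_def)
  have Hb: "H x = H b" if "b \<le> x" for x
  proof -
    have "(f has_integral (H x - H b)) {b..x}"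
      by (rule fundamental_theorem_of_calculus[OF that]) (rule has_vector_derivative_at_within[OF Hd])
    moreover have "(f has_integral 0) {b..x}" by (rule has_integral_is_0) (use B0 in \<open>auto simp: f_def\<close>)
    ultimately have "H x - H b = 0" by (rule has_integral_unique)
    then show ?thesis by simp
  qed
  have Hne: "H b \<noteq> 0"
  proof -
    have i: "(f has_integral (H b - H a)) {a..b}"
      by (rule fundamental_theorem_of_calculus[OF less_imp_le[OF ab]]) (rule has_vector_derivative_at_within[OF Hd])
    then have ir: "((\<lambda>x. Re (f x)) has_integral Re (H b)) {a..b}"
      using has_integral_Re[OF i] H0[of a] by simp
    have pos: "Re (f x) > 0" if "a < x" "x < b" for x using Bp[OF that] by (auto simp: f_def)
    have "Re (H b) \<noteq> 0"
    proof
      assume "Re (H b) = 0"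
      then have iz: "((\<lambda>x. Re (f x)) has_integral 0) (cbox a b)" using ir by simp
      have "Re (f ((a + b) / 2)) = 0"
      proof (rule has_integral_0_cbox_imp_0[OF _ _ iz])
        show "continuous_on (cbox a b) (\<lambda>x. Re (f x))"
          by (intro continuous_intros continuous_on_subset[OF fc]) auto
        show "0 \<le> Re (f x)" if "x \<in> box a b" for x using pos[of x] that by simp
        show "box a b \<noteq> {}" "(a + b) / 2 \<in> cbox a b" using ab by auto
      qed
      then show False using pos[of "(a + b) / 2"] ab by simp
    qed
    then show ?thesis by auto
  qed
  have Hbd: "\<exists>K>0. \<forall>x. cmod (of_real (exp (- \<rho> * x)) * H x) \<le> K"
  proof -
    have "continuous_on {a..b} H"
      by (rule continuous_on_of_vector_derivative[of _ _ f]) (rule has_vector_derivative_at_within[OF Hd])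
    then have "bounded (H ` {a..b})" by (intro compact_imp_bounded compact_continuous_image) auto
    then obtain K where K: "K > 0" "\<And>x. x \<in> {a..b} \<Longrightarrow> cmod (H x) \<le> K" unfolding bounded_pos by blast
    have "cmod (of_real (exp (- \<rho> * x)) * H x) \<le> K" for x
    proof (cases "x \<le> a")
      case True
      then show ?thesis using H0 K by simp
    next
      case False
      have "cmod (H x) \<le> K" using K(2)[of x] K(2)[of b] Hb[of x] False ab by (cases "x \<le> b") auto
      moreover have "exp (- \<rho> * x) \<le> 1" using False a \<rho> by simp
      ultimately have "exp (- \<rho> * x) * cmod (H x) \<le> 1 * K" by (intro mult_mono) auto
      then show ?thesis by (simp add: norm_mult)
    qed
    then show ?thesis using K by blast
  qed
  then obtain K0 where K0: "K0 > 0" "\<And>x. cmod (of_real (exp (- \<rho> * x)) * H x) \<le> K0" by blast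
  \<comment> \<open>\<open>G 0\<close> is \<open>exp(- \<rho> x)\<close> times a smooth step from 0
    (left of a) to 1 (right of b). It satisfies \<open>G' = - \<rho> G + B 0 / H b\<close>, and
    differentiating this equation repeatedly gives the recursion, so \<open>G i\<close> is the i-th
    derivative.\<close>
  define G where "G = rec_nat (\<lambda>x. of_real (exp (- \<rho> * x)) * H x / H b) (\<lambda>i g x. - of_real \<rho> * g x + B i x / H b)"
  have G0: "G 0 x = of_real (exp (- \<rho> * x)) * H x / H b" for x by (simp add: G_def)
  have GS: "G (Suc i) x = - of_real \<rho> * G i x + B i x / H b" for i x by (simp add: G_def)
  have Gd: "(G i has_vector_derivative G (Suc i) x) (at x)" for i x
  proof (induction i arbitrary: x)
    case 0
    have e: "((\<lambda>x. of_real (exp (- \<rho> * x)) :: complex) has_vector_derivative of_real (exp (- \<rho> * x) * (- \<rho>))) (at x)"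
      by (intro has_vector_derivative_of_real) (auto intro!: derivative_eq_intros simp flip: has_real_derivative_iff_has_vector_derivative)
    have "((\<lambda>x. of_real (exp (- \<rho> * x)) * H x * (1 / H b)) has_vector_derivative
        (of_real (exp (- \<rho> * x)) * f x + of_real (exp (- \<rho> * x) * (- \<rho>)) * H x) * (1 / H b)) (at x)"
      by (intro has_vector_derivative_mult_left has_vector_derivative_mult e Hd)
    moreover have "of_real (exp (- \<rho> * x)) * f x = B 0 x"
      unfolding f_def mult.assoc[symmetric] by (simp flip: of_real_mult exp_add)
    then have "(of_real (exp (- \<rho> * x)) * f x + of_real (exp (- \<rho> * x) * (- \<rho>)) * H x) * (1 / H b) = G (Suc 0) x"
      unfolding GS G0 by (simp add: divide_inverse algebra_simps)
    moreover have "G 0 = (\<lambda>x. of_real (exp (- \<rho> * x)) * H x * (1 / H b))" by (simp add: fun_eq_iff G0)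
    ultimately show ?case by metis
  next
    case (Suc i)
    have "((\<lambda>x. - of_real \<rho> * G i x + B i x * (1 / H b)) has_vector_derivative (- of_real \<rho> * G (Suc i) x + B (Suc i) x * (1 / H b))) (at x)"
      by (intro has_vector_derivative_add has_vector_derivative_mult_right has_vector_derivative_mult_left Suc Bd)
    then show ?case using GS by (simp add: GS[abs_def] divide_inverse)
  qed
  have Gc: "continuous_on S (G i)" for i S
    using continuous_on_of_vector_derivative[of S "G i"] Gd has_vector_derivative_at_within by blast
  have Ga: "G i x = 0" if "x \<le> a" for i x
    by (induction i) (use that B0 H0 in \<open>auto simp: G0 GS\<close>)
  have Gb: "G i x = (- of_real \<rho>) ^ i * of_real (exp (- \<rho> * x))" if "b \<le> x" for i x
    by (induction i) (use that B0 Hb[OF that] Hne in \<open>auto simp: G0 GS\<close>)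
  \<comment> \<open>The base has to dominate both 8, the base of the bump, and
    \<open>\<rho> + 1\<close>, which each step of the recursion contributes.\<close>
  define Q where "Q = \<rho> + 8"
  define K where "K = (K0 + 1) / cmod (H b)"
  have Kpos: "K > 0" "1 / cmod (H b) \<le> K" "K0 / cmod (H b) \<le> K"
    using Hne K0 by (auto simp: K_def divide_right_mono)
  have Gbd: "cmod (G i x) \<le> K * Q ^ i * gev i" for i x
  proof (induction i)
    case 0
    have "cmod (G 0 x) \<le> K0 / cmod (H b)"
      unfolding G0 norm_divide using K0(2)[of x] by (intro divide_right_mono) auto
    then show ?case using Kpos by (simp add: gev_def)
  next
    case (Suc i)
    have "cmod (G (Suc i) x) \<le> cmod (- of_real \<rho> * G i x) + cmod (B i x / H b)"
      unfolding GS by (rule norm_triangle_ineq)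
    also have "\<dots> = \<rho> * cmod (G i x) + cmod (B i x) * (1 / cmod (H b))"
      using \<rho> by (simp add: norm_mult norm_divide)
    also have "\<dots> \<le> \<rho> * (K * Q ^ i * gev i) + (8 ^ i * gev i) * K"
      using \<rho> Suc Bb[of i x] Kpos gev_pos[of i] by (intro add_mono mult_mono) (auto intro: less_imp_le)
    also have "8 ^ i * gev i * K \<le> Q ^ i * gev i * K"
      using \<rho> Kpos gev_pos[of i] by (intro mult_right_mono power_mono) (auto simp: Q_def)
    also have "\<rho> * (K * Q ^ i * gev i) + Q ^ i * gev i * K = K * Q ^ i * gev i * (\<rho> + 1)"
      by (simp add: algebra_simps)
    also have "\<dots> \<le> K * Q ^ i * gev i * Q"
      using \<rho> Kpos gev_pos[of i] by (intro mult_left_mono) (auto simp: Q_def)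
    also have "\<dots> \<le> K * Q ^ Suc i * gev (Suc i)"
      using mult_left_mono[OF gev_mono[of i], of "K * Q ^ i * Q"] \<rho> Kpos by (simp add: Q_def algebra_simps)
    finally show ?case by simp
  qed
  have Q1: "Q \<ge> 1" "Q \<ge> 0" using \<rho> by (auto simp: Q_def)
  define s where "s i = (- 1) ^ i * L ^ (2 * i + 1) / fact (2 * i + 1)" for i :: nat
  define M where "M i = K * Q * L * (2 * L\<^sup>2 * Q) ^ i / sqrt (fact i)" for i
  have Msum: "summable M"
  proof -
    have "summable (\<lambda>i. (K * Q * L) * ((2 * L\<^sup>2 * Q) ^ i / sqrt (fact i)))"
      by (intro summable_mult summable_power_sqrt_fact) (use Q1 in auto)
    then show ?thesis by (simp add: M_def[abs_def])
  qed
  have sM: "\<bar>s i\<bar> * (K * Q ^ Suc i * gev (Suc i)) \<le> M i" for i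
  proof -
    have "\<bar>s i\<bar> = L ^ (2 * i + 1) / fact (2 * i + 1)" using L by (simp add: s_def abs_mult power_abs)
    moreover have "gev (Suc i) \<le> 2 ^ i * fact (2 * i + 1) / sqrt (fact i)"
      using gev_Suc_le_fact[of i] by (simp add: field_simps)
    ultimately have "\<bar>s i\<bar> * (K * Q ^ Suc i * gev (Suc i)) \<le> L ^ (2 * i + 1) / fact (2 * i + 1) * (K * Q ^ Suc i * (2 ^ i * fact (2 * i + 1) / sqrt (fact i)))"
      using L Kpos Q1 by (simp only:) (intro mult_left_mono, auto)
    also have "\<dots> = M i"
      by (simp add: M_def power_mult_distrib power_add flip: power_mult)
    finally show ?thesis .
  qed
  have sM0: "\<bar>s i\<bar> * (K * Q ^ i * gev i) \<le> M i" for i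
  proof (rule order.trans[OF mult_left_mono sM])
    show "K * Q ^ i * gev i \<le> K * Q ^ Suc i * gev (Suc i)"
      using Kpos Q1 gev_pos[of i] gev_mono[of i]
      by (intro mult_mono power_increasing) auto
  qed simp
  let ?F = "\<lambda>i x. of_real (s i) * G i x" and ?F' = "\<lambda>i x. of_real (s i) * G (Suc i) x"
  have FM: "cmod (?F i x) \<le> M i" and FM': "cmod (?F' i x) \<le> M i" for i x
  proof -
    have "\<bar>s i\<bar> * cmod (G i x) \<le> \<bar>s i\<bar> * (K * Q ^ i * gev i)" by (intro mult_left_mono Gbd) auto
    then show "cmod (?F i x) \<le> M i" using sM0[of i] by (simp add: norm_mult)
    have "\<bar>s i\<bar> * cmod (G (Suc i) x) \<le> \<bar>s i\<bar> * (K * Q ^ Suc i * gev (Suc i))" by (intro mult_left_mono Gbd) auto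
    then show "cmod (?F' i x) \<le> M i" using sM[of i] by (simp add: norm_mult)
  qed
  have sumF: "summable (\<lambda>i. ?F i x)" for x
    by (rule summable_comparison_test'[OF Msum, of 0]) (use FM in auto)
  define \<Sigma> where "\<Sigma> x = (\<Sum>i. ?F i x)" for x
  define \<Sigma>' where "\<Sigma>' x = (\<Sum>i. ?F' i x)" for x
  have \<Sigma>d: "(\<Sigma> has_vector_derivative \<Sigma>' x) (at x)" for x
    unfolding \<Sigma>_def[abs_def] \<Sigma>'_def
    by (rule vector_derivative_series[OF _ sumF FM' Msum]) (intro has_vector_derivative_mult_right Gd)
  have \<Sigma>'c: "continuous_on UNIV \<Sigma>'"
  proof (rule uniform_limit_theorem)
    show "uniform_limit UNIV (\<lambda>n x. \<Sum>i<n. ?F' i x) \<Sigma>' sequentially"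
      unfolding \<Sigma>'_def[abs_def] by (rule Weierstrass_m_test[OF FM' Msum])
  qed (auto intro!: always_eventually continuous_intros Gc)
  \<comment> \<open>The value of the series on \<open>exp(- \<rho> x)\<close>, namely
    \<open>sinh(L sqrt \<rho>) / sqrt \<rho>\<close>. All terms are positive, so dividing by it
    normalises \<open>E\<close>.\<close>
  define N where "N = (\<Sum>i. L ^ (2 * i + 1) * \<rho> ^ i / fact (2 * i + 1))"
  have sN: "s i * (- \<rho>) ^ i = L ^ (2 * i + 1) * \<rho> ^ i / fact (2 * i + 1)" for i
  proof -
    have "(- 1) ^ i * (- \<rho>) ^ i = \<rho> ^ i" unfolding power_mult_distrib[symmetric] by simp
    moreover have "s i * (- \<rho>) ^ i = ((- 1) ^ i * (- \<rho>) ^ i) * (L ^ (2 * i + 1) / fact (2 * i + 1))"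
      by (simp only: s_def divide_inverse ac_simps)
    ultimately show ?thesis by simp
  qed
  have sumN: "summable (\<lambda>i. L ^ (2 * i + 1) * \<rho> ^ i / fact (2 * i + 1))"
  proof -
    have "summable (\<lambda>i. ?F i b)" by (rule sumF)
    then have "summable (\<lambda>i. Re (?F i b) * exp (\<rho> * b))" using summable_Re summable_mult2 by blast
    moreover have "Re (?F i b) * exp (\<rho> * b) = L ^ (2 * i + 1) * \<rho> ^ i / fact (2 * i + 1)" for i
    proof -
      have "?F i b = of_real (s i * (- \<rho>) ^ i * exp (- \<rho> * b))" by (simp add: Gb)
      then have "Re (?F i b) = s i * (- \<rho>) ^ i * exp (- \<rho> * b)" by (simp only: Re_complex_of_real)
      then have "Re (?F i b) * exp (\<rho> * b) = s i * (- \<rho>) ^ i * (exp (- \<rho> * b) * exp (\<rho> * b))"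
        by (simp only: mult.assoc)
      also have "exp (- \<rho> * b) * exp (\<rho> * b) = 1" by (simp flip: exp_add)
      finally show ?thesis using sN by simp
    qed
    ultimately show ?thesis by simp
  qed
  have Npos: "N > 0" unfolding N_def by (rule suminf_pos[OF sumN]) (use L \<rho> in auto)
  have \<Sigma>b: "\<Sigma> x = of_real (N * exp (- \<rho> * x))" if "b \<le> x" for x
  proof -
    have "?F i x = of_real (L ^ (2 * i + 1) * \<rho> ^ i / fact (2 * i + 1) * exp (- \<rho> * x))" for i
      unfolding sN[symmetric] using that by (simp add: Gb)
    then have "\<Sigma> x = of_real (\<Sum>i. L ^ (2 * i + 1) * \<rho> ^ i / fact (2 * i + 1) * exp (- \<rho> * x))"
      unfolding \<Sigma>_def by (simp only: suminf_of_real[OF summable_mult2[OF sumN]])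
    then show ?thesis unfolding N_def using suminf_mult2[OF sumN] by simp
  qed
  have int: "integral {0..Y} (\<lambda>x. of_real (exp (- z * x)) * \<Sigma> x) = - of_real (N * exp (- (z + \<rho>) * Y) / (z + \<rho>))"
    if n: "n \<ge> 1" and Y: "b \<le> Y" and z: "z = (real n * pi / L)\<^sup>2" for n :: nat and Y z
  proof -
    define I where "I i = integral {0..Y} (\<lambda>x. of_real (exp (- z * x)) * G i x)" for i
    have Y0: "0 \<le> Y" using Y a ab by simp
    have z0: "z \<ge> 0" by (simp add: z)
    have zr: "z + \<rho> > 0" using \<rho> z0 by simp
    have ci: "continuous_on {0..Y} (\<lambda>x. of_real (exp (- z * x)) * G i x)" for i
      by (intro continuous_intros Gc)
    \<comment> \<open>Integration by parts; the boundary term at 0 disappears because all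
      \<open>G i\<close> vanish up to \<open>a\<close>, which is at least 0.\<close>
    have IS: "I (Suc i) = of_real z * I i + of_real (exp (- z * Y)) * G i Y" for i
    proof -
      have d: "((\<lambda>x. of_real (exp (- z * x)) * G i x) has_vector_derivative
         (of_real (exp (- z * x)) * G (Suc i) x + of_real (exp (- z * x) * (- z)) * G i x)) (at x)" for x
        by (intro has_vector_derivative_mult Gd has_vector_derivative_of_real)
          (auto intro!: derivative_eq_intros simp flip: has_real_derivative_iff_has_vector_derivative)
      have m1: "((\<lambda>x. of_real (exp (- z * x)) * G (Suc i) x + of_real (exp (- z * x) * (- z)) * G i x) has_integral
         (of_real (exp (- z * Y)) * G i Y - of_real (exp (- z * 0)) * G i 0)) {0..Y}"
        by (rule fundamental_theorem_of_calculus[OF Y0]) (rule has_vector_derivative_at_within[OF d])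
      have eq: "(\<lambda>x. of_real (exp (- z * x)) * G (Suc i) x + of_real (exp (- z * x) * (- z)) * G i x)
         = (\<lambda>x. of_real (exp (- z * x)) * G (Suc i) x - of_real z * (of_real (exp (- z * x)) * G i x))"
        by (auto simp: fun_eq_iff)
      have m2: "((\<lambda>x. of_real (exp (- z * x)) * G (Suc i) x - of_real z * (of_real (exp (- z * x)) * G i x)) has_integral
          (I (Suc i) - of_real z * I i)) {0..Y}"
        unfolding I_def by (intro has_integral_diff has_integral_mult_right integrable_integral integrable_continuous_interval ci)
      have "I (Suc i) - of_real z * I i = of_real (exp (- z * Y)) * G i Y - of_real (exp (- z * 0)) * G i 0"
        by (rule has_integral_unique[OF m2 m1[unfolded eq]])
      then show ?thesis using Ga[of 0 i] a by (simp add: algebra_simps)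
    qed
    \<comment> \<open>The moment of \<open>G 0\<close> over the part of the half-line after Y. Hence
      \<open>I 0 + w\<close> is its full half-line moment, and \<open>Ii\<close> splits
      \<open>I i\<close> into \<open>z^i\<close> times this full moment minus the tail.\<close>
    define w where "w = exp (- (z + \<rho>) * Y) / (z + \<rho>)"
    have Ii: "I i = of_real (z ^ i) * (I 0 + of_real w) - of_real (w * (- \<rho>) ^ i)" for i
    proof (induction i)
      case (Suc i)
      have "of_real (exp (- z * Y)) * G i Y = (of_real ((z + \<rho>) * w * (- \<rho>) ^ i) :: complex)"
      proof -
        have "of_real (exp (- z * Y)) * G i Y = (of_real (exp (- z * Y) * exp (- \<rho> * Y) * (- \<rho>) ^ i) :: complex)"
          using Gb[OF Y] by simp
        also have "exp (- z * Y) * exp (- \<rho> * Y) = exp (- (z + \<rho>) * Y)"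
          by (simp only: exp_add[symmetric]) (simp add: algebra_simps)
        also have "\<dots> = (z + \<rho>) * w" using zr by (simp add: w_def)
        finally show ?thesis .
      qed
      then show ?case unfolding IS Suc by (simp add: algebra_simps)
    qed simp
    have "(\<lambda>i. of_real (s i) * I i) sums integral {0..Y} (\<lambda>x. of_real (exp (- z * x)) * \<Sigma> x)"
    proof -
      have u: "uniform_limit {0..Y} (\<lambda>m x. \<Sum>i<m. of_real (exp (- z * x)) * ?F i x) (\<lambda>x. \<Sum>i. of_real (exp (- z * x)) * ?F i x) sequentially"
      proof (rule Weierstrass_m_test[OF _ Msum])
        fix i x assume "x \<in> {0..Y}"
        then have "exp (- z * x) \<le> 1" using z0 by simp
        then have "exp (- z * x) * cmod (?F i x) \<le> 1 * M i" using FM[of i x] by (intro mult_mono) auto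
        then show "cmod (of_real (exp (- z * x)) * ?F i x) \<le> M i" by (simp add: norm_mult)
      qed
      obtain J j where J: "\<And>m. ((\<lambda>x. \<Sum>i<m. of_real (exp (- z * x)) * ?F i x) has_integral J m) {0..Y}"
        and j: "((\<lambda>x. \<Sum>i. of_real (exp (- z * x)) * ?F i x) has_integral j) {0..Y}" and lim: "J \<longlonglongrightarrow> j"
        by (rule uniform_limit_integral[OF u]) (auto intro!: continuous_intros Gc)
      have "((\<lambda>x. \<Sum>i<m. of_real (exp (- z * x)) * ?F i x) has_integral (\<Sum>i<m. of_real (s i) * I i)) {0..Y}" for m
      proof (rule has_integral_sum)
        fix i assume "i \<in> {..<m}"
        have "((\<lambda>x. of_real (s i) * (of_real (exp (- z * x)) * G i x)) has_integral (of_real (s i) * I i)) {0..Y}"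
          unfolding I_def by (intro has_integral_mult_right integrable_integral integrable_continuous_interval ci)
        then show "((\<lambda>x. of_real (exp (- z * x)) * ?F i x) has_integral (of_real (s i) * I i)) {0..Y}"
          by (simp add: mult.left_commute)
      qed simp
      then have "J m = (\<Sum>i<m. of_real (s i) * I i)" for m using J has_integral_unique by blast
      then have "J = (\<lambda>m. \<Sum>i<m. of_real (s i) * I i)" by (rule ext)
      moreover have "(\<lambda>x. \<Sum>i. of_real (exp (- z * x)) * ?F i x) = (\<lambda>x. of_real (exp (- z * x)) * \<Sigma> x)"
        unfolding \<Sigma>_def by (rule ext) (rule suminf_mult[OF sumF])
      ultimately show ?thesis using lim j by (simp add: sums_def integral_unique)
    qed
    \<comment> \<open>Summation against \<open>s i\<close> multiplies the full half-line moment by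
      \<open>sin(L k) / k\<close>, which is 0 at an eigenvalue \<open>z = k^2\<close>; only the
      tail, multiplied by N, survives.\<close>
    moreover have "(\<lambda>i. of_real (s i) * I i) sums (of_real 0 * (I 0 + of_real w) - of_real (w * N))"
    proof -
      define k where "k = real n * pi / L"
      have k: "k > 0" "z = k\<^sup>2" using n L by (auto simp: k_def z)
      have "(\<lambda>i. (- 1) ^ i / fact (2 * i + 1) * (L * k) ^ (2 * i + 1) / k) sums (sin (L * k) / k)"
        by (intro sums_divide sin_paired)
      moreover have "(- 1) ^ i / fact (2 * i + 1) * (L * k) ^ (2 * i + 1) / k = s i * z ^ i" for i
        using k by (simp add: s_def power_mult_distrib power_mult power_add)
      moreover have "sin (L * k) = 0" using L by (simp add: k_def)
      ultimately have "(\<lambda>i. s i * z ^ i) sums 0" by simp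
      then have 1: "(\<lambda>i. of_real (s i * z ^ i) :: complex) sums of_real 0" by (rule sums_of_real)
      have "(\<lambda>i. s i * (- \<rho>) ^ i) sums N" unfolding sN N_def using sumN by (rule summable_sums)
      then have "(\<lambda>i. w * (s i * (- \<rho>) ^ i)) sums (w * N)" by (rule sums_mult)
      then have 2: "(\<lambda>i. of_real (w * (s i * (- \<rho>) ^ i)) :: complex) sums of_real (w * N)" by (rule sums_of_real)
      have "(\<lambda>i. of_real (s i * z ^ i) * (I 0 + of_real w) - of_real (w * (s i * (- \<rho>) ^ i))) sums (of_real 0 * (I 0 + of_real w) - of_real (w * N))"
        by (rule sums_diff[OF sums_mult2[OF 1] 2])
      moreover have "of_real (s i) * I i = of_real (s i * z ^ i) * (I 0 + of_real w) - of_real (w * (s i * (- \<rho>) ^ i))" for i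
        unfolding Ii[of i] by (simp add: algebra_simps)
      ultimately show ?thesis by simp
    qed
    ultimately have "integral {0..Y} (\<lambda>x. of_real (exp (- z * x)) * \<Sigma> x) = of_real 0 * (I 0 + of_real w) - of_real (w * N)"
      by (rule sums_unique2)
    then show ?thesis by (simp add: w_def mult.commute)
  qed
  define E where "E x = \<Sigma> x / of_real N" for x
  define E' where "E' x = \<Sigma>' x / of_real N" for x
  show ?thesis
  proof (rule that[of E E'])
    show "E x = 0" if "x \<le> a" for x using Ga[OF that] by (simp add: E_def \<Sigma>_def)
    show "E x = of_real (exp (- \<rho> * x))" if "b \<le> x" for x using \<Sigma>b[OF that] Npos by (simp add: E_def)
    show "(E has_vector_derivative E' x) (at x)" for x
      using has_vector_derivative_mult_left[OF \<Sigma>d[of x], of "1 / of_real N"] by (simp add: E_def[abs_def] E'_def)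
    show "continuous_on UNIV E'" unfolding E'_def[abs_def] using Npos by (intro continuous_intros \<Sigma>'c) auto
    fix n :: nat and Y :: real assume n: "1 \<le> n" and Y: "b \<le> Y"
    let ?z = "(real n * pi / L)\<^sup>2"
    have "integral {0..Y} (\<lambda>x. of_real (exp (- ?z * x)) * E x) = integral {0..Y} (\<lambda>x. of_real (exp (- ?z * x)) * \<Sigma> x * (1 / of_real N))"
      by (simp add: E_def)
    also have "\<dots> = integral {0..Y} (\<lambda>x. of_real (exp (- ?z * x)) * \<Sigma> x) * (1 / of_real N)"
      by (rule integral_mult_left)
    also have "\<dots> = - of_real (exp (- (?z + \<rho>) * Y) / (?z + \<rho>))"
      unfolding int[OF n Y refl] using Npos by simp
    finally show "integral {0..Y} (\<lambda>x. of_real (exp (- ?z * x)) * E x) = - of_real (exp (- (?z + \<rho>) * Y) / (?z + \<rho>))" .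
  qed
qed

section \<open>The operator and its adjoint\<close>

lemma vector_derivative_hwd:
  assumes L: "L > 0" and g: "has_weak_deriv L g d" and d: "has_weak_deriv L d e" and x: "x \<in> {0..L}"
  shows "vector_derivative g (at x within {0..L}) = d x"
  by (rule vector_derivative_within_cbox[of 0 L, unfolded cbox_interval])
    (use L x hwd_vector_derivative[OF g hwd_continuous[OF d] x] in auto)

lemma l2ip_ibp:
  assumes L: "0 \<le> L" and g: "has_weak_deriv L g d" and h: "has_weak_deriv L h e"
  shows "l2ip L d h = g L * cnj (h L) - g 0 * cnj (h 0) - l2ip L g e"
  unfolding l2ip_def by (rule hwd_ibp[OF L g hwd_cnj[OF h]])

lemma l2ip_add_right:
  "f \<in> L2 L \<Longrightarrow> g \<in> L2 L \<Longrightarrow> h \<in> L2 L \<Longrightarrow> l2ip L h (\<lambda>x. f x + g x) = l2ip L h f + l2ip L h g"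
  using l2ip_add[of f L g h] l2ip_cnj[of L h] by (metis complex_cnj_add)

lemma l2ip_cmult_right: "l2ip L h (\<lambda>x. a * f x) = cnj a * l2ip L h f"
  by (metis complex_cnj_mult l2ip_cmult l2ip_cnj)

lemma l2ip_diff_right:
  "f \<in> L2 L \<Longrightarrow> g \<in> L2 L \<Longrightarrow> h \<in> L2 L \<Longrightarrow> l2ip L h (\<lambda>x. f x - g x) = l2ip L h f - l2ip L h g"
  using l2ip_add_right[OF _ L2_cmult[of g L "-1"], of f h] by (simp add: l2ip_cmult_right[of L h "-1", simplified])

lemma l2ip_diff:
  "f \<in> L2 L \<Longrightarrow> g \<in> L2 L \<Longrightarrow> h \<in> L2 L \<Longrightarrow> l2ip L (\<lambda>x. f x - g x) h = l2ip L f h - l2ip L g h"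
  using l2ip_add[OF _ L2_cmult[of g L "-1"], of f h] by (simp add: l2ip_cmult[of L "-1", simplified])

lemma l2ip_minus_right: "l2ip L h (\<lambda>x. - f x) = - l2ip L h f"
  using l2ip_cmult_right[of L h "-1" f] by simp

lemma l2ip_zero_left: "l2ip L (\<lambda>x. 0) h = 0" and l2ip_zero_right: "l2ip L h (\<lambda>x. 0) = 0"
  by (simp_all add: l2ip_def)

definition lincomb_solution ::
  "(real \<Rightarrow> complex) \<Rightarrow> (real \<Rightarrow> complex) \<Rightarrow> complex \<Rightarrow> (real \<Rightarrow> complex) \<Rightarrow> real \<Rightarrow> complex" where
  "lincomb_solution C s A F x = A * s x - s x * (LINT y|mI x. C y * F y) + C x * (LINT y|mI x. s y * F y)"

text \<open>Variation of constants for \<open>r'' = k r - F\<close>; \<open>C\<close> and \<open>s\<close> are the fundamental solutions \<open>cosh\<close> and \<open>sinh\<close>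
  of \<open>r'' = k r\<close> (or \<open>1\<close> and \<open>x\<close> when \<open>k = 0\<close>).\<close>

lemma variation_of_constants:
  fixes C s F :: "real \<Rightarrow> complex" and A k :: complex
  assumes L: "0 \<le> L" and F: "F \<in> L2 L"
    and s: "\<And>x. (s has_vector_derivative C x) (at x)" and C: "\<And>x. (C has_vector_derivative k * s x) (at x)"
    and pyth: "\<And>x. C x * C x - k * (s x * s x) = 1" and s0: "s 0 = 0" and C0: "C 0 = 1"
  defines "r \<equiv> lincomb_solution C s A F"
  obtains r' where "has_weak_deriv L r r'" "has_weak_deriv L r' (\<lambda>x. k * r x - F x)"
    "r 0 = 0" "r' 0 = A"
    "r L = A * s L - s L * (LINT y|mI L. C y * F y) + C L * (LINT y|mI L. s y * F y)"
    "r' L = A * C L - C L * (LINT y|mI L. C y * F y) + k * s L * (LINT y|mI L. s y * F y)"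
proof -
  have sc: "continuous_on {0..L} s"
    by (intro continuous_at_imp_continuous_on ballI has_vector_derivative_continuous[OF s])
  have Cc: "continuous_on {0..L} C"
    by (intro continuous_at_imp_continuous_on ballI has_vector_derivative_continuous[OF C])
  have hs: "has_weak_deriv L s C" by (rule hwd_C1'[OF Cc s])
  have hC: "has_weak_deriv L C (\<lambda>x. k * s x)" by (rule hwd_C1'[OF _ C]) (intro continuous_intros sc)
  define P where "P x = (LINT y|mI x. C y * F y)" for x
  define R where "R x = (LINT y|mI x. s y * F y)" for x
  have CF: "(\<lambda>y. C y * F y) \<in> L2 L" and sF: "(\<lambda>y. s y * F y) \<in> L2 L"
    using L2_mult_continuous[OF F Cc] L2_mult_continuous[OF F sc] by auto
  have hP: "has_weak_deriv L P (\<lambda>y. C y * F y)" using hwd_primitive[OF CF, of 0] by (simp add: P_def[abs_def])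
  have hR: "has_weak_deriv L R (\<lambda>y. s y * F y)" using hwd_primitive[OF sF, of 0] by (simp add: R_def[abs_def])
  have P0: "P 0 = 0" and R0: "R 0 = 0" using hwd_eq[OF hP, of 0] hwd_eq[OF hR, of 0] L by (auto simp: P_def R_def)
  define r' where "r' x = A * C x - C x * P x + k * (s x * R x)" for x
  have req: "r x = A * s x - s x * P x + C x * R x" for x
    by (simp add: r_def lincomb_solution_def P_def R_def)
  have 1: "has_weak_deriv L (\<lambda>x. A * s x - s x * P x + C x * R x)
     (\<lambda>x. A * C x - (C x * P x + s x * (C x * F x)) + (k * s x * R x + C x * (s x * F x)))"
    by (intro hwd_add hwd_diff hwd_cmult hwd_mult hs hC hP hR)
  have h1: "has_weak_deriv L r r'"
  proof -
    have "r' = (\<lambda>x. A * C x - (C x * P x + s x * (C x * F x)) + (k * s x * R x + C x * (s x * F x)))"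
      by (rule ext) (simp add: r'_def algebra_simps)
    moreover have "r = (\<lambda>x. A * s x - s x * P x + C x * R x)" by (rule ext) (rule req)
    ultimately show ?thesis using 1 by simp
  qed
  have 2: "has_weak_deriv L (\<lambda>x. A * C x - C x * P x + k * (s x * R x))
     (\<lambda>x. A * (k * s x) - (k * s x * P x + C x * (C x * F x)) + k * (C x * R x + s x * (s x * F x)))"
    by (intro hwd_add hwd_diff hwd_cmult hwd_mult hs hC hP hR)
  have h2: "has_weak_deriv L r' (\<lambda>x. k * r x - F x)"
  proof -
    have "A * (k * s x) - (k * s x * P x + C x * (C x * F x)) + k * (C x * R x + s x * (s x * F x)) = k * r x - F x" for x
    proof -
      have "A * (k * s x) - (k * s x * P x + C x * (C x * F x)) + k * (C x * R x + s x * (s x * F x))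
        = k * r x - (C x * C x - k * (s x * s x)) * F x" unfolding req by (simp add: algebra_simps)
      then show ?thesis using pyth[of x] by simp
    qed
    moreover have "r' = (\<lambda>x. A * C x - C x * P x + k * (s x * R x))" by (rule ext) (simp add: r'_def)
    ultimately show ?thesis using 2 by simp
  qed
  show ?thesis
    by (rule that[OF h1 h2]) (auto simp: req r'_def s0 C0 P0 R0, auto simp: P_def R_def)
qed

lemma fundamental_system:
  fixes \<kappa> :: complex
  assumes "\<kappa> \<noteq> 0"
  shows "((\<lambda>x. sinh (\<kappa> * of_real x) / \<kappa>) has_vector_derivative cosh (\<kappa> * of_real x)) (at x)"
    and "((\<lambda>x. cosh (\<kappa> * of_real x)) has_vector_derivative \<kappa>\<^sup>2 * (sinh (\<kappa> * of_real x) / \<kappa>)) (at x)"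
    and "cosh (\<kappa> * of_real x) * cosh (\<kappa> * of_real x) - \<kappa>\<^sup>2 * ((sinh (\<kappa> * of_real x) / \<kappa>) * (sinh (\<kappa> * of_real x) / \<kappa>)) = 1"
proof -
  have "((\<lambda>z. sinh (\<kappa> * z) / \<kappa>) has_field_derivative cosh (\<kappa> * of_real x)) (at (of_real x))"
    using assms by (auto intro!: derivative_eq_intros)
  then show "((\<lambda>x. sinh (\<kappa> * of_real x) / \<kappa>) has_vector_derivative cosh (\<kappa> * of_real x)) (at x)"
    by (rule has_vector_derivative_real_field)
  have "((\<lambda>z. cosh (\<kappa> * z)) has_field_derivative \<kappa>\<^sup>2 * (sinh (\<kappa> * of_real x) / \<kappa>)) (at (of_real x))"
    using assms by (auto intro!: derivative_eq_intros simp: power2_eq_square)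
  then show "((\<lambda>x. cosh (\<kappa> * of_real x)) has_vector_derivative \<kappa>\<^sup>2 * (sinh (\<kappa> * of_real x) / \<kappa>)) (at x)"
    by (rule has_vector_derivative_real_field)
  show "cosh (\<kappa> * of_real x) * cosh (\<kappa> * of_real x) - \<kappa>\<^sup>2 * ((sinh (\<kappa> * of_real x) / \<kappa>) * (sinh (\<kappa> * of_real x) / \<kappa>)) = 1"
    using assms cosh_square_eq[of "\<kappa> * of_real x"] by (simp add: power2_eq_square field_simps)
qed

lemma sinh_eq_0_imp_Re: "sinh z = 0 \<Longrightarrow> Re z = 0" for z :: complex
proof -
  assume "sinh z = 0"
  then have "exp z = exp (- z)" by (simp add: sinh_def)
  then have "norm (exp z) = norm (exp (- z))" by simp
  then show "Re z = 0" by (simp add: norm_exp_eq_Re)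
qed

section \<open>The generator, its formal adjoint and the boundary trace\<close>

locale wave_heat =
  fixes L c :: real and \<beta> :: "real \<Rightarrow> real"
  assumes L: "L > 0" and beta: "\<beta> \<in> Linfty L"
begin

sublocale H: semi_hilbert "HH L" smul "ip L"
  rewrites "semi_inner.nrm (ip L) = Hnorm L"
  by (rule semi_hilbert_HH) (rule nrm_Hnorm)

lemma L0: "0 \<le> L" using L by simp

lemma beta_measurable: "(\<lambda>x. complex_of_real (\<beta> x)) \<in> borel_measurable (mI L)"
  using beta by (auto simp: Linfty_def)

lemma beta_bounded: obtains M where "M > 0" "AE x in mI L. \<bar>\<beta> x\<bar> \<le> M"
proof -
  obtain M where M: "AE x in mI L. \<bar>\<beta> x\<bar> \<le> M" using beta by (auto simp: Linfty_def)
  have "AE x in mI L. \<bar>\<beta> x\<bar> \<le> max M 1" using M by eventually_elim simp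
  then show ?thesis by (intro that[of "max M 1"]) auto
qed

lemma beta_L2: "f \<in> L2 L \<Longrightarrow> (\<lambda>x. of_real (\<beta> x) * f x) \<in> L2 L"
proof -
  assume f: "f \<in> L2 L"
  obtain M where "AE x in mI L. \<bar>\<beta> x\<bar> \<le> M" by (rule beta_bounded)
  then show ?thesis by (intro L2_mult_bounded[OF f beta_measurable, of M]) simp
qed

lemma dom_A_cases:
  assumes "X \<in> dom_A L"
  obtains f f1 g g1 h h1 where "X = (f, g, h)" "has_weak_deriv L f f1" "has_weak_deriv L f1 (weak_deriv2 L f)"
    "has_weak_deriv L g g1" "has_weak_deriv L g1 (weak_deriv2 L g)" "has_weak_deriv L h h1"
    "f 0 = 0" "f L = 0" "g 0 = 0" "g1 L = 0" "h 0 = 0"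
proof -
  obtain f g h where X: "X = (f, g, h)" by (cases X)
  with assms have a: "f \<in> H2 L" "g \<in> H2 L" "h \<in> H1 L" "f 0 = 0" "f L = 0" "g 0 = 0"
    "vector_derivative g (at L within {0..L}) = 0" "h 0 = 0" by (auto simp: dom_A_def)
  obtain f1 where f: "has_weak_deriv L f f1" "has_weak_deriv L f1 (weak_deriv2 L f)" using H2_obtain[OF a(1)] .
  obtain g1 where g: "has_weak_deriv L g g1" "has_weak_deriv L g1 (weak_deriv2 L g)" using H2_obtain[OF a(2)] .
  show ?thesis
    by (rule that[OF X f g H1_weak_deriv[OF a(3)]])
      (use a vector_derivative_hwd[OF L g, of L] L0 in auto)
qed

lemma dom_A_I:
  assumes "has_weak_deriv L f f1" "has_weak_deriv L f1 f2" "has_weak_deriv L g g1" "has_weak_deriv L g1 g2"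
    "has_weak_deriv L h h1" "f 0 = 0" "f L = 0" "g 0 = 0" "g1 L = 0" "h 0 = 0"
  shows "(f, g, h) \<in> dom_A L"
  using assms vector_derivative_hwd[OF L assms(3,4), of L] L0
  by (auto simp: dom_A_def intro: hwd_H2 hwd_H1)

lemma dom_A_HH: "X \<in> dom_A L \<Longrightarrow> X \<in> HH L"
  by (erule dom_A_cases) (auto intro: HH_I hwd_in_L2)

lemma op_A_HH: "X \<in> dom_A L \<Longrightarrow> op_A L c \<beta> X \<in> HH L"
proof (erule dom_A_cases)
  fix f f1 g g1 h h1
  assume a: "X = (f, g, h)" "has_weak_deriv L f f1" "has_weak_deriv L f1 (weak_deriv2 L f)"
    "has_weak_deriv L g g1" "has_weak_deriv L g1 (weak_deriv2 L g)" "has_weak_deriv L h h1" "h 0 = 0"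
  show "op_A L c \<beta> X \<in> HH L"
    unfolding a(1) op_A_def prod.case
    by (rule HH_I[OF L2_add[OF L2_add[OF hwd_L2[OF a(3)] L2_cmult[OF hwd_in_L2[OF a(2)]]] beta_L2[OF hwd_in_L2[OF a(4)]]]
          a(6,7) hwd_L2[OF a(5)]])
qed

text \<open>\<open>tail_prim p\<close> is \<open>x \<mapsto> \<integral>\<^sub>0\<^sup>x \<integral>\<^sub>s\<^sup>L \<beta>p\<close>, the element of \<open>H\<^sup>1\<^sub>(\<^sub>0\<^sub>)\<close> that represents \<open>g \<mapsto> \<langle>\<beta>g, p\<rangle>\<close>.\<close>

definition tail :: "(real \<Rightarrow> complex) \<Rightarrow> real \<Rightarrow> complex" where
  "tail p x = (LINT y|mI L. of_real (\<beta> y) * p y) - (LINT y|mI x. of_real (\<beta> y) * p y)"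

definition tail_prim :: "(real \<Rightarrow> complex) \<Rightarrow> real \<Rightarrow> complex" where
  "tail_prim p x = (LINT y|mI x. tail p y)"

lemma hwd_tail:
  assumes p: "p \<in> L2 L"
  shows "has_weak_deriv L (tail p) (\<lambda>x. - (of_real (\<beta> x) * p x))" "tail p L = 0"
proof -
  have "has_weak_deriv L (\<lambda>x. (LINT y|mI L. of_real (\<beta> y) * p y) - (0 + (LINT y|mI x. of_real (\<beta> y) * p y)))
     (\<lambda>x. 0 - of_real (\<beta> x) * p x)"
    by (intro hwd_diff hwd_const hwd_primitive beta_L2 p)
  then show "has_weak_deriv L (tail p) (\<lambda>x. - (of_real (\<beta> x) * p x))" by (simp add: tail_def[abs_def])
qed (simp add: tail_def)

lemma hwd_tail_prim:
  assumes p: "p \<in> L2 L"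
  shows "has_weak_deriv L (tail_prim p) (tail p)" "tail_prim p 0 = 0"
proof -
  show h: "has_weak_deriv L (tail_prim p) (tail p)"
    using hwd_primitive[OF hwd_in_L2[OF hwd_tail(1)[OF p]], of 0] by (simp add: tail_prim_def[abs_def])
  show "tail_prim p 0 = 0" using hwd_eq[OF h, of 0] L0 by (simp add: tail_prim_def)
qed

lemma l2ip_beta:
  assumes p: "p \<in> L2 L" and g: "has_weak_deriv L g g1" and g0: "g 0 = 0"
  shows "l2ip L (\<lambda>x. of_real (\<beta> x) * g x) p = l2ip L g1 (tail p)"
proof -
  have "l2ip L g1 (tail p) = g L * cnj (tail p L) - g 0 * cnj (tail p 0) - l2ip L g (\<lambda>x. - (of_real (\<beta> x) * p x))"
    by (rule l2ip_ibp[OF L0 g hwd_tail(1)[OF p]])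
  also have "\<dots> = l2ip L g (\<lambda>x. of_real (\<beta> x) * p x)" by (simp add: hwd_tail(2)[OF p] g0 l2ip_minus_right)
  also have "\<dots> = l2ip L (\<lambda>x. of_real (\<beta> x) * g x) p" by (simp add: l2ip_def algebra_simps)
  finally show ?thesis by simp
qed

text \<open>The formal adjoint for the energy inner product: the wave part is skew and changes sign,
  while the coupling moves from the first row to the second, where it is represented in the space
  with derivative inner product by \<open>tail_prim p\<close>.\<close>

definition A_star :: "state \<Rightarrow> state" where
  "A_star = (\<lambda>(p, q, r). (\<lambda>x. weak_deriv2 L p x + of_real c * p x, \<lambda>x. tail_prim p x - r x, \<lambda>x. - weak_deriv2 L q x))"

lemma A_star_HH: "\<psi> \<in> dom_A L \<Longrightarrow> A_star \<psi> \<in> HH L"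
proof (erule dom_A_cases)
  fix f f1 g g1 h h1
  assume a: "\<psi> = (f, g, h)" "has_weak_deriv L f f1" "has_weak_deriv L f1 (weak_deriv2 L f)"
    "has_weak_deriv L g g1" "has_weak_deriv L g1 (weak_deriv2 L g)" "has_weak_deriv L h h1" "h 0 = 0"
  then show "A_star \<psi> \<in> HH L"
    by (auto simp: A_star_def hwd_tail_prim(2) hwd_in_L2 intro!: HH_I[OF _ hwd_diff[OF hwd_tail_prim(1)]] L2_add L2_cmult L2_uminus intro: hwd_L2 hwd_in_L2)
qed

lemma adjoint_identity:
  assumes X: "X \<in> dom_A L" and \<psi>: "\<psi> \<in> dom_A L"
  shows "ip L (op_A L c \<beta> X) \<psi> = ip L X (A_star \<psi>)"
proof -
  obtain f f1 g g1 h h1 where X': "X = (f, g, h)" "has_weak_deriv L f f1" "has_weak_deriv L f1 (weak_deriv2 L f)"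
    "has_weak_deriv L g g1" "has_weak_deriv L g1 (weak_deriv2 L g)" "has_weak_deriv L h h1"
    "f 0 = 0" "f L = 0" "g 0 = 0" "g1 L = 0" "h 0 = 0" using X by (rule dom_A_cases)
  obtain p p1 q q1 r r1 where P: "\<psi> = (p, q, r)" "has_weak_deriv L p p1" "has_weak_deriv L p1 (weak_deriv2 L p)"
    "has_weak_deriv L q q1" "has_weak_deriv L q1 (weak_deriv2 L q)" "has_weak_deriv L r r1"
    "p 0 = 0" "p L = 0" "q 0 = 0" "q1 L = 0" "r 0 = 0" using \<psi> by (rule dom_A_cases)
  note L2s = hwd_L2[OF X'(3)] hwd_L2[OF X'(5)] hwd_L2[OF X'(2)] hwd_L2[OF X'(4)] hwd_L2[OF X'(6)]
    hwd_in_L2[OF X'(2)] hwd_in_L2[OF X'(4)] hwd_in_L2[OF X'(6)]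
    hwd_L2[OF P(3)] hwd_L2[OF P(5)] hwd_L2[OF P(2)] hwd_L2[OF P(4)] hwd_L2[OF P(6)]
    hwd_in_L2[OF P(2)] hwd_in_L2[OF P(4)] hwd_in_L2[OF P(6)]
  have pL: "p \<in> L2 L" by (rule hwd_in_L2[OF P(2)])
  have tl: "tail p \<in> L2 L" by (rule hwd_in_L2[OF hwd_tail(1)[OF pL]])
  have "ip L (op_A L c \<beta> X) \<psi> = l2ip L (\<lambda>x. weak_deriv2 L f x + of_real c * f x + of_real (\<beta> x) * g x) p
      + l2ip L h1 q1 + l2ip L (weak_deriv2 L g) r"
    unfolding X'(1) P(1) op_A_def prod.case
    by (rule ip_hwd[OF _ _ _ _ X'(6) X'(11) P(4) P(9)]) (use L2s in \<open>auto intro!: L2_add L2_cmult beta_L2\<close>)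
  also have "l2ip L (\<lambda>x. weak_deriv2 L f x + of_real c * f x + of_real (\<beta> x) * g x) p
      = l2ip L (weak_deriv2 L f) p + of_real c * l2ip L f p + l2ip L g1 (tail p)"
    using L2s by (simp add: l2ip_add L2_add L2_cmult beta_L2 l2ip_cmult l2ip_beta[OF pL X'(4,9)])
  also have "l2ip L (weak_deriv2 L f) p = l2ip L f (weak_deriv2 L p)"
    using l2ip_ibp[OF L0 X'(3) P(2)] l2ip_ibp[OF L0 X'(2) P(3)] X' P by simp
  also have "l2ip L h1 q1 = - l2ip L h (weak_deriv2 L q)"
    using l2ip_ibp[OF L0 X'(6) P(5)] X' P by simp
  also have "l2ip L (weak_deriv2 L g) r = - l2ip L g1 r1"
    using l2ip_ibp[OF L0 X'(5) P(6)] X' P by simp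
  finally have lhs: "ip L (op_A L c \<beta> X) \<psi> = l2ip L f (weak_deriv2 L p) + of_real c * l2ip L f p + l2ip L g1 (tail p)
     - l2ip L h (weak_deriv2 L q) - l2ip L g1 r1" by simp
  have "ip L X (A_star \<psi>) = l2ip L f (\<lambda>x. weak_deriv2 L p x + of_real c * p x) + l2ip L g1 (\<lambda>x. tail p x - r1 x)
     + l2ip L h (\<lambda>x. - weak_deriv2 L q x)"
    unfolding X'(1) P(1) A_star_def prod.case
    by (rule ip_hwd[OF _ _ _ _ X'(4) X'(9) hwd_diff[OF hwd_tail_prim(1)[OF pL] P(6)]])
      (use L2s P hwd_tail_prim(2)[OF pL] in \<open>auto intro!: L2_add L2_cmult L2_uminus\<close>)
  also have "\<dots> = l2ip L f (weak_deriv2 L p) + of_real c * l2ip L f p + (l2ip L g1 (tail p) - l2ip L g1 r1) - l2ip L h (weak_deriv2 L q)"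
    using L2s tl by (simp add: l2ip_add_right l2ip_diff_right L2_cmult l2ip_cmult_right l2ip_minus_right)
  finally show ?thesis using lhs by simp
qed

text \<open>A stationary wave profile with flux 1 at L. The differential expression of the system,
  applied to it without the boundary condition at L, gives \<open>lift1\<close>. Hence the input
  operator is \<open>lift1\<close> minus the extended generator applied to \<open>lift0\<close>, and
  traces become inner products with two fixed states.\<close>

definition lift0 :: state where "lift0 = (\<lambda>x. 0, \<lambda>x. of_real x, \<lambda>x. 0)"

definition lift1 :: state where "lift1 = (\<lambda>x. of_real (\<beta> x) * of_real x, \<lambda>x. 0, \<lambda>x. 0)"

lemma hwd_id: "has_weak_deriv L (\<lambda>x. of_real x) (\<lambda>x. 1)"
proof (rule hwd_C1')
  show "(complex_of_real has_vector_derivative 1) (at x)" for x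
    using has_vector_derivative_of_real[of "\<lambda>x. x" 1 "at x"] by simp
qed simp

lemma lift0_HH: "lift0 \<in> HH L"
  unfolding lift0_def by (rule HH_I[OF _ hwd_id]) auto

lemma id_L2: "(\<lambda>x. complex_of_real x) \<in> L2 L" by (rule hwd_in_L2[OF hwd_id])

lemma lift1_HH: "lift1 \<in> HH L"
  unfolding lift1_def by (rule HH_I[OF beta_L2[OF id_L2] hwd_const]) auto

lemma ip_lift1:
  assumes "(p, q, r) \<in> HH L" shows "ip L lift1 (p, q, r) = l2ip L (\<lambda>x. 1) (tail p)"
proof -
  have p: "p \<in> L2 L" "r \<in> L2 L" "has_weak_deriv L q (weak_deriv L q)" "q 0 = 0" using HH_D[OF assms] H1_weak_deriv by auto
  have "ip L lift1 (p, q, r) = l2ip L (\<lambda>x. of_real (\<beta> x) * of_real x) p + l2ip L (\<lambda>x. 0) (weak_deriv L q) + l2ip L (\<lambda>x. 0) r"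
    unfolding lift1_def by (rule ip_hwd[OF _ _ _ _ hwd_const _ p(3,4)]) (use p in \<open>auto intro: beta_L2 id_L2\<close>)
  then show ?thesis using l2ip_beta[OF p(1) hwd_id] by (simp add: l2ip_zero_left)
qed

lemma ip_lift0:
  assumes "p \<in> L2 L" "r \<in> L2 L" "has_weak_deriv L q d" "q 0 = 0"
  shows "ip L lift0 (p, q, r) = l2ip L (\<lambda>x. 1) d"
  unfolding lift0_def by (subst ip_hwd[OF _ _ _ _ hwd_id _ assms(3,4)]) (use assms in \<open>auto simp: l2ip_zero_left\<close>)

text \<open>Integrating the derivative of the second component of \<open>A_star\<close> produces the
  value at L of the third component plus a coupling term, and \<open>lift1\<close> compensates the
  latter.\<close>

lemma trace_formula:
  assumes "(p, q, r) \<in> dom_A L"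
  shows "cnj (r L) = ip L lift1 (p, q, r) - ip L lift0 (A_star (p, q, r))"
proof -
  obtain p1 q1 r1 where P: "has_weak_deriv L p p1" "has_weak_deriv L p1 (weak_deriv2 L p)"
    "has_weak_deriv L q q1" "has_weak_deriv L q1 (weak_deriv2 L q)" "has_weak_deriv L r r1" "q 0 = 0" "r 0 = 0"
    using assms by (rule dom_A_cases) auto
  have pL: "p \<in> L2 L" by (rule hwd_in_L2[OF P(1)])
  have "ip L lift0 (A_star (p, q, r)) = l2ip L (\<lambda>x. 1) (\<lambda>x. tail p x - r1 x)"
    unfolding A_star_def prod.case
    by (rule ip_lift0[OF _ _ hwd_diff[OF hwd_tail_prim(1)[OF pL] P(5)]])
      (use P pL hwd_tail_prim(2)[OF pL] in \<open>auto intro!: L2_add L2_cmult L2_uminus intro: hwd_L2\<close>)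
  also have "\<dots> = l2ip L (\<lambda>x. 1) (tail p) - l2ip L (\<lambda>x. 1) r1"
    using hwd_in_L2[OF hwd_tail(1)[OF pL]] hwd_L2[OF P(5)] by (simp add: l2ip_diff_right)
  also have "l2ip L (\<lambda>x. 1) r1 = cnj (r L)"
    using l2ip_ibp[OF L0 hwd_const[of L 1] P(5)] P(7) by (simp add: l2ip_zero_left)
  finally show ?thesis using ip_lift1[OF dom_A_HH[OF assms]] by simp
qed

lemma l2ip_self_zero:
  assumes "f \<in> L2 L" "l2ip L f f = 0" shows "AE x in mI L. f x = 0"
proof -
  have "(LINT x|mI L. (cmod (f x))\<^sup>2) = 0" using assms by (simp add: l2ip_self)
  then have "AE x in mI L. (cmod (f x))\<^sup>2 = 0"
    using integral_nonneg_eq_0_iff_AE[OF L2_sq_integrable[OF assms(1)]] by simp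
  then show ?thesis by simp
qed

lemma B_star_eq:
  assumes K: "K \<in> H1 L" and ae: "AE x in mI L. K x = snd (snd Z) x"
  shows "B_star L Z = K L"
  unfolding B_star_def
proof (rule the_equality)
  show "\<exists>h\<in>H1 L. (AE x in mI L. h x = snd (snd Z) x) \<and> K L = h L" using K ae by blast
  fix v assume "\<exists>h\<in>H1 L. (AE x in mI L. h x = snd (snd Z) x) \<and> v = h L"
  then obtain h where h: "h \<in> H1 L" "AE x in mI L. h x = snd (snd Z) x" "v = h L" by blast
  have "AE x in mI L. h x = K x" using h(2) ae by eventually_elim simp
  then show "v = K L"
    using AE_eq_continuous[OF L hwd_continuous[OF H1_weak_deriv[OF h(1)]] hwd_continuous[OF H1_weak_deriv[OF K]], of L] h L0 by auto
qed

text \<open>Testing against \<open>(0, g, 0)\<close> with arbitrary \<open>g''\<close> identifies the third component of a vector in the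
  domain of the adjoint.\<close>

lemma B_star_weak:
  assumes Z: "Z \<in> HH L" and Z': "Z' \<in> HH L"
    and w: "\<And>X. X \<in> dom_A L \<Longrightarrow> ip L (op_A L c \<beta> X) Z = ip L X Z'"
  shows "cnj (B_star L Z) = ip L lift1 Z - ip L lift0 Z'"
proof -
  obtain z1 z2 z3 d where z: "Z = (z1, z2, z3)" "z1 \<in> L2 L" "has_weak_deriv L z2 d" "z2 0 = 0" "z3 \<in> L2 L"
    using Z by (rule HH_cases)
  obtain y1 y2 y3 e where y: "Z' = (y1, y2, y3)" "y1 \<in> L2 L" "has_weak_deriv L y2 e" "y2 0 = 0" "y3 \<in> L2 L"
    using Z' by (rule HH_cases)
  have eL: "e \<in> L2 L" by (rule hwd_L2[OF y(3)])
  have nL: "tail z1 \<in> L2 L" by (rule hwd_in_L2[OF hwd_tail(1)[OF z(2)]])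
  \<comment> \<open>The second row of the adjoint equation reads
    \<open>tail_prim z1 - z3 = y2\<close>; differentiated, it prescribes the derivative of the third
    component, and \<open>K\<close> is the primitive starting at 0.\<close>
  define K where "K x = (LINT t|mI x. tail z1 t - e t)" for x
  have hK: "has_weak_deriv L K (\<lambda>t. tail z1 t - e t)"
    using hwd_primitive[OF L2_diff[OF nL eL], of 0] by (simp add: K_def[abs_def])
  have K0: "K 0 = 0" using hwd_eq[OF hK, of 0] L0 by (simp add: K_def)
  have KL2: "K \<in> L2 L" by (rule hwd_in_L2[OF hK])
  have key: "l2ip L \<phi> z3 = l2ip L \<phi> K" if \<phi>: "\<phi> \<in> L2 L" for \<phi>
  proof -
    \<comment> \<open>The constant is chosen to give \<open>G L = 0\<close>, so that the primitive g
      satisfies \<open>g'' = \<phi>\<close>, \<open>g 0 = 0\<close> and \<open>g' L = 0\<close> and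
      yields an admissible test state.\<close>
    define G where "G x = - (LINT t|mI L. \<phi> t) + (LINT t|mI x. \<phi> t)" for x
    have hG: "has_weak_deriv L G \<phi>" unfolding G_def[abs_def] by (rule hwd_primitive[OF \<phi>])
    have GL: "G L = 0" by (simp add: G_def)
    define g where "g x = (LINT t|mI x. G t)" for x
    have hg: "has_weak_deriv L g G" using hwd_primitive[OF hwd_in_L2[OF hG], of 0] by (simp add: g_def[abs_def])
    have g0: "g 0 = 0" using hwd_eq[OF hg, of 0] L0 by (simp add: g_def)
    have dom: "(\<lambda>x. 0, g, \<lambda>x. 0) \<in> dom_A L"
      by (rule dom_A_I[OF hwd_const hwd_const hg hG hwd_const]) (auto simp: g0 GL)
    have w20: "AE x in mI L. weak_deriv2 L (\<lambda>x. 0) x = 0" by (rule weak_deriv2_AE[OF L hwd_const hwd_const])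
    have w2g: "AE x in mI L. weak_deriv2 L g x = \<phi> x" by (rule weak_deriv2_AE[OF L hg hG])
    have m: "weak_deriv2 L (\<lambda>x. 0) \<in> L2 L" "weak_deriv2 L g \<in> L2 L"
      using H2_obtain[OF hwd_H2[OF hwd_const hwd_const]] H2_obtain[OF hwd_H2[OF hg hG]] hwd_L2 by metis+
    have "ip L (op_A L c \<beta> (\<lambda>x. 0, g, \<lambda>x. 0)) Z = l2ip L (\<lambda>x. weak_deriv2 L (\<lambda>x. 0) x + of_real c * 0 + of_real (\<beta> x) * g x) z1
      + l2ip L (\<lambda>x. 0) d + l2ip L (weak_deriv2 L g) z3"
      unfolding z(1) op_A_def prod.case
      by (rule ip_hwd[OF _ _ _ _ hwd_const _ z(3,4)]) (use z m in \<open>auto intro!: L2_add beta_L2 hwd_in_L2[OF hg]\<close>)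
    also have "l2ip L (weak_deriv2 L g) z3 = l2ip L \<phi> z3"
      by (rule l2ip_cong_AE) (use m \<phi> z w2g in auto)
    also have "l2ip L (\<lambda>x. weak_deriv2 L (\<lambda>x. 0) x + of_real c * 0 + of_real (\<beta> x) * g x) z1 = l2ip L (\<lambda>x. of_real (\<beta> x) * g x) z1"
    proof (rule l2ip_cong_AE)
      show "AE x in mI L. weak_deriv2 L (\<lambda>x. 0) x + of_real c * 0 + of_real (\<beta> x) * g x = of_real (\<beta> x) * g x"
        using w20 by eventually_elim simp
    qed (use m z in \<open>auto intro!: L2_add beta_L2 hwd_in_L2[OF hg]\<close>)
    also have "\<dots> = l2ip L G (tail z1)" by (rule l2ip_beta[OF z(2) hg g0])
    finally have a: "ip L (op_A L c \<beta> (\<lambda>x. 0, g, \<lambda>x. 0)) Z = l2ip L G (tail z1) + l2ip L \<phi> z3" by (simp add: l2ip_zero_left)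
    have b: "ip L (\<lambda>x. 0, g, \<lambda>x. 0) Z' = l2ip L G e"
      unfolding y(1) by (subst ip_hwd[OF _ _ _ _ hg g0 y(3,4)]) (use y in \<open>auto simp: l2ip_zero_left\<close>)
    have "l2ip L \<phi> z3 = - l2ip L G (\<lambda>t. tail z1 t - e t)"
      using w[OF dom] a b nL eL hwd_in_L2[OF hG] by (simp add: l2ip_diff_right algebra_simps)
    also have "\<dots> = l2ip L \<phi> K" using l2ip_ibp[OF L0 hG hK] GL K0 by simp
    finally show ?thesis .
  qed
  have "l2ip L (\<lambda>x. K x - z3 x) (\<lambda>x. K x - z3 x) = 0"
    using key[OF L2_diff[OF KL2 z(5)]] KL2 z(5) L2_diff[OF KL2 z(5)] by (simp add: l2ip_diff_right)
  then have "AE x in mI L. K x - z3 x = 0" by (rule l2ip_self_zero[OF L2_diff[OF KL2 z(5)]])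
  then have "B_star L Z = K L" by (intro B_star_eq hwd_H1[OF hK]) (simp add: z(1))
  moreover have "cnj (K L) = l2ip L (\<lambda>x. 1) (\<lambda>t. tail z1 t - e t)"
    using l2ip_ibp[OF L0 hwd_const[of L 1] hK] K0 by (simp add: l2ip_zero_left)
  moreover have "\<dots> = l2ip L (\<lambda>x. 1) (tail z1) - l2ip L (\<lambda>x. 1) e" using nL eL by (simp add: l2ip_diff_right)
  moreover have "l2ip L (\<lambda>x. 1) (tail z1) = ip L lift1 Z" using ip_lift1 Z unfolding z(1) by simp
  moreover have "l2ip L (\<lambda>x. 1) e = ip L lift0 Z'" unfolding y(1) using y by (subst ip_lift0) auto
  ultimately show ?thesis by simp
qed

section \<open>Eigenvectors\<close>

lemma Hnorm_zero_I:
  assumes "f1 \<in> L2 L" "has_weak_deriv L g1 d1" "g1 0 = 0" "h1 \<in> L2 L"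
    and "f2 \<in> L2 L" "has_weak_deriv L g2 d2" "h2 \<in> L2 L"
    and ae: "AE x in mI L. f1 x = f2 x" "\<And>x. x \<in> {0..L} \<Longrightarrow> g1 x = g2 x" "AE x in mI L. h1 x = h2 x"
  shows "Hnorm L ((f1, g1, h1) - (f2, g2, h2)) = 0"
proof -
  have g20: "g2 0 = 0" using ae(2)[of 0] assms(3) L0 by simp
  have z: "(LINT x|mI L. (cmod (a x - b x))\<^sup>2) = 0" if "AE x in mI L. a x = b x" for a b
    by (rule integral_eq_zero_AE) (use that in \<open>auto elim: eventually_mono\<close>)
  have "(Hnorm L ((f1, g1, h1) - (f2, g2, h2)))\<^sup>2 = 0"
    unfolding Hnorm_diff_sq[OF assms(1-6) g20 assms(7)]
    using z[OF ae(1)] z[OF hwd_AE_unique[OF assms(2,6) ae(2)]] z[OF ae(3)] by simp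
  then show ?thesis by simp
qed

definition lam :: "nat + int \<Rightarrow> complex" where
  "lam = case_sum (\<lambda>n. of_real (lam1 L c n)) (lam2 L)"

definition sine :: "nat \<Rightarrow> real \<Rightarrow> complex" where
  "sine n x = of_real (sqrt (2 / L) * sin (real n * pi * x / L))"

lemma phi1_sine: "phi1 L n = (sine n, \<lambda>x. 0, \<lambda>x. 0)"
  by (simp add: phi1_def sine_def[abs_def])

definition cosine :: "nat \<Rightarrow> real \<Rightarrow> complex" where
  "cosine n x = of_real (sqrt (2 / L) * cos (real n * pi * x / L))"

lemma hwd_sine:
  shows "has_weak_deriv L (sine n) (\<lambda>x. of_real (real n * pi / L) * cosine n x)"
    and "has_weak_deriv L (cosine n) (\<lambda>x. - of_real (real n * pi / L) * sine n x)"
proof -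
  have s: "(sine n has_vector_derivative of_real (real n * pi / L) * cosine n x) (at x)" for x
  proof -
    have "((\<lambda>x. sqrt (2 / L) * sin (real n * pi * x / L)) has_real_derivative (real n * pi / L) * (sqrt (2 / L) * cos (real n * pi * x / L))) (at x)"
      using L by (auto intro!: derivative_eq_intros)
    from has_vector_derivative_of_real[OF this, where ?'a = complex] show ?thesis by (simp add: sine_def[abs_def] cosine_def)
  qed
  have c: "(cosine n has_vector_derivative - of_real (real n * pi / L) * sine n x) (at x)" for x
  proof -
    have "((\<lambda>x. sqrt (2 / L) * cos (real n * pi * x / L)) has_real_derivative - (real n * pi / L) * (sqrt (2 / L) * sin (real n * pi * x / L))) (at x)"
      using L by (auto intro!: derivative_eq_intros)
    from has_vector_derivative_of_real[OF this, where ?'a = complex] show ?thesis by (simp add: sine_def cosine_def[abs_def])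
  qed
  have cs: "continuous_on {0..L} (sine n)" and cc: "continuous_on {0..L} (cosine n)"
    using L by (auto simp: sine_def[abs_def] cosine_def[abs_def] intro!: continuous_intros)
  show "has_weak_deriv L (sine n) (\<lambda>x. of_real (real n * pi / L) * cosine n x)"
    by (rule hwd_C1'[OF _ s]) (intro continuous_intros cc)
  show "has_weak_deriv L (cosine n) (\<lambda>x. - of_real (real n * pi / L) * sine n x)"
    by (rule hwd_C1'[OF _ c]) (intro continuous_intros cs)
qed

lemma sine_0 [simp]: "sine n 0 = 0" and sine_L [simp]: "sine n L = 0"
  using L by (simp_all add: sine_def)

lemma sine_L2: "sine n \<in> L2 L" and cosine_L2: "cosine n \<in> L2 L"
  by (rule hwd_in_L2, rule hwd_sine)+

text \<open>Integration by parts shows that sine and cosine have equal norms, while the sum of their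
  squares is the constant 2/L.\<close>

lemma sine_norm:
  assumes n: "n \<ge> 1" shows "l2ip L (sine n) (sine n) = 1"
proof -
  define k where "k = complex_of_real (real n * pi / L)"
  have k: "cnj k = k" "k \<noteq> 0" using n L by (auto simp: k_def)
  have "l2ip L (\<lambda>x. k * cosine n x) (cosine n)
     = sine n L * cnj (cosine n L) - sine n 0 * cnj (cosine n 0) - l2ip L (sine n) (\<lambda>x. - k * sine n x)"
    unfolding k_def by (rule l2ip_ibp[OF L0 hwd_sine])
  then have "k * l2ip L (cosine n) (cosine n) = k * l2ip L (sine n) (sine n)"
    by (simp only: l2ip_cmult l2ip_cmult_right sine_0 sine_L) (simp add: k)
  then have eq: "l2ip L (cosine n) (cosine n) = l2ip L (sine n) (sine n)" using k by simp
  have pw: "(cmod (cosine n x))\<^sup>2 + (cmod (sine n x))\<^sup>2 = 2 / L" for x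
  proof -
    have "(cmod (cosine n x))\<^sup>2 + (cmod (sine n x))\<^sup>2 = 2 / L * ((cos (real n * pi * x / L))\<^sup>2 + (sin (real n * pi * x / L))\<^sup>2)"
      using L unfolding cosine_def sine_def norm_of_real by (simp add: power_mult_distrib sin_squared_eq field_simps)
    then show ?thesis by simp
  qed
  have "l2ip L (cosine n) (cosine n) + l2ip L (sine n) (sine n) = of_real (LINT x|mI L. (cmod (cosine n x))\<^sup>2 + (cmod (sine n x))\<^sup>2)"
    using L2_sq_integrable[OF sine_L2] L2_sq_integrable[OF cosine_L2] by (simp add: l2ip_self sine_L2 cosine_L2)
  also have "\<dots> = 2"
  proof -
    have "(LINT x|mI L. (2 / L :: real)) = 2 / L * measure (mI L) (space (mI L))" by simp
    also have "\<dots> = 2" using L by (simp add: measure_restrict_space)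
    finally show ?thesis unfolding pw by simp
  qed
  finally show ?thesis unfolding eq by simp
qed

lemma phi1_dom: "phi1 L n \<in> dom_A L"
  unfolding phi1_sine by (rule dom_A_I[OF hwd_sine(1) hwd_cmult[OF hwd_sine(2)] hwd_const hwd_const hwd_const]) auto

lemma sine_second:
  "AE x in mI L. weak_deriv2 L (sine n) x + of_real c * sine n x = of_real (lam1 L c n) * sine n x"
proof -
  have "AE x in mI L. weak_deriv2 L (sine n) x = of_real (real n * pi / L) * (- of_real (real n * pi / L) * sine n x)"
    by (rule weak_deriv2_AE[OF L hwd_sine(1) hwd_cmult[OF hwd_sine(2)]])
  then show ?thesis
    by eventually_elim (simp add: lam1_def power_divide power_mult_distrib algebra_simps power2_eq_square)
qed

lemma weak_deriv2_L2: "has_weak_deriv L g d \<Longrightarrow> has_weak_deriv L d e \<Longrightarrow> weak_deriv2 L g \<in> L2 L"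
  using H2_obtain[OF hwd_H2] hwd_L2 by metis

lemma weak_deriv2_zero: "AE x in mI L. weak_deriv2 L (\<lambda>x. 0) x = 0" "weak_deriv2 L (\<lambda>x. 0) \<in> L2 L"
  by (rule weak_deriv2_AE[OF L hwd_const hwd_const], rule weak_deriv2_L2[OF hwd_const hwd_const])

lemma phi1_eigen: "Hnorm L (op_A L c \<beta> (phi1 L n) - smul (lam (Inl n)) (phi1 L n)) = 0"
  unfolding phi1_sine op_A_def prod.case smul_Pair
proof (rule Hnorm_zero_I[OF _ hwd_const _ _ _ hwd_cmult[OF hwd_const]])
  show "AE x in mI L. weak_deriv2 L (sine n) x + of_real c * sine n x + of_real (\<beta> x) * 0 = lam (Inl n) * sine n x"
    using sine_second by eventually_elim (simp add: lam_def)
  show "AE x in mI L. weak_deriv2 L (\<lambda>x. 0) x = lam (Inl n) * 0" using weak_deriv2_zero(1) by eventually_elim simp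
qed (auto intro!: L2_add L2_cmult sine_L2 weak_deriv2_L2[OF hwd_sine(1) hwd_cmult[OF hwd_sine(2)]] weak_deriv2_zero)

definition om :: "int \<Rightarrow> real" where "om m = (2 * real_of_int m + 1) * pi / (2 * L)"

lemma lam2_om: "lam2 L m = \<i> * of_real (om m)" by (simp add: lam2_def om_def)

lemma om_nz: "om m \<noteq> 0"
proof -
  have "2 * m + 1 \<noteq> 0" by presburger
  then have "real_of_int (2 * m + 1) \<noteq> 0" by linarith
  then show ?thesis using L by (simp add: om_def)
qed

lemma cos_om: "cos (om m * L) = 0"
proof -
  have "om m * L = pi / 2 + pi * of_int m" using L by (simp add: om_def field_simps)
  then show ?thesis by (simp add: cos_add)
qed

lemma sin_om: "(sin (om m * L))\<^sup>2 = 1"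
  using sin_cos_squared_add[of "om m * L"] by (simp add: cos_om)

text \<open>The amplitude that gives the wave part of each hyperbolic eigenvector energy one, as
  \<open>phi2_2_norm\<close> shows.\<close>

definition Kc :: "int \<Rightarrow> real" where "Kc m = 1 / (sqrt L * \<bar>om m\<bar>)"

lemma Kc_eq: "2 * sqrt L / (\<bar>2 * real_of_int m + 1\<bar> * pi) = Kc m"
proof -
  have "\<bar>om m\<bar> = \<bar>2 * real_of_int m + 1\<bar> * pi / (2 * L)" using L by (simp add: om_def abs_mult)
  then have "Kc m = 2 * (L / sqrt L) / (\<bar>2 * real_of_int m + 1\<bar> * pi)" using L by (simp add: Kc_def)
  then show ?thesis using L by (simp add: real_div_sqrt)
qed

lemma phi2_2_eq: "phi2_2 L m x = \<i> * of_real (Kc m * sin (om m * x))"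
proof -
  have "sinh (\<i> * of_real (om m) * of_real x) = \<i> * of_real (sin (om m * x))"
    by (simp add: sinh_def sin_exp_eq sin_of_real[symmetric] field_simps scaleR_conv_of_real)
  then show ?thesis unfolding phi2_2_def lam2_om Kc_eq by simp
qed

definition wave1 :: "int \<Rightarrow> real \<Rightarrow> complex" where
  "wave1 m x = \<i> * of_real (Kc m * om m * cos (om m * x))"

lemma hwd_phi2_2:
  shows "has_weak_deriv L (phi2_2 L m) (wave1 m)"
    and "has_weak_deriv L (wave1 m) (\<lambda>x. (lam2 L m)\<^sup>2 * phi2_2 L m x)"
proof -
  have s: "(phi2_2 L m has_vector_derivative wave1 m x) (at x)" for x
  proof -
    have "((\<lambda>x. Kc m * sin (om m * x)) has_real_derivative Kc m * om m * cos (om m * x)) (at x)"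
      by (auto intro!: derivative_eq_intros)
    from has_vector_derivative_mult_right[OF has_vector_derivative_of_real[OF this], of \<i>]
    show ?thesis by (simp only: phi2_2_eq[abs_def] wave1_def)
  qed
  have c: "(wave1 m has_vector_derivative (lam2 L m)\<^sup>2 * phi2_2 L m x) (at x)" for x
  proof -
    have "((\<lambda>x. Kc m * om m * cos (om m * x)) has_real_derivative Kc m * om m * (- sin (om m * x) * om m)) (at x)"
      by (auto intro!: derivative_eq_intros)
    from has_vector_derivative_mult_right[OF has_vector_derivative_of_real[OF this], of \<i>]
    have "(wave1 m has_vector_derivative \<i> * of_real (Kc m * om m * (- sin (om m * x) * om m))) (at x)" by (simp only: wave1_def[abs_def])
    moreover have "\<i> * of_real (Kc m * om m * (- sin (om m * x) * om m)) = (lam2 L m)\<^sup>2 * phi2_2 L m x"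
      by (simp add: phi2_2_eq lam2_om power2_eq_square algebra_simps)
    ultimately show ?thesis by simp
  qed
  have cw: "continuous_on {0..L} (wave1 m)" unfolding wave1_def[abs_def] by (intro continuous_intros)
  have cp: "continuous_on {0..L} (phi2_2 L m)" unfolding phi2_2_eq[abs_def] by (intro continuous_intros)
  show "has_weak_deriv L (phi2_2 L m) (wave1 m)" by (rule hwd_C1'[OF cw s])
  show "has_weak_deriv L (wave1 m) (\<lambda>x. (lam2 L m)\<^sup>2 * phi2_2 L m x)"
    by (rule hwd_C1'[OF _ c]) (intro continuous_intros cp)
qed

lemma phi2_2_0 [simp]: "phi2_2 L m 0 = 0" and wave1_L [simp]: "wave1 m L = 0"
  by (simp_all add: phi2_2_eq wave1_def cos_om)

lemma phi2_2_L2: "phi2_2 L m \<in> L2 L" and wave1_L2: "wave1 m \<in> L2 L"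
  by (rule hwd_in_L2, rule hwd_phi2_2)+

text \<open>The Dirichlet problem is solved by shooting from 0. It is not resonant: a zero of the
  hyperbolic sine would make its parameter \<open>lam2 L m - c\<close> real, but its imaginary part
  is \<open>om m\<close>, which is nonzero.\<close>

lemma phi2_1_exists:
  "\<exists>f. f \<in> H2 L \<and> f 0 = 0 \<and> f L = 0 \<and> (AE x in mI L.
        (lam2 L m - of_real c) * f x - weak_deriv2 L f x = of_real (\<beta> x) * phi2_2 L m x)"
proof -
  define \<mu> where "\<mu> = lam2 L m - of_real c"
  have im: "Im \<mu> = om m" by (simp add: \<mu>_def lam2_om)
  define \<kappa> where "\<kappa> = csqrt \<mu>"
  have \<kappa>2: "\<kappa>\<^sup>2 = \<mu>" by (simp add: \<kappa>_def)
  have \<kappa>: "\<kappa> \<noteq> 0" using \<kappa>2 im om_nz[of m] by auto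
  define C where "C x = cosh (\<kappa> * of_real x)" for x :: real
  define s where "s x = sinh (\<kappa> * of_real x) / \<kappa>" for x :: real
  note fs = fundamental_system[OF \<kappa>, folded C_def s_def, unfolded \<kappa>2]
  have sL: "s L \<noteq> 0"
  proof
    assume "s L = 0"
    then have "Re (\<kappa> * of_real L) = 0" using \<kappa> by (intro sinh_eq_0_imp_Re) (simp add: s_def)
    then have "Re \<kappa> = 0" using L by simp
    then have "Im (\<kappa>\<^sup>2) = 0" by (simp add: power2_eq_square)
    then show False using im \<kappa>2 om_nz[of m] by simp
  qed
  have F: "(\<lambda>x. of_real (\<beta> x) * phi2_2 L m x) \<in> L2 L" by (rule beta_L2[OF phi2_2_L2])
  let ?F = "\<lambda>x. of_real (\<beta> x) * phi2_2 L m x"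
  \<comment> \<open>The initial slope for which the solution vanishes at L.\<close>
  define A where "A = (LINT y|mI L. C y * ?F y) - C L / s L * (LINT y|mI L. s y * ?F y)"
  have s0: "s 0 = 0" "C 0 = 1" by (simp_all add: s_def C_def)
  obtain r' where r: "has_weak_deriv L (lincomb_solution C s A ?F) r'"
      "has_weak_deriv L r' (\<lambda>x. \<mu> * lincomb_solution C s A ?F x - ?F x)"
      "lincomb_solution C s A ?F 0 = 0" "r' 0 = A"
      "lincomb_solution C s A ?F L = A * s L - s L * (LINT y|mI L. C y * ?F y) + C L * (LINT y|mI L. s y * ?F y)"
      "r' L = A * C L - C L * (LINT y|mI L. C y * ?F y) + \<mu> * s L * (LINT y|mI L. s y * ?F y)"
    by (rule variation_of_constants[OF L0 F fs s0])
  have rL: "lincomb_solution C s A ?F L = 0" unfolding r(5) unfolding A_def using sL by (simp add: field_simps)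
  have "AE x in mI L. weak_deriv2 L (lincomb_solution C s A ?F) x = \<mu> * lincomb_solution C s A ?F x - ?F x"
    by (rule weak_deriv2_AE[OF L r(1,2)])
  then have "AE x in mI L. (lam2 L m - of_real c) * lincomb_solution C s A ?F x - weak_deriv2 L (lincomb_solution C s A ?F) x = ?F x"
    by eventually_elim (simp add: \<mu>_def)
  then show ?thesis using hwd_H2[OF r(1,2)] r(3) rL by blast
qed

lemma phi2_1_facts:
  obtains f1 where "has_weak_deriv L (phi2_1 L c \<beta> m) f1"
    "has_weak_deriv L f1 (\<lambda>x. (lam2 L m - of_real c) * phi2_1 L c \<beta> m x - of_real (\<beta> x) * phi2_2 L m x)"
    "phi2_1 L c \<beta> m 0 = 0" "phi2_1 L c \<beta> m L = 0"
proof -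
  let ?f = "phi2_1 L c \<beta> m"
  have f: "?f \<in> H2 L" "?f 0 = 0" "?f L = 0"
    "AE x in mI L. (lam2 L m - of_real c) * ?f x - weak_deriv2 L ?f x = of_real (\<beta> x) * phi2_2 L m x"
    using someI_ex[OF phi2_1_exists[of m]] unfolding phi2_1_def by blast+
  obtain f1 where f1: "has_weak_deriv L ?f f1" "has_weak_deriv L f1 (weak_deriv2 L ?f)" using H2_obtain[OF f(1)] .
  have "has_weak_deriv L f1 (\<lambda>x. (lam2 L m - of_real c) * ?f x - of_real (\<beta> x) * phi2_2 L m x)"
  proof (rule hwd_cong[OF f1(2)])
    show "AE x in mI L. (lam2 L m - of_real c) * ?f x - of_real (\<beta> x) * phi2_2 L m x = weak_deriv2 L ?f x"
      using f(4) by eventually_elim (simp add: algebra_simps)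
  qed (auto intro!: L2_diff L2_cmult beta_L2 phi2_2_L2 hwd_in_L2[OF f1(1)])
  then show ?thesis using that f1 f by blast
qed

lemma phi2_dom: "phi2 L c \<beta> m \<in> dom_A L"
proof -
  obtain f1 where f: "has_weak_deriv L (phi2_1 L c \<beta> m) f1"
    "has_weak_deriv L f1 (\<lambda>x. (lam2 L m - of_real c) * phi2_1 L c \<beta> m x - of_real (\<beta> x) * phi2_2 L m x)"
    "phi2_1 L c \<beta> m 0 = 0" "phi2_1 L c \<beta> m L = 0" by (rule phi2_1_facts)
  show ?thesis unfolding phi2_def
    by (rule dom_A_I[OF f(1,2) hwd_phi2_2 hwd_cmult[OF hwd_phi2_2(1)]]) (auto simp: f)
qed

lemma phi2_2_second: "AE x in mI L. weak_deriv2 L (phi2_2 L m) x = (lam2 L m)\<^sup>2 * phi2_2 L m x"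
  by (rule weak_deriv2_AE[OF L hwd_phi2_2])

lemma phi2_eigen: "Hnorm L (op_A L c \<beta> (phi2 L c \<beta> m) - smul (lam (Inr m)) (phi2 L c \<beta> m)) = 0"
proof -
  let ?f = "phi2_1 L c \<beta> m"
  obtain f1 where f: "has_weak_deriv L ?f f1"
    "has_weak_deriv L f1 (\<lambda>x. (lam2 L m - of_real c) * ?f x - of_real (\<beta> x) * phi2_2 L m x)"
    by (rule phi2_1_facts)
  have w: "AE x in mI L. weak_deriv2 L ?f x = (lam2 L m - of_real c) * ?f x - of_real (\<beta> x) * phi2_2 L m x"
    by (rule weak_deriv2_AE[OF L f])
  show ?thesis unfolding phi2_def op_A_def prod.case smul_Pair
  proof (rule Hnorm_zero_I[OF _ hwd_cmult[OF hwd_phi2_2(1)] _ _ _ hwd_cmult[OF hwd_phi2_2(1)]])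
    show "AE x in mI L. weak_deriv2 L ?f x + of_real c * ?f x + of_real (\<beta> x) * phi2_2 L m x = lam (Inr m) * ?f x"
      using w by eventually_elim (simp add: lam_def algebra_simps)
    show "AE x in mI L. weak_deriv2 L (phi2_2 L m) x = lam (Inr m) * (lam2 L m * phi2_2 L m x)"
      using phi2_2_second[of m] by eventually_elim (simp add: lam_def power2_eq_square)
  qed (auto simp: lam_def intro!: L2_add L2_cmult beta_L2 phi2_2_L2 hwd_in_L2[OF f(1)] weak_deriv2_L2[OF f] weak_deriv2_L2[OF hwd_phi2_2])
qed

lemma phi_dom: "phi L c \<beta> j \<in> dom_A L"
  by (cases j) (auto simp: phi_def phi1_dom phi2_dom)

lemma phi_HH: "phi L c \<beta> j \<in> HH L" by (rule dom_A_HH[OF phi_dom])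

lemma phi_eigen: "Hnorm L (op_A L c \<beta> (phi L c \<beta> j) - smul (lam j) (phi L c \<beta> j)) = 0"
  by (cases j) (auto simp: phi_def phi1_eigen phi2_eigen)

section \<open>Eigenvectors of the adjoint and their traces\<close>

definition psi2 :: "int \<Rightarrow> state" where
  "psi2 m = (\<lambda>x. 0, phi2_2 L m, \<lambda>x. lam2 L m * phi2_2 L m x)"

text \<open>The coupling acts only from the wave on the heat equation, so in the adjoint a state
  without heat component sees the pure wave operator.\<close>

lemma psi2_eigen:
  shows "psi2 m \<in> dom_A L" "Hnorm L (A_star (psi2 m) - smul (cnj (lam (Inr m))) (psi2 m)) = 0"
proof -
  show "psi2 m \<in> dom_A L" unfolding psi2_def
    by (rule dom_A_I[OF hwd_const hwd_const hwd_phi2_2 hwd_cmult[OF hwd_phi2_2(1)]]) auto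
  have t0: "tail_prim (\<lambda>x. 0) x = 0" for x by (simp add: tail_prim_def tail_def)
  show "Hnorm L (A_star (psi2 m) - smul (cnj (lam (Inr m))) (psi2 m)) = 0"
    unfolding psi2_def A_star_def prod.case smul_Pair t0
  proof (rule Hnorm_zero_I[OF _ hwd_diff[OF hwd_const hwd_cmult[OF hwd_phi2_2(1)]] _ _ _ hwd_cmult[OF hwd_phi2_2(1)]])
    show "AE x in mI L. weak_deriv2 L (\<lambda>x. 0) x + of_real c * 0 = cnj (lam (Inr m)) * 0"
      using weak_deriv2_zero(1) by eventually_elim simp
    show "AE x in mI L. - weak_deriv2 L (phi2_2 L m) x = cnj (lam (Inr m)) * (lam2 L m * phi2_2 L m x)"
      using phi2_2_second[of m] by eventually_elim (simp add: lam_def lam2_om power2_eq_square)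
  qed (auto simp: lam_def lam2_om intro!: L2_add L2_cmult L2_uminus phi2_2_L2 weak_deriv2_zero weak_deriv2_L2[OF hwd_phi2_2])
qed

lemma phi2_2_norm: "l2ip L (wave1 m) (wave1 m) + l2ip L (\<lambda>x. lam2 L m * phi2_2 L m x) (\<lambda>x. lam2 L m * phi2_2 L m x) = 1"
proof -
  have pw: "(cmod (wave1 m x))\<^sup>2 + (cmod (lam2 L m * phi2_2 L m x))\<^sup>2 = 1 / L" for x
  proof -
    have "(cmod (wave1 m x))\<^sup>2 + (cmod (lam2 L m * phi2_2 L m x))\<^sup>2 = (Kc m * om m)\<^sup>2 * ((cos (om m * x))\<^sup>2 + (sin (om m * x))\<^sup>2)"
      unfolding wave1_def phi2_2_eq lam2_om norm_mult norm_of_real by (simp add: abs_mult power_mult_distrib sin_squared_eq algebra_simps)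
    also have "(Kc m * om m)\<^sup>2 = 1 / L" using om_nz[of m] L by (simp add: Kc_def power_mult_distrib power_divide)
    finally show ?thesis by simp
  qed
  have l: "(\<lambda>x. lam2 L m * phi2_2 L m x) \<in> L2 L" by (intro L2_cmult phi2_2_L2)
  have "l2ip L (wave1 m) (wave1 m) + l2ip L (\<lambda>x. lam2 L m * phi2_2 L m x) (\<lambda>x. lam2 L m * phi2_2 L m x)
     = of_real (LINT x|mI L. (cmod (wave1 m x))\<^sup>2 + (cmod (lam2 L m * phi2_2 L m x))\<^sup>2)"
    using L2_sq_integrable[OF wave1_L2] L2_sq_integrable[OF l] by (simp only: l2ip_self wave1_L2 l) simp
  also have "\<dots> = 1"
  proof -
    have "(LINT x|mI L. (1 / L :: real)) = 1 / L * measure (mI L) (space (mI L))" by simp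
    also have "\<dots> = 1" using L by (simp add: measure_restrict_space)
    finally show ?thesis unfolding pw by simp
  qed
  finally show ?thesis .
qed

lemma ip_phi2_psi2: "ip L (phi2 L c \<beta> m) (psi2 m) = 1"
proof -
  obtain f1 where f: "has_weak_deriv L (phi2_1 L c \<beta> m) f1" by (rule phi2_1_facts)
  have "ip L (phi2 L c \<beta> m) (psi2 m) = l2ip L (phi2_1 L c \<beta> m) (\<lambda>x. 0) + l2ip L (wave1 m) (wave1 m)
     + l2ip L (\<lambda>x. lam2 L m * phi2_2 L m x) (\<lambda>x. lam2 L m * phi2_2 L m x)"
    unfolding phi2_def psi2_def
    by (rule ip_hwd[OF _ _ _ _ hwd_phi2_2(1) _ hwd_phi2_2(1)]) (auto intro!: L2_cmult phi2_2_L2 hwd_in_L2[OF f])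
  then show ?thesis using phi2_2_norm[of m] by (simp add: l2ip_zero_right)
qed

lemma integral_beta_sine:
  fixes w :: "real \<Rightarrow> real"
  shows "(LINT y|mI L. of_real (w y) * (of_real (\<beta> y) * sine n y))
     = of_real (sqrt (2 / L) * (LINT y|mI L. \<beta> y * sin (real n * pi / L * y) * w y))"
proof -
  have "(LINT y|mI L. of_real (w y) * (of_real (\<beta> y) * sine n y))
      = (LINT y|mI L. complex_of_real (sqrt (2 / L) * (\<beta> y * sin (real n * pi / L * y) * w y)))"
    by (rule Bochner_Integration.integral_cong) (auto simp: sine_def)
  also have "\<dots> = of_real (LINT y|mI L. sqrt (2 / L) * (\<beta> y * sin (real n * pi / L * y) * w y))"
    by (rule integral_complex_of_real)
  also have "(LINT y|mI L. sqrt (2 / L) * (\<beta> y * sin (real n * pi / L * y) * w y))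
     = sqrt (2 / L) * (LINT y|mI L. \<beta> y * sin (real n * pi / L * y) * w y)"
    by (rule integral_mult_right_zero)
  finally show ?thesis .
qed

text \<open>Closed form of the boundary traces of the family dual to the eigenvectors. In a
  parabolic mode the coupling coefficient appears as the solution of the adjoint wave equation
  evaluated at L, whence the factor \<open>cosh\<close> in the denominator.\<close>

definition tr :: "nat + int \<Rightarrow> complex" where
  "tr = case_sum (\<lambda>n. of_real (sqrt (2 / L) * gam L c \<beta> n /
      (if lam1 L c n = 0 then 1 else lam1 L c n * cosh (lam1 L c n * L)))) (\<lambda>m. lam2 L m * phi2_2 L m L)"

definition is_psi :: "nat + int \<Rightarrow> state \<Rightarrow> bool" where
  "is_psi j \<psi> \<longleftrightarrow> \<psi> \<in> dom_A L \<and> Hnorm L (A_star \<psi> - smul (cnj (lam j)) \<psi>) = 0 \<and>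
     ip L (phi L c \<beta> j) \<psi> = 1 \<and> snd (snd \<psi>) L = tr j"

lemma ip_phi1:
  assumes "has_weak_deriv L q d" "q 0 = 0" "r \<in> L2 L"
  shows "ip L (phi1 L n) (sine k, q, r) = l2ip L (sine n) (sine k)"
  unfolding phi1_sine
  by (subst ip_hwd[OF _ _ _ _ hwd_const _ assms(1,2)]) (use assms in \<open>auto simp: l2ip_zero_left sine_L2\<close>)

text \<open>At eigenvalue zero the wave rows leave only \<open>q = 0\<close> and
  \<open>r = tail_prim (sine n)\<close>. The trace is then the integral of \<open>\<beta>\<close>
  against sine times s, which explains the separate clause of \<open>gam\<close>.\<close>

lemma psi1_exists_0:
  assumes n: "n \<ge> 1" and z: "lam1 L c n = 0"
  shows "\<exists>\<psi>. is_psi (Inl n) \<psi>"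
proof -
  let ?W = "tail_prim (sine n)"
  note W = hwd_tail_prim[OF sine_L2[of n]] and T = hwd_tail[OF sine_L2[of n]]
  have dom: "(sine n, \<lambda>x. 0, ?W) \<in> dom_A L"
    by (rule dom_A_I[OF hwd_sine(1) hwd_cmult[OF hwd_sine(2)] hwd_const hwd_const W(1)]) (auto simp: W)
  have e: "Hnorm L (A_star (sine n, \<lambda>x. 0, ?W) - smul (cnj (lam (Inl n))) (sine n, \<lambda>x. 0, ?W)) = 0"
    unfolding A_star_def prod.case smul_Pair
  proof (rule Hnorm_zero_I[OF _ hwd_diff[OF W(1) W(1)] _ _ _ hwd_cmult[OF hwd_const]])
    show "AE x in mI L. weak_deriv2 L (sine n) x + of_real c * sine n x = cnj (lam (Inl n)) * sine n x"
      using sine_second by eventually_elim (simp add: lam_def)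
    show "AE x in mI L. - weak_deriv2 L (\<lambda>x. 0) x = cnj (lam (Inl n)) * ?W x"
      using weak_deriv2_zero(1) by eventually_elim (simp add: lam_def z)
  qed (auto intro!: L2_add L2_cmult L2_uminus sine_L2 weak_deriv2_L2[OF hwd_sine(1) hwd_cmult[OF hwd_sine(2)]] weak_deriv2_zero hwd_in_L2[OF W(1)])
  have "cnj (?W L) = l2ip L (\<lambda>x. 1) (tail (sine n))"
    using l2ip_ibp[OF L0 hwd_const[of L 1] W(1)] W(2) by (simp add: l2ip_zero_left)
  also have "\<dots> = l2ip L (\<lambda>x. of_real (\<beta> x) * of_real x) (sine n)"
    by (rule l2ip_beta[OF sine_L2 hwd_id, symmetric]) simp
  also have "\<dots> = (LINT y|mI L. of_real y * (of_real (\<beta> y) * sine n y))"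
    unfolding l2ip_def by (rule Bochner_Integration.integral_cong) (auto simp: sine_def)
  also have "\<dots> = tr (Inl n)" unfolding integral_beta_sine using z by (simp add: tr_def gam_def)
  finally have "?W L = cnj (tr (Inl n))" by (metis complex_cnj_cnj)
  also have "\<dots> = tr (Inl n)" by (simp add: tr_def)
  finally have t: "?W L = tr (Inl n)" .
  have "ip L (phi L c \<beta> (Inl n)) (sine n, \<lambda>x. 0, ?W) = 1"
    using ip_phi1[OF hwd_const _ hwd_in_L2[OF W(1)]] sine_norm[OF n] by (simp add: phi_def)
  then show ?thesis using dom e t by (intro exI[of _ "(sine n, \<lambda>x. 0, ?W)"]) (simp add: is_psi_def)
qed

text \<open>Eliminating q from \<open>tail_prim p - r = \<mu> q\<close> and
  \<open>- q'' = \<mu> r\<close> leaves \<open>r'' = \<mu>^2 r - \<beta> p\<close> with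
  \<open>r 0 = 0\<close> and \<open>r' L = 0\<close>, which variation of constants solves; q is then
  read off the first of these equations.\<close>

lemma psi1_exists_nz:
  assumes n: "n \<ge> 1" and nz: "lam1 L c n \<noteq> 0"
  shows "\<exists>\<psi>. is_psi (Inl n) \<psi>"
proof -
  define \<mu> where "\<mu> = complex_of_real (lam1 L c n)"
  have \<mu>: "\<mu> \<noteq> 0" "cnj \<mu> = \<mu>" using nz by (auto simp: \<mu>_def)
  define C where "C x = cosh (\<mu> * of_real x)" for x :: real
  define s where "s x = sinh (\<mu> * of_real x) / \<mu>" for x :: real
  note fs = fundamental_system[OF \<mu>(1), folded C_def s_def]
  have Cr: "C x = of_real (cosh (lam1 L c n * x))" for x
    by (simp add: C_def \<mu>_def cosh_def scaleR_conv_of_real flip: of_real_mult of_real_minus exp_of_real)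
  have sr: "s x = of_real (sinh (lam1 L c n * x) / lam1 L c n)" for x
  proof -
    have "exp (\<mu> * of_real x) = of_real (exp (lam1 L c n * x))" "exp (- (\<mu> * of_real x)) = of_real (exp (- (lam1 L c n * x)))"
      unfolding exp_of_real[symmetric] by (simp_all add: \<mu>_def)
    then show ?thesis by (simp add: s_def sinh_def scaleR_conv_of_real) (simp add: \<mu>_def)
  qed
  have CL: "C L \<noteq> 0" unfolding Cr by simp
  let ?F = "\<lambda>x. of_real (\<beta> x) * sine n x"
  have F: "?F \<in> L2 L" by (rule beta_L2[OF sine_L2])
  define IC where "IC = (LINT y|mI L. C y * ?F y)"
  define Is where "Is = (LINT y|mI L. s y * ?F y)"
  \<comment> \<open>The initial slope that makes \<open>r'\<close> vanish at L; the division is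
    possible because the real hyperbolic cosine has no zero.\<close>
  define A where "A = IC - \<mu>\<^sup>2 * s L * Is / C L"
  define r where "r = lincomb_solution C s A ?F"
  have s0: "s 0 = 0" "C 0 = 1" by (simp_all add: s_def C_def)
  obtain r' where r0: "has_weak_deriv L r r'" "has_weak_deriv L r' (\<lambda>x. \<mu>\<^sup>2 * r x - ?F x)"
      "r 0 = 0" "r' 0 = A" "r L = A * s L - s L * IC + C L * Is" "r' L = A * C L - C L * IC + \<mu>\<^sup>2 * s L * Is"
    unfolding r_def IC_def Is_def by (rule variation_of_constants[OF L0 F fs s0])
  note r = r0(1-3,5,6)
  have r'L: "r' L = 0" unfolding r(5) A_def using CL by (simp add: field_simps)
  \<comment> \<open>The identity \<open>C^2 - \<mu>^2 s^2 = 1\<close> collapses the two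
    contributions, so that the trace is the integral against the hyperbolic sine divided by
    \<open>C L\<close>.\<close>
  have rL: "r L = Is / C L"
  proof -
    have "r L * C L = Is * (C L * C L - \<mu>\<^sup>2 * (s L * s L))"
      unfolding r(4) A_def using CL by (simp add: field_simps)
    then show ?thesis using fs(3)[of L] CL by (simp add: field_simps)
  qed
  note W = hwd_tail_prim[OF sine_L2[of n]] and T = hwd_tail[OF sine_L2[of n]]
  define q where "q x = 1 / \<mu> * (tail_prim (sine n) x - r x)" for x
  define q' where "q' x = 1 / \<mu> * (tail (sine n) x - r' x)" for x
  have q: "has_weak_deriv L q q'" unfolding q_def[abs_def] q'_def[abs_def] by (intro hwd_cmult hwd_diff W(1) r(1))
  have "has_weak_deriv L q' (\<lambda>x. 1 / \<mu> * (- ?F x - (\<mu>\<^sup>2 * r x - ?F x)))"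
    unfolding q'_def[abs_def] by (intro hwd_cmult hwd_diff T(1) r(2))
  moreover have "1 / \<mu> * (- ?F x - (\<mu>\<^sup>2 * r x - ?F x)) = - \<mu> * r x" for x
    using \<mu> by (simp add: field_simps power2_eq_square)
  ultimately have q': "has_weak_deriv L q' (\<lambda>x. - \<mu> * r x)" by simp
  have q0: "q 0 = 0" and q'L: "q' L = 0" by (simp_all add: q_def q'_def W(2) r(3) T(2) r'L)
  have dom: "(sine n, q, r) \<in> dom_A L"
    by (rule dom_A_I[OF hwd_sine(1) hwd_cmult[OF hwd_sine(2)] q q' r(1)]) (auto simp: q0 q'L r(3))
  have e: "Hnorm L (A_star (sine n, q, r) - smul (cnj (lam (Inl n))) (sine n, q, r)) = 0"
    unfolding A_star_def prod.case smul_Pair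
  proof (rule Hnorm_zero_I[OF _ hwd_diff[OF W(1) r(1)] _ _ _ hwd_cmult[OF q]])
    show "AE x in mI L. weak_deriv2 L (sine n) x + of_real c * sine n x = cnj (lam (Inl n)) * sine n x"
      using sine_second by eventually_elim (simp add: lam_def)
    have "AE x in mI L. weak_deriv2 L q x = - \<mu> * r x" by (rule weak_deriv2_AE[OF L q q'])
    then show "AE x in mI L. - weak_deriv2 L q x = cnj (lam (Inl n)) * r x"
      by eventually_elim (simp add: lam_def \<mu>_def)
    show "tail_prim (sine n) x - r x = cnj (lam (Inl n)) * q x" for x using \<mu> by (simp add: q_def lam_def \<mu>_def)
  qed (auto simp: W(2) r(3) intro!: L2_add L2_cmult L2_uminus sine_L2 weak_deriv2_L2[OF hwd_sine(1) hwd_cmult[OF hwd_sine(2)]] weak_deriv2_L2[OF q q'] hwd_in_L2[OF r(1)])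
  have "Is = of_real (sqrt (2 / L) * (LINT y|mI L. \<beta> y * sin (real n * pi / L * y) * (sinh (lam1 L c n * y) / lam1 L c n)))"
    unfolding Is_def sr by (rule integral_beta_sine)
  also have "(LINT y|mI L. \<beta> y * sin (real n * pi / L * y) * (sinh (lam1 L c n * y) / lam1 L c n))
     = (LINT y|mI L. (\<beta> y * sin (real n * pi / L * y) * sinh (lam1 L c n * y)) / lam1 L c n)" by simp
  also have "\<dots> = gam L c \<beta> n / lam1 L c n"
    unfolding gam_def using nz by (subst integral_divide_zero) simp
  finally have t: "r L = tr (Inl n)" unfolding rL Cr tr_def using nz by simp
  have "ip L (phi L c \<beta> (Inl n)) (sine n, q, r) = 1"
    using ip_phi1[OF q q0 hwd_in_L2[OF r(1)]] sine_norm[OF n] by (simp add: phi_def)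
  then show ?thesis using dom e t by (intro exI[of _ "(sine n, q, r)"]) (simp add: is_psi_def)
qed

definition psi :: "nat + int \<Rightarrow> state" where "psi j = (SOME \<psi>. is_psi j \<psi>)"

lemma psi: "j \<in> modes \<Longrightarrow> is_psi j (psi j)"
proof -
  assume "j \<in> modes"
  then have "\<exists>\<psi>. is_psi j \<psi>"
  proof (cases j)
    case (Inl n)
    then have "n \<ge> 1" using \<open>j \<in> modes\<close> by (auto simp: modes_def)
    then show ?thesis using Inl psi1_exists_0 psi1_exists_nz by (cases "lam1 L c n = 0") blast+
  next
    case (Inr m)
    have "is_psi (Inr m) (psi2 m)"
      using psi2_eigen ip_phi2_psi2 by (simp add: is_psi_def phi_def tr_def psi2_def)
    then show ?thesis using Inr by blast
  qed
  then show ?thesis unfolding psi_def by (rule someI_ex)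
qed

lemma psi_dom: "j \<in> modes \<Longrightarrow> psi j \<in> dom_A L" and psi_HH: "j \<in> modes \<Longrightarrow> psi j \<in> HH L"
  using psi by (auto simp: is_psi_def dom_A_HH)

text \<open>Parabolic eigenvalues are real and distinct; hyperbolic ones are distinct and have
  nonzero imaginary part \<open>om m\<close>.\<close>

lemma lam_inj: "i \<in> modes \<Longrightarrow> j \<in> modes \<Longrightarrow> lam i = lam j \<Longrightarrow> i = j"
proof (cases i; cases j)
  fix n k assume a: "i \<in> modes" "j \<in> modes" "lam i = lam j" "i = Inl n" "j = Inl k"
  then have "lam1 L c n = lam1 L c k" by (simp add: lam_def)
  then have "(real n)\<^sup>2 = (real k)\<^sup>2" using L by (simp add: lam1_def)
  then show "i = j" using a by simp
next
  fix n m assume "lam i = lam j" "i = Inl n" "j = Inr m"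
  then have "Im (lam2 L m) = 0" by (simp add: lam_def flip: \<open>lam i = lam j\<close>) (metis Im_complex_of_real)
  then show "i = j" using om_nz[of m] by (simp add: lam2_om)
next
  fix n m assume "lam i = lam j" "i = Inr m" "j = Inl n"
  then have "Im (lam2 L m) = 0" by (simp add: lam_def)
  then show "i = j" using om_nz[of m] by (simp add: lam2_om)
next
  fix m k assume a: "lam i = lam j" "i = Inr m" "j = Inr k"
  then have "om m = om k" by (simp add: lam_def lam2_om)
  then show "i = j" using a L by (simp add: om_def)
qed

lemma biorthogonal:
  assumes i: "i \<in> modes" and j: "j \<in> modes"
  shows "ip L (phi L c \<beta> i) (psi j) = (if i = j then 1 else 0)"
proof (cases "i = j")
  case True
  then show ?thesis using psi[OF j] by (simp add: is_psi_def)
next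
  case False
  let ?\<phi> = "phi L c \<beta> i" and ?\<psi> = "psi j"
  have "lam i * ip L ?\<phi> ?\<psi> = ip L (smul (lam i) ?\<phi>) ?\<psi>" by (simp add: H.ip_sm phi_HH psi_HH j)
  also have "\<dots> = ip L (op_A L c \<beta> ?\<phi>) ?\<psi>"
    by (rule H.ip_cong0[OF _ _ _ H.nrm_diff_commute[THEN trans, OF _ _ phi_eigen]])
      (auto intro: H.sm_closed phi_HH psi_HH[OF j] op_A_HH[OF phi_dom])
  also have "\<dots> = ip L ?\<phi> (A_star ?\<psi>)" by (rule adjoint_identity[OF phi_dom psi_dom[OF j]])
  also have "\<dots> = ip L ?\<phi> (smul (cnj (lam j)) ?\<psi>)"
    by (rule H.ip_cong0_right) (use psi[OF j] in \<open>auto simp: is_psi_def intro: A_star_HH H.sm_closed phi_HH dom_A_HH\<close>)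
  also have "\<dots> = lam j * ip L ?\<phi> ?\<psi>" by (simp add: H.ip_sm_right phi_HH psi_HH j)
  finally show ?thesis using lam_inj[OF i j] False by auto
qed

text \<open>The left side is the coefficient of mode j in \<open>lift1\<close> minus
  \<open>lam j\<close> times that in \<open>lift0\<close>; so \<open>cnj (tr j)\<close> is the j-th
  coefficient of the input operator.\<close>

lemma trace_psi: assumes "j \<in> modes"
  shows "ip L lift1 (psi j) - lam j * ip L lift0 (psi j) = cnj (tr j)"
proof -
  obtain p q r where P: "psi j = (p, q, r)" by (cases "psi j")
  have "cnj (tr j) = ip L lift1 (psi j) - ip L lift0 (A_star (psi j))"
    using trace_formula[of p q r] psi[OF assms] unfolding P by (auto simp: is_psi_def)
  also have "ip L lift0 (A_star (psi j)) = ip L lift0 (smul (cnj (lam j)) (psi j))"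
    by (rule H.ip_cong0_right) (use psi[OF assms] in \<open>auto simp: is_psi_def intro: A_star_HH H.sm_closed lift0_HH dom_A_HH\<close>)
  also have "\<dots> = lam j * ip L lift0 (psi j)" by (simp add: H.ip_sm_right lift0_HH psi_HH assms)
  finally show ?thesis by simp
qed

end

section \<open>Expansions in the eigenvectors\<close>

lemma (in semi_inner) nrm_sq_orthonormal:
  assumes "finite F" "\<And>i. i \<in> F \<Longrightarrow> u i \<in> H"
    and on: "\<And>i j. i \<in> F \<Longrightarrow> j \<in> F \<Longrightarrow> ip (u i) (u j) = (if i = j then 1 else 0)"
  shows "(nrm (\<Sum>i\<in>F. sm (a i) (u i)))\<^sup>2 = (\<Sum>i\<in>F. (cmod (a i))\<^sup>2)"
proof -
  let ?S = "\<Sum>i\<in>F. sm (a i) (u i)"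
  have S: "?S \<in> H" using assms by (intro sum_closed sm_closed)
  have "ip ?S ?S = (\<Sum>i\<in>F. ip (sm (a i) (u i)) ?S)" using assms S by (intro ip_sum sm_closed)
  also have "\<dots> = (\<Sum>i\<in>F. \<Sum>j\<in>F. a i * (cnj (a j) * (if i = j then 1 else 0)))"
  proof (rule sum.cong[OF refl])
    fix i assume i: "i \<in> F"
    have "ip (sm (a i) (u i)) ?S = (\<Sum>j\<in>F. ip (sm (a i) (u i)) (sm (a j) (u j)))"
      using assms i by (intro ip_sum_right sm_closed)
    also have "\<dots> = (\<Sum>j\<in>F. a i * (cnj (a j) * (if i = j then 1 else 0)))"
      using assms i by (intro sum.cong) (auto simp: ip_sm ip_sm_right sm_closed)
    finally show "ip (sm (a i) (u i)) ?S = \<dots>" .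
  qed
  also have "\<dots> = (\<Sum>i\<in>F. a i * cnj (a i))"
    using assms(1) by (simp add: sum.delta' if_distrib cong: if_cong)
  also have "\<dots> = of_real (\<Sum>i\<in>F. (cmod (a i))\<^sup>2)" by (simp only: complex_norm_square of_real_sum)
  finally show ?thesis using ip_self[OF S] by (simp only: of_real_eq_iff)
qed

lemma (in semi_inner) nrm_sq_diff_orthonormal:
  assumes F: "finite F" "\<And>i. i \<in> F \<Longrightarrow> u i \<in> H"
    and on: "\<And>i j. i \<in> F \<Longrightarrow> j \<in> F \<Longrightarrow> ip (u i) (u j) = (if i = j then 1 else 0)"
    and X: "X \<in> H"
  shows "(nrm (X - (\<Sum>i\<in>F. sm (ip X (u i)) (u i))))\<^sup>2 = (nrm X)\<^sup>2 - (\<Sum>i\<in>F. (cmod (ip X (u i)))\<^sup>2)"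
proof -
  let ?S = "\<Sum>i\<in>F. sm (ip X (u i)) (u i)"
  have S: "?S \<in> H" using F by (intro sum_closed sm_closed)
  have "ip X ?S = (\<Sum>i\<in>F. ip X (sm (ip X (u i)) (u i)))" using F X by (intro ip_sum_right sm_closed)
  also have "\<dots> = (\<Sum>i\<in>F. of_real ((cmod (ip X (u i)))\<^sup>2))"
  proof (rule sum.cong[OF refl])
    fix i assume "i \<in> F"
    then have "ip X (sm (ip X (u i)) (u i)) = ip X (u i) * cnj (ip X (u i))"
      using F X by (simp add: ip_sm_right)
    then show "ip X (sm (ip X (u i)) (u i)) = of_real ((cmod (ip X (u i)))\<^sup>2)" by (simp only: complex_norm_square)
  qed
  finally have "Re (ip X ?S) = (\<Sum>i\<in>F. (cmod (ip X (u i)))\<^sup>2)" by (simp only: Re_complex_of_real flip: of_real_sum)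
  then show ?thesis using nrm_sq_diff[OF X S] nrm_sq_orthonormal[OF F on, of "\<lambda>i. ip X (u i)"] by simp
qed

lemma summable_on_tail:
  fixes f :: "'b \<Rightarrow> real"
  assumes s: "f summable_on J" and pos: "\<And>j. j \<in> J \<Longrightarrow> 0 \<le> f j" and e: "e > 0"
  obtains F where "finite F" "F \<subseteq> J" "\<And>G. finite G \<Longrightarrow> G \<subseteq> J \<Longrightarrow> G \<inter> F = {} \<Longrightarrow> (\<Sum>j\<in>G. f j) < e"
proof -
  have "(sum f \<longlongrightarrow> infsum f J) (finite_subsets_at_top J)" using s has_sum_def has_sum_infsum by blast
  then have "\<forall>\<^sub>F F in finite_subsets_at_top J. dist (sum f F) (infsum f J) < e" using e by (rule tendstoD)
  then obtain F where F: "finite F" "F \<subseteq> J" "dist (sum f F) (infsum f J) < e"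
    unfolding eventually_finite_subsets_at_top by blast
  have "(\<Sum>j\<in>G. f j) < e" if G: "finite G" "G \<subseteq> J" "G \<inter> F = {}" for G
  proof -
    have "sum f (F \<union> G) \<le> infsum f J"
      by (rule finite_sum_le_infsum[OF s]) (use F G pos in auto)
    moreover have "sum f (F \<union> G) = sum f F + sum f G" using F G by (intro sum.union_disjoint) auto
    ultimately show ?thesis using F(3) by (simp add: dist_real_def)
  qed
  then show ?thesis using that F by blast
qed

text \<open>The upper Riesz bound turns small tails of the coefficients into small partial sums.
  Completeness is available for sequences only, so a sequence of finite index sets with tails below
  1/(n+1) represents the net of all finite sums.\<close>

lemma (in semi_hilbert) expansion_exists:
  assumes v: "\<And>j. j \<in> J \<Longrightarrow> v j \<in> H" and C: "C > 0"
    and bd: "\<And>F b. finite F \<Longrightarrow> F \<subseteq> J \<Longrightarrow> (nrm (\<Sum>j\<in>F. sm (b j) (v j)))\<^sup>2 \<le> C * (\<Sum>j\<in>F. (cmod (b j))\<^sup>2)"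
    and s: "(\<lambda>j. (cmod (a j))\<^sup>2) summable_on J"
  shows "\<exists>X\<in>H. ((\<lambda>F. nrm (X - (\<Sum>j\<in>F. sm (a j) (v j)))) \<longlongrightarrow> 0) (finite_subsets_at_top J)"
proof -
  let ?S = "\<lambda>F. \<Sum>j\<in>F. sm (a j) (v j)"
  have SH: "?S F \<in> H" if "F \<subseteq> J" for F using that v by (intro sum_closed sm_closed) auto
  have "\<exists>F. finite F \<and> F \<subseteq> J \<and> (\<forall>G. finite G \<longrightarrow> G \<subseteq> J \<longrightarrow> G \<inter> F = {} \<longrightarrow> nrm (?S G) < e)" if e: "e > 0" for e
  proof -
    have "e\<^sup>2 / C > 0" using e C by simp
    then obtain F where F: "finite F" "F \<subseteq> J" and t: "\<And>G. finite G \<Longrightarrow> G \<subseteq> J \<Longrightarrow> G \<inter> F = {} \<Longrightarrow> (\<Sum>j\<in>G. (cmod (a j))\<^sup>2) < e\<^sup>2 / C"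
      using summable_on_tail[OF s] by (metis zero_le_power2)
    have "nrm (?S G) < e" if G: "finite G" "G \<subseteq> J" "G \<inter> F = {}" for G
    proof -
      have "(nrm (?S G))\<^sup>2 \<le> C * (\<Sum>j\<in>G. (cmod (a j))\<^sup>2)" by (rule bd[OF G(1,2)])
      also have "\<dots> < C * (e\<^sup>2 / C)" using t[OF G] C by (intro mult_strict_left_mono)
      finally show ?thesis using e C by (intro power2_less_imp_less[of "nrm (?S G)" e]) auto
    qed
    then show ?thesis using F by blast
  qed
  then have "\<forall>n. \<exists>F. finite F \<and> F \<subseteq> J \<and> (\<forall>G. finite G \<longrightarrow> G \<subseteq> J \<longrightarrow> G \<inter> F = {} \<longrightarrow> nrm (?S G) < 1 / real (Suc n))"
    by simp
  then obtain F where F: "\<And>n. finite (F n)" "\<And>n. F n \<subseteq> J"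
    and t: "\<And>n G. finite G \<Longrightarrow> G \<subseteq> J \<Longrightarrow> G \<inter> F n = {} \<Longrightarrow> nrm (?S G) < 1 / real (Suc n)" by metis
  have split: "nrm (?S A - ?S B) \<le> nrm (?S (A - B)) + nrm (?S (B - A))" if A: "finite A" "A \<subseteq> J" and B: "finite B" "B \<subseteq> J" for A B
  proof -
    have "?S A = ?S (A - B) + ?S (A \<inter> B)" "?S B = ?S (B - A) + ?S (A \<inter> B)"
      using sum.Int_Diff[OF A(1), of _ B] sum.Int_Diff[OF B(1), of _ A] by (simp_all add: add.commute Int_commute)
    then have "?S A - ?S B = ?S (A - B) - ?S (B - A)" by simp
    moreover have "A - B \<subseteq> J" "B - A \<subseteq> J" using A B by auto
    ultimately show ?thesis using nrm_triangle_diff[OF SH[of "A - B"] SH[of "B - A"]] by simp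
  qed
  have "\<exists>l\<in>H. (\<lambda>n. nrm (?S (F n) - l)) \<longlonglongrightarrow> 0"
  proof (rule complete[OF SH[OF F(2)]])
    fix e :: real assume e: "e > 0"
    obtain N where N: "2 / e < real N" using reals_Archimedean2 by blast
    have "nrm (?S (F m) - ?S (F n)) < e" if mn: "m \<ge> N" "n \<ge> N" for m n
    proof -
      have "2 / e < real (Suc N)" using N by simp
      then have "1 / real (Suc N) < e / 2" using e by (simp add: field_simps)
      moreover have "1 / real (Suc m) \<le> 1 / real (Suc N)" "1 / real (Suc n) \<le> 1 / real (Suc N)"
        using mn by (auto simp: frac_le)
      ultimately have small: "1 / real (Suc m) < e / 2" "1 / real (Suc n) < e / 2" by linarith+
      have "nrm (?S (F m) - ?S (F n)) \<le> nrm (?S (F m - F n)) + nrm (?S (F n - F m))"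
        by (rule split[OF F F])
      moreover have "nrm (?S (F m - F n)) < 1 / real (Suc n)" using F by (intro t) auto
      moreover have "nrm (?S (F n - F m)) < 1 / real (Suc m)" using F by (intro t) auto
      ultimately show ?thesis using small by linarith
    qed
    then show "\<exists>N. \<forall>m\<ge>N. \<forall>n\<ge>N. nrm (?S (F m) - ?S (F n)) < e" by blast
  qed
  then obtain X where X: "X \<in> H" and lim: "(\<lambda>n. nrm (?S (F n) - X)) \<longlonglongrightarrow> 0" by blast
  have "((\<lambda>G. nrm (X - ?S G)) \<longlongrightarrow> 0) (finite_subsets_at_top J)"
  proof (rule tendstoI)
    fix e :: real assume e: "e > 0"
    have "\<forall>\<^sub>F n in sequentially. nrm (?S (F n) - X) < e / 2" using lim e by (intro order_tendstoD) auto
    moreover have "\<forall>\<^sub>F n in sequentially. 1 / real (Suc n) < e / 2"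
      using LIMSEQ_Suc[OF lim_1_over_n] e by (intro order_tendstoD) auto
    ultimately have "\<forall>\<^sub>F n in sequentially. nrm (?S (F n) - X) < e / 2 \<and> 1 / real (Suc n) < e / 2"
      by (rule eventually_conj)
    then obtain n where n: "nrm (?S (F n) - X) < e / 2" "1 / real (Suc n) < e / 2"
      by (auto simp: eventually_sequentially)
    show "\<forall>\<^sub>F G in finite_subsets_at_top J. dist (nrm (X - ?S G)) 0 < e"
      unfolding eventually_finite_subsets_at_top
    proof (intro exI[of _ "F n"] conjI allI impI F)
      fix G assume G: "finite G \<and> F n \<subseteq> G \<and> G \<subseteq> J"
      have "F n - G = {}" using G by auto
      then have "nrm (?S (F n) - ?S G) \<le> nrm (?S (G - F n))" using split[OF F(1,2), of G n] G unfolding \<open>F n - G = {}\<close> by (simp add: nrm_zero)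
      also have "\<dots> < 1 / real (Suc n)" using G by (intro t) auto
      finally have "nrm (?S (F n) - ?S G) < e / 2" using n by simp
      moreover have "nrm (X - ?S G) \<le> nrm (X - ?S (F n)) + nrm (?S (F n) - ?S G)"
        by (rule nrm_triangle3[OF X SH[OF F(2)] SH]) (use G in auto)
      moreover have "nrm (X - ?S (F n)) = nrm (?S (F n) - X)" by (rule nrm_diff_commute[OF X SH[OF F(2)]])
      ultimately show "dist (nrm (X - ?S G)) 0 < e" using n nrm_nonneg[OF diff_closed[OF X SH]] G by (simp add: dist_real_def)
    qed
  qed
  then show ?thesis using X by blast
qed

section \<open>Upper Riesz bound for the eigenvectors\<close>

context wave_heat begin

lemma Inr_modes [simp]: "Inr m \<in> modes" and Inl_modes [simp]: "Inl n \<in> modes \<longleftrightarrow> n \<ge> 1"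
  by (auto simp: modes_def)

lemma sine_orthogonal:
  assumes "n \<noteq> k" shows "l2ip L (sine n) (sine k) = 0"
proof -
  define a where "a = complex_of_real (real n * pi / L)"
  define b where "b = complex_of_real (real k * pi / L)"
  have ab: "cnj a = a" "cnj b = b" by (auto simp: a_def b_def)
  have 1: "l2ip L (\<lambda>x. - a * sine n x) (sine k) = - l2ip L (cosine n) (\<lambda>x. b * cosine k x)"
    using l2ip_ibp[OF L0 hwd_sine(2)[of n] hwd_sine(1)[of k]] by (simp only: a_def b_def sine_0 sine_L) simp
  have 2: "l2ip L (\<lambda>x. a * cosine n x) (cosine k) = - l2ip L (sine n) (\<lambda>x. - b * sine k x)"
    using l2ip_ibp[OF L0 hwd_sine(1)[of n] hwd_sine(2)[of k]] by (simp only: a_def b_def sine_0 sine_L) simp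
  have "a * l2ip L (sine n) (sine k) = b * l2ip L (cosine n) (cosine k)"
    using 1 by (simp only: l2ip_cmult l2ip_cmult_right) (simp add: ab)
  moreover have "a * l2ip L (cosine n) (cosine k) = b * l2ip L (sine n) (sine k)"
    using 2 by (simp only: l2ip_cmult l2ip_cmult_right) (simp add: ab)
  ultimately have "(a * a - b * b) * l2ip L (sine n) (sine k) = 0" by (simp add: algebra_simps)
  moreover have "a * a \<noteq> b * b"
  proof
    assume "a * a = b * b"
    then have "(real n * pi / L) * (real n * pi / L) = (real k * pi / L) * (real k * pi / L)"
      unfolding a_def b_def by (simp only: of_real_mult[symmetric] of_real_eq_iff)
    then have "(real n)\<^sup>2 = (real k)\<^sup>2" using L by (simp add: power2_eq_square)
    then show False using assms by simp
  qed
  ultimately show ?thesis by simp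
qed

lemma psi2_HH: "psi2 m \<in> HH L" by (rule dom_A_HH[OF psi2_eigen(1)])

lemma ip_phi_psi2:
  assumes "i \<in> modes" "i \<noteq> Inr m" shows "ip L (phi L c \<beta> i) (psi2 m) = 0"
proof -
  let ?\<phi> = "phi L c \<beta> i" and ?\<psi> = "psi2 m"
  have "lam i * ip L ?\<phi> ?\<psi> = ip L (smul (lam i) ?\<phi>) ?\<psi>" by (simp add: H.ip_sm phi_HH psi2_HH)
  also have "\<dots> = ip L (op_A L c \<beta> ?\<phi>) ?\<psi>"
    by (rule H.ip_cong0[OF _ _ _ H.nrm_diff_commute[THEN trans, OF _ _ phi_eigen]])
      (auto intro: H.sm_closed phi_HH psi2_HH op_A_HH[OF phi_dom])
  also have "\<dots> = ip L ?\<phi> (A_star ?\<psi>)" by (rule adjoint_identity[OF phi_dom psi2_eigen(1)])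
  also have "\<dots> = ip L ?\<phi> (smul (cnj (lam (Inr m))) ?\<psi>)"
    by (rule H.ip_cong0_right) (use psi2_eigen[of m] in \<open>auto intro: A_star_HH H.sm_closed phi_HH psi2_HH\<close>)
  also have "\<dots> = lam (Inr m) * ip L ?\<phi> ?\<psi>" by (simp add: H.ip_sm_right phi_HH psi2_HH)
  finally show ?thesis using lam_inj[of i "Inr m"] assms by (auto simp: modes_def)
qed

text \<open>The heat component of \<open>phi2\<close> is invisible to \<open>psi2 k\<close>, which
  has none. Biorthogonality of the eigenvectors to \<open>psi2\<close> is thereby orthonormality of
  \<open>psi2\<close>.\<close>

lemma ip_phi2_psi2_eq: "ip L (phi2 L c \<beta> m) (psi2 k) = ip L (psi2 m) (psi2 k)"
proof -
  obtain f1 where f: "has_weak_deriv L (phi2_1 L c \<beta> m) f1" by (rule phi2_1_facts)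
  have "ip L (phi2 L c \<beta> m) (psi2 k) = l2ip L (phi2_1 L c \<beta> m) (\<lambda>x. 0) + l2ip L (wave1 m) (wave1 k)
     + l2ip L (\<lambda>x. lam2 L m * phi2_2 L m x) (\<lambda>x. lam2 L k * phi2_2 L k x)"
    unfolding phi2_def psi2_def
    by (rule ip_hwd[OF _ _ _ _ hwd_phi2_2(1) _ hwd_phi2_2(1)]) (auto intro!: L2_cmult phi2_2_L2 hwd_in_L2[OF f])
  moreover have "ip L (psi2 m) (psi2 k) = l2ip L (\<lambda>x. 0) (\<lambda>x. 0) + l2ip L (wave1 m) (wave1 k)
     + l2ip L (\<lambda>x. lam2 L m * phi2_2 L m x) (\<lambda>x. lam2 L k * phi2_2 L k x)"
    unfolding psi2_def
    by (rule ip_hwd[OF _ _ _ _ hwd_phi2_2(1) _ hwd_phi2_2(1)]) (auto intro!: L2_cmult phi2_2_L2)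
  ultimately show ?thesis by (simp add: l2ip_zero_right)
qed

text \<open>The eigenvectors of the decoupled system with zero \<open>\<beta>\<close>. They are
  orthonormal, and the true eigenvectors differ from them by the square-summable perturbation
  \<open>coupling\<close>.\<close>

definition ortho :: "nat + int \<Rightarrow> state" where "ortho = case_sum (phi1 L) psi2"

lemma ortho_HH: "ortho j \<in> HH L"
  by (cases j) (auto simp: ortho_def psi2_HH intro: dom_A_HH[OF phi1_dom])

lemma ortho_orthonormal:
  assumes "i \<in> modes" "j \<in> modes"
  shows "ip L (ortho i) (ortho j) = (if i = j then 1 else 0)"
proof -
  have mixed: "ip L (phi1 L n) (psi2 m) = 0" for n m
    unfolding phi1_sine psi2_def
    by (subst ip_hwd[OF _ _ _ _ hwd_const _ hwd_phi2_2(1)]) (auto simp: l2ip_zero_left l2ip_zero_right intro!: sine_L2 L2_cmult phi2_2_L2)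
  show ?thesis
  proof (cases i; cases j)
    fix n k assume "i = Inl n" "j = Inl k"
    moreover have "ip L (phi1 L n) (phi1 L k) = l2ip L (sine n) (sine k)"
      unfolding phi1_sine[of k] by (rule ip_phi1[OF hwd_const]) auto
    ultimately show ?thesis using sine_orthogonal sine_norm assms by (auto simp: ortho_def modes_def)
  next
    fix n m assume "i = Inl n" "j = Inr m"
    then show ?thesis by (simp add: ortho_def mixed)
  next
    fix n m assume "i = Inr m" "j = Inl n"
    then show ?thesis using H.ip_cnj[of "phi1 L n" "psi2 m"] mixed[of n m] ortho_HH[of i] ortho_HH[of j] by (simp add: ortho_def)
  next
    fix m k assume "i = Inr m" "j = Inr k"
    then show ?thesis
      using ip_phi2_psi2[of m] ip_phi_psi2[of "Inr m" k] by (auto simp: ortho_def ip_phi2_psi2_eq phi_def)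
  qed
qed

definition coupling :: "nat + int \<Rightarrow> state" where
  "coupling = case_sum (\<lambda>n. 0) (\<lambda>m. (phi2_1 L c \<beta> m, \<lambda>x. 0, \<lambda>x. 0))"

lemma phi_ortho: "phi L c \<beta> j = ortho j + coupling j"
  by (cases j) (auto simp: phi_def ortho_def coupling_def phi2_def psi2_def plus_fun_eq)

lemma coupling_HH: "coupling j \<in> HH L"
proof (cases j)
  case (Inr m)
  obtain f1 where f: "has_weak_deriv L (phi2_1 L c \<beta> m) f1" by (rule phi2_1_facts)
  then show ?thesis using Inr by (auto simp: coupling_def intro!: HH_I[OF _ hwd_const] hwd_in_L2[OF f])
qed (simp add: coupling_def H.zero_closed)

text \<open>The imaginary part of the energy identity bounds the parabolic component by \<open>O(1/m\<^sup>2)\<close>.\<close>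

lemma coupling_bound: obtains M where "M > 0" "\<And>m. Hnorm L (coupling (Inr m)) \<le> M / (om m)\<^sup>2"
proof -
  obtain M where M: "M > 0" "AE x in mI L. \<bar>\<beta> x\<bar> \<le> M" by (rule beta_bounded)
  have "Hnorm L (coupling (Inr m)) \<le> M / (om m)\<^sup>2" for m
  proof -
    let ?f = "phi2_1 L c \<beta> m" and ?F = "\<lambda>x. of_real (\<beta> x) * phi2_2 L m x"
    obtain f1 where f: "has_weak_deriv L ?f f1" "has_weak_deriv L f1 (\<lambda>x. (lam2 L m - of_real c) * ?f x - ?F x)"
      "?f 0 = 0" "?f L = 0" by (rule phi2_1_facts)
    have fL: "?f \<in> L2 L" by (rule hwd_in_L2[OF f(1)])
    have f1L: "f1 \<in> L2 L" by (rule hwd_in_L2[OF f(2)])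
    have FL: "?F \<in> L2 L" by (rule beta_L2[OF phi2_2_L2])
    let ?N = "LINT x|mI L. (cmod (?f x))\<^sup>2"
    have "l2ip L (\<lambda>x. (lam2 L m - of_real c) * ?f x - ?F x) ?f = - l2ip L f1 f1"
      using l2ip_ibp[OF L0 f(2) f(1)] f by simp
    then have "(lam2 L m - of_real c) * l2ip L ?f ?f - l2ip L ?F ?f = - l2ip L f1 f1"
      using fL FL by (simp only: l2ip_diff L2_cmult l2ip_cmult)
    then have "Im ((lam2 L m - of_real c) * of_real ?N - l2ip L ?F ?f) = Im (- of_real (LINT x|mI L. (cmod (f1 x))\<^sup>2))"
      by (simp only: l2ip_self[OF fL] l2ip_self[OF f1L])
    then have eq: "om m * ?N = Im (l2ip L ?F ?f)" by (simp add: lam2_om)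
    have hf: "(?f, \<lambda>x. 0, \<lambda>x. 0) \<in> HH L" and hF: "(?F, \<lambda>x. 0, \<lambda>x. 0) \<in> HH L"
      using fL FL by (auto intro!: HH_I[OF _ hwd_const])
    have nf: "(Hnorm L (?f, \<lambda>x. 0, \<lambda>x. 0))\<^sup>2 = ?N" using Hnorm_sq[OF fL hwd_const[of L 0] _ L2_const[of 0]] by simp
    have nF: "(Hnorm L (?F, \<lambda>x. 0, \<lambda>x. 0))\<^sup>2 \<le> (M / \<bar>om m\<bar>)\<^sup>2"
    proof -
      have "(Hnorm L (?F, \<lambda>x. 0, \<lambda>x. 0))\<^sup>2 = (LINT x|mI L. (cmod (?F x))\<^sup>2)" using Hnorm_sq[OF FL hwd_const[of L 0] _ L2_const[of 0]] by simp
      also have "\<dots> \<le> (LINT x|mI L. M\<^sup>2 * (Kc m)\<^sup>2)"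
      proof (rule integral_mono_AE)
        show "integrable (mI L) (\<lambda>x. (cmod (?F x))\<^sup>2)" by (rule L2_sq_integrable[OF FL])
        show "integrable (mI L) (\<lambda>x. M\<^sup>2 * (Kc m)\<^sup>2)" by (rule finite_measure.integrable_const[OF finite_mI])
        show "AE x in mI L. (cmod (?F x))\<^sup>2 \<le> M\<^sup>2 * (Kc m)\<^sup>2"
          using M(2)
        proof eventually_elim
          case (elim x)
          have "\<bar>sin (om m * x)\<bar> \<le> 1" by simp
          then have "cmod (phi2_2 L m x) \<le> \<bar>Kc m\<bar>"
            unfolding phi2_2_eq norm_mult norm_of_real by (simp add: abs_mult mult_left_le)
          then have "cmod (?F x) \<le> M * \<bar>Kc m\<bar>" unfolding norm_mult norm_of_real using elim M(1) by (intro mult_mono) auto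
          then have "(cmod (?F x))\<^sup>2 \<le> (M * \<bar>Kc m\<bar>)\<^sup>2" by (intro power_mono) auto
          then show ?case by (simp add: power_mult_distrib)
        qed
      qed
      also have "\<dots> = M\<^sup>2 * (Kc m)\<^sup>2 * L" using L by (simp add: measure_restrict_space)
      also have "\<dots> = (M / \<bar>om m\<bar>)\<^sup>2" using L om_nz[of m] by (simp add: Kc_def power_divide power_mult_distrib)
      finally show ?thesis .
    qed
    have "ip L (?F, \<lambda>x. 0, \<lambda>x. 0) (?f, \<lambda>x. 0, \<lambda>x. 0) = l2ip L ?F ?f"
      by (subst ip_hwd[OF _ _ _ _ hwd_const _ hwd_const]) (use fL FL in \<open>auto simp: l2ip_zero_left\<close>)
    then have "cmod (l2ip L ?F ?f) \<le> Hnorm L (?F, \<lambda>x. 0, \<lambda>x. 0) * Hnorm L (?f, \<lambda>x. 0, \<lambda>x. 0)"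
      using H.cauchy_schwarz[OF hF hf] by simp
    then have "\<bar>om m\<bar> * (Hnorm L (?f, \<lambda>x. 0, \<lambda>x. 0))\<^sup>2 \<le> Hnorm L (?F, \<lambda>x. 0, \<lambda>x. 0) * Hnorm L (?f, \<lambda>x. 0, \<lambda>x. 0)"
      using abs_Im_le_cmod[of "l2ip L ?F ?f"] unfolding nf eq[symmetric] abs_mult by simp
    moreover have "Hnorm L (?F, \<lambda>x. 0, \<lambda>x. 0) \<le> M / \<bar>om m\<bar>"
      using power2_le_imp_le[OF nF] M(1) by simp
    moreover have fpos: "0 \<le> Hnorm L (?f, \<lambda>x. 0, \<lambda>x. 0)" by (rule H.nrm_nonneg[OF hf])
    ultimately have le: "\<bar>om m\<bar> * (Hnorm L (?f, \<lambda>x. 0, \<lambda>x. 0))\<^sup>2 \<le> M / \<bar>om m\<bar> * Hnorm L (?f, \<lambda>x. 0, \<lambda>x. 0)"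
      by (meson mult_right_mono order_trans)
    have o: "\<bar>om m\<bar> > 0" using om_nz by simp
    have "Hnorm L (?f, \<lambda>x. 0, \<lambda>x. 0) \<le> M / (\<bar>om m\<bar> * \<bar>om m\<bar>)"
    proof (cases "Hnorm L (?f, \<lambda>x. 0, \<lambda>x. 0) = 0")
      case True
      then show ?thesis using M(1) by simp
    next
      case False
      then have "Hnorm L (?f, \<lambda>x. 0, \<lambda>x. 0) > 0" using fpos by simp
      then have "\<bar>om m\<bar> * Hnorm L (?f, \<lambda>x. 0, \<lambda>x. 0) \<le> M / \<bar>om m\<bar>"
        using mult_right_le_imp_le[of "\<bar>om m\<bar> * Hnorm L (?f, \<lambda>x. 0, \<lambda>x. 0)" "Hnorm L (?f, \<lambda>x. 0, \<lambda>x. 0)" "M / \<bar>om m\<bar>"] le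
        by (simp only: power2_eq_square mult.assoc)
      then have "Hnorm L (?f, \<lambda>x. 0, \<lambda>x. 0) * \<bar>om m\<bar> * \<bar>om m\<bar> \<le> M"
        using o by (simp only: pos_le_divide_eq mult.commute mult.left_commute)
      then show ?thesis by (simp only: pos_le_divide_eq[OF mult_pos_pos[OF o o]] mult.assoc)
    qed
    then show ?thesis by (simp add: coupling_def power2_eq_square)
  qed
  then show ?thesis using that M(1) by blast
qed

lemma summable_om: "(\<lambda>m. 1 / (om m)\<^sup>2) summable_on (UNIV :: int set)"
proof -
  have s: "summable (\<lambda>n. 1 / (om (int n))\<^sup>2)"
  proof (rule summable_comparison_test')
    show "summable (\<lambda>n. (2 * L / pi)\<^sup>2 * (1 / (real n + 1)\<^sup>2))"
      using inverse_squares_sums by (intro summable_mult) (auto simp: sums_iff add.commute)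
    fix n :: nat
    have "(real n + 1) * pi / (2 * L) \<le> om (int n)" using L by (simp add: om_def divide_right_mono)
    then have "((real n + 1) * pi / (2 * L))\<^sup>2 \<le> (om (int n))\<^sup>2" using L by (intro power_mono) auto
    then have "1 / (om (int n))\<^sup>2 \<le> 1 / ((real n + 1) * pi / (2 * L))\<^sup>2" using L by (intro divide_left_mono) (auto simp: om_nz)
    also have "\<dots> = (2 * L / pi)\<^sup>2 * (1 / (real n + 1)\<^sup>2)" using L by (simp add: power_divide power_mult_distrib)
    finally show "norm (1 / (om (int n))\<^sup>2) \<le> (2 * L / pi)\<^sup>2 * (1 / (real n + 1)\<^sup>2)" by simp
  qed
  then have s1: "(\<lambda>n. 1 / (om (int n))\<^sup>2) summable_on UNIV" by (intro summable_nonneg_imp_summable_on) auto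
  \<comment> \<open>The reflection \<open>m \<mapsto> - m - 1\<close> changes the sign of the
    half-integer frequency, so the negative indices repeat the sum over the nonnegative
    ones.\<close>
  have neg: "om (- int n - 1) = - om (int n)" for n
  proof -
    have "2 * real_of_int (- int n - 1) + 1 = - (2 * real_of_int (int n) + 1)" by simp
    then show ?thesis unfolding om_def by (simp only: minus_mult_left minus_divide_left)
  qed
  have a: "(\<lambda>m. 1 / (om m)\<^sup>2) summable_on range int"
    by (subst summable_on_reindex) (use s1 in \<open>auto simp: o_def\<close>)
  have "inj (\<lambda>n. - int n - 1)" by (auto intro: injI)
  then have b: "(\<lambda>m. 1 / (om m)\<^sup>2) summable_on range (\<lambda>n. - int n - 1)"
    by (subst summable_on_reindex) (use s1 neg in \<open>auto simp: o_def\<close>)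
  have "x \<in> range int \<union> range (\<lambda>n. - int n - 1)" for x :: int
  proof (cases "x \<ge> 0")
    case True then show ?thesis by (metis UnI1 nonneg_int_cases rangeI)
  next
    case False
    then have "x = - int (nat (- x - 1)) - 1" by simp
    then show ?thesis by blast
  qed
  then have "(UNIV :: int set) = range int \<union> range (\<lambda>n. - int n - 1)" by auto
  then show ?thesis using summable_on_union[OF a b] by simp
qed

text \<open>The orthonormal part contributes exactly the square sum of the coefficients; the
  perturbation is handled by Cauchy-Schwarz, its squared norms being bounded by multiples of the
  summable \<open>1 / (om m)^4\<close>.\<close>

lemma riesz_upper:
  obtains C where "C > 0" "\<And>F b. finite F \<Longrightarrow> F \<subseteq> modes \<Longrightarrow>
    (Hnorm L (\<Sum>j\<in>F. smul (b j) (phi L c \<beta> j)))\<^sup>2 \<le> C * (\<Sum>j\<in>F. (cmod (b j))\<^sup>2)"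
proof -
  obtain M where M: "M > 0" "\<And>m. Hnorm L (coupling (Inr m)) \<le> M / (om m)\<^sup>2" by (rule coupling_bound) blast
  have oms: "(\<lambda>m. (1 / (om m)\<^sup>2)\<^sup>2) summable_on UNIV"
  proof -
    have "summable (\<lambda>n::nat. 0::real)" by simp
    define B where "B = (\<Sum>\<^sub>\<infinity>m. 1 / (om m)\<^sup>2)"
    have le: "1 / (om m)\<^sup>2 \<le> B" for m
      using finite_sum_le_infsum[OF summable_om, of "{m}"] by (simp add: B_def)
    show ?thesis
    proof (rule summable_on_comparison_test)
      show "(\<lambda>m. B * (1 / (om m)\<^sup>2)) summable_on UNIV" by (rule summable_on_cmult_right[OF summable_om])
      show "(1 / (om m)\<^sup>2)\<^sup>2 \<le> B * (1 / (om m)\<^sup>2)" for m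
        unfolding power2_eq_square[of "1 / (om m)\<^sup>2"] using le by (intro mult_right_mono) auto
    qed simp
  qed
  define D where "D = (\<Sum>\<^sub>\<infinity>m. (1 / (om m)\<^sup>2)\<^sup>2)"
  have D: "D \<ge> 0" unfolding D_def by (rule infsum_nonneg) simp
  have Ebd: "(\<Sum>j\<in>F. (Hnorm L (coupling j))\<^sup>2) \<le> M\<^sup>2 * D" if F: "finite F" for F
  proof -
    define G where "G = Inr -` F"
    have G: "finite G" unfolding G_def using F by (intro finite_vimageI) auto
    have "(\<Sum>j\<in>F. (Hnorm L (coupling j))\<^sup>2) = (\<Sum>j\<in>Inr ` G. (Hnorm L (coupling j))\<^sup>2)"
    proof (rule sum.mono_neutral_right[OF F])
      show "\<forall>j\<in>F - Inr ` G. (Hnorm L (coupling j))\<^sup>2 = 0"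
      proof
        fix j assume "j \<in> F - Inr ` G"
        then obtain n where "j = Inl n" by (cases j) (auto simp: G_def)
        then show "(Hnorm L (coupling j))\<^sup>2 = 0" by (simp add: coupling_def H.nrm_zero)
      qed
    qed (auto simp: G_def)
    also have "\<dots> = (\<Sum>m\<in>G. (Hnorm L (coupling (Inr m)))\<^sup>2)" by (simp add: sum.reindex)
    also have "\<dots> \<le> (\<Sum>m\<in>G. M\<^sup>2 * (1 / (om m)\<^sup>2)\<^sup>2)"
    proof (rule sum_mono)
      fix m
      have "(Hnorm L (coupling (Inr m)))\<^sup>2 \<le> (M / (om m)\<^sup>2)\<^sup>2" by (intro power_mono M(2) H.nrm_nonneg coupling_HH)
      then show "(Hnorm L (coupling (Inr m)))\<^sup>2 \<le> M\<^sup>2 * (1 / (om m)\<^sup>2)\<^sup>2" by (simp add: power_divide)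
    qed
    also have "\<dots> = M\<^sup>2 * (\<Sum>m\<in>G. (1 / (om m)\<^sup>2)\<^sup>2)" by (simp add: sum_distrib_left)
    also have "\<dots> \<le> M\<^sup>2 * D" unfolding D_def
      by (intro mult_left_mono finite_sum_le_infsum oms G) auto
    finally show ?thesis .
  qed
  define C where "C = (1 + M * sqrt D)\<^sup>2"
  have "(Hnorm L (\<Sum>j\<in>F. smul (b j) (phi L c \<beta> j)))\<^sup>2 \<le> C * (\<Sum>j\<in>F. (cmod (b j))\<^sup>2)"
    if F: "finite F" "F \<subseteq> modes" for F b
  proof -
    let ?Q = "\<Sum>j\<in>F. (cmod (b j))\<^sup>2"
    have Q: "?Q \<ge> 0" by (rule sum_nonneg) simp
    have eq: "(\<Sum>j\<in>F. smul (b j) (phi L c \<beta> j)) = (\<Sum>j\<in>F. smul (b j) (ortho j)) + (\<Sum>j\<in>F. smul (b j) (coupling j))"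
      by (simp add: phi_ortho H.sm_dist sum.distrib)
    have cl: "(\<Sum>j\<in>F. smul (b j) (ortho j)) \<in> HH L" "(\<Sum>j\<in>F. smul (b j) (coupling j)) \<in> HH L"
      by (auto intro!: H.sum_closed H.sm_closed ortho_HH coupling_HH)
    have "(Hnorm L (\<Sum>j\<in>F. smul (b j) (ortho j)))\<^sup>2 = ?Q"
      by (rule H.nrm_sq_orthonormal[OF F(1) ortho_HH ortho_orthonormal[OF subsetD[OF F(2)] subsetD[OF F(2)]]])
    from real_sqrt_unique[OF this H.nrm_nonneg[OF cl(1)]]
    have 1: "Hnorm L (\<Sum>j\<in>F. smul (b j) (ortho j)) = sqrt ?Q" by (rule sym)
    have "Hnorm L (\<Sum>j\<in>F. smul (b j) (coupling j)) \<le> (\<Sum>j\<in>F. Hnorm L (smul (b j) (coupling j)))"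
      by (intro H.nrm_sum H.sm_closed coupling_HH)
    also have "\<dots> = (\<Sum>j\<in>F. \<bar>cmod (b j)\<bar> * \<bar>Hnorm L (coupling j)\<bar>)"
      by (intro sum.cong refl) (simp add: H.nrm_sm coupling_HH H.nrm_nonneg)
    also have "\<dots> \<le> L2_set (\<lambda>j. cmod (b j)) F * L2_set (\<lambda>j. Hnorm L (coupling j)) F"
      by (rule L2_set_mult_ineq)
    also have "\<dots> \<le> sqrt ?Q * sqrt (M\<^sup>2 * D)"
      unfolding L2_set_def by (intro mult_mono real_sqrt_le_mono Ebd F) (auto intro: sum_nonneg)
    also have "sqrt (M\<^sup>2 * D) = M * sqrt D" using M by (simp add: real_sqrt_mult)
    finally have "Hnorm L (\<Sum>j\<in>F. smul (b j) (phi L c \<beta> j)) \<le> sqrt ?Q * (1 + M * sqrt D)"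
      using H.nrm_triangle[OF cl] unfolding eq 1 by (simp add: algebra_simps)
    then have "(Hnorm L (\<Sum>j\<in>F. smul (b j) (phi L c \<beta> j)))\<^sup>2 \<le> (sqrt ?Q * (1 + M * sqrt D))\<^sup>2"
      by (intro power_mono H.nrm_nonneg H.sum_closed H.sm_closed phi_HH)
    then show ?thesis using Q by (simp add: C_def power_mult_distrib mult.commute)
  qed
  moreover have "C > 0"
  proof -
    have "0 \<le> M * sqrt D" using M D by simp
    then show ?thesis unfolding C_def by (intro zero_less_power) linarith
  qed
  ultimately show ?thesis using that by blast
qed

lemma has_expansion_exists:
  assumes "(\<lambda>j. (cmod (a j))\<^sup>2) summable_on modes"
  shows "\<exists>X\<in>HH L. has_expansion L c \<beta> X a"
proof -
  obtain C where C: "C > 0" "\<And>F b. finite F \<Longrightarrow> F \<subseteq> modes \<Longrightarrow>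
    (Hnorm L (\<Sum>j\<in>F. smul (b j) (phi L c \<beta> j)))\<^sup>2 \<le> C * (\<Sum>j\<in>F. (cmod (b j))\<^sup>2)" using riesz_upper by blast
  show ?thesis unfolding has_expansion_def
    by (rule H.expansion_exists[OF phi_HH C assms])
qed

lemma expansion_sum_HH: "(\<Sum>j\<in>F. smul (a j) (phi L c \<beta> j)) \<in> HH L"
  by (intro H.sum_closed H.sm_closed phi_HH)

lemma has_expansion_ip:
  assumes X: "X \<in> HH L" and e: "has_expansion L c \<beta> X a" and Y: "Y \<in> HH L"
  shows "((\<lambda>F. \<Sum>j\<in>F. a j * ip L (phi L c \<beta> j) Y) \<longlongrightarrow> ip L X Y) (finite_subsets_at_top modes)"
proof -
  have lim: "((\<lambda>F. Hnorm L (X - (\<Sum>j\<in>F. smul (a j) (phi L c \<beta> j))) * Hnorm L Y) \<longlongrightarrow> 0 * Hnorm L Y) (finite_subsets_at_top modes)"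
    using e unfolding has_expansion_def by (intro tendsto_mult tendsto_const)
  have "((\<lambda>F. (\<Sum>j\<in>F. a j * ip L (phi L c \<beta> j) Y) - ip L X Y) \<longlongrightarrow> 0) (finite_subsets_at_top modes)"
  proof (rule Lim_null_comparison[OF always_eventually])
    show "\<forall>F. norm ((\<Sum>j\<in>F. a j * ip L (phi L c \<beta> j) Y) - ip L X Y) \<le> Hnorm L (X - (\<Sum>j\<in>F. smul (a j) (phi L c \<beta> j))) * Hnorm L Y"
    proof
      fix F
      have "(\<Sum>j\<in>F. a j * ip L (phi L c \<beta> j) Y) = ip L (\<Sum>j\<in>F. smul (a j) (phi L c \<beta> j)) Y"
        by (subst H.ip_sum) (auto intro!: H.sm_closed phi_HH Y simp: H.ip_sm[OF phi_HH Y])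
      then have "ip L X Y - (\<Sum>j\<in>F. a j * ip L (phi L c \<beta> j) Y) = ip L (X - (\<Sum>j\<in>F. smul (a j) (phi L c \<beta> j))) Y"
        by (simp add: H.ip_diff X Y expansion_sum_HH)
      then show "norm ((\<Sum>j\<in>F. a j * ip L (phi L c \<beta> j) Y) - ip L X Y) \<le> Hnorm L (X - (\<Sum>j\<in>F. smul (a j) (phi L c \<beta> j))) * Hnorm L Y"
        using H.cauchy_schwarz[OF H.diff_closed[OF X expansion_sum_HH[of a F]] Y] by (subst norm_minus_commute) simp
    qed
  qed (use lim in simp)
  then show ?thesis by (rule LIM_zero_cancel)
qed

text \<open>Uniqueness of expansions: tested against the dual vector of mode j, the finite sums are
  constant as soon as they contain j.\<close>

lemma has_expansion_coeff:
  assumes X: "X \<in> HH L" and e: "has_expansion L c \<beta> X a" and j: "j \<in> modes"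
  shows "a j = ip L X (psi j)"
proof -
  have "((\<lambda>F. \<Sum>i\<in>F. a i * ip L (phi L c \<beta> i) (psi j)) \<longlongrightarrow> ip L X (psi j)) (finite_subsets_at_top modes)"
    by (rule has_expansion_ip[OF X e psi_HH[OF j]])
  moreover have "((\<lambda>F. \<Sum>i\<in>F. a i * ip L (phi L c \<beta> i) (psi j)) \<longlongrightarrow> a j) (finite_subsets_at_top modes)"
  proof (rule tendsto_eventually)
    show "\<forall>\<^sub>F F in finite_subsets_at_top modes. (\<Sum>i\<in>F. a i * ip L (phi L c \<beta> i) (psi j)) = a j"
      unfolding eventually_finite_subsets_at_top
    proof (intro exI[of _ "{j}"] conjI allI impI)
      fix F assume F: "finite F \<and> {j} \<subseteq> F \<and> F \<subseteq> modes"
      then have "(\<Sum>i\<in>F. a i * ip L (phi L c \<beta> i) (psi j)) = (\<Sum>i\<in>F. if i = j then a j else 0)"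
        using j by (intro sum.cong refl) (auto simp: biorthogonal)
      then show "(\<Sum>i\<in>F. a i * ip L (phi L c \<beta> i) (psi j)) = a j" using F by simp
    qed (use j in auto)
  qed
  ultimately show ?thesis using tendsto_unique[OF finite_subsets_at_top_neq_bot] by blast
qed

lemma has_expansion_diff:
  assumes X: "X \<in> HH L" "has_expansion L c \<beta> X a" and Y: "Y \<in> HH L" "has_expansion L c \<beta> Y b"
  shows "has_expansion L c \<beta> (X - Y) (\<lambda>j. a j - b j)"
  unfolding has_expansion_def
proof (rule Lim_null_comparison[OF always_eventually])
  let ?S = "\<lambda>a F. \<Sum>j\<in>F. smul (a j) (phi L c \<beta> j)"
  show "((\<lambda>F. Hnorm L (X - ?S a F) + Hnorm L (Y - ?S b F)) \<longlongrightarrow> 0) (finite_subsets_at_top modes)"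
    using tendsto_add[OF X(2)[unfolded has_expansion_def] Y(2)[unfolded has_expansion_def]] by simp
  show "\<forall>F. norm (Hnorm L (X - Y - ?S (\<lambda>j. a j - b j) F)) \<le> Hnorm L (X - ?S a F) + Hnorm L (Y - ?S b F)"
  proof
    fix F
    have d: "smul (a j - b j) v = smul (a j) v - smul (b j) v" for j v
      using H.sm_add[of "a j - b j" "b j" v] by simp
    have "X - Y - ?S (\<lambda>j. a j - b j) F = (X - ?S a F) - (Y - ?S b F)"
      by (simp add: d sum_subtractf)
    then show "norm (Hnorm L (X - Y - ?S (\<lambda>j. a j - b j) F)) \<le> Hnorm L (X - ?S a F) + Hnorm L (Y - ?S b F)"
      using H.nrm_triangle_diff[OF H.diff_closed[OF X(1) expansion_sum_HH[of a F]] H.diff_closed[OF Y(1) expansion_sum_HH[of b F]]]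
        H.nrm_nonneg[OF H.diff_closed[OF H.diff_closed[OF X(1) expansion_sum_HH[of a F]] H.diff_closed[OF Y(1) expansion_sum_HH[of b F]]]]
      unfolding \<open>X - Y - ?S (\<lambda>j. a j - b j) F = _\<close> by simp
  qed
qed

lemma has_expansion_cong:
  assumes X: "X \<in> HH L" "has_expansion L c \<beta> X a" and Y: "Y \<in> HH L" "Hnorm L (Y - X) = 0"
    and ab: "\<And>j. j \<in> modes \<Longrightarrow> a j = b j"
  shows "has_expansion L c \<beta> Y b"
  unfolding has_expansion_def
proof (rule Lim_null_comparison)
  let ?S = "\<lambda>a F. \<Sum>j\<in>F. smul (a j) (phi L c \<beta> j)"
  show "((\<lambda>F. Hnorm L (X - ?S a F)) \<longlongrightarrow> 0) (finite_subsets_at_top modes)"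
    using X(2) by (simp add: has_expansion_def)
  have "norm (Hnorm L (Y - ?S b F)) \<le> Hnorm L (X - ?S a F)" if "F \<subseteq> modes" for F
  proof -
    have "?S b F = ?S a F" using that ab by (intro sum.cong) auto
    then show ?thesis
      using H.nrm_triangle3[OF Y(1) X(1) expansion_sum_HH[of a F]] Y(2) H.nrm_nonneg[OF H.diff_closed[OF Y(1) expansion_sum_HH[of a F]]] by simp
  qed
  then show "\<forall>\<^sub>F F in finite_subsets_at_top modes. norm (Hnorm L (Y - ?S b F)) \<le> Hnorm L (X - ?S a F)"
    unfolding eventually_finite_subsets_at_top by (intro exI[of _ "{}"]) auto
qed

section \<open>Completeness of the sine system\<close>

text \<open>Multiplication by the cosine of \<open>pi x / L\<close> maps sine n to the mean of its
  two neighbours, so vanishing against all sines is preserved. For n = 1 the lower neighbour is the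
  zero function.\<close>

lemma sine_moment_step:
  assumes F: "F \<in> L2 L" and z: "\<And>n. n \<ge> 1 \<Longrightarrow> l2ip L F (sine n) = 0"
  shows "n \<ge> 1 \<Longrightarrow> l2ip L (\<lambda>x. F x * of_real (cos (pi * x / L)) ^ k) (sine n) = 0"
proof (induction k arbitrary: n)
  case (Suc k)
  let ?G = "\<lambda>x. F x * of_real (cos (pi * x / L)) ^ k"
  have G: "?G \<in> L2 L"
    using L2_mult_continuous[OF F, of "\<lambda>x. of_real (cos (pi * x / L)) ^ k"] by (simp add: mult.commute continuous_intros L[THEN less_imp_neq, symmetric])
  have tri: "cos (pi * x / L) * sin (real n * pi * x / L) = (sin (real (n + 1) * pi * x / L) + sin (real (n - 1) * pi * x / L)) / 2" for x
  proof -
    have e: "real (n + 1) * pi * x / L = real n * pi * x / L + pi * x / L" "real (n - 1) * pi * x / L = real n * pi * x / L - pi * x / L"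
      using Suc.prems by (auto simp: of_nat_diff algebra_simps add_divide_distrib diff_divide_distrib)
    show ?thesis unfolding e sin_add sin_diff by simp
  qed
  have "l2ip L (\<lambda>x. F x * of_real (cos (pi * x / L)) ^ Suc k) (sine n) = l2ip L ?G (\<lambda>x. 1/2 * (sine (n + 1) x + sine (n - 1) x))"
    unfolding l2ip_def
  proof (rule Bochner_Integration.integral_cong[OF refl])
    fix x
    have "complex_of_real (cos (pi * x / L)) * sine n x = 1/2 * (sine (n + 1) x + sine (n - 1) x)"
    proof -
      have "complex_of_real (cos (pi * x / L)) * sine n x = of_real (sqrt (2 / L) * (cos (pi * x / L) * sin (real n * pi * x / L)))"
        by (simp add: sine_def)
      also have "\<dots> = 1/2 * (sine (n + 1) x + sine (n - 1) x)" unfolding tri sine_def by (simp add: algebra_simps add_divide_distrib)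
      finally show ?thesis .
    qed
    moreover have r: "cnj (sine n x) = sine n x" for n x by (simp add: sine_def)
    have "cnj (1/2 * (sine (n + 1) x + sine (n - 1) x)) = 1/2 * (sine (n + 1) x + sine (n - 1) x)" by (simp add: r)
    moreover have "F x * of_real (cos (pi * x / L)) ^ Suc k * cnj (sine n x) = ?G x * (complex_of_real (cos (pi * x / L)) * sine n x)"
      by (simp add: r)
    ultimately show "F x * of_real (cos (pi * x / L)) ^ Suc k * cnj (sine n x) = ?G x * cnj (1/2 * (sine (n + 1) x + sine (n - 1) x))"
      by (simp only:)
  qed
  also have "\<dots> = cnj (1/2) * (l2ip L ?G (sine (n + 1)) + l2ip L ?G (sine (n - 1)))"
    using G by (simp only: l2ip_cmult_right l2ip_add_right sine_L2)
  also have "l2ip L ?G (sine (n + 1)) = 0" by (rule Suc.IH) simp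
  also have "l2ip L ?G (sine (n - 1)) = 0"
  proof (cases "n = 1")
    case True
    then show ?thesis by (simp add: l2ip_def sine_def)
  next
    case False
    then show ?thesis using Suc.prems by (intro Suc.IH) simp
  qed
  finally show ?case by simp
qed (use z in simp)

text \<open>All moments of \<open>G\<close> against powers of \<open>cos (pi x / L)\<close> vanish,
  hence by Weierstrass those against continuous functions of it. The cosine is strictly decreasing
  on the interval, so indicators of \<open>{0..x0}\<close> are limits of such functions and the
  primitive of \<open>G\<close> vanishes.\<close>

lemma sine_complete:
  assumes F: "F \<in> L2 L" and z: "\<And>n. n \<ge> 1 \<Longrightarrow> l2ip L F (sine n) = 0"
  shows "AE x in mI L. F x = 0"
proof -
  define G where "G x = F x * of_real (sin (pi * x / L))" for x
  have sc: "continuous_on {0..L} (\<lambda>x. complex_of_real (sin (pi * x / L)))" using L by (intro continuous_intros) auto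
  have GL: "G \<in> L2 L" unfolding G_def using L2_mult_continuous[OF F sc] by (simp add: mult.commute)
  have Gi: "integrable (mI L) G" by (rule L2_integrable[OF GL])
  have cm: "(\<lambda>x. cos (pi * x / L)) \<in> borel_measurable (mI L)" using L by (intro continuous_measurable_mI continuous_intros) auto
  have Gm[measurable]: "G \<in> borel_measurable (mI L)" by (rule L2_measurable[OF GL])
  have hm: "(\<lambda>x. complex_of_real (h (cos (pi * x / L)))) \<in> borel_measurable (mI L)" if "continuous_on UNIV h" for h :: "real \<Rightarrow> real"
    using measurable_compose[OF cm borel_measurable_continuous_onI[OF that]] by simp
  have mom: "(LINT x|mI L. G x * of_real (cos (pi * x / L)) ^ k) = 0" for k
  proof -
    have "l2ip L (\<lambda>x. F x * of_real (cos (pi * x / L)) ^ k) (sine 1) = 0" by (rule sine_moment_step[OF F z]) auto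
    moreover have "l2ip L (\<lambda>x. F x * of_real (cos (pi * x / L)) ^ k) (sine 1) = (LINT x|mI L. of_real (sqrt (2 / L)) * (G x * of_real (cos (pi * x / L)) ^ k))"
      unfolding l2ip_def by (rule Bochner_Integration.integral_cong) (auto simp: sine_def G_def algebra_simps)
    ultimately have "of_real (sqrt (2 / L)) * (LINT x|mI L. G x * of_real (cos (pi * x / L)) ^ k) = 0" by simp
    then show ?thesis using L by simp
  qed
  have Gk: "integrable (mI L) (\<lambda>x. G x * of_real (cos (pi * x / L)) ^ k)" for k
  proof -
    have "continuous_on {0..L} (\<lambda>x. complex_of_real (cos (pi * x / L)) ^ k)" using L by (intro continuous_intros) auto
    from L2_integrable[OF L2_mult_continuous[OF GL this]] show ?thesis by (simp add: mult.commute)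
  qed
  have bdd_int: "integrable (mI L) (\<lambda>x. G x * of_real (h (cos (pi * x / L))))"
    if "continuous_on UNIV h" "\<And>t. \<bar>h t\<bar> \<le> B" for h :: "real \<Rightarrow> real" and B
  proof (rule Bochner_Integration.integrable_bound[OF integrable_mult_right[OF Gi, of "of_real B"]])
    show "(\<lambda>x. G x * of_real (h (cos (pi * x / L)))) \<in> borel_measurable (mI L)" using hm[OF that(1)] by measurable
    have "cmod (G x) * \<bar>h t\<bar> \<le> \<bar>B\<bar> * cmod (G x)" for x t
      using mult_right_mono[OF order.trans[OF that(2)[of t] abs_ge_self], of "cmod (G x)"] by (simp add: mult.commute)
    then show "AE x in mI L. norm (G x * of_real (h (cos (pi * x / L)))) \<le> norm (of_real B * G x)"
      by (simp add: norm_mult)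
  qed
  have cont0: "(LINT x|mI L. G x * of_real (h (cos (pi * x / L)))) = 0"
    if h: "continuous_on UNIV h" "\<And>t. \<bar>h t\<bar> \<le> B" for h :: "real \<Rightarrow> real" and B
  proof -
    let ?I = "LINT x|mI L. G x * of_real (h (cos (pi * x / L)))"
    let ?N = "LINT x|mI L. cmod (G x)"
    have N: "?N \<ge> 0" by (simp add: integral_nonneg_AE)
    have "cmod ?I \<le> e * ?N" if e: "e > 0" for e
    proof -
      obtain g where g: "real_polynomial_function g" "\<And>t. t \<in> {-1..1} \<Longrightarrow> \<bar>h t - g t\<bar> < e"
        using Stone_Weierstrass_real_polynomial_function[of "{-1..1::real}" h e] continuous_on_subset[OF h(1)] e by auto
      obtain a m where gs: "g = (\<lambda>t. \<Sum>i\<le>m. a i * t ^ i)" using g(1) by (auto simp: real_polynomial_function_iff_sum)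
      have eq: "G x * of_real (g (cos (pi * x / L))) = (\<Sum>i\<le>m. of_real (a i) * (G x * of_real (cos (pi * x / L)) ^ i))" for x
        by (simp add: gs sum_distrib_left algebra_simps)
      have gi: "integrable (mI L) (\<lambda>x. G x * of_real (g (cos (pi * x / L))))"
        unfolding eq by (intro Bochner_Integration.integrable_sum integrable_mult_right Gk)
      have g0: "(LINT x|mI L. G x * of_real (g (cos (pi * x / L)))) = 0"
        unfolding eq by (subst Bochner_Integration.integral_sum) (auto intro!: integrable_mult_right Gk simp: mom)
      have "?I = (LINT x|mI L. G x * of_real (h (cos (pi * x / L))) - G x * of_real (g (cos (pi * x / L))))"
        using bdd_int[OF h] gi g0 by simp
      also have "cmod \<dots> \<le> (LINT x|mI L. cmod (G x * of_real (h (cos (pi * x / L))) - G x * of_real (g (cos (pi * x / L)))))"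
        by (rule integral_norm_bound)
      also have "\<dots> \<le> (LINT x|mI L. e * cmod (G x))"
      proof (rule integral_mono)
        show "integrable (mI L) (\<lambda>x. cmod (G x * of_real (h (cos (pi * x / L))) - G x * of_real (g (cos (pi * x / L)))))"
          using bdd_int[OF h] gi by (intro integrable_norm Bochner_Integration.integrable_diff)
        show "integrable (mI L) (\<lambda>x. e * cmod (G x))" using Gi by simp
        fix x
        have "\<bar>h (cos (pi * x / L)) - g (cos (pi * x / L))\<bar> \<le> e" using g(2)[of "cos (pi * x / L)"] by simp
        then have "cmod (G x) * \<bar>h (cos (pi * x / L)) - g (cos (pi * x / L))\<bar> \<le> cmod (G x) * e" by (intro mult_left_mono) auto
        then show "cmod (G x * of_real (h (cos (pi * x / L))) - G x * of_real (g (cos (pi * x / L)))) \<le> e * cmod (G x)"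
          by (simp only: right_diff_distrib[symmetric] of_real_diff[symmetric] norm_mult norm_of_real) (simp only: mult.commute)
      qed
      also have "\<dots> = e * ?N" by simp
      finally show ?thesis .
    qed
    then have b: "cmod ?I \<le> e * ?N" if "e > 0" for e using that by blast
    have "cmod ?I \<le> 0"
    proof (rule field_le_epsilon)
      fix e :: real assume e: "e > 0"
      have "cmod ?I \<le> e / (?N + 1) * ?N" using e N by (intro b divide_pos_pos) linarith+
      also have "\<dots> = e * (?N / (?N + 1))" by simp
      also have "\<dots> \<le> e * 1"
      proof (rule mult_left_mono)
        have "?N + 1 > 0" using N by linarith
        then show "?N / (?N + 1) \<le> 1" by (subst pos_divide_le_eq) auto
      qed (use e in simp)
      finally show "cmod ?I \<le> 0 + e" by simp
    qed
    then show ?thesis by simp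
  qed
  have "AE x in mI L. G x = 0"
  proof (rule AE_zero_of_primitive_zero[OF Gi])
    fix x0 assume x0: "x0 \<in> {0..L}"
    define t0 where "t0 = cos (pi * x0 / L)"
    \<comment> \<open>Continuous ramps that increase to the indicator of \<open>t > t0\<close>; in
      terms of x this is the indicator of \<open>x < x0\<close>.\<close>
    define h where "h k t = min 1 (max 0 (real k * (t - t0)))" for k t
    have hc: "continuous_on UNIV (h k)" for k unfolding h_def by (intro continuous_intros)
    have hb: "\<bar>h k t\<bar> \<le> 1" for k t by (simp add: h_def)
    have lim: "(\<lambda>k. h k t) \<longlonglongrightarrow> (if t > t0 then 1 else 0)" for t
    proof (cases "t > t0")
      case True
      obtain N where N: "1 / (t - t0) < real N" using reals_Archimedean2 by blast
      have "h k t = 1" if "k \<ge> N" for k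
      proof -
        have "1 / (t - t0) \<le> real k" using N that by simp
        then have "1 \<le> real k * (t - t0)" using True by (simp add: field_simps)
        then show ?thesis by (simp add: h_def)
      qed
      then have "\<forall>\<^sub>F k in sequentially. h k t = 1" unfolding eventually_sequentially by blast
      then show ?thesis using True by (simp add: tendsto_eventually)
    next
      case False
      then have "h k t = 0" for k by (simp add: h_def mult_nonneg_nonpos)
      then show ?thesis using False by simp
    qed
    have "(\<lambda>k. LINT x|mI L. G x * of_real (h k (cos (pi * x / L)))) \<longlonglongrightarrow> (LINT x|mI L. G x * of_real (if cos (pi * x / L) > t0 then 1 else 0))"
    proof (rule integral_dominated_convergence[where w = "\<lambda>x. cmod (G x)"])
      show "(\<lambda>x. G x * of_real (if cos (pi * x / L) > t0 then 1 else 0)) \<in> borel_measurable (mI L)"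
        using cm by measurable
      show "(\<lambda>x. G x * of_real (h k (cos (pi * x / L)))) \<in> borel_measurable (mI L)" for k using hm[OF hc] by measurable
      show "integrable (mI L) (\<lambda>x. cmod (G x))" using Gi by simp
      show "AE x in mI L. (\<lambda>k. G x * of_real (h k (cos (pi * x / L)))) \<longlonglongrightarrow> G x * of_real (if cos (pi * x / L) > t0 then 1 else 0)"
        by (intro AE_I2 tendsto_mult tendsto_const tendsto_of_real lim)
      show "AE x in mI L. norm (G x * of_real (h k (cos (pi * x / L)))) \<le> cmod (G x)" for k
        using hb by (simp add: norm_mult mult_left_le)
    qed
    then have "(LINT x|mI L. G x * of_real (if cos (pi * x / L) > t0 then 1 else 0)) = 0"
      using cont0[OF hc hb] LIMSEQ_unique[OF _ tendsto_const] by auto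
    moreover have "(LINT x|mI L. G x * of_real (if cos (pi * x / L) > t0 then 1 else 0)) = (LINT x|mI L. indicat_real {0..x0} x *\<^sub>R G x)"
    proof (rule integral_cong_AE)
      show "(\<lambda>x. G x * of_real (if cos (pi * x / L) > t0 then 1 else 0)) \<in> borel_measurable (mI L)" using cm by measurable
      have "{0..x0} \<in> sets (mI L)" using x0 by (simp add: sets_restrict_space_iff)
      then show "(\<lambda>x. indicat_real {0..x0} x *\<^sub>R G x) \<in> borel_measurable (mI L)" by measurable
      have "AE x in lebesgue. x \<noteq> x0" by (rule AE_I'[of "{x0}"]) (auto simp flip: negligible_iff_null_sets)
      then have ae: "AE x in mI L. x \<noteq> x0" by (auto simp: AE_restrict_space_iff elim: eventually_mono)
      have key: "(cos (pi * x / L) > t0) = (x < x0)" if "x \<in> {0..L}" for x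
      proof -
        have "0 \<le> pi * x / L" "pi * x / L \<le> pi" "0 \<le> pi * x0 / L" "pi * x0 / L \<le> pi"
          using that x0 L by (auto simp: field_simps)
        then have "(cos (pi * x / L) > t0) = (pi * x / L < pi * x0 / L)" unfolding t0_def by (intro cos_mono_less_eq)
        also have "\<dots> = (x < x0)" using L by (simp add: divide_less_cancel)
        finally show ?thesis .
      qed
      show "AE x in mI L. G x * of_real (if cos (pi * x / L) > t0 then 1 else 0) = indicat_real {0..x0} x *\<^sub>R G x"
        by (rule AE_mp[OF ae AE_I2]) (auto simp: key indicator_def)
    qed
    ultimately show "integral\<^sup>L (mI x0) G = 0" using integral_mI_sub[of x0 L G] x0 by simp
  qed
  moreover have "AE x in mI L. x \<noteq> 0 \<and> x \<noteq> L"
  proof -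
    have "AE x in lebesgue. x \<noteq> 0 \<and> x \<noteq> L" by (rule AE_I'[of "{0, L}"]) (auto simp flip: negligible_iff_null_sets)
    then show ?thesis by (auto simp: AE_restrict_space_iff elim: eventually_mono)
  qed
  moreover have "AE x in mI L. x \<in> {0..L}" by (rule AE_I2) simp
  ultimately show ?thesis
  \<comment> \<open>\<open>G\<close> contains the factor \<open>sin (pi x / L)\<close>, which
    vanishes only at the end points; away from them it can be divided out.\<close>
  proof eventually_elim
    case (elim x)
    then have "0 < pi * x / L" "pi * x / L < pi" using L by (auto simp: field_simps)
    then have "sin (pi * x / L) \<noteq> 0" using sin_gt_zero by fastforce
    then show ?case using elim by (simp add: G_def)
  qed
qed

lemma bessel_summable:
  assumes X: "X \<in> HH L" and J: "J \<subseteq> modes"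
  shows "(\<lambda>j. (cmod (ip L X (ortho j)))\<^sup>2) summable_on J"
proof (rule nonneg_bounded_partial_sums_imp_summable_on)
  show "\<forall>\<^sub>F F in finite_subsets_at_top J. (\<Sum>j\<in>F. (cmod (ip L X (ortho j)))\<^sup>2) \<le> (Hnorm L X)\<^sup>2"
    unfolding eventually_finite_subsets_at_top
  proof (intro exI[of _ "{}"] conjI allI impI)
    fix F assume "finite F \<and> {} \<subseteq> F \<and> F \<subseteq> J"
    then have F: "finite F" "\<And>j. j \<in> F \<Longrightarrow> j \<in> modes" using J by auto
    have "0 \<le> (Hnorm L (X - (\<Sum>i\<in>F. smul (ip L X (ortho i)) (ortho i))))\<^sup>2" by simp
    also have "\<dots> = (Hnorm L X)\<^sup>2 - (\<Sum>i\<in>F. (cmod (ip L X (ortho i)))\<^sup>2)"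
      by (rule H.nrm_sq_diff_orthonormal[OF F(1) ortho_HH ortho_orthonormal[OF F(2) F(2)] X])
    finally show "(\<Sum>j\<in>F. (cmod (ip L X (ortho j)))\<^sup>2) \<le> (Hnorm L X)\<^sup>2" by simp
  qed auto
qed auto

text \<open>The sine coefficients define an expansion by Bessel's inequality. Its sum has no wave
  part, and its heat part has the same sine coefficients as F, so completeness of the sines
  identifies the two.\<close>

lemma expansion_heat:
  assumes F: "F \<in> L2 L"
  shows "\<exists>a. has_expansion L c \<beta> (F, \<lambda>x. 0, \<lambda>x. 0) a"
proof -
  let ?X = "(F, \<lambda>x. 0, \<lambda>x. 0) :: state"
  have X: "?X \<in> HH L" using F by (auto intro!: HH_I[OF _ hwd_const])
  define a where "a = case_sum (\<lambda>n. l2ip L F (sine n)) (\<lambda>m::int. 0)"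
  have ipu: "ip L ?X (ortho j) = a j" if "j \<in> modes" for j
  proof (cases j)
    case (Inl n)
    then show ?thesis unfolding a_def ortho_def
      by (simp add: phi1_sine, subst ip_hwd[OF _ _ _ _ hwd_const _ hwd_const]) (use F in \<open>auto simp: sine_L2 l2ip_zero_left\<close>)
  next
    case (Inr m)
    then show ?thesis unfolding a_def ortho_def
      by (simp add: psi2_def, subst ip_hwd[OF _ _ _ _ hwd_const _ hwd_phi2_2(1)])
        (use F in \<open>auto simp: l2ip_zero_left l2ip_zero_right intro!: L2_cmult phi2_2_L2\<close>)
  qed
  have "(\<lambda>j. (cmod (a j))\<^sup>2) summable_on modes"
    using bessel_summable[OF X, of modes] by (rule summable_on_cong[THEN iffD1, rotated]) (simp_all add: ipu)
  then obtain Y where Y: "Y \<in> HH L" "has_expansion L c \<beta> Y a" using has_expansion_exists by blast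
  obtain f g h d where y: "Y = (f, g, h)" "f \<in> L2 L" "has_weak_deriv L g d" "g 0 = 0" "h \<in> L2 L"
    using Y(1) by (rule HH_cases)
  have iph: "a j * ip L (phi L c \<beta> j) Z = a j * ip L (ortho j) Z" for j Z
    by (cases j) (auto simp: a_def phi_def ortho_def)
  \<comment> \<open>Only parabolic eigenvectors occur, and each is orthogonal to the wave part of Y;
    that part is therefore orthogonal to itself.\<close>
  have "ip L Y (\<lambda>x. 0, g, h) = 0"
  proof -
    have Z: "(\<lambda>x. 0, g, h) \<in> HH L" using y by (auto intro!: HH_I)
    have "a j * ip L (phi L c \<beta> j) (\<lambda>x. 0, g, h) = 0" for j
    proof (cases j)
      case (Inl n)
      have "ip L (phi1 L n) (\<lambda>x. 0, g, h) = 0"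
        unfolding phi1_sine by (subst ip_hwd[OF _ _ _ _ hwd_const _ y(3,4)]) (use y in \<open>auto simp: l2ip_zero_left l2ip_zero_right sine_L2\<close>)
      then show ?thesis using Inl by (simp add: phi_def)
    qed (simp add: a_def)
    then have "(\<lambda>F. \<Sum>j\<in>F. a j * ip L (phi L c \<beta> j) (\<lambda>x. 0, g, h)) = (\<lambda>F. 0)" by (intro ext sum.neutral) blast
    then have "((\<lambda>F. 0) \<longlongrightarrow> ip L Y (\<lambda>x. 0, g, h)) (finite_subsets_at_top modes)"
      using has_expansion_ip[OF Y Z] by simp
    then show ?thesis using tendsto_unique[OF finite_subsets_at_top_neq_bot _ tendsto_const] by blast
  qed
  then have "l2ip L d d + l2ip L h h = 0"
    unfolding y(1) by (subst (asm) ip_hwd[OF _ _ _ _ y(3,4) y(3,4)]) (use y in \<open>auto simp: l2ip_zero_right\<close>)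
  then have "complex_of_real ((LINT x|mI L. (cmod (d x))\<^sup>2) + (LINT x|mI L. (cmod (h x))\<^sup>2)) = 0"
    using y hwd_L2[OF y(3)] by (simp add: l2ip_self)
  then have s: "(LINT x|mI L. (cmod (d x))\<^sup>2) + (LINT x|mI L. (cmod (h x))\<^sup>2) = 0" by (simp only: of_real_eq_0_iff)
  have p: "0 \<le> (LINT x|mI L. (cmod (d x))\<^sup>2)" "0 \<le> (LINT x|mI L. (cmod (h x))\<^sup>2)" by (simp_all add: integral_nonneg_AE)
  have "AE x in mI L. F x - f x = 0"
  proof (rule sine_complete[OF L2_diff[OF F y(2)]])
    fix n :: nat assume n: "n \<ge> 1"
    have "((\<lambda>F. \<Sum>j\<in>F. a j * ip L (phi L c \<beta> j) (phi1 L n)) \<longlongrightarrow> ip L Y (phi1 L n)) (finite_subsets_at_top modes)"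
      by (rule has_expansion_ip[OF Y dom_A_HH[OF phi1_dom]])
    moreover have "((\<lambda>F. \<Sum>j\<in>F. a j * ip L (phi L c \<beta> j) (phi1 L n)) \<longlongrightarrow> a (Inl n)) (finite_subsets_at_top modes)"
    proof (rule tendsto_eventually)
      show "\<forall>\<^sub>F F in finite_subsets_at_top modes. (\<Sum>j\<in>F. a j * ip L (phi L c \<beta> j) (phi1 L n)) = a (Inl n)"
        unfolding eventually_finite_subsets_at_top
      proof (intro exI[of _ "{Inl n}"] conjI allI impI)
        fix F assume F: "finite F \<and> {Inl n} \<subseteq> F \<and> F \<subseteq> modes"
        have u: "ortho (Inl n) = phi1 L n" by (simp add: ortho_def)
        have "(\<Sum>j\<in>F. a j * ip L (phi L c \<beta> j) (phi1 L n)) = (\<Sum>j\<in>F. if j = Inl n then a (Inl n) else 0)"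
          unfolding iph u[symmetric] by (intro sum.cong refl) (use F n in \<open>auto simp: ortho_orthonormal subset_iff\<close>)
        then show "(\<Sum>j\<in>F. a j * ip L (phi L c \<beta> j) (phi1 L n)) = a (Inl n)" using F by simp
      qed (use n in auto)
    qed
    ultimately have "ip L Y (phi1 L n) = a (Inl n)" using tendsto_unique[OF finite_subsets_at_top_neq_bot] by blast
    moreover have "ip L Y (phi1 L n) = l2ip L f (sine n)"
      unfolding y(1) phi1_sine by (subst ip_hwd[OF _ _ _ _ y(3,4) hwd_const]) (use y in \<open>auto simp: l2ip_zero_right sine_L2\<close>)
    ultimately show "l2ip L (\<lambda>x. F x - f x) (sine n) = 0"
      using F y by (simp add: l2ip_diff sine_L2 a_def)
  qed
  then have "(LINT x|mI L. (cmod (F x - f x))\<^sup>2) = 0" by (intro integral_eq_zero_AE) (auto elim: eventually_mono)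
  then have "(Hnorm L (?X - Y))\<^sup>2 = 0"
    unfolding y(1) by (subst Hnorm_diff_sq[OF F hwd_const _ L2_const y(2-5)]) (use s p in auto)
  then have "Hnorm L (?X - Y) = 0" by simp
  then show ?thesis using has_expansion_cong[OF Y X] by blast
qed

end

section \<open>Expansion of the boundary lifts\<close>

context wave_heat begin

text \<open>From the sum of all inverse squares remove the even ones, which are a quarter of it:
  \<open>pi^2/6 - pi^2/24\<close>. The summand is shifted by one, so even denominators sit at the
  odd indices \<open>2 * k + 1\<close>.\<close>

lemma odd_inverse_squares: "((\<lambda>n. 1 / (2 * real n + 1)\<^sup>2) has_sum (pi\<^sup>2 / 8)) UNIV"
proof -
  let ?f = "\<lambda>n. 1 / (real n + 1)\<^sup>2"
  have s: "?f sums (pi\<^sup>2 / 6)" using inverse_squares_sums by (simp add: add.commute)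
  have f: "(?f has_sum (pi\<^sup>2 / 6)) UNIV" by (rule sums_nonneg_imp_has_sum[OF s]) auto
  have i: "inj (\<lambda>k::nat. 2 * k)" "inj (\<lambda>k::nat. 2 * k + 1)" by (auto intro: injI)
  have "((\<lambda>k. 1/4 * ?f k) has_sum (1/4 * (pi\<^sup>2 / 6))) UNIV" by (rule has_sum_cmult_right[OF f])
  moreover have "1/4 * ?f k = (?f \<circ> (\<lambda>k. 2 * k + 1)) k" for k
  proof -
    have "real (2 * k + 1) + 1 = 2 * (real k + 1)" by simp
    then show ?thesis by (simp only: o_def power_mult_distrib) simp
  qed
  ultimately have e: "(?f has_sum (1/4 * (pi\<^sup>2 / 6))) (range (\<lambda>k. 2 * k + 1))"
    using has_sum_reindex[OF i(2), of ?f] by (simp add: o_def)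
  have "?f summable_on range (\<lambda>k. 2 * k)"
    using summable_on_subset_banach[OF has_sum_imp_summable[OF f]] by blast
  then obtain a where a: "(?f has_sum a) (range (\<lambda>k. 2 * k))" by (auto simp: summable_on_def)
  have "x \<in> range (\<lambda>k::nat. 2 * k) \<union> range (\<lambda>k. 2 * k + 1)" for x :: nat
  proof (cases "even x")
    case True then show ?thesis by (auto elim!: evenE)
  next
    case False then show ?thesis by (auto elim!: oddE)
  qed
  then have un: "range (\<lambda>k::nat. 2 * k) \<union> range (\<lambda>k. 2 * k + 1) = UNIV" by blast
  have disj: "range (\<lambda>k::nat. 2 * k) \<inter> range (\<lambda>k. 2 * k + 1) = {}"
  proof -
    have "2 * j \<noteq> 2 * k + 1" for j k :: nat by presburger
    then show ?thesis by auto
  qed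
  have "(?f has_sum (a + 1/4 * (pi\<^sup>2 / 6))) UNIV"
    using has_sum_Un_disjoint[OF a e disj] unfolding un .
  then have "a + 1/4 * (pi\<^sup>2 / 6) = pi\<^sup>2 / 6" using f by (rule has_sum_unique)
  then have a8: "a = pi\<^sup>2 / 8" by simp
  have "((?f \<circ> (\<lambda>k. 2 * k)) has_sum (pi\<^sup>2 / 8)) UNIV" using a has_sum_reindex[OF i(1), of ?f "pi\<^sup>2 / 8"] unfolding a8 by blast
  then show ?thesis by (simp add: o_def)
qed

lemma om_has_sum: "((\<lambda>m. 1 / (om m)\<^sup>2) has_sum L\<^sup>2) (UNIV :: int set)"
proof -
  have "((\<lambda>n. (4 * L\<^sup>2 / pi\<^sup>2) * (1 / (2 * real n + 1)\<^sup>2)) has_sum ((4 * L\<^sup>2 / pi\<^sup>2) * (pi\<^sup>2 / 8))) UNIV"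
    by (rule has_sum_cmult_right[OF odd_inverse_squares])
  moreover have "(4 * L\<^sup>2 / pi\<^sup>2) * (1 / (2 * real n + 1)\<^sup>2) = 1 / (om (int n))\<^sup>2" for n
    by (simp add: om_def power_divide power_mult_distrib)
  ultimately have h: "((\<lambda>n. 1 / (om (int n))\<^sup>2) has_sum (L\<^sup>2 / 2)) UNIV" by simp
  have neg: "om (- int n - 1) = - om (int n)" for n
  proof -
    have "2 * real_of_int (- int n - 1) + 1 = - (2 * real_of_int (int n) + 1)" by simp
    then show ?thesis unfolding om_def by (simp only: minus_mult_left minus_divide_left)
  qed
  have i: "inj int" "inj (\<lambda>n. - int n - 1)" by (auto intro: injI)
  have a: "((\<lambda>m. 1 / (om m)\<^sup>2) has_sum (L\<^sup>2 / 2)) (range int)"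
    using has_sum_reindex[OF i(1), of "\<lambda>m. 1 / (om m)\<^sup>2"] h by (simp add: o_def)
  have b: "((\<lambda>m. 1 / (om m)\<^sup>2) has_sum (L\<^sup>2 / 2)) (range (\<lambda>n. - int n - 1))"
    using has_sum_reindex[OF i(2), of "\<lambda>m. 1 / (om m)\<^sup>2"] h neg by (simp add: o_def)
  have "x \<in> range int \<union> range (\<lambda>n. - int n - 1)" for x :: int
  proof (cases "x \<ge> 0")
    case True then show ?thesis by (metis UnI1 nonneg_int_cases rangeI)
  next
    case False
    then have "x = - int (nat (- x - 1)) - 1" by simp
    then show ?thesis by blast
  qed
  then have un: "range int \<union> range (\<lambda>n. - int n - 1) = UNIV" by blast
  have disj: "range int \<inter> range (\<lambda>n. - int n - 1) = {}"
  proof -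
    have "int j \<noteq> - int k - 1" for j k by linarith
    then show ?thesis by auto
  qed
  show ?thesis using has_sum_Un_disjoint[OF a b disj] unfolding un by simp
qed

text \<open>By \<open>om_has_sum\<close> these numbers add up to L, the squared norm of
  \<open>lift0\<close>; Bessel's inequality for the orthonormal waves is thus an equality.\<close>

lemma lift0_psi2: "(cmod (ip L lift0 (psi2 m)))\<^sup>2 = 1 / L * (1 / (om m)\<^sup>2)"
proof -
  have "ip L lift0 (psi2 m) = l2ip L (\<lambda>x. 1) (wave1 m)"
    unfolding psi2_def by (rule ip_lift0[OF _ _ hwd_phi2_2(1)]) (auto intro!: L2_cmult phi2_2_L2)
  also have "\<dots> = cnj (l2ip L (wave1 m) (\<lambda>x. 1))" by (rule l2ip_cnj)
  also have "l2ip L (wave1 m) (\<lambda>x. 1) = phi2_2 L m L"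
    using l2ip_ibp[OF L0 hwd_phi2_2(1) hwd_const[of L 1], of m] by (simp add: l2ip_zero_right)
  finally have "(cmod (ip L lift0 (psi2 m)))\<^sup>2 = (Kc m * sin (om m * L))\<^sup>2"
    unfolding phi2_2_eq by (simp add: norm_mult abs_mult power_mult_distrib)
  then show ?thesis using sin_om[of m] L by (simp add: Kc_def power_mult_distrib power_divide)
qed

lemma lift0_norm: "(Hnorm L lift0)\<^sup>2 = L"
proof -
  have "(Hnorm L lift0)\<^sup>2 = (LINT x|mI L. (cmod (0::complex))\<^sup>2) + (LINT x|mI L. (cmod (1::complex))\<^sup>2) + (LINT x|mI L. (cmod (0::complex))\<^sup>2)"
    unfolding lift0_def by (rule Hnorm_sq[OF _ hwd_id]) auto
  then show ?thesis using L by (simp add: measure_restrict_space)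
qed

text \<open>The wave part of \<open>lift0\<close> is recovered by Parseval's identity, which reduces to \<open>\<Sum> 1/(2n+1)\<^sup>2 = \<pi>\<^sup>2/8\<close>.\<close>

lemma expansion_lift0: "\<exists>a. has_expansion L c \<beta> lift0 a"
proof -
  define l where "l m = ip L lift0 (psi2 m)" for m
  define a where "a = case_sum (\<lambda>n::nat. 0) l"
  have al: "a (Inr m) = ip L lift0 (ortho (Inr m))" for m by (simp add: a_def l_def ortho_def)
  have ls: "(\<lambda>j. (cmod (a j))\<^sup>2) summable_on modes"
  proof (rule summable_on_comparison_test[OF bessel_summable[OF lift0_HH order_refl]])
    show "(cmod (a j))\<^sup>2 \<le> (cmod (ip L lift0 (ortho j)))\<^sup>2" for j by (cases j) (simp_all add: al, simp add: a_def)
  qed auto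
  then obtain X where X: "X \<in> HH L" "has_expansion L c \<beta> X a" using has_expansion_exists by blast
  obtain f g h d where x: "X = (f, g, h)" "f \<in> L2 L" "has_weak_deriv L g d" "g 0 = 0" "h \<in> L2 L"
    using X(1) by (rule HH_cases)
  define P where "P = (\<lambda>x::real. 0::complex, g, h)"
  have P: "P \<in> HH L" unfolding P_def using x by (auto intro!: HH_I)
  let ?U = "\<lambda>F. \<Sum>j\<in>F. smul (a j) (ortho j)" and ?S = "\<lambda>F. \<Sum>j\<in>F. smul (a j) (phi L c \<beta> j)"
  have UH: "?U F \<in> HH L" for F by (intro H.sum_closed H.sm_closed ortho_HH)
  \<comment> \<open>Deleting the heat component cannot increase the norm. It turns X into its wave
    part P and the partial sum in \<open>phi\<close> into the one in \<open>ortho\<close>, since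
    \<open>coupling\<close> lives in the heat component.\<close>
  have Pu: "Hnorm L (P - ?U F) \<le> Hnorm L (X - ?S F)" for F
  proof -
    have split: "?S F = ?U F + (\<Sum>j\<in>F. smul (a j) (coupling j))"
      by (simp add: phi_ortho H.sm_dist sum.distrib)
    have "\<exists>k. k \<in> L2 L \<and> (\<Sum>j\<in>F. smul (a j) (coupling j)) = (k, \<lambda>x. 0, \<lambda>x. 0)"
    proof (induction F rule: infinite_finite_induct)
      case (insert j F)
      then obtain k where k: "k \<in> L2 L" "(\<Sum>j\<in>F. smul (a j) (coupling j)) = (k, \<lambda>x. 0, \<lambda>x. 0)" by blast
      obtain k' where k': "k' \<in> L2 L" "smul (a j) (coupling j) = (k', \<lambda>x. 0, \<lambda>x. 0)"
      proof (cases j)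
        case (Inl n)
        then show ?thesis using that[of "\<lambda>x. 0"] by (simp add: coupling_def zero_prod_def zero_fun_def)
      next
        case (Inr m)
        obtain f1 where "has_weak_deriv L (phi2_1 L c \<beta> m) f1" by (rule phi2_1_facts)
        then show ?thesis using Inr that[of "\<lambda>x. a j * phi2_1 L c \<beta> m x"] by (simp add: coupling_def L2_cmult hwd_in_L2)
      qed
      show ?case using insert.hyps k k' L2_add[OF k'(1) k(1)] by (auto simp: plus_fun_eq)
    qed (auto simp: zero_prod_def zero_fun_def)
    then obtain k where k: "k \<in> L2 L" "(\<Sum>j\<in>F. smul (a j) (coupling j)) = (k, \<lambda>x. 0, \<lambda>x. 0)" by blast
    have "\<exists>G K e. ?U F = (\<lambda>x. 0, G, K) \<and> has_weak_deriv L G e \<and> G 0 = 0 \<and> K \<in> L2 L"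
    proof (induction F rule: infinite_finite_induct)
      case (insert j F)
      then obtain G K e where G: "?U F = (\<lambda>x. 0, G, K)" "has_weak_deriv L G e" "G 0 = 0" "K \<in> L2 L" by blast
      obtain G' K' e' where G': "smul (a j) (ortho j) = (\<lambda>x. 0, G', K')" "has_weak_deriv L G' e'" "G' 0 = 0" "K' \<in> L2 L"
      proof (cases j)
        case (Inl n)
        then show ?thesis using that[of "\<lambda>x. 0" "\<lambda>x. 0" "\<lambda>x. 0"] hwd_const[of L 0] by (simp add: ortho_def a_def phi1_sine)
      next
        case (Inr m)
        have "smul (a j) (ortho j) = (\<lambda>x. 0, \<lambda>x. a j * phi2_2 L m x, \<lambda>x. a j * (lam2 L m * phi2_2 L m x))"
          using Inr by (simp add: ortho_def psi2_def)
        then show ?thesis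
          by (rule that[OF _ hwd_cmult[OF hwd_phi2_2(1)]]) (auto intro!: L2_cmult phi2_2_L2)
      qed
      have "?U (insert j F) = (\<lambda>x. 0, \<lambda>x. G' x + G x, \<lambda>x. K' x + K x)"
        using insert.hyps G G' by (simp add: plus_fun_eq)
      then show ?case using hwd_add[OF G'(2) G(2)] L2_add[OF G'(4) G(4)] G(3) G'(3)
        by (intro exI[of _ "\<lambda>x. G' x + G x"] exI[of _ "\<lambda>x. K' x + K x"] exI[of _ "\<lambda>x. e' x + e x"]) auto
    qed (use hwd_const[of L 0] in \<open>auto simp: zero_prod_def zero_fun_def\<close>)
    then obtain G K e where G: "?U F = (\<lambda>x. 0, G, K)" "has_weak_deriv L G e" "G 0 = 0" "K \<in> L2 L" by blast
    have 1: "(Hnorm L (P - ?U F))\<^sup>2 = (LINT y|mI L. (cmod (0 - 0 :: complex))\<^sup>2) + (LINT y|mI L. (cmod (d y - e y))\<^sup>2) + (LINT y|mI L. (cmod (h y - K y))\<^sup>2)"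
      unfolding P_def G(1) by (rule Hnorm_diff_sq[OF _ x(3-5) _ G(2-4)]) auto
    have "?S F = (\<lambda>y. 0 + k y, \<lambda>y. G y + 0, \<lambda>y. K y + 0)"
      unfolding split G(1) k(2) plus_prod_def fst_conv snd_conv plus_fun_eq ..
    then have "?S F = (k, G, K)" by simp
    then have 2: "(Hnorm L (X - ?S F))\<^sup>2 = (LINT y|mI L. (cmod (f y - k y))\<^sup>2) + (LINT y|mI L. (cmod (d y - e y))\<^sup>2) + (LINT y|mI L. (cmod (h y - K y))\<^sup>2)"
      unfolding x(1) by (simp only:) (rule Hnorm_diff_sq[OF x(2-5) k(1) G(2-4)])
    have "0 \<le> (LINT y|mI L. (cmod (f y - k y))\<^sup>2)" by (simp add: integral_nonneg_AE)
    then have "(Hnorm L (P - ?U F))\<^sup>2 \<le> (Hnorm L (X - ?S F))\<^sup>2" unfolding 1 2 by simp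
    then show ?thesis by (rule power2_le_imp_le) (rule H.nrm_nonneg[OF H.diff_closed[OF X(1) expansion_sum_HH]])
  qed
  \<comment> \<open>The squared distance is L minus the partial sum of the squared coefficients,
    which tends to L.\<close>
  have "((\<lambda>F. (Hnorm L (lift0 - ?U F))\<^sup>2) \<longlongrightarrow> 0) (finite_subsets_at_top modes)"
  proof -
    have inj: "inj (Inr :: int \<Rightarrow> nat + int)" by (auto intro: injI)
    have "((\<lambda>m. 1 / L * (1 / (om m)\<^sup>2)) has_sum (1 / L * L\<^sup>2)) UNIV" by (rule has_sum_cmult_right[OF om_has_sum])
    then have "((\<lambda>m. (cmod (l m))\<^sup>2) has_sum L) UNIV" using L unfolding l_def lift0_psi2 by (simp add: power2_eq_square)
    then have "((\<lambda>j. (cmod (a j))\<^sup>2) has_sum L) (range Inr)"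
      using has_sum_reindex[OF inj, of "\<lambda>j. (cmod (a j))\<^sup>2" L] by (simp add: o_def a_def)
    then have "((\<lambda>j. (cmod (a j))\<^sup>2) has_sum L) modes"
      by (rule has_sum_cong_neutral[THEN iffD1, rotated -1]) (auto simp: a_def modes_def)
    then have "((\<lambda>F. L - (\<Sum>j\<in>F. (cmod (a j))\<^sup>2)) \<longlongrightarrow> 0) (finite_subsets_at_top modes)"
      using tendsto_diff[OF tendsto_const[of L]] unfolding has_sum_def by fastforce
    moreover have "\<forall>\<^sub>F F in finite_subsets_at_top modes. L - (\<Sum>j\<in>F. (cmod (a j))\<^sup>2) = (Hnorm L (lift0 - ?U F))\<^sup>2"
      unfolding eventually_finite_subsets_at_top
    proof (intro exI[of _ "{}"] conjI allI impI)
      fix F assume F: "finite F \<and> {} \<subseteq> F \<and> F \<subseteq> modes"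
      define G where "G = F \<inter> range Inr"
      have G: "finite G" "G \<subseteq> F" "\<And>j. j \<in> G \<Longrightarrow> j \<in> modes" "\<And>j. j \<in> G \<Longrightarrow> a j = ip L lift0 (ortho j)"
        using F by (auto simp: G_def al)
      have z: "a j = 0" if "j \<in> F - G" for j using that by (cases j) (auto simp: G_def a_def)
      have "?U F = ?U G"
        by (rule sum.mono_neutral_right) (use F G z H.sm_add[of 0 0] in auto)
      also have "\<dots> = (\<Sum>j\<in>G. smul (ip L lift0 (ortho j)) (ortho j))" by (rule sum.cong) (auto simp: G)
      finally have U: "?U F = (\<Sum>j\<in>G. smul (ip L lift0 (ortho j)) (ortho j))" .
      have "(\<Sum>j\<in>F. (cmod (a j))\<^sup>2) = (\<Sum>j\<in>G. (cmod (a j))\<^sup>2)"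
        by (rule sum.mono_neutral_right) (use F G z in auto)
      also have "\<dots> = (\<Sum>j\<in>G. (cmod (ip L lift0 (ortho j)))\<^sup>2)" by (rule sum.cong) (auto simp: G)
      finally show "L - (\<Sum>j\<in>F. (cmod (a j))\<^sup>2) = (Hnorm L (lift0 - ?U F))\<^sup>2"
        unfolding U using H.nrm_sq_diff_orthonormal[OF G(1) ortho_HH ortho_orthonormal[OF G(3) G(3)] lift0_HH] by (simp add: lift0_norm)
    qed auto
    ultimately show ?thesis by (rule Lim_transform_eventually)
  qed
  then have "((\<lambda>F. sqrt ((Hnorm L (lift0 - ?U F))\<^sup>2)) \<longlongrightarrow> sqrt 0) (finite_subsets_at_top modes)" by (rule tendsto_real_sqrt)
  moreover have "sqrt ((Hnorm L (lift0 - ?U F))\<^sup>2) = Hnorm L (lift0 - ?U F)" for F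
    using H.nrm_nonneg[OF H.diff_closed[OF lift0_HH UH]] by simp
  ultimately have lim: "((\<lambda>F. Hnorm L (lift0 - ?U F) + Hnorm L (X - ?S F)) \<longlongrightarrow> 0 + 0) (finite_subsets_at_top modes)"
    using X(2) by (intro tendsto_add) (auto simp: has_expansion_def)
  have "Hnorm L (lift0 - P) \<le> Hnorm L (lift0 - ?U F) + Hnorm L (X - ?S F)" for F
    using H.nrm_triangle3[OF lift0_HH UH[of F] P] Pu[of F] H.nrm_diff_commute[OF P UH[of F]] by simp
  then have "Hnorm L (lift0 - P) \<le> 0"
    using tendsto_lowerbound[OF lim _ finite_subsets_at_top_neq_bot, of "Hnorm L (lift0 - P)"] by simp
  then have z: "Hnorm L (lift0 - P) = 0" using H.nrm_nonneg[OF H.diff_closed[OF lift0_HH P]] by simp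
  \<comment> \<open>X agrees with \<open>lift0\<close> up to its heat component f; removing f at the
    level of coefficients uses the expansion of a pure heat state.\<close>
  have F0: "(f, \<lambda>x. 0, \<lambda>x. 0) \<in> HH L" using x by (auto intro!: HH_I[OF _ hwd_const])
  obtain b where b: "has_expansion L c \<beta> (f, \<lambda>x. 0, \<lambda>x. 0) b" using expansion_heat[OF x(2)] by blast
  have "X - (f, \<lambda>x. 0, \<lambda>x. 0) = P" unfolding x(1) P_def by (simp add: minus_fun_eq, simp add: zero_fun_def)
  then have "has_expansion L c \<beta> P (\<lambda>j. a j - b j)" using has_expansion_diff[OF X F0 b] by simp
  then have "has_expansion L c \<beta> lift0 (\<lambda>j. a j - b j)" by (rule has_expansion_cong[OF P _ lift0_HH z]) simp
  then show ?thesis by blast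
qed

lemma expansion_lift1: "\<exists>a. has_expansion L c \<beta> lift1 a"
  unfolding lift1_def by (rule expansion_heat[OF beta_L2[OF id_L2]])

end

section \<open>The semigroup and its controlled trajectories\<close>

locale wave_heat_semigroup = wave_heat +
  fixes S :: "real \<Rightarrow> state \<Rightarrow> state"
  assumes gen: "generates L (dom_A L) (op_A L c \<beta>) S"
begin

sublocale SG: semi_semigroup "HH L" smul "ip L" S
  rewrites "semi_inner.nrm (ip L) = Hnorm L"
proof -
  have C: "C0_semigroup L S" using gen by (simp add: generates_def)
  show "semi_semigroup (HH L) smul (ip L) S"
  proof (intro semi_semigroup.intro semi_hilbert_HH semi_semigroup_axioms.intro, unfold nrm_Hnorm)
    fix t :: real and X assume "0 \<le> t" "X \<in> HH L"
    then show "S t X \<in> HH L" using C unfolding C0_semigroup_def by blast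
  next
    fix t :: real and X Y a b assume "0 \<le> t" "X \<in> HH L" "Y \<in> HH L"
    then show "Hnorm L (S t (smul a X + smul b Y) - (smul a (S t X) + smul b (S t Y))) = 0"
      using C unfolding C0_semigroup_def Heq_def by blast
  next
    fix t assume "(0::real) \<le> t"
    then show "\<exists>M. \<forall>X\<in>HH L. Hnorm L (S t X) \<le> M * Hnorm L X" using C unfolding C0_semigroup_def by blast
  next
    fix X assume "X \<in> HH L"
    then show "Hnorm L (S 0 X - X) = 0" using C unfolding C0_semigroup_def Heq_def by blast
  next
    fix s t X assume "(0::real) \<le> s" "(0::real) \<le> t" "X \<in> HH L"
    then show "Hnorm L (S (s + t) X - S s (S t X)) = 0" using C unfolding C0_semigroup_def Heq_def by blast
  next
    fix X assume "X \<in> HH L"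
    then show "((\<lambda>t. Hnorm L (S t X - X)) \<longlongrightarrow> 0) (at_right 0)" using C unfolding C0_semigroup_def by blast
  qed
qed (rule nrm_Hnorm)

lemma generator_iff:
  assumes "X \<in> HH L" "Y \<in> HH L"
  shows "((\<lambda>t. Hnorm L (smul (of_real (1 / t)) (S t X - X) - Y)) \<longlongrightarrow> 0) (at_right 0)
     \<longleftrightarrow> (\<exists>X'\<in>dom_A L. Hnorm L (X - X') = 0 \<and> Hnorm L (Y - op_A L c \<beta> X') = 0)"
  using gen assms unfolding generates_def has_generator_def Heq_def by blast

lemma S_phi:
  assumes "t \<ge> 0" shows "SG.eqv (S t (phi L c \<beta> j)) (smul (exp (lam j * of_real t)) (phi L c \<beta> j))"
proof (rule SG.S_eigenvector[OF phi_HH assms])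
  show "((\<lambda>t. Hnorm L (smul (of_real (1 / t)) (S t (phi L c \<beta> j) - phi L c \<beta> j) - smul (lam j) (phi L c \<beta> j))) \<longlongrightarrow> 0) (at_right 0)"
    unfolding generator_iff[OF phi_HH H.sm_closed[OF phi_HH]]
  proof (intro bexI[OF _ phi_dom] conjI)
    show "Hnorm L (phi L c \<beta> j - phi L c \<beta> j) = 0" by (simp add: H.nrm_zero)
    show "Hnorm L (smul (lam j) (phi L c \<beta> j) - op_A L c \<beta> (phi L c \<beta> j)) = 0"
      using H.nrm_diff_commute[OF H.sm_closed[OF phi_HH] op_A_HH[OF phi_dom]] phi_eigen by simp
  qed
qed

lemma S_sum_phi:
  assumes t: "t \<ge> 0"
  shows "SG.eqv (S t (\<Sum>j\<in>F. smul (a j) (phi L c \<beta> j))) (\<Sum>j\<in>F. smul (exp (lam j * of_real t) * a j) (phi L c \<beta> j))"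
proof -
  have each: "SG.eqv (S t (smul (a j) (phi L c \<beta> j))) (smul (exp (lam j * of_real t) * a j) (phi L c \<beta> j))" for j
  proof -
    have 1: "SG.eqv (S t (smul (a j) (phi L c \<beta> j))) (smul (a j) (S t (phi L c \<beta> j)))"
      by (rule SG.S_sm[OF t phi_HH])
    have 2: "SG.eqv (smul (a j) (S t (phi L c \<beta> j))) (smul (a j) (smul (exp (lam j * of_real t)) (phi L c \<beta> j)))"
      by (rule SG.eqv_sm[OF SG.S_closed[OF t phi_HH] H.sm_closed[OF phi_HH] S_phi[OF t]])
    have 3: "smul (a j) (smul (exp (lam j * of_real t)) (phi L c \<beta> j)) = smul (exp (lam j * of_real t) * a j) (phi L c \<beta> j)"
      by (simp add: H.sm_sm mult.commute)
    show ?thesis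
      by (rule SG.eqv_trans[OF _ _ _ 1 2[unfolded 3]]) (use t in \<open>auto intro!: SG.S_closed H.sm_closed phi_HH\<close>)
  qed
  show ?thesis
  proof (rule SG.eqv_trans)
    show "SG.eqv (S t (\<Sum>j\<in>F. smul (a j) (phi L c \<beta> j))) (\<Sum>j\<in>F. S t (smul (a j) (phi L c \<beta> j)))"
      by (rule SG.S_sum[OF t]) (intro H.sm_closed phi_HH)
    show "SG.eqv (\<Sum>j\<in>F. S t (smul (a j) (phi L c \<beta> j))) (\<Sum>j\<in>F. smul (exp (lam j * of_real t) * a j) (phi L c \<beta> j))"
      by (rule SG.eqv_sum) (use t in \<open>auto intro!: SG.S_closed H.sm_closed phi_HH each\<close>)
  qed (use t in \<open>auto intro!: SG.S_closed H.sum_closed H.sm_closed phi_HH\<close>)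
qed

text \<open>The truncation error is transported by the operator itself. Since M can be chosen
  uniformly on a time interval, this later makes the kernel series converge uniformly in
  time.\<close>

lemma S_expansion_bound:
  assumes t: "t \<ge> 0" and M: "\<And>Y. Y \<in> HH L \<Longrightarrow> Hnorm L (S t Y) \<le> M * Hnorm L Y" and X: "X \<in> HH L"
  shows "Hnorm L (S t X - (\<Sum>j\<in>F. smul (exp (lam j * of_real t) * a j) (phi L c \<beta> j)))
    \<le> M * Hnorm L (X - (\<Sum>j\<in>F. smul (a j) (phi L c \<beta> j)))"
proof -
  let ?S = "\<Sum>j\<in>F. smul (a j) (phi L c \<beta> j)" and ?T = "\<Sum>j\<in>F. smul (exp (lam j * of_real t) * a j) (phi L c \<beta> j)"
  have cl: "X - ?S \<in> HH L" "S t X \<in> HH L" "S t ?S \<in> HH L" "?T \<in> HH L" "S t (X - ?S) \<in> HH L"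
    using t X by (auto intro!: H.diff_closed SG.S_closed expansion_sum_HH)
  have "SG.eqv (S t X - ?T) (S t X - S t ?S)"
    by (rule SG.eqv_diff[OF cl(2,2,4,3) SG.eqv_refl SG.eqv_sym[OF cl(3,4) S_sum_phi[OF t]]])
  moreover have "SG.eqv (S t X - S t ?S) (S t (X - ?S))"
    by (rule SG.eqv_sym[OF cl(5) H.diff_closed[OF cl(2,3)] SG.S_diff[OF t X expansion_sum_HH]])
  ultimately have "SG.eqv (S t X - ?T) (S t (X - ?S))"
    by (rule SG.eqv_trans[OF H.diff_closed[OF cl(2,4)] H.diff_closed[OF cl(2,3)] cl(5)])
  then have "Hnorm L (S t X - ?T) = Hnorm L (S t (X - ?S))"
    by (rule SG.eqv_nrm[OF H.diff_closed[OF cl(2,4)] cl(5)])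
  then show ?thesis using M[OF cl(1)] by simp
qed

lemma has_expansion_S:
  assumes t: "t \<ge> 0" and X: "X \<in> HH L" and e: "has_expansion L c \<beta> X a"
  shows "has_expansion L c \<beta> (S t X) (\<lambda>j. exp (lam j * of_real t) * a j)"
proof -
  obtain M where M: "\<And>Y. Y \<in> HH L \<Longrightarrow> Hnorm L (S t Y) \<le> M * Hnorm L Y" using SG.S_bd[OF t] by blast
  show ?thesis unfolding has_expansion_def
  proof (rule Lim_null_comparison[OF always_eventually])
    show "((\<lambda>F. M * Hnorm L (X - (\<Sum>j\<in>F. smul (a j) (phi L c \<beta> j)))) \<longlongrightarrow> 0) (finite_subsets_at_top modes)"
      using tendsto_mult[OF tendsto_const[of M] e[unfolded has_expansion_def]] by simp
    show "\<forall>F. norm (Hnorm L (S t X - (\<Sum>j\<in>F. smul (exp (lam j * of_real t) * a j) (phi L c \<beta> j))))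
        \<le> M * Hnorm L (X - (\<Sum>j\<in>F. smul (a j) (phi L c \<beta> j)))"
    proof
      fix F
      have "0 \<le> Hnorm L (S t X - (\<Sum>j\<in>F. smul (exp (lam j * of_real t) * a j) (phi L c \<beta> j)))"
        by (rule H.nrm_nonneg[OF H.diff_closed[OF SG.S_closed[OF t X] expansion_sum_HH]])
      then show "norm (Hnorm L (S t X - (\<Sum>j\<in>F. smul (exp (lam j * of_real t) * a j) (phi L c \<beta> j))))
        \<le> M * Hnorm L (X - (\<Sum>j\<in>F. smul (a j) (phi L c \<beta> j)))"
        using S_expansion_bound[OF t M X, where F = F and a = a] by simp
    qed
  qed
qed

section \<open>Boundary traces along adjoint orbits\<close>

lemma adj_S:
  assumes t: "t \<ge> 0" and \<psi>: "\<psi> \<in> HH L"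
  shows "adj L (S t) \<psi> \<in> HH L" "X \<in> HH L \<Longrightarrow> ip L (S t X) \<psi> = ip L X (adj L (S t) \<psi>)"
proof -
  obtain M where M: "\<And>Y. Y \<in> HH L \<Longrightarrow> Hnorm L (S t Y) \<le> M * Hnorm L Y" using SG.S_bd[OF t] by blast
  have "\<exists>Z\<in>HH L. \<forall>X\<in>HH L. ip L (S t X) \<psi> = ip L X Z"
  proof (rule H.riesz[where M = "M * Hnorm L \<psi>"])
    fix X Y assume XY: "X \<in> HH L" "Y \<in> HH L"
    have "ip L (S t (X + Y)) \<psi> = ip L (S t X + S t Y) \<psi>"
      by (rule H.ip_cong0) (use t XY \<psi> SG.S_add[OF t XY] in \<open>auto intro!: SG.S_closed H.add_closed simp: SG.eqv_def\<close>)
    then show "ip L (S t (X + Y)) \<psi> = ip L (S t X) \<psi> + ip L (S t Y) \<psi>"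
      using t XY \<psi> by (simp add: H.ip_add SG.S_closed)
  next
    fix X a assume X: "X \<in> HH L"
    have "ip L (S t (smul a X)) \<psi> = ip L (smul a (S t X)) \<psi>"
      by (rule H.ip_cong0) (use t X \<psi> SG.S_sm[OF t X] in \<open>auto intro!: SG.S_closed H.sm_closed simp: SG.eqv_def\<close>)
    then show "ip L (S t (smul a X)) \<psi> = a * ip L (S t X) \<psi>"
      using t X \<psi> by (simp add: H.ip_sm SG.S_closed)
  next
    fix X assume X: "X \<in> HH L"
    have "cmod (ip L (S t X) \<psi>) \<le> Hnorm L (S t X) * Hnorm L \<psi>"
      by (rule H.cauchy_schwarz[OF SG.S_closed[OF t X] \<psi>])
    also have "\<dots> \<le> (M * Hnorm L X) * Hnorm L \<psi>" by (intro mult_right_mono M X H.nrm_nonneg \<psi>)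
    finally show "cmod (ip L (S t X) \<psi>) \<le> M * Hnorm L \<psi> * Hnorm L X" by (simp add: algebra_simps)
  qed
  then have "\<exists>Z. Z \<in> HH L \<and> (\<forall>X\<in>HH L. ip L (S t X) \<psi> = ip L X Z)" by blast
  from someI_ex[OF this] have "adj L (S t) \<psi> \<in> HH L \<and> (\<forall>X\<in>HH L. ip L (S t X) \<psi> = ip L X (adj L (S t) \<psi>))"
    unfolding adj_def .
  then show "adj L (S t) \<psi> \<in> HH L" "X \<in> HH L \<Longrightarrow> ip L (S t X) \<psi> = ip L X (adj L (S t) \<psi>)" by blast+
qed

text \<open>\<open>S t\<close> maps the difference quotients at X to those at \<open>S t X\<close>.
  The generator determines states only up to their class, so the orbit is equivalent to, rather than
  equal to, an element of the domain.\<close>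

lemma S_dom:
  assumes t: "t \<ge> 0" and X: "X \<in> dom_A L"
  shows "\<exists>X'\<in>dom_A L. Hnorm L (S t X - X') = 0 \<and> Hnorm L (S t (op_A L c \<beta> X) - op_A L c \<beta> X') = 0"
proof -
  let ?A = "op_A L c \<beta> X"
  have XH: "X \<in> HH L" and AH: "?A \<in> HH L" using X by (auto intro: dom_A_HH op_A_HH)
  have lim: "((\<lambda>h. Hnorm L (smul (of_real (1 / h)) (S h X - X) - ?A)) \<longlongrightarrow> 0) (at_right 0)"
    unfolding generator_iff[OF XH AH] using X H.nrm_zero by (intro bexI[of _ X]) auto
  obtain M where M: "\<And>Y. Y \<in> HH L \<Longrightarrow> Hnorm L (S t Y) \<le> M * Hnorm L Y" using SG.S_bd[OF t] by blast
  have SX: "S t X \<in> HH L" "S t ?A \<in> HH L" using t XH AH by (auto intro: SG.S_closed)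
  have "((\<lambda>h. Hnorm L (smul (of_real (1 / h)) (S h (S t X) - S t X) - S t ?A)) \<longlongrightarrow> 0) (at_right 0)"
  proof (rule Lim_null_comparison)
    show "((\<lambda>h. M * Hnorm L (smul (of_real (1 / h)) (S h X - X) - ?A)) \<longlongrightarrow> 0) (at_right 0)"
      using tendsto_mult[OF tendsto_const[of M] lim] by simp
    have "norm (Hnorm L (smul (of_real (1 / h)) (S h (S t X) - S t X) - S t ?A)) \<le> M * Hnorm L (smul (of_real (1 / h)) (S h X - X) - ?A)"
      if h: "h > 0" for h
    proof -
      let ?D = "S h X - X" and ?k = "complex_of_real (1 / h)"
      have h0: "h \<ge> 0" using h by simp
      have cl: "S h (S t X) \<in> HH L" "S t (S h X) \<in> HH L" "S h X \<in> HH L" "S (h + t) X \<in> HH L" "?D \<in> HH L" "S t ?D \<in> HH L"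
        using t h0 XH SX by (auto intro!: SG.S_closed H.diff_closed)
      have 1: "SG.eqv (S h (S t X)) (S t (S h X))"
      proof (rule SG.eqv_trans[OF cl(1) cl(4) cl(2)])
        show "SG.eqv (S h (S t X)) (S (h + t) X)"
          by (rule SG.eqv_sym[OF cl(4,1)]) (simp add: SG.eqv_def SG.S_plus h0 t XH)
        show "SG.eqv (S (h + t) X) (S t (S h X))" using SG.S_plus[OF t h0 XH] by (simp add: SG.eqv_def add.commute)
      qed
      have 2: "SG.eqv (S h (S t X) - S t X) (S t ?D)"
      proof (rule SG.eqv_trans[OF H.diff_closed[OF cl(1) SX(1)] H.diff_closed[OF cl(2) SX(1)] cl(6)])
        show "SG.eqv (S h (S t X) - S t X) (S t (S h X) - S t X)"
          by (rule SG.eqv_diff[OF cl(1,2) SX(1,1) 1 SG.eqv_refl])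
        show "SG.eqv (S t (S h X) - S t X) (S t ?D)"
          by (rule SG.eqv_sym[OF cl(6) H.diff_closed[OF cl(2) SX(1)] SG.S_diff[OF t cl(3) XH]])
      qed
      have kD: "smul ?k ?D \<in> HH L" "S t (smul ?k ?D) \<in> HH L" using cl t by (auto intro!: H.sm_closed SG.S_closed)
      have 3: "SG.eqv (smul ?k (S h (S t X) - S t X)) (S t (smul ?k ?D))"
      proof (rule SG.eqv_trans[OF _ _ _ SG.eqv_sm[OF _ _ 2]])
        show "SG.eqv (smul ?k (S t ?D)) (S t (smul ?k ?D))"
          by (rule SG.eqv_sym[OF kD(2) H.sm_closed[OF cl(6)] SG.S_sm[OF t cl(5)]])
      qed (use cl SX kD in \<open>auto intro!: H.sm_closed H.diff_closed\<close>)
      have 4: "SG.eqv (smul ?k (S h (S t X) - S t X) - S t ?A) (S t (smul ?k ?D - ?A))"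
      proof (rule SG.eqv_trans[OF _ _ _ SG.eqv_diff[OF _ _ SX(2,2) 3 SG.eqv_refl]])
        show "SG.eqv (S t (smul ?k ?D) - S t ?A) (S t (smul ?k ?D - ?A))"
          by (rule SG.eqv_sym[OF _ _ SG.S_diff[OF t kD(1) AH]]) (use kD AH SX t in \<open>auto intro!: H.diff_closed SG.S_closed\<close>)
      qed (use cl SX kD AH t in \<open>auto intro!: H.sm_closed H.diff_closed SG.S_closed\<close>)
      have cl4: "smul ?k (S h (S t X) - S t X) - S t ?A \<in> HH L" "S t (smul ?k ?D - ?A) \<in> HH L"
        using cl SX kD AH t by (auto intro!: H.sm_closed H.diff_closed SG.S_closed)
      have "Hnorm L (smul ?k (S h (S t X) - S t X) - S t ?A) = Hnorm L (S t (smul ?k ?D - ?A))"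
        by (rule SG.eqv_nrm[OF cl4 4])
      then show ?thesis using M[OF H.diff_closed[OF kD(1) AH]] H.nrm_nonneg[OF cl4(1)] by simp
    qed
    then show "\<forall>\<^sub>F h in at_right 0. norm (Hnorm L (smul (of_real (1 / h)) (S h (S t X) - S t X) - S t ?A))
       \<le> M * Hnorm L (smul (of_real (1 / h)) (S h X - X) - ?A)"
      by (auto simp: eventually_at_filter)
  qed
  then show ?thesis unfolding generator_iff[OF SX] .
qed

text \<open>Invariance of the domain shows that \<open>adj L (S t) (A_star \<psi>)\<close> serves as
  the weak adjoint image of \<open>adj L (S t) \<psi>\<close>; \<open>B_star_weak\<close> then
  expresses the trace by the two lifts, and the operators move back onto them.\<close>

lemma B_star_adj:
  assumes t: "t \<ge> 0" and \<psi>: "\<psi> \<in> dom_A L"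
  shows "cnj (B_star L (adj L (S t) \<psi>)) = ip L (S t lift1) \<psi> - ip L (S t lift0) (A_star \<psi>)"
proof -
  have \<psi>H: "\<psi> \<in> HH L" "A_star \<psi> \<in> HH L" using \<psi> by (auto intro: dom_A_HH A_star_HH)
  have "cnj (B_star L (adj L (S t) \<psi>)) = ip L lift1 (adj L (S t) \<psi>) - ip L lift0 (adj L (S t) (A_star \<psi>))"
  proof (rule B_star_weak[OF adj_S(1)[OF t \<psi>H(1)] adj_S(1)[OF t \<psi>H(2)]])
    fix X assume X: "X \<in> dom_A L"
    then have XH: "X \<in> HH L" "op_A L c \<beta> X \<in> HH L" by (auto intro: dom_A_HH op_A_HH)
    obtain X' where X': "X' \<in> dom_A L" "Hnorm L (S t X - X') = 0" "Hnorm L (S t (op_A L c \<beta> X) - op_A L c \<beta> X') = 0"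
      using S_dom[OF t X] by blast
    have "ip L (op_A L c \<beta> X) (adj L (S t) \<psi>) = ip L (S t (op_A L c \<beta> X)) \<psi>" using adj_S(2)[OF t \<psi>H(1) XH(2)] by simp
    also have "\<dots> = ip L (op_A L c \<beta> X') \<psi>"
      by (rule H.ip_cong0[OF SG.S_closed[OF t XH(2)] op_A_HH[OF X'(1)] \<psi>H(1) X'(3)])
    also have "\<dots> = ip L X' (A_star \<psi>)" by (rule adjoint_identity[OF X'(1) \<psi>])
    also have "\<dots> = ip L (S t X) (A_star \<psi>)"
      by (rule H.ip_cong0[OF SG.S_closed[OF t XH(1)] dom_A_HH[OF X'(1)] \<psi>H(2) X'(2), symmetric])
    also have "\<dots> = ip L X (adj L (S t) (A_star \<psi>))" by (rule adj_S(2)[OF t \<psi>H(2) XH(1)])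
    finally show "ip L (op_A L c \<beta> X) (adj L (S t) \<psi>) = ip L X (adj L (S t) (A_star \<psi>))" .
  qed
  then show ?thesis using adj_S(2)[OF t \<psi>H(1) lift1_HH] adj_S(2)[OF t \<psi>H(2) lift0_HH] by simp
qed

lemma ip_phi_A_star: "\<psi> \<in> dom_A L \<Longrightarrow> ip L (phi L c \<beta> j) (A_star \<psi>) = lam j * ip L (phi L c \<beta> j) \<psi>"
proof -
  assume \<psi>: "\<psi> \<in> dom_A L"
  have "ip L (phi L c \<beta> j) (A_star \<psi>) = ip L (op_A L c \<beta> (phi L c \<beta> j)) \<psi>" by (rule adjoint_identity[OF phi_dom \<psi>, symmetric])
  also have "\<dots> = ip L (smul (lam j) (phi L c \<beta> j)) \<psi>"
    by (rule H.ip_cong0[OF op_A_HH[OF phi_dom] H.sm_closed[OF phi_HH] dom_A_HH[OF \<psi>] phi_eigen])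
  finally show ?thesis by (simp add: H.ip_sm phi_HH dom_A_HH \<psi>)
qed

text \<open>The expansions of both lifts are propagated by the semigroup. Their coefficients combine
  to \<open>cnj (tr j)\<close> because \<open>A_star\<close> on the test side supplies the factor
  \<open>lam j\<close>. Uniformity in time permits integration against a control term by
  term.\<close>

lemma kernel_uniform_limit:
  assumes \<psi>: "\<psi> \<in> dom_A L"
  shows "uniform_limit {0..T} (\<lambda>F t. \<Sum>j\<in>F. cnj (tr j) * exp (lam j * of_real t) * ip L (phi L c \<beta> j) \<psi>)
     (\<lambda>t. cnj (B_star L (adj L (S t) \<psi>))) (finite_subsets_at_top modes)"
proof -
  obtain a0 where a0: "has_expansion L c \<beta> lift0 a0" using expansion_lift0 by blast
  obtain a1 where a1: "has_expansion L c \<beta> lift1 a1" using expansion_lift1 by blast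
  have \<psi>H: "\<psi> \<in> HH L" "A_star \<psi> \<in> HH L" using \<psi> by (auto intro: dom_A_HH A_star_HH)
  obtain M where M: "M \<ge> 1" "\<And>t Y. t \<in> {0..T} \<Longrightarrow> Y \<in> HH L \<Longrightarrow> Hnorm L (S t Y) \<le> M * Hnorm L Y"
    using SG.bounded_on_interval[of T] by blast
  have tr: "cnj (tr j) = a1 j - lam j * a0 j" if "j \<in> modes" for j
    using trace_psi[OF that] has_expansion_coeff[OF lift1_HH a1 that] has_expansion_coeff[OF lift0_HH a0 that] by simp
  let ?e = "\<lambda>F. M * Hnorm L (lift1 - (\<Sum>j\<in>F. smul (a1 j) (phi L c \<beta> j))) * Hnorm L \<psi>
      + M * Hnorm L (lift0 - (\<Sum>j\<in>F. smul (a0 j) (phi L c \<beta> j))) * Hnorm L (A_star \<psi>)"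
  have lim: "(?e \<longlongrightarrow> M * 0 * Hnorm L \<psi> + M * 0 * Hnorm L (A_star \<psi>)) (finite_subsets_at_top modes)"
    using a0 a1 unfolding has_expansion_def by (intro tendsto_intros)
  have bd: "cmod ((\<Sum>j\<in>F. cnj (tr j) * exp (lam j * of_real t) * ip L (phi L c \<beta> j) \<psi>) - cnj (B_star L (adj L (S t) \<psi>))) \<le> ?e F"
    if F: "F \<subseteq> modes" and t: "t \<in> {0..T}" for F t
  proof -
    have t0: "t \<ge> 0" using t by simp
    let ?T = "\<lambda>a. \<Sum>j\<in>F. smul (exp (lam j * of_real t) * a j) (phi L c \<beta> j)"
    have est: "cmod (ip L (S t X) Y - ip L (?T a) Y) \<le> M * Hnorm L (X - (\<Sum>j\<in>F. smul (a j) (phi L c \<beta> j))) * Hnorm L Y"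
      if X: "X \<in> HH L" and Y: "Y \<in> HH L" for X Y a
    proof -
      have cl: "S t X - ?T a \<in> HH L" by (intro H.diff_closed SG.S_closed t0 X expansion_sum_HH)
      have "ip L (S t X) Y - ip L (?T a) Y = ip L (S t X - ?T a) Y"
        by (simp add: H.ip_diff SG.S_closed t0 X Y expansion_sum_HH)
      then have "cmod (ip L (S t X) Y - ip L (?T a) Y) \<le> Hnorm L (S t X - ?T a) * Hnorm L Y"
        using H.cauchy_schwarz[OF cl Y] by simp
      also have "\<dots> \<le> M * Hnorm L (X - (\<Sum>j\<in>F. smul (a j) (phi L c \<beta> j))) * Hnorm L Y"
        by (intro mult_right_mono S_expansion_bound[OF t0 M(2)[OF t] X] H.nrm_nonneg Y)
      finally show ?thesis .
    qed
    have ipT: "ip L (?T a) Y = (\<Sum>j\<in>F. exp (lam j * of_real t) * a j * ip L (phi L c \<beta> j) Y)" if Y: "Y \<in> HH L" for Y a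
      by (subst H.ip_sum) (auto intro!: H.sm_closed phi_HH Y simp: H.ip_sm[OF phi_HH Y])
    have "(\<Sum>j\<in>F. cnj (tr j) * exp (lam j * of_real t) * ip L (phi L c \<beta> j) \<psi>) = ip L (?T a1) \<psi> - ip L (?T a0) (A_star \<psi>)"
      unfolding ipT[OF \<psi>H(1)] ipT[OF \<psi>H(2)] sum_subtractf[symmetric]
      by (intro sum.cong refl) (use F in \<open>auto simp: tr ip_phi_A_star[OF \<psi>] algebra_simps\<close>)
    then have eq: "(\<Sum>j\<in>F. cnj (tr j) * exp (lam j * of_real t) * ip L (phi L c \<beta> j) \<psi>) - cnj (B_star L (adj L (S t) \<psi>))
      = (ip L (S t lift0) (A_star \<psi>) - ip L (?T a0) (A_star \<psi>)) - (ip L (S t lift1) \<psi> - ip L (?T a1) \<psi>)"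
      unfolding B_star_adj[OF t0 \<psi>] by (simp only: algebra_simps)
    show ?thesis
      unfolding eq
      by (rule order_trans[OF norm_triangle_ineq4], subst add.commute)
        (rule add_mono[OF est[OF lift1_HH \<psi>H(1)] est[OF lift0_HH \<psi>H(2)]])
  qed
  show ?thesis
  proof (rule uniform_limitI)
    fix \<epsilon> :: real assume \<epsilon>: "\<epsilon> > 0"
    have "\<forall>\<^sub>F F in finite_subsets_at_top modes. ?e F < \<epsilon>" using lim \<epsilon> by (intro order_tendstoD) auto
    moreover have "\<forall>\<^sub>F F in finite_subsets_at_top modes. F \<subseteq> modes"
      unfolding eventually_finite_subsets_at_top by (intro exI[of _ "{}"]) auto
    ultimately show "\<forall>\<^sub>F F in finite_subsets_at_top modes. \<forall>t\<in>{0..T}.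
      dist (\<Sum>j\<in>F. cnj (tr j) * exp (lam j * of_real t) * ip L (phi L c \<beta> j) \<psi>) (cnj (B_star L (adj L (S t) \<psi>))) < \<epsilon>"
    proof eventually_elim
      case (elim F)
      show ?case unfolding dist_norm using bd[OF elim(2)] elim(1) by (meson order.strict_trans1)
    qed
  qed
qed

lemma kernel_psi:
  assumes j: "j \<in> modes" and t: "t \<ge> 0"
  shows "cnj (B_star L (adj L (S t) (psi j))) = cnj (tr j) * exp (lam j * of_real t)"
proof -
  have "((\<lambda>F. \<Sum>i\<in>F. cnj (tr i) * exp (lam i * of_real t) * ip L (phi L c \<beta> i) (psi j)) \<longlongrightarrow> cnj (B_star L (adj L (S t) (psi j)))) (finite_subsets_at_top modes)"
    using tendsto_uniform_limitI[OF kernel_uniform_limit[OF psi_dom[OF j], of t], of t] t by simp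
  moreover have "((\<lambda>F. \<Sum>i\<in>F. cnj (tr i) * exp (lam i * of_real t) * ip L (phi L c \<beta> i) (psi j)) \<longlongrightarrow> cnj (tr j) * exp (lam j * of_real t)) (finite_subsets_at_top modes)"
  proof (rule tendsto_eventually)
    show "\<forall>\<^sub>F F in finite_subsets_at_top modes. (\<Sum>i\<in>F. cnj (tr i) * exp (lam i * of_real t) * ip L (phi L c \<beta> i) (psi j)) = cnj (tr j) * exp (lam j * of_real t)"
      unfolding eventually_finite_subsets_at_top
    proof (intro exI[of _ "{j}"] conjI allI impI)
      fix F assume F: "finite F \<and> {j} \<subseteq> F \<and> F \<subseteq> modes"
      then have "(\<Sum>i\<in>F. cnj (tr i) * exp (lam i * of_real t) * ip L (phi L c \<beta> i) (psi j)) = (\<Sum>i\<in>F. if i = j then cnj (tr j) * exp (lam j * of_real t) else 0)"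
        using j by (intro sum.cong refl) (auto simp: biorthogonal)
      then show "(\<Sum>i\<in>F. cnj (tr i) * exp (lam i * of_real t) * ip L (phi L c \<beta> i) (psi j)) = cnj (tr j) * exp (lam j * of_real t)" using F by simp
    qed (use j in auto)
  qed
  ultimately show ?thesis using tendsto_unique[OF finite_subsets_at_top_neq_bot] by blast
qed

section \<open>Mild solutions started at zero\<close>

lemma S_zero_ip: "t \<ge> 0 \<Longrightarrow> Y \<in> HH L \<Longrightarrow> ip L (S t 0) Y = 0"
  using H.ip_cong0[of "S t 0" 0 Y] SG.S_zero[of t] by (simp add: SG.S_closed H.zero_closed SG.eqv_def H.ip_zero)

text \<open>Constructs the controlled state from its moments: the uniformly convergent kernel series
  may be integrated termwise against a continuous control, and the result is the weak formulation on
  the domain.\<close>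

lemma mild_solution_expansion:
  fixes u :: "real \<Rightarrow> complex"
  assumes t: "t \<ge> 0" and u: "continuous_on {0..t} u" and X: "X \<in> HH L"
    and e: "has_expansion L c \<beta> X (\<lambda>j. cnj (tr j) * integral {0..t} (\<lambda>s. u s * exp (lam j * of_real (t - s))))"
  shows "mild_solution L S 0 u t X"
  unfolding mild_solution_def
proof (intro conjI ballI X)
  fix \<psi> assume \<psi>: "\<psi> \<in> dom_A L"
  let ?K = "\<lambda>s. cnj (B_star L (adj L (S s) \<psi>))"
  let ?\<Sigma> = "\<lambda>F s. \<Sum>j\<in>F. cnj (tr j) * exp (lam j * of_real s) * ip L (phi L c \<beta> j) \<psi>"
  have ul: "uniform_limit {0..t} ?\<Sigma> ?K (finite_subsets_at_top modes)" by (rule kernel_uniform_limit[OF \<psi>])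
  have Kc: "continuous_on {0..t} ?K"
    by (rule uniform_limit_theorem[OF _ ul finite_subsets_at_top_neq_bot])
      (auto intro!: always_eventually continuous_intros)
  have mt: "(\<lambda>s. t - s) ` {0..t} \<subseteq> {0..t}" by auto
  have Kc': "continuous_on {0..t} (\<lambda>s. ?K (t - s))"
    by (rule continuous_on_compose2[OF Kc _ mt]) (intro continuous_intros)
  have ul': "uniform_limit {0..t} (\<lambda>F s. ?\<Sigma> F (t - s)) (\<lambda>s. ?K (t - s)) (finite_subsets_at_top modes)"
    by (rule uniform_limit_compose'[OF ul]) auto
  have bu: "bounded (u ` {0..t})" "bounded ((\<lambda>s. ?K (t - s)) ` {0..t})"
    using u Kc' by (auto intro!: compact_imp_bounded compact_continuous_image)
  have "uniform_limit {0..t} (\<lambda>F s. u s * ?\<Sigma> F (t - s)) (\<lambda>s. u s * ?K (t - s)) (finite_subsets_at_top modes)"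
    by (rule uniform_lim_mult[OF uniform_limit_const ul' bu])
  then obtain I J where I: "\<And>F. ((\<lambda>s. u s * ?\<Sigma> F (t - s)) has_integral I F) {0..t}"
    and J: "((\<lambda>s. u s * ?K (t - s)) has_integral J) {0..t}" and IJ: "(I \<longlongrightarrow> J) (finite_subsets_at_top modes)"
    by (rule uniform_limit_integral) (auto intro!: continuous_intros u)
  have "I F = (\<Sum>j\<in>F. cnj (tr j) * integral {0..t} (\<lambda>s. u s * exp (lam j * of_real (t - s))) * ip L (phi L c \<beta> j) \<psi>)" for F
  proof -
    have "((\<lambda>s. \<Sum>j\<in>F. (cnj (tr j) * ip L (phi L c \<beta> j) \<psi>) * (u s * exp (lam j * of_real (t - s)))) has_integral
       (\<Sum>j\<in>F. (cnj (tr j) * ip L (phi L c \<beta> j) \<psi>) * integral {0..t} (\<lambda>s. u s * exp (lam j * of_real (t - s))))) {0..t}"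
      if "finite F"
      by (intro has_integral_sum that has_integral_mult_right integrable_integral integrable_continuous_interval continuous_intros u)
    moreover have "(\<lambda>s. \<Sum>j\<in>F. (cnj (tr j) * ip L (phi L c \<beta> j) \<psi>) * (u s * exp (lam j * of_real (t - s)))) = (\<lambda>s. u s * ?\<Sigma> F (t - s))"
      by (rule ext) (simp add: sum_distrib_left algebra_simps)
    ultimately have "finite F \<Longrightarrow> I F = (\<Sum>j\<in>F. (cnj (tr j) * ip L (phi L c \<beta> j) \<psi>) * integral {0..t} (\<lambda>s. u s * exp (lam j * of_real (t - s))))"
      using has_integral_unique[OF I[of F]] by simp
    \<comment> \<open>For an infinite index set both the integrand and the sum are the default value
      0 of \<open>sum\<close>.\<close>
    moreover have "infinite F \<Longrightarrow> I F = 0" using I[of F] has_integral_0_eq by simp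
    ultimately show ?thesis by (cases "finite F") (simp_all add: algebra_simps)
  qed
  then have "((\<lambda>F. \<Sum>j\<in>F. cnj (tr j) * integral {0..t} (\<lambda>s. u s * exp (lam j * of_real (t - s))) * ip L (phi L c \<beta> j) \<psi>) \<longlongrightarrow> J) (finite_subsets_at_top modes)"
    using IJ by presburger
  moreover have "((\<lambda>F. \<Sum>j\<in>F. cnj (tr j) * integral {0..t} (\<lambda>s. u s * exp (lam j * of_real (t - s))) * ip L (phi L c \<beta> j) \<psi>) \<longlongrightarrow> ip L X \<psi>) (finite_subsets_at_top modes)"
    by (rule has_expansion_ip[OF X e dom_A_HH[OF \<psi>]])
  ultimately have "ip L X \<psi> = J" using tendsto_unique[OF finite_subsets_at_top_neq_bot] by blast
  moreover have "(LINT s|lebesgue_on {0..t}. u s * ?K (t - s)) = J"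
  proof -
    have "integrable (mI t) (\<lambda>s. u s * ?K (t - s))"
      by (intro integrable_continuous_mI continuous_on_mult u Kc')
    then show ?thesis by (rule trans[OF integral_mI_HK integral_unique[OF J]])
  qed
  ultimately show "ip L X \<psi> = ip L (S t 0) \<psi> + (LINT s|lebesgue_on {0..t}. u s * ?K (t - s))"
    by (simp add: S_zero_ip[OF t dom_A_HH[OF \<psi>]])
qed

text \<open>Testing against a dual vector isolates one moment. The control may be arbitrary here, so
  this applies to all competitors in the minimisation of the norm.\<close>

lemma mild_solution_coeff:
  assumes "t \<ge> 0" "mild_solution L S 0 u t X" "j \<in> modes"
  shows "ip L X (psi j) = (LINT s|mI t. u s * (cnj (tr j) * exp (lam j * of_real (t - s))))"
proof -
  have "ip L X (psi j) = ip L (S t 0) (psi j) + (LINT s|mI t. u s * cnj (B_star L (adj L (S (t - s)) (psi j))))"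
    using assms psi_dom unfolding mild_solution_def by blast
  moreover have "(LINT s|mI t. u s * cnj (B_star L (adj L (S (t - s)) (psi j)))) = (LINT s|mI t. u s * (cnj (tr j) * exp (lam j * of_real (t - s))))"
    by (rule Bochner_Integration.integral_cong) (auto simp: kernel_psi[OF assms(3)])
  ultimately show ?thesis using S_zero_ip[OF assms(1) psi_HH[OF assms(3)]] by simp
qed

end

section \<open>The control\<close>

lemma integral_exp_by_parts:
  fixes V V' :: "real \<Rightarrow> complex" and z :: complex
  assumes "\<And>x. (V has_vector_derivative V' x) (at x)" "continuous_on UNIV V'" "0 \<le> t"
  shows "z * integral {0..t} (\<lambda>y. V y * exp (z * of_real y))
    = V t * exp (z * of_real t) - V 0 - integral {0..t} (\<lambda>y. V' y * exp (z * of_real y))"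
proof -
  have Vc: "continuous_on {0..t} V" "continuous_on {0..t} V'"
    using continuous_on_of_vector_derivative[OF has_vector_derivative_at_within[OF assms(1)]] continuous_on_subset[OF assms(2)]
    by auto
  have "((\<lambda>y. V y * (z * exp (z * of_real y)) + V' y * exp (z * of_real y)) has_integral
      (V t * exp (z * of_real t) - V 0 * exp (z * of_real 0))) {0..t}"
  proof (rule fundamental_theorem_of_calculus[OF assms(3)])
    fix x assume "x \<in> {0..t}"
    have "((\<lambda>y. z * of_real y) has_vector_derivative z) (at x within {0..t})"
      by (auto intro!: derivative_eq_intros has_vector_derivative_real_field)
    then have "((\<lambda>y. exp (z * of_real y)) has_vector_derivative z * exp (z * of_real x)) (at x within {0..t})"
      using field_vector_diff_chain_within[OF _ DERIV_subset[OF DERIV_exp], of "\<lambda>y. z * of_real y" z x "{0..t}"] by (simp add: o_def)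
    then show "((\<lambda>y. V y * exp (z * of_real y)) has_vector_derivative
        (V x * (z * exp (z * of_real x)) + V' x * exp (z * of_real x))) (at x within {0..t})"
      by (rule has_vector_derivative_mult[OF has_vector_derivative_at_within[OF assms(1)]])
  qed
  then have "integral {0..t} (\<lambda>y. V y * (z * exp (z * of_real y)) + V' y * exp (z * of_real y)) = V t * exp (z * of_real t) - V 0"
    by (simp add: integral_unique)
  moreover have "integral {0..t} (\<lambda>y. V y * (z * exp (z * of_real y)) + V' y * exp (z * of_real y))
     = integral {0..t} (\<lambda>y. V y * (z * exp (z * of_real y))) + integral {0..t} (\<lambda>y. V' y * exp (z * of_real y))"
    by (intro integral_add integrable_continuous_interval continuous_intros Vc)
  moreover have "integral {0..t} (\<lambda>y. V y * (z * exp (z * of_real y))) = z * integral {0..t} (\<lambda>y. V y * exp (z * of_real y))"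
    by (subst integral_mult_right[symmetric]) (simp add: mult.left_commute)
  ultimately show ?thesis by (simp add: algebra_simps)
qed

lemma integral_exp_bound:
  fixes V :: "real \<Rightarrow> complex"
  assumes V: "continuous_on {s..t} V" "\<And>x. x \<in> {s..t} \<Longrightarrow> cmod (V x) \<le> M" and p: "p > 0" and st: "s \<le> t"
  shows "cmod (integral {s..t} (\<lambda>y. V y * of_real (exp (- p * y)))) \<le> M * exp (- p * s) / p"
proof -
  have M: "M \<ge> 0" using V(2)[of s] st norm_ge_zero order_trans by (metis atLeastAtMost_iff order_refl)
  have I: "((\<lambda>y. M * exp (- p * y)) has_integral (- M * exp (- p * t) / p - - M * exp (- p * s) / p)) {s..t}"
    using p by (intro fundamental_theorem_of_calculus[OF st])
      (auto intro!: derivative_eq_intros simp: has_real_derivative_iff_has_vector_derivative[symmetric])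
  have "cmod (integral {s..t} (\<lambda>y. V y * of_real (exp (- p * y)))) \<le> integral {s..t} (\<lambda>y. M * exp (- p * y))"
  proof (rule integral_norm_bound_integral)
    show "(\<lambda>y. V y * of_real (exp (- p * y))) integrable_on {s..t}"
      by (intro integrable_continuous_interval continuous_intros V)
    show "(\<lambda>y. M * exp (- p * y)) integrable_on {s..t}" using I by blast
    show "cmod (V x * of_real (exp (- p * x))) \<le> M * exp (- p * x)" if "x \<in> {s..t}" for x
      using V(2)[OF that] by (simp add: norm_mult mult_right_mono)
  qed
  also have "\<dots> = - M * exp (- p * t) / p - - M * exp (- p * s) / p" by (rule integral_unique[OF I])
  also have "\<dots> \<le> M * exp (- p * s) / p" using M p by simp
  finally show ?thesis .
qed

section \<open>Approximation by the hyperbolic exponentials\<close>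

inductive trig_poly :: "real \<Rightarrow> (real \<Rightarrow> complex) \<Rightarrow> bool" for L where
  mono: "trig_poly L (\<lambda>x. a * exp (\<i> * of_real (real_of_int k * pi * x / L)))"
| add: "trig_poly L f \<Longrightarrow> trig_poly L g \<Longrightarrow> trig_poly L (\<lambda>x. f x + g x)"

lemma trig_poly_const: "trig_poly L (\<lambda>x. a)"
  using trig_poly.mono[of L a 0] by simp

lemma trig_poly_mult:
  assumes "trig_poly L f" "trig_poly L g" shows "trig_poly L (\<lambda>x. f x * g x)"
  using assms
proof (induction f rule: trig_poly.induct)
  case (mono a k)
  from mono.prems show ?case
  proof (induction g rule: trig_poly.induct)
    case (mono b l)
    have "(\<lambda>x. a * exp (\<i> * of_real (real_of_int k * pi * x / L)) * (b * exp (\<i> * of_real (real_of_int l * pi * x / L))))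
      = (\<lambda>x. a * b * exp (\<i> * of_real (real_of_int (k + l) * pi * x / L)))"
      by (rule ext) (simp add: exp_add[symmetric] ring_distribs add_divide_distrib)
    then show ?case using trig_poly.mono[of L "a * b" "k + l"] by simp
  qed (simp add: ring_distribs trig_poly.add)
qed (simp add: ring_distribs trig_poly.add)

lemma trig_poly_periodic:
  assumes "trig_poly L f" "L > 0" shows "f (x + 2 * L) = f x"
  using assms(1)
proof (induction rule: trig_poly.induct)
  case (mono a k)
  have "\<i> * of_real (real_of_int k * pi * (x + 2 * L) / L) = \<i> * of_real (real_of_int k * pi * x / L) + 2 * of_int k * of_real pi * \<i>"
    using assms(2) by (simp add: field_simps)
  moreover have "exp (2 * of_int k * of_real pi * \<i>) = 1" using exp_integer_2pi[OF Ints_of_int[of k]] by simp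
  ultimately show ?case by (simp only: exp_add mult_1_right)
qed simp

lemma trig_poly_polynomial:
  assumes "real_polynomial_function r"
  shows "trig_poly L (\<lambda>x. of_real (r (exp (\<i> * of_real (pi * x / L)))))"
  using assms
proof (induction r rule: real_polynomial_function.induct)
  case (linear f)
  interpret f: bounded_linear f by (rule linear)
  have f: "f z = Re z * f 1 + Im z * f \<i>" for z
  proof -
    have "f z = f (Re z *\<^sub>R 1 + Im z *\<^sub>R \<i>)" by (rule arg_cong[of _ _ f]) (simp add: complex_eq_iff)
    then show ?thesis by (simp only: f.add f.scaleR) simp
  qed
  have "(\<lambda>x. of_real (f (exp (\<i> * of_real (pi * x / L))))) =
    (\<lambda>x. (of_real (f 1) - \<i> * of_real (f \<i>)) / 2 * exp (\<i> * of_real (real_of_int 1 * pi * x / L))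
       + (of_real (f 1) + \<i> * of_real (f \<i>)) / 2 * exp (\<i> * of_real (real_of_int (-1) * pi * x / L)))"
  proof (rule ext)
    fix x
    have c: "exp (\<i> * of_real (pi * x / L)) = cis (pi * x / L)" "exp (\<i> * of_real (real_of_int 1 * pi * x / L)) = cis (pi * x / L)"
      "exp (\<i> * of_real (real_of_int (-1) * pi * x / L)) = cis (- (pi * x / L))"
      by (simp_all add: cis_conv_exp)
    show "of_real (f (exp (\<i> * of_real (pi * x / L)))) =
      (of_real (f 1) - \<i> * of_real (f \<i>)) / 2 * exp (\<i> * of_real (real_of_int 1 * pi * x / L))
       + (of_real (f 1) + \<i> * of_real (f \<i>)) / 2 * exp (\<i> * of_real (real_of_int (-1) * pi * x / L))"
      unfolding c by (subst f) (simp add: complex_eq_iff field_simps)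
  qed
  then show ?case by (simp only: trig_poly.add[OF trig_poly.mono trig_poly.mono])
qed (simp_all add: trig_poly_const trig_poly.add trig_poly_mult)

text \<open>A periodic function is a function on the unit circle, where Stone-Weierstrass gives
  polynomials in real and imaginary part; restricted to the circle these are trigonometric
  polynomials.\<close>

lemma periodic_trig_approx:
  fixes v :: "real \<Rightarrow> complex"
  assumes L: "L > 0" and v: "continuous_on {0..2 * L} v" "v (2 * L) = v 0" and e: "e > 0"
  obtains g where "trig_poly L g" "\<And>x. 0 \<le> x \<Longrightarrow> x < 2 * L \<Longrightarrow> cmod (v x - g x) < e"
proof -
  define p where "p s = v (2 * L * s)" for s
  define h where "h = p \<circ> (\<lambda>z. Arg2pi z / (2 * pi))"
  have "continuous_on {0..1} p" unfolding p_def
    by (rule continuous_on_compose2[OF v(1)]) (use L in \<open>auto intro!: continuous_intros\<close>)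
  \<comment> \<open>A loop is homotopic to itself; the passage from loops to circle maps then yields
    continuity of \<open>h\<close> also across the cut of \<open>Arg2pi\<close>.\<close>
  then have "homotopic_loops UNIV p p"
    unfolding homotopic_loops_refl using v(2) by (auto simp: path_def pathfinish_def pathstart_def p_def)
  then have hc: "continuous_on (sphere 0 1) h"
    unfolding h_def by (rule homotopic_with_imp_continuous[OF homotopic_loops_imp_homotopic_circlemaps, THEN conjunct1])
  obtain G where G: "polynomial_function G" "\<And>z. z \<in> sphere 0 1 \<Longrightarrow> cmod (h z - G z) < e"
    using Stone_Weierstrass_polynomial_function[OF compact_sphere hc e] by blast
  have r: "real_polynomial_function (\<lambda>z. Re (G z))" "real_polynomial_function (\<lambda>z. Im (G z))"
    using G(1) bounded_linear_Re bounded_linear_Im unfolding polynomial_function_def o_def by blast+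
  have "trig_poly L (\<lambda>x. of_real (Re (G (exp (\<i> * of_real (pi * x / L))))) + \<i> * of_real (Im (G (exp (\<i> * of_real (pi * x / L))))))"
    by (intro trig_poly.add trig_poly_mult trig_poly_const trig_poly_polynomial[OF r(1)] trig_poly_polynomial[OF r(2)])
  then have "trig_poly L (\<lambda>x. G (exp (\<i> * of_real (pi * x / L))))" by (simp add: complex_eq[symmetric])
  moreover have "cmod (v x - G (exp (\<i> * of_real (pi * x / L)))) < e" if "0 \<le> x" "x < 2 * L" for x
  proof -
    have "Arg2pi (exp (\<i> * of_real (pi * x / L))) = pi * x / L"
      using that L by (subst Arg2pi_exp) (auto simp: field_simps)
    then have "h (exp (\<i> * of_real (pi * x / L))) = v x" using L by (simp add: h_def p_def)
    then show ?thesis using G(2)[of "exp (\<i> * of_real (pi * x / L))"] by (simp add: norm_exp_eq_Re)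
  qed
  ultimately show ?thesis using that by blast
qed

text \<open>An antiperiodic function is the half-frequency factor \<open>?q\<close> times a periodic
  one, hence a uniform limit of combinations of hyperbolic exponentials on \<open>{0..T}\<close>, to
  each of which d is orthogonal.\<close>

lemma antiperiodic_orthogonal:
  fixes d w :: "real \<Rightarrow> complex"
  assumes L: "L > 0" and d: "integrable (lebesgue_on {0..T}) d" and w: "continuous_on UNIV w"
    and anti: "\<And>x. 0 \<le> x \<Longrightarrow> x \<le> T \<Longrightarrow> w (x + 2 * L) = - w x"
    and orth: "\<And>m::int. (LINT s|lebesgue_on {0..T}. d s * exp (\<i> * of_real ((2 * real_of_int m + 1) * pi / (2 * L)) * of_real (T - s))) = 0"
    and T: "T \<ge> 0"
  shows "(LINT s|lebesgue_on {0..T}. d s * w (T - s)) = 0"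
proof -
  let ?M = "lebesgue_on {0..T}" and ?q = "\<lambda>x. exp (\<i> * of_real (pi * x / (2 * L)))"
  have dint: "integrable ?M (\<lambda>s. d s * k s)" if k: "continuous_on {0..T} k" for k
  proof -
    obtain B where B: "\<And>s. s \<in> {0..T} \<Longrightarrow> cmod (k s) \<le> B"
      using compact_imp_bounded[OF compact_continuous_image[OF k compact_Icc]] unfolding bounded_iff by fastforce
    show ?thesis
    proof (rule Bochner_Integration.integrable_bound)
      show "integrable ?M (\<lambda>s. B * cmod (d s))" using d by simp
      show "(\<lambda>s. d s * k s) \<in> borel_measurable ?M"
        using d continuous_imp_measurable_on_sets_lebesgue[OF k] by auto
      have "cmod (d s * k s) \<le> norm (B * cmod (d s))" if "s \<in> {0..T}" for s
        using mult_left_mono[OF order_trans[OF B[OF that] abs_ge_self], of "cmod (d s)"] by (simp add: norm_mult abs_mult mult.commute)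
      then show "AE s in ?M. cmod (d s * k s) \<le> norm (B * cmod (d s))"
        by (auto simp: AE_restrict_space_iff)
    qed
  qed
  have gc: "continuous_on UNIV g" if "trig_poly L g" for g
    using that by (induction rule: trig_poly.induct) (use L in \<open>auto intro!: continuous_intros\<close>)
  have qgc: "continuous_on {0..T} (\<lambda>s. ?q (T - s) * g (T - s))" if "trig_poly L g" for g
    using L by (auto intro!: continuous_intros continuous_on_compose2[OF gc[OF that]])
  have wc: "continuous_on {0..T} (\<lambda>s. w (T - s))"
    by (auto intro!: continuous_intros continuous_on_compose2[OF w])
  have vanish: "(LINT s|?M. d s * (?q (T - s) * g (T - s))) = 0" if "trig_poly L g" for g
    using that
  proof (induction rule: trig_poly.induct)
    case (mono a k)
    have "?q x * exp (\<i> * of_real (real_of_int k * pi * x / L)) = exp (\<i> * of_real ((2 * real_of_int k + 1) * pi / (2 * L)) * of_real x)" for x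
    proof -
      have "\<i> * of_real (pi * x / (2 * L)) + \<i> * of_real (real_of_int k * pi * x / L) = \<i> * of_real ((2 * real_of_int k + 1) * pi / (2 * L)) * of_real x"
        using L by (simp add: field_simps)
      then show ?thesis by (metis exp_add)
    qed
    then have "d s * (?q (T - s) * (a * exp (\<i> * of_real (real_of_int k * pi * (T - s) / L))))
      = a * (d s * exp (\<i> * of_real ((2 * real_of_int k + 1) * pi / (2 * L)) * of_real (T - s)))" for s
      by (metis mult.left_commute)
    then show ?case by (simp only: integral_mult_right_zero orth mult_zero_right)
  next
    case (add f g)
    have "(LINT s|?M. d s * (?q (T - s) * (f (T - s) + g (T - s))))
      = (LINT s|?M. d s * (?q (T - s) * f (T - s)) + d s * (?q (T - s) * g (T - s)))"
      by (simp only: distrib_left)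
    also have "\<dots> = (LINT s|?M. d s * (?q (T - s) * f (T - s))) + (LINT s|?M. d s * (?q (T - s) * g (T - s)))"
      by (intro Bochner_Integration.integral_add dint qgc add.hyps)
    finally show ?case using add.IH by simp
  qed
  have qshift: "?q (x + 2 * L) = - ?q x" for x
  proof -
    have "\<i> * of_real (pi * (x + 2 * L) / (2 * L)) = \<i> * of_real (pi * x / (2 * L)) + of_real pi * \<i>"
      using L by (simp add: field_simps)
    then show ?thesis by (simp only: exp_add exp_pi_i) simp
  qed
  let ?N = "LINT s|?M. cmod (d s)" and ?I = "LINT s|?M. d s * w (T - s)"
  have N: "?N \<ge> 0" by (simp add: integral_nonneg_AE)
  have bd: "cmod ?I \<le> e * ?N" if e: "e > 0" for e
  proof -
    \<comment> \<open>Both w and \<open>?q\<close> change sign under the shift by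
      \<open>2 * L\<close>; their quotient has matching end values, as the periodic approximation
      requires.\<close>
    define v where "v x = w x * exp (- (\<i> * of_real (pi * x / (2 * L))))" for x
    have vc: "continuous_on {0..2 * L} v" unfolding v_def
      using L by (auto intro!: continuous_intros continuous_on_subset[OF w])
    have "v (2 * L) = v 0" using anti[of 0] T L by (simp add: v_def exp_minus)
    from periodic_trig_approx[OF L vc this e] obtain g where g: "trig_poly L g"
      "\<And>x. 0 \<le> x \<Longrightarrow> x < 2 * L \<Longrightarrow> cmod (v x - g x) < e" by blast
    have near: "cmod (w x - ?q x * g x) < e" if "0 \<le> x" "x < 2 * L" for x
    proof -
      have "w x - ?q x * g x = ?q x * (v x - g x)" by (simp add: v_def exp_minus algebra_simps)
      then show ?thesis using g(2)[OF that] by (simp add: norm_mult)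
    qed
    \<comment> \<open>The approximation on one period propagates with the same error, since w and
      \<open>?q\<close> times g change sign together.\<close>
    have near': "0 \<le> x \<Longrightarrow> x + 2 * L * real k \<le> T \<Longrightarrow> x < 2 * L \<Longrightarrow> cmod (w (x + 2 * L * real k) - ?q (x + 2 * L * real k) * g (x + 2 * L * real k)) < e" for x k
    proof (induction k)
      case (Suc k)
      let ?y = "x + 2 * L * real k"
      have y: "0 \<le> ?y" "?y \<le> T" using Suc.prems L by (simp_all add: algebra_simps)
      have s: "x + 2 * L * real (Suc k) = ?y + 2 * L" by (simp add: algebra_simps)
      have "w (?y + 2 * L) - ?q (?y + 2 * L) * g (?y + 2 * L) = - (w ?y - ?q ?y * g ?y)"
        unfolding anti[OF y] qshift trig_poly_periodic[OF g(1) L] by simp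
      then show ?case unfolding s using Suc.IH[OF Suc.prems(1) y(2) Suc.prems(3)] by (simp only: norm_minus_cancel)
    qed (use near in simp)
    have near2: "cmod (w x - ?q x * g x) < e" if x: "0 \<le> x" "x \<le> T" for x
    proof -
      define k where "k = nat \<lfloor>x / (2 * L)\<rfloor>"
      have k: "real k \<le> x / (2 * L)" "x / (2 * L) < real k + 1"
        using x L unfolding k_def by (simp_all add: of_nat_nat)
      then have "0 \<le> x - 2 * L * real k" "x - 2 * L * real k < 2 * L" using L by (simp_all add: field_simps)
      then show ?thesis using near'[of "x - 2 * L * real k" k] x by simp
    qed
    have i1: "integrable ?M (\<lambda>s. d s * w (T - s))" by (rule dint[OF wc])
    have i2: "integrable ?M (\<lambda>s. d s * (?q (T - s) * g (T - s)))" by (rule dint[OF qgc[OF g(1)]])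
    have I: "?I = (LINT s|?M. d s * w (T - s) - d s * (?q (T - s) * g (T - s)))"
      unfolding Bochner_Integration.integral_diff[OF i1 i2] vanish[OF g(1)] by (rule diff_zero[symmetric])
    have "cmod ?I \<le> (LINT s|?M. cmod (d s * w (T - s) - d s * (?q (T - s) * g (T - s))))"
      unfolding I by (rule integral_norm_bound)
    also have "\<dots> \<le> (LINT s|?M. e * cmod (d s))"
    proof (rule integral_mono_AE)
      show "integrable ?M (\<lambda>s. cmod (d s * w (T - s) - d s * (?q (T - s) * g (T - s))))"
        by (intro integrable_norm Bochner_Integration.integrable_diff i1 i2)
      show "integrable ?M (\<lambda>s. e * cmod (d s))" using d by simp
      have "cmod (d s * w (T - s) - d s * (?q (T - s) * g (T - s))) \<le> e * cmod (d s)" if s: "s \<in> {0..T}" for s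
      proof -
        have "cmod (w (T - s) - ?q (T - s) * g (T - s)) \<le> e" using near2[of "T - s"] s by auto
        then have "cmod (d s) * cmod (w (T - s) - ?q (T - s) * g (T - s)) \<le> cmod (d s) * e" by (intro mult_left_mono) auto
        then show ?thesis by (simp only: right_diff_distrib[symmetric] norm_mult mult.commute[of e])
      qed
      then show "AE s in ?M. cmod (d s * w (T - s) - d s * (?q (T - s) * g (T - s))) \<le> e * cmod (d s)"
        by (auto simp: AE_restrict_space_iff)
    qed
    also have "\<dots> = e * ?N" by simp
    finally show ?thesis .
  qed
  have "cmod ?I \<le> 0"
  proof (rule field_le_epsilon)
    fix e :: real assume e: "e > 0"
    have "cmod ?I \<le> e / (?N + 1) * ?N" using e N by (intro bd divide_pos_pos) linarith+
    also have "\<dots> = e * (?N / (?N + 1))" by simp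
    also have "\<dots> \<le> e * 1"
    proof (rule mult_left_mono)
      have "?N + 1 > 0" using N by linarith
      then show "?N / (?N + 1) \<le> 1" by (subst pos_divide_le_eq) auto
    qed (use e in simp)
    finally show "cmod ?I \<le> 0 + e" by simp
  qed
  then show ?thesis by simp
qed

lemma control_function:
  fixes L c T \<tau> :: real
  assumes L: "L > 0" and \<tau>: "0 < \<tau>" "\<tau> \<le> T"
  obtains U U' :: "real \<Rightarrow> complex" and N :: nat and K :: real where
    "\<And>x. (U has_vector_derivative U' x) (at x)" "continuous_on UNIV U'" "N \<ge> 1"
    "\<And>x. 0 \<le> x \<Longrightarrow> x \<le> T \<Longrightarrow>
       U (x + 2 * L) + of_real (exp (- ((real N * pi / L)\<^sup>2 - c) * (x + 2 * L)))
         = - (U x + of_real (exp (- ((real N * pi / L)\<^sup>2 - c) * x)))"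
    "U \<tau> \<noteq> 0"
    "\<And>n. n \<ge> 1 \<Longrightarrow> (real n * pi / L)\<^sup>2 - c > 0 \<Longrightarrow>
       cmod (integral {0..T} (\<lambda>x. U x * of_real (exp (- ((real n * pi / L)\<^sup>2 - c) * x))))
         \<le> K * exp (- ((real n * pi / L)\<^sup>2 - c) * T) / ((real n * pi / L)\<^sup>2 - c)"
proof -
  \<comment> \<open>Large enough for both the decay rate q of the chosen mode and the rate
    \<open>\<rho> = q - c\<close> of the flat function to be positive.\<close>
  obtain N :: nat where N: "2 * \<bar>c\<bar> + 1 < real N * (pi / L)\<^sup>2"
    using reals_Archimedean3[of "(pi / L)\<^sup>2" ] L by auto
  have N1: "N \<ge> 1" using N by (cases N) auto
  define q where "q = (real N * pi / L)\<^sup>2 - c"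
  \<comment> \<open>The factor \<open>exp(- c x)\<close> in \<open>e\<close> removes the shift of
    the heat eigenvalues by c; the flat function must then decay at rate \<open>q - c\<close> for
    \<open>e\<close> to decay at rate q.\<close>
  define \<rho> where "\<rho> = q - c"
  have "real N * (pi / L)\<^sup>2 \<le> (real N)\<^sup>2 * (pi / L)\<^sup>2"
    using N1 by (intro mult_right_mono) (auto simp: power2_eq_square)
  then have "2 * \<bar>c\<bar> + 1 < (real N * pi / L)\<^sup>2" using N by (simp add: power_mult_distrib power_divide)
  then have q: "q > 0" and \<rho>: "\<rho> > 0" unfolding q_def \<rho>_def by linarith+
  define k0 where "k0 = nat \<lfloor>\<tau> / (2 * L)\<rfloor>"
  define \<tau>' where "\<tau>' = \<tau> - 2 * L * real k0"
  have "real k0 \<le> \<tau> / (2 * L)" "\<tau> / (2 * L) < real k0 + 1"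
    using \<tau> L unfolding k0_def by (simp_all add: of_nat_nat)
  then have \<tau>': "0 \<le> \<tau>'" "\<tau>' < 2 * L" using L unfolding \<tau>'_def by (simp_all add: field_simps)
  \<comment> \<open>The transition of \<open>e\<close> ends at the reduced time
    \<open>\<tau>'\<close>, so that \<open>e\<close> is the pure exponential there. If
    \<open>\<tau>' = 0\<close>, the value \<open>e 0 = 0\<close> is known anyway and any b in
    \<open>(0, 2 L)\<close> serves.\<close>
  define b where "b = (if \<tau>' = 0 then L else \<tau>')"
  have b: "0 < b" "b < 2 * L" using \<tau>' L by (auto simp: b_def)
  obtain E E' :: "real \<Rightarrow> complex" where E: "\<And>x. x \<le> 0 \<Longrightarrow> E x = 0" "\<And>x. b \<le> x \<Longrightarrow> E x = of_real (exp (- \<rho> * x))"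
    "\<And>x. (E has_vector_derivative E' x) (at x)" "continuous_on UNIV E'"
    "\<And>n Y. n \<ge> 1 \<Longrightarrow> b \<le> Y \<Longrightarrow>
        integral {0..Y} (\<lambda>x. of_real (exp (- (real n * pi / L)\<^sup>2 * x)) * E x)
          = - of_real (exp (- ((real n * pi / L)\<^sup>2 + \<rho>) * Y) / ((real n * pi / L)\<^sup>2 + \<rho>))"
    using flat_function[OF L order_refl b(1) \<rho>] by blast
  define e where "e x = of_real (exp (- c * x)) * E x" for x
  define e' where "e' x = of_real (exp (- c * x)) * E' x + of_real (- c * exp (- c * x)) * E x" for x
  have Ec: "continuous_on UNIV E" by (rule continuous_on_of_vector_derivative) (use E(3) in simp)
  have e0: "e x = 0" if "x \<le> 0" for x using E(1)[OF that] by (simp add: e_def)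
  have eb: "e x = of_real (exp (- q * x))" if "b \<le> x" for x
  proof -
    have "- c * x + - \<rho> * x = - q * x" by (simp add: \<rho>_def algebra_simps)
    then show ?thesis unfolding e_def E(2)[OF that] of_real_mult[symmetric] exp_add[symmetric] by simp
  qed
  have ed: "(e has_vector_derivative e' x) (at x)" for x
    unfolding e_def e'_def
  proof (rule has_vector_derivative_mult[OF _ E(3)])
    have "((\<lambda>x. exp (- c * x)) has_real_derivative - c * exp (- c * x)) (at x)"
      by (auto intro!: derivative_eq_intros)
    then show "((\<lambda>x. complex_of_real (exp (- c * x))) has_vector_derivative of_real (- c * exp (- c * x))) (at x)"
      by (intro has_vector_derivative_of_real) (simp add: has_real_derivative_iff_has_vector_derivative)
  qed
  have ec: "continuous_on UNIV e" by (rule continuous_on_of_vector_derivative) (use ed in simp)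
  have e'c: "continuous_on UNIV e'" unfolding e'_def by (intro continuous_intros E(4) Ec)
  \<comment> \<open>Antiperiodicity of \<open>w\<close> demands
    \<open>U(x + 2 L) + U(x) = - exp(- q (x + 2 L)) - exp(- q x)\<close>; the right side equals
    \<open>- C exp(- q (x + 2 L))\<close>, which is \<open>- C e(x + 2 L)\<close> because
    \<open>b < 2 L\<close>.\<close>
  define C where "C = 1 + exp (2 * L * q)"
  have C0: "C > 0" by (simp add: C_def add_pos_pos)
  \<comment> \<open>So many translates that the next one, by \<open>2 * L * real R\<close>, still
    vanishes up to time \<open>T + 2 * L\<close>; the finite sum then satisfies the recurrence on
    \<open>[0, T]\<close>.\<close>
  obtain R :: nat where R: "(T + 2 * L) / (2 * L) < real R" using reals_Archimedean2 by blast
  define U where "U x = - of_real C * (\<Sum>k<R. (- 1) ^ k * e (x - 2 * L * real k))" for x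
  define U' where "U' x = - of_real C * (\<Sum>k<R. (- 1) ^ k * e' (x - 2 * L * real k))" for x
  have Ud: "(U has_vector_derivative U' x) (at x)" for x
  proof -
    have sh: "((\<lambda>x. e (x - 2 * L * real k)) has_vector_derivative e' (x - 2 * L * real k)) (at x)" for k
    proof -
      have "((\<lambda>x. x - 2 * L * real k) has_vector_derivative 1 - 0) (at x)"
        by (intro has_vector_derivative_diff has_vector_derivative_id has_vector_derivative_const)
      then show ?thesis
        using vector_diff_chain_at[of "\<lambda>x. x - 2 * L * real k" 1 x e "e' (x - 2 * L * real k)"] ed by (simp add: o_def)
    qed
    show ?thesis unfolding U_def U'_def
      by (intro has_vector_derivative_mult_right has_vector_derivative_sum sh)
  qed
  have U'c: "continuous_on UNIV U'" unfolding U'_def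
    by (intro continuous_intros continuous_on_compose2[OF e'c]) auto
  define w where "w x = U x + of_real (exp (- q * x))" for x
  have anti: "w (x + 2 * L) = - w x" if x: "0 \<le> x" "x \<le> T" for x
  proof -
    have Rp: "R > 0" using R x L by (cases R) (auto simp: field_simps)
    have last: "e (x + 2 * L - 2 * L * real R) = 0"
      using R x L by (intro e0) (simp add: field_simps)
    let ?f = "\<lambda>k. (- 1) ^ k * e (x + 2 * L - 2 * L * real k)"
    have "(\<Sum>k<R. ?f k) = (\<Sum>k<Suc R. ?f k)" using last by simp
    also have "\<dots> = ?f 0 + (\<Sum>k<R. ?f (Suc k))" by (rule sum.lessThan_Suc_shift)
    also have "(\<Sum>k<R. ?f (Suc k)) = - (\<Sum>k<R. (- 1) ^ k * e (x - 2 * L * real k))"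
      unfolding sum_negf[symmetric] by (rule sum.cong) (auto simp: algebra_simps)
    also have "?f 0 = of_real (exp (- q * (x + 2 * L)))" using eb[of "x + 2 * L"] x b by simp
    finally have U2: "U (x + 2 * L) = - of_real C * of_real (exp (- q * (x + 2 * L))) - U x"
      unfolding U_def by (simp only:) (simp only: ring_distribs mult_minus_right diff_conv_add_uminus)
    have "C * exp (- q * (x + 2 * L)) = exp (- q * (x + 2 * L)) + exp (2 * L * q + - q * (x + 2 * L))"
      unfolding C_def exp_add by (simp add: algebra_simps)
    also have "2 * L * q + - q * (x + 2 * L) = - q * x" by (simp add: algebra_simps)
    finally have "of_real C * of_real (exp (- q * (x + 2 * L))) = (of_real (exp (- q * (x + 2 * L)) + exp (- q * x)) :: complex)"
      unfolding of_real_mult[symmetric] by (rule arg_cong)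
    then show ?thesis unfolding w_def U2 by simp
  qed
  have "U \<tau> \<noteq> 0"
  proof -
    have U0: "U x = - of_real C * e x" if "x < 2 * L" for x
    proof -
      have "(\<Sum>k<R. (- 1) ^ k * e (x - 2 * L * real k)) = (\<Sum>k\<in>{0}. (- 1) ^ k * e (x - 2 * L * real k))"
      proof (rule sum.mono_neutral_right)
        have "1 * 1 \<le> (T + 2 * L) / (2 * L)" using \<tau> L by (simp add: field_simps)
        then show "{0} \<subseteq> {..<R}" using R by (cases R) auto
        have "e (x - 2 * L * real k) = 0" if "k > 0" for k :: nat
        proof (rule e0)
          have "2 * L * 1 \<le> 2 * L * real k" using that L by (intro mult_left_mono) auto
          then show "x - 2 * L * real k \<le> 0" using \<open>x < 2 * L\<close> by simp
        qed
        then show "\<forall>k\<in>{..<R} - {0}. (- 1) ^ k * e (x - 2 * L * real k) = 0" by auto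
      qed simp
      then show ?thesis by (simp add: U_def)
    qed
    have "2 * L * real k0 + \<tau>' = \<tau>" by (simp add: \<tau>'_def)
    have wk: "\<tau>' + 2 * L * real k \<le> T \<Longrightarrow> w (\<tau>' + 2 * L * real k) = (- 1) ^ k * w \<tau>'" for k
    proof (induction k)
      case (Suc k)
      have s: "\<tau>' + 2 * L * real (Suc k) = (\<tau>' + 2 * L * real k) + 2 * L" by (simp add: algebra_simps)
      have y: "0 \<le> \<tau>' + 2 * L * real k" "\<tau>' + 2 * L * real k \<le> T" using Suc.prems \<tau>' L by (simp_all add: algebra_simps)
      show ?case unfolding s anti[OF y] Suc.IH[OF y(2)] by simp
    qed simp
    \<comment> \<open>Antiperiodicity carries w back to the first period, where its modulus is at
      least 1. Since \<open>exp(- q * \<tau>)\<close> is below 1, the difference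
      \<open>U \<tau>\<close> cannot vanish.\<close>
    have "cmod (w \<tau>) = cmod (w \<tau>')" using wk[of k0] \<tau> by (simp add: \<tau>'_def norm_mult norm_power)
    moreover have "cmod (w \<tau>') \<ge> 1"
    proof (cases "\<tau>' = 0")
      case True
      then show ?thesis using U0[of 0] e0[of 0] L by (simp add: w_def)
    next
      case False
      then have "e \<tau>' = of_real (exp (- q * \<tau>'))" by (intro eb) (simp add: b_def)
      then have "w \<tau>' = of_real (- C * exp (- q * \<tau>') + exp (- q * \<tau>'))" using U0[OF \<tau>'(2)] by (simp add: w_def)
      also have "- C * exp (- q * \<tau>') + exp (- q * \<tau>') = - exp (2 * L * q + - q * \<tau>')" unfolding exp_add C_def by (simp add: algebra_simps)
      finally have "cmod (w \<tau>') = exp (2 * L * q + - q * \<tau>')" by simp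
      moreover have "q * \<tau>' \<le> q * (2 * L)" using q \<tau>' by (intro mult_left_mono) auto
      ultimately show ?thesis by (simp add: mult.commute)
    qed
    moreover have "exp (- q * \<tau>) < 1" using q \<tau> by simp
    ultimately have "w \<tau> \<noteq> of_real (exp (- q * \<tau>))" by (metis norm_of_real abs_exp_cancel not_le)
    then show ?thesis by (auto simp: w_def)
  qed
  moreover have "\<exists>K. \<forall>n\<ge>1. (real n * pi / L)\<^sup>2 - c > 0 \<longrightarrow>
       cmod (integral {0..T} (\<lambda>x. U x * of_real (exp (- ((real n * pi / L)\<^sup>2 - c) * x))))
         \<le> K * exp (- ((real n * pi / L)\<^sup>2 - c) * T) / ((real n * pi / L)\<^sup>2 - c)"
  proof -
    obtain M where M: "\<And>x. x \<in> {0..b} \<Longrightarrow> cmod (e x) \<le> M"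
      using compact_imp_bounded[OF compact_continuous_image[OF continuous_on_subset[OF ec subset_UNIV] compact_Icc], of 0 b]
      unfolding bounded_iff by fastforce
    have M0: "M \<ge> 0" using M[of 0] b order_trans[OF norm_ge_zero, of "e 0" M] by simp
    have est: "cmod (integral {0..Y} (\<lambda>x. e x * of_real (exp (- p * x)))) \<le> (1 + M) * exp (- p * Y) / p"
      if n: "n \<ge> 1" and p: "p = (real n * pi / L)\<^sup>2 - c" "p > 0" and Y: "0 \<le> Y" for n p Y
    proof -
      have int: "(\<lambda>x. e x * of_real (exp (- p * x))) integrable_on {s..t}" for s t
        by (intro integrable_continuous_interval continuous_intros continuous_on_subset[OF ec]) auto
      have late: "cmod (integral {0..Y} (\<lambda>x. e x * of_real (exp (- p * x)))) \<le> exp (- p * Y) / p" if Y: "b \<le> Y" for Y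
      proof -
        have eq: "e x * of_real (exp (- p * x)) = of_real (exp (- (real n * pi / L)\<^sup>2 * x)) * E x" for x
        proof -
          have "- c * x + - p * x = - (real n * pi / L)\<^sup>2 * x" unfolding p(1) by (simp add: algebra_simps)
          then have "exp (- c * x) * exp (- p * x) = exp (- (real n * pi / L)\<^sup>2 * x)" by (simp only: exp_add[symmetric])
          then have "(of_real (exp (- c * x)) * of_real (exp (- p * x)) :: complex) = of_real (exp (- (real n * pi / L)\<^sup>2 * x))"
            by (simp only: of_real_mult[symmetric])
          then show ?thesis unfolding e_def by (metis mult.assoc mult.commute)
        qed
        have pq: "(real n * pi / L)\<^sup>2 + \<rho> = p + q" unfolding p(1) \<rho>_def by simp
        have "cmod (integral {0..Y} (\<lambda>x. e x * of_real (exp (- p * x)))) = exp (- (p + q) * Y) / (p + q)"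
          unfolding eq E(5)[OF n Y] pq norm_minus_cancel norm_of_real using p(2) q by simp
        also have "\<dots> \<le> exp (- p * Y) / p"
        proof (rule frac_le)
          have "0 \<le> q * Y" using q Y b by simp
          then show "exp (- (p + q) * Y) \<le> exp (- p * Y)" by (simp add: algebra_simps)
        qed (use p q in auto)
        finally show ?thesis .
      qed
      show ?thesis
      proof (cases "b \<le> Y")
        case True
        have "exp (- p * Y) / p \<le> (1 + M) * exp (- p * Y) / p" using M0 p(2) by (simp add: divide_right_mono)
        then show ?thesis using late[OF True] by linarith
      next
        case False
        \<comment> \<open>Before the transition has ended, the moment up to b is still known; the
          missing piece over \<open>{Y..b}\<close> has the required size because its exponential
          weight is at most \<open>exp(- p * Y)\<close>.\<close>
        have "integral {0..Y} (\<lambda>x. e x * of_real (exp (- p * x))) + integral {Y..b} (\<lambda>x. e x * of_real (exp (- p * x)))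
            = integral {0..b} (\<lambda>x. e x * of_real (exp (- p * x)))"
          using False Y by (intro Henstock_Kurzweil_Integration.integral_combine int) auto
        then have "integral {0..Y} (\<lambda>x. e x * of_real (exp (- p * x)))
          = integral {0..b} (\<lambda>x. e x * of_real (exp (- p * x))) - integral {Y..b} (\<lambda>x. e x * of_real (exp (- p * x)))"
          by (simp add: eq_diff_eq)
        also have "cmod \<dots> \<le> cmod (integral {0..b} (\<lambda>x. e x * of_real (exp (- p * x)))) + cmod (integral {Y..b} (\<lambda>x. e x * of_real (exp (- p * x))))"
          by (rule norm_triangle_ineq4)
        also have "\<dots> \<le> exp (- p * b) / p + M * exp (- p * Y) / p"
        proof (rule add_mono)
          show "cmod (integral {0..b} (\<lambda>x. e x * of_real (exp (- p * x)))) \<le> exp (- p * b) / p" by (rule late) simp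
          show "cmod (integral {Y..b} (\<lambda>x. e x * of_real (exp (- p * x)))) \<le> M * exp (- p * Y) / p"
            using False Y p(2) M by (intro integral_exp_bound continuous_on_subset[OF ec]) auto
        qed
        also have "exp (- p * b) / p \<le> exp (- p * Y) / p" using False p(2) by (intro divide_right_mono) auto
        finally show ?thesis by (simp add: add_divide_distrib algebra_simps)
      qed
    qed
    show ?thesis
    proof (intro exI[of _ "C * (real R * (1 + M))"] allI impI)
      fix n :: nat assume n: "n \<ge> 1" and p0: "(real n * pi / L)\<^sup>2 - c > 0"
      define p where "p = (real n * pi / L)\<^sup>2 - c"
      have p: "p > 0" using p0 by (simp add: p_def)
      \<comment> \<open>Translation by \<open>2 * L * real k\<close> multiplies the moment by
        \<open>exp(- p * ?a)\<close> and shortens the horizon to \<open>T - ?a\<close>; the two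
        exponentials combine to \<open>exp(- p * T)\<close>. A translate starting after T does not
        contribute.\<close>
      have single: "cmod (integral {0..T} (\<lambda>x. e (x - 2 * L * real k) * of_real (exp (- p * x)))) \<le> (1 + M) * exp (- p * T) / p" for k
      proof (cases "2 * L * real k \<le> T")
        case True
        let ?a = "2 * L * real k"
        have a0: "?a \<ge> 0" using L by simp
        have int: "(\<lambda>x. e (x - ?a) * of_real (exp (- p * x))) integrable_on {0..T}"
          by (intro integrable_continuous_interval continuous_intros continuous_on_compose2[OF ec]) auto
        have "integral {0..?a} (\<lambda>x. e (x - ?a) * of_real (exp (- p * x))) = integral {0..?a} (\<lambda>x. 0)"
          by (rule integral_cong) (simp add: e0)
        then have "integral {0..T} (\<lambda>x. e (x - ?a) * of_real (exp (- p * x))) = integral {?a..T} (\<lambda>x. e (x - ?a) * of_real (exp (- p * x)))"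
          using Henstock_Kurzweil_Integration.integral_combine[OF a0 True int] by simp
        also have "\<dots> = integral {0..T - ?a} ((\<lambda>x. e (x - ?a) * of_real (exp (- p * x))) \<circ> (+) ?a)"
          unfolding integral_shift_Icc_real by simp
        also have "\<dots> = integral {0..T - ?a} (\<lambda>x. of_real (exp (- p * ?a)) * (e x * of_real (exp (- p * x))))"
        proof (rule integral_cong)
          fix x
          have "- p * (?a + x) = - p * ?a + - p * x" by (simp add: algebra_simps)
          then have "exp (- p * (?a + x)) = exp (- p * ?a) * exp (- p * x)" by (simp only: exp_add)
          then show "((\<lambda>x. e (x - ?a) * of_real (exp (- p * x))) \<circ> (+) ?a) x = of_real (exp (- p * ?a)) * (e x * of_real (exp (- p * x)))"
            by (simp only: o_def add_diff_cancel_left' of_real_mult mult.left_commute)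
        qed
        also have "\<dots> = of_real (exp (- p * ?a)) * integral {0..T - ?a} (\<lambda>x. e x * of_real (exp (- p * x)))"
          by (rule integral_mult_right)
        finally have "cmod (integral {0..T} (\<lambda>x. e (x - ?a) * of_real (exp (- p * x))))
          = exp (- p * ?a) * cmod (integral {0..T - ?a} (\<lambda>x. e x * of_real (exp (- p * x))))" by (simp only: norm_mult norm_of_real abs_exp_cancel)
        also have "\<dots> \<le> exp (- p * ?a) * ((1 + M) * exp (- p * (T - ?a)) / p)"
          using True by (intro mult_left_mono est[OF n p_def p]) auto
        also have "\<dots> = (1 + M) * (exp (- p * ?a) * exp (- p * (T - ?a))) / p" by simp
        also have "exp (- p * ?a) * exp (- p * (T - ?a)) = exp (- p * T)" unfolding exp_add[symmetric] by (simp add: algebra_simps)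
        finally show ?thesis .
      next
        case False
        have "integral {0..T} (\<lambda>x. e (x - 2 * L * real k) * of_real (exp (- p * x))) = integral {0..T} (\<lambda>x. 0)"
          by (rule integral_cong) (use False in \<open>simp add: e0\<close>)
        then show ?thesis using M0 p by simp
      qed
      have "integral {0..T} (\<lambda>x. U x * of_real (exp (- p * x)))
        = integral {0..T} (\<lambda>x. - of_real C * (\<Sum>k<R. (- 1) ^ k * (e (x - 2 * L * real k) * of_real (exp (- p * x)))))"
        unfolding U_def by (simp only: sum_distrib_right mult.assoc)
      also have "\<dots> = - of_real C * (\<Sum>k<R. (- 1) ^ k * integral {0..T} (\<lambda>x. e (x - 2 * L * real k) * of_real (exp (- p * x))))"
        unfolding integral_mult_right
        by (subst integral_sum) (auto intro!: integrable_continuous_interval continuous_intros continuous_on_compose2[OF ec])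
      finally have "cmod (integral {0..T} (\<lambda>x. U x * of_real (exp (- p * x))))
        = C * cmod (\<Sum>k<R. (- 1) ^ k * integral {0..T} (\<lambda>x. e (x - 2 * L * real k) * of_real (exp (- p * x))))"
        using C0 by (simp only: norm_mult norm_minus_cancel norm_of_real abs_of_pos)
      also have "\<dots> \<le> C * (\<Sum>k<R. (1 + M) * exp (- p * T) / p)"
      proof (rule mult_left_mono)
        show "cmod (\<Sum>k<R. (- 1) ^ k * integral {0..T} (\<lambda>x. e (x - 2 * L * real k) * of_real (exp (- p * x)))) \<le> (\<Sum>k<R. (1 + M) * exp (- p * T) / p)"
          by (rule sum_norm_le) (use single in \<open>simp add: norm_mult norm_power\<close>)
      qed (use C0 in simp)
      finally show "cmod (integral {0..T} (\<lambda>x. U x * of_real (exp (- ((real n * pi / L)\<^sup>2 - c) * x))))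
         \<le> C * (real R * (1 + M)) * exp (- ((real n * pi / L)\<^sup>2 - c) * T) / ((real n * pi / L)\<^sup>2 - c)"
        unfolding p_def by simp
    qed
  qed
  ultimately show ?thesis using that[OF Ud U'c N1] anti unfolding w_def q_def by blast
qed

section \<open>The trajectory leaves \<open>V\<close>\<close>

lemma summable_on_nat_iff:
  fixes f :: "nat \<Rightarrow> real"
  assumes "\<And>n. f n \<ge> 0"
  shows "f summable_on {1..} \<longleftrightarrow> summable (\<lambda>n. f (Suc n))"
proof -
  have "{1..} = range Suc" by (auto simp: image_iff) (metis Suc_pred' less_eq_Suc_le)
  then have "f summable_on {1..} \<longleftrightarrow> (f \<circ> Suc) summable_on UNIV" using summable_on_reindex[of Suc UNIV f] by simp
  also have "\<dots> \<longleftrightarrow> summable (f \<circ> Suc)" by (rule summable_on_UNIV_nonneg_real_iff) (simp add: assms)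
  finally show ?thesis by (simp add: o_def)
qed

lemma summable_on_modes_iff:
  fixes f :: "nat + int \<Rightarrow> real"
  shows "f summable_on modes \<longleftrightarrow> (\<lambda>n. f (Inl n)) summable_on {1..} \<and> (\<lambda>m. f (Inr m)) summable_on UNIV"
proof -
  have m: "modes = Inl ` {1..} \<union> range Inr" by (auto simp: modes_def)
  have l: "f summable_on (Inl ` {1..}) \<longleftrightarrow> (\<lambda>n. f (Inl n)) summable_on {1..}"
    using summable_on_reindex[of Inl "{1..}" f] by (simp add: o_def)
  have r: "f summable_on (range Inr) \<longleftrightarrow> (\<lambda>m. f (Inr m)) summable_on UNIV"
    using summable_on_reindex[of Inr UNIV f] by (simp add: o_def)
  have "f summable_on modes \<longleftrightarrow> f summable_on (Inl ` {1..}) \<and> f summable_on (range Inr)"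
    unfolding m using summable_on_subset_banach[of f "Inl ` {1..} \<union> range Inr"]
    by (auto intro!: summable_on_Un_disjoint)
  then show ?thesis unfolding l r .
qed

lemma summable_on_inverse_squares:
  fixes f :: "nat \<Rightarrow> real"
  assumes "\<And>n. f n \<ge> 0" "\<And>n. n \<ge> N \<Longrightarrow> f n \<le> C / (real n)\<^sup>2"
  shows "f summable_on {1..}"
  unfolding summable_on_nat_iff[OF assms(1)] summable_Suc_iff
proof (rule summable_comparison_test)
  show "\<exists>N. \<forall>n\<ge>N. norm (f n) \<le> C * inverse ((real n)\<^sup>2)"
    using assms by (intro exI[of _ N]) (auto simp: divide_inverse)
  show "summable (\<lambda>n. C * inverse ((real n)\<^sup>2))"
    by (intro summable_mult inverse_power_summable) simp
qed

lemma not_summable_on_bounded_below: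
  fixes f :: "nat \<Rightarrow> real"
  assumes "\<And>n. f n \<ge> 0" "\<kappa> > 0" "\<And>n. n \<ge> N \<Longrightarrow> f n \<ge> \<kappa>"
  shows "\<not> f summable_on {1..}"
  unfolding summable_on_nat_iff[OF assms(1)] summable_Suc_iff
proof
  assume "summable f"
  then have "f \<longlonglongrightarrow> 0" by (rule summable_LIMSEQ_zero)
  then have "\<forall>\<^sub>F n in sequentially. f n < \<kappa>" using assms(2) by (rule order_tendstoD(2))
  then obtain M where "\<And>n. n \<ge> M \<Longrightarrow> f n < \<kappa>" unfolding eventually_sequentially by blast
  then show False using assms(3)[of "max M N"] by (metis max.cobounded1 max.cobounded2 not_less)
qed

lemma integral_reflect_Icc:
  fixes f :: "real \<Rightarrow> complex"
  shows "integral {0..t} (\<lambda>s. f (t - s)) = integral {0..t} f"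
proof -
  have "integral {0..t} (\<lambda>s. f (t - s)) = integral {0..t} ((\<lambda>x. f (- x)) \<circ> (+) (- t))" by (simp add: o_def)
  also have "\<dots> = integral {- t..- 0} (\<lambda>x. f (- x))" unfolding integral_shift_Icc_real by simp
  also have "\<dots> = integral {0..t} f" using Henstock_Kurzweil_Integration.integral_reflect_real[of t 0 f] by simp
  finally show ?thesis .
qed

section \<open>Weights, traces and moments\<close>

context wave_heat
begin

definition decay :: "nat \<Rightarrow> real" where "decay n = (real n * pi / L)\<^sup>2 - c"

lemma lam_Inl: "lam (Inl n) = of_real (- decay n)" and lam1_decay: "lam1 L c n = - decay n"
  by (simp_all add: lam_def lam1_def decay_def power_mult_distrib power_divide)

lemma lam_Inr: "lam (Inr m) = \<i> * of_real (om m)" by (simp add: lam_def lam2_om)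

lemma decay_large:
  obtains N where "\<And>n. n \<ge> N \<Longrightarrow> n \<ge> 1 \<and> decay n \<ge> real n \<and>
    (real n * pi / L)\<^sup>2 \<le> 2 * decay n \<and> decay n \<le> 2 * (real n * pi / L)\<^sup>2"
proof -
  obtain N :: nat where N: "2 + 2 * \<bar>c\<bar> < real N * (pi / L)\<^sup>2"
    using reals_Archimedean3[of "(pi / L)\<^sup>2"] L by auto
  have N1: "N \<ge> 1" using N by (cases N) auto
  show ?thesis
  proof (rule that[of N])
    fix n assume n: "n \<ge> N"
    have "real N * (pi / L)\<^sup>2 \<le> real n * (pi / L)\<^sup>2" using n by (intro mult_right_mono) auto
    then have "real n * (2 + 2 * \<bar>c\<bar>) \<le> real n * (real n * (pi / L)\<^sup>2)" using N by (intro mult_left_mono) auto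
    also have "\<dots> = (real n * pi / L)\<^sup>2" by (simp add: power2_eq_square)
    finally have a: "2 * real n + 2 * (real n * \<bar>c\<bar>) \<le> (real n * pi / L)\<^sup>2" by (simp add: algebra_simps)
    have n1: "n \<ge> 1" "real n \<ge> 1" using n N1 by simp_all
    have b: "1 * \<bar>c\<bar> \<le> real n * \<bar>c\<bar>" using n1 by (intro mult_right_mono) auto
    define F where "F = (real n * pi / L)\<^sup>2"
    have "F - c \<ge> real n" "F \<le> 2 * (F - c)" "F - c \<le> 2 * F"
      using a b n1 abs_ge_self[of c] abs_ge_minus_self[of c] unfolding F_def[symmetric] by argo+
    then show "n \<ge> 1 \<and> decay n \<ge> real n \<and> (real n * pi / L)\<^sup>2 \<le> 2 * decay n \<and> decay n \<le> 2 * (real n * pi / L)\<^sup>2"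
      using n1 unfolding decay_def F_def by blast
  qed
qed

text \<open>The factor \<open>cosh (lam1 L c n * L)\<close> is the one that \<open>tr\<close>
  divides by, so this keeps the parabolic traces bounded for large n.\<close>

lemma gam_bound: obtains B where "B \<ge> 0" "\<And>n. lam1 L c n \<noteq> 0 \<Longrightarrow> \<bar>gam L c \<beta> n\<bar> \<le> B * cosh (lam1 L c n * L)"
proof (rule that)
  let ?B = "LINT x|mI L. \<bar>\<beta> x\<bar>"
  show "?B \<ge> 0" by (simp add: integral_nonneg_AE)
  fix n assume nz: "lam1 L c n \<noteq> 0"
  have "integrable (mI L) (\<lambda>x. cmod (of_real (\<beta> x) * 1))" by (intro integrable_norm L2_integrable beta_L2) simp
  then have bi: "integrable (mI L) (\<lambda>x. \<bar>\<beta> x\<bar>)" by simp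
  have "\<bar>gam L c \<beta> n\<bar> = norm (LINT s|mI L. \<beta> s * sin (real n * pi / L * s) * sinh (lam1 L c n * s))"
    using nz by (simp add: gam_def)
  also have "\<dots> \<le> (LINT s|mI L. norm (\<beta> s * sin (real n * pi / L * s) * sinh (lam1 L c n * s)))"
    by (rule integral_norm_bound)
  also have "\<dots> \<le> (LINT s|mI L. \<bar>\<beta> s\<bar> * cosh (lam1 L c n * L))"
  proof (rule integral_mono')
    show "integrable (mI L) (\<lambda>s. \<bar>\<beta> s\<bar> * cosh (lam1 L c n * L))" using bi by simp
    fix s assume "s \<in> space (mI L)"
    then have s: "0 \<le> s" "s \<le> L" by auto
    have "\<bar>sinh (lam1 L c n * s)\<bar> \<le> cosh (lam1 L c n * s)"
      by (simp add: sinh_def cosh_def abs_le_iff add_nonneg_nonneg)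
    also have "\<dots> = cosh (\<bar>lam1 L c n\<bar> * s)" by (simp add: abs_if)
    also have "\<dots> \<le> cosh (\<bar>lam1 L c n\<bar> * L)" using s by (subst cosh_real_nonneg_le_iff) (auto intro!: mult_left_mono)
    also have "\<dots> = cosh (lam1 L c n * L)" by (simp add: abs_if)
    finally have "\<bar>sin (real n * pi / L * s)\<bar> * \<bar>sinh (lam1 L c n * s)\<bar> \<le> 1 * cosh (lam1 L c n * L)"
      by (intro mult_mono) auto
    then have "\<bar>\<beta> s\<bar> * (\<bar>sin (real n * pi / L * s)\<bar> * \<bar>sinh (lam1 L c n * s)\<bar>) \<le> \<bar>\<beta> s\<bar> * cosh (lam1 L c n * L)"
      by (intro mult_left_mono) auto
    then show "norm (\<beta> s * sin (real n * pi / L * s) * sinh (lam1 L c n * s)) \<le> \<bar>\<beta> s\<bar> * cosh (lam1 L c n * L)"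
      by (simp add: abs_mult mult.assoc)
  qed simp
  also have "\<dots> = ?B * cosh (lam1 L c n * L)" by simp
  finally show "\<bar>gam L c \<beta> n\<bar> \<le> ?B * cosh (lam1 L c n * L)" .
qed

lemma cmod_tr_Inr: "cmod (tr (Inr m)) = 1 / sqrt L"
proof -
  have "\<bar>sin (om m * L)\<bar> = 1" using sin_om[of m] by (metis abs_1 power2_eq_1_iff abs_minus_cancel)
  then show ?thesis using om_nz[of m] L
    by (simp add: tr_def phi2_2_eq lam2_om norm_mult norm_divide Kc_def abs_mult)
qed

lemma tr_nonzero:
  assumes "\<And>n. n \<ge> 1 \<Longrightarrow> gam L c \<beta> n \<noteq> 0" "j \<in> modes" shows "tr j \<noteq> 0"
proof (cases j)
  case (Inl n)
  then show ?thesis using assms L by (simp add: tr_def)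
next
  case (Inr m)
  then show ?thesis using cmod_tr_Inr[of m] L by auto
qed

lemma cmod_tr_Inl:
  assumes "decay n > 0"
  shows "cmod (tr (Inl n)) = sqrt (2 / L) * \<bar>gam L c \<beta> n\<bar> / (decay n * cosh (decay n * L))"
  using assms L by (simp add: tr_def lam1_decay norm_mult norm_divide abs_mult)

text \<open>The factor \<open>\<gamma>\<^sub>n\<close> cancels, so that in \<open>V\<close> the controlled parabolic coefficients
  carry exactly the weight \<open>exp (p\<^sub>n T)\<close>, \<open>p\<^sub>n = - \<lambda>\<^sub>1\<^sub>,\<^sub>n\<close>.\<close>

lemma weight_tr_bounds:
  assumes gam: "\<And>n. n \<ge> 1 \<Longrightarrow> gam L c \<beta> n \<noteq> 0"
  obtains k N K where "k > 0" "\<And>n. n \<ge> N \<Longrightarrow> n \<ge> 1 \<and> decay n \<ge> real n \<and>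
     k * exp (2 * decay n * T) \<le> V_weight L c \<beta> T (Inl n) * (cmod (tr (Inl n)))\<^sup>2 \<and>
     V_weight L c \<beta> T (Inl n) * (cmod (tr (Inl n)))\<^sup>2 \<le> K * exp (2 * decay n * T)"
proof -
  define G where "G = (2 / L) * (L / pi) ^ 4 * exp (2 * c * (L + T))"
  have G: "G > 0" using L by (simp add: G_def)
  obtain N where N: "\<And>n. n \<ge> N \<Longrightarrow> n \<ge> 1 \<and> decay n \<ge> real n \<and>
    (real n * pi / L)\<^sup>2 \<le> 2 * decay n \<and> decay n \<le> 2 * (real n * pi / L)\<^sup>2" using decay_large by blast
  show ?thesis
  proof (rule that[of "G / 4" N "16 * G"])
    show "G / 4 > 0" using G by simp
    fix n assume n: "n \<ge> N"
    let ?F = "(real n * pi / L)\<^sup>2" and ?W = "V_weight L c \<beta> T (Inl n) * (cmod (tr (Inl n)))\<^sup>2"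
    have p: "decay n > 0" "n \<ge> 1" "?F \<le> 2 * decay n" "decay n \<le> 2 * ?F" using N[OF n] by auto
    define x where "x = ?F / decay n"
    define y where "y = exp (decay n * L) / cosh (decay n * L)"
    have x: "1 / 2 \<le> x" "x \<le> 2"
      unfolding x_def using p by (subst pos_le_divide_eq pos_divide_le_eq; linarith)+
    have y: "1 \<le> y" "y \<le> 2"
    proof -
      have "exp (- (decay n * L)) \<le> exp (decay n * L)" using p L by simp
      then show "1 \<le> y" "y \<le> 2" unfolding y_def by (simp_all add: pos_divide_le_eq pos_le_divide_eq) (simp_all add: cosh_def)
    qed
    \<comment> \<open>Here the value of \<open>nu\<close> matters: it splits into a constant,
      \<open>2 p L\<close> that cancels the squared hyperbolic cosine of the trace up to bounded
      factors, and \<open>2 p T\<close>, where p is \<open>decay n\<close>.\<close>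
    have "nu L T * (real n)\<^sup>2 = 2 * ?F * (L + T)" using L by (simp add: nu_def power_mult_distrib power_divide power2_eq_square field_simps)
    also have "\<dots> = 2 * c * (L + T) + (2 * (decay n * L) + 2 * decay n * T)" by (simp add: decay_def algebra_simps)
    finally have e: "exp (nu L T * (real n)\<^sup>2) = exp (2 * c * (L + T)) * ((exp (decay n * L))\<^sup>2 * exp (2 * decay n * T))"
      by (simp only: exp_add exp_double)
    have n4: "real n ^ 4 = (L / pi) ^ 4 * ?F\<^sup>2"
      using L by (simp add: power_mult_distrib power_divide)
    have "?W = real n ^ 4 / (gam L c \<beta> n)\<^sup>2 * exp (nu L T * (real n)\<^sup>2) * ((2 / L) * (gam L c \<beta> n)\<^sup>2 / ((decay n)\<^sup>2 * (cosh (decay n * L))\<^sup>2))"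
      unfolding cmod_tr_Inl[OF p(1)] using L by (simp add: V_weight_def power_mult_distrib power_divide)
    also have "\<dots> = (2 / L) * real n ^ 4 * exp (nu L T * (real n)\<^sup>2) / ((decay n)\<^sup>2 * (cosh (decay n * L))\<^sup>2)"
      using gam[OF p(2)] by simp
    also have "\<dots> = G * (x\<^sup>2 * y\<^sup>2) * exp (2 * decay n * T)"
      unfolding e n4 G_def x_def y_def power_divide by (simp add: power_mult_distrib)
    finally have W: "?W = G * (x\<^sup>2 * y\<^sup>2) * exp (2 * decay n * T)" .
    have x2: "1 / 4 \<le> x\<^sup>2" "x\<^sup>2 \<le> 4" using power_mono[OF x(1), of 2] power_mono[OF x(2), of 2] x by (simp_all add: power_divide)
    have y2: "1 \<le> y\<^sup>2" "y\<^sup>2 \<le> 4" using power_mono[OF y(1), of 2] power_mono[OF y(2), of 2] y by simp_all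
    have "1 / 4 * 1 \<le> x\<^sup>2 * y\<^sup>2" using x2 y2 by (intro mult_mono) auto
    then have lo: "G * (1 / 4) \<le> G * (x\<^sup>2 * y\<^sup>2)" using G by (intro mult_left_mono) auto
    have "x\<^sup>2 * y\<^sup>2 \<le> 4 * 4" using x2 y2 by (intro mult_mono) auto
    then have hi: "G * (x\<^sup>2 * y\<^sup>2) \<le> G * 16" using G by (intro mult_left_mono) auto
    have "G / 4 * exp (2 * decay n * T) \<le> ?W" unfolding W using lo by (intro mult_right_mono) auto
    moreover have "?W \<le> 16 * G * exp (2 * decay n * T)" unfolding W using hi by (intro mult_right_mono) auto
    ultimately show "n \<ge> 1 \<and> decay n \<ge> real n \<and> G / 4 * exp (2 * decay n * T) \<le> ?W \<and> ?W \<le> 16 * G * exp (2 * decay n * T)"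
      using N[OF n] by blast
  qed
qed

lemma V_iff:
  assumes X: "X \<in> HH L" and e: "has_expansion L c \<beta> X a"
  shows "X \<in> V L c \<beta> T \<longleftrightarrow> (\<lambda>j. V_weight L c \<beta> T j * (cmod (a j))\<^sup>2) summable_on modes"
proof
  assume "X \<in> V L c \<beta> T"
  then obtain b where b: "has_expansion L c \<beta> X b" "(\<lambda>j. V_weight L c \<beta> T j * (cmod (b j))\<^sup>2) summable_on modes"
    by (auto simp: V_def)
  have "a j = b j" if "j \<in> modes" for j using has_expansion_coeff[OF X e that] has_expansion_coeff[OF X b(1) that] by simp
  then show "(\<lambda>j. V_weight L c \<beta> T j * (cmod (a j))\<^sup>2) summable_on modes"
    by (intro summable_on_cong[THEN iffD1, OF _ b(2)]) simp
qed (use X e in \<open>auto simp: V_def\<close>)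

lemma V_norm_eq:
  assumes X: "X \<in> HH L" and e: "has_expansion L c \<beta> X a"
  shows "V_norm L c \<beta> T X = sqrt (\<Sum>\<^sub>\<infinity>j\<in>modes. V_weight L c \<beta> T j * (cmod (a j))\<^sup>2)"
proof -
  have "has_expansion L c \<beta> X (coeffs_of L c \<beta> X)" unfolding coeffs_of_def by (rule someI[of _ a]) (rule e)
  then have "coeffs_of L c \<beta> X j = a j" if "j \<in> modes" for j
    using has_expansion_coeff[OF X e that] has_expansion_coeff[OF X _ that] by metis
  then show ?thesis unfolding V_norm_def by (intro arg_cong[of _ _ sqrt] infsum_cong) simp
qed

lemma V_weight_nonneg: "V_weight L c \<beta> T j \<ge> 0"
  by (cases j) (auto simp: V_weight_def)

lemma exp_lam_bound: "t \<ge> 0 \<Longrightarrow> cmod (exp (lam j * of_real t)) \<le> exp (\<bar>c\<bar> * t)"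
proof (cases j)
  case (Inl n)
  assume t: "t \<ge> 0"
  have "- decay n \<le> \<bar>c\<bar>" using zero_le_power2[of "real n * pi / L"] unfolding decay_def by linarith
  then have "- decay n * t \<le> \<bar>c\<bar> * t" using t by (rule mult_right_mono)
  then show ?thesis using Inl by (simp add: lam_Inl norm_exp_eq_Re)
qed (simp add: lam_Inr norm_exp_eq_Re)

text \<open>One integration by parts. On the left half-plane the boundary terms are bounded, so the
  moments are O(1/|z|); on the negative axis only the boundary term at y = 0 survives, which gives
  the leading coefficient \<open>U r\<close>.\<close>

lemma moment_bound:
  fixes U U' :: "real \<Rightarrow> complex"
  assumes U: "\<And>x. (U has_vector_derivative U' x) (at x)" "continuous_on UNIV U'" and t: "0 < t"
  obtains A where "A > 0" "\<And>z. Re z \<le> 0 \<Longrightarrow> cmod (z * integral {0..t} (\<lambda>y. U (r + y) * exp (z * of_real y))) \<le> A"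
    "\<And>p. p > 0 \<Longrightarrow> cmod (p * integral {0..t} (\<lambda>y. U (r + y) * exp (of_real (- p) * of_real y)) - U r) \<le> A / p"
proof -
  define V where "V y = U (r + y)" for y
  define V' where "V' y = U' (r + y)" for y
  have V: "(V has_vector_derivative V' x) (at x)" for x
  proof -
    have "((\<lambda>y. r + y) has_vector_derivative 0 + 1) (at x)"
      by (intro has_vector_derivative_add has_vector_derivative_id has_vector_derivative_const)
    then show ?thesis unfolding V_def V'_def
      using vector_diff_chain_at[of "\<lambda>y. r + y" 1 x U "U' (r + x)"] U(1) by (simp add: o_def)
  qed
  have V': "continuous_on UNIV V'" unfolding V'_def
    by (rule continuous_on_compose2[OF U(2)]) (auto intro!: continuous_intros)
  note parts = integral_exp_by_parts[of V V', OF V V' less_imp_le[OF t]]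
  have "bounded (V' ` {0..t})" by (intro compact_imp_bounded compact_continuous_image continuous_on_subset[OF V']) auto
  then obtain M where M: "\<And>y. y \<in> {0..t} \<Longrightarrow> cmod (V' y) \<le> M" unfolding bounded_iff by blast
  have M0: "M \<ge> 0" using order_trans[OF norm_ge_zero M[of 0]] t by simp
  \<comment> \<open>The summand with \<open>1 / t\<close> absorbs the far boundary term through
    \<open>exp(- p t) \<le> 1 / (p t)\<close>; the final 1 keeps A positive.\<close>
  define A where "A = cmod (V t) * (1 + 1 / t) + cmod (V 0) + M * (t + 1) + 1"
  have "cmod (z * integral {0..t} (\<lambda>y. V y * exp (z * of_real y))) \<le> A" if z: "Re z \<le> 0" for z
  proof -
    have ez: "cmod (exp (z * of_real y)) \<le> 1" if "0 \<le> y" for y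
      using z that by (simp add: norm_exp_eq_Re mult_nonpos_nonneg)
    have "cmod (integral {0..t} (\<lambda>y. V' y * exp (z * of_real y))) \<le> M * (t - 0)"
    proof (rule integral_bound)
      show "continuous_on {0..t} (\<lambda>y. V' y * exp (z * of_real y))"
        by (intro continuous_intros continuous_on_subset[OF V']) auto
      show "cmod (V' y * exp (z * of_real y)) \<le> M" if "y \<in> {0..t}" for y
        using mult_mono[OF M[OF that] ez, of y] that M0 by (simp add: norm_mult)
    qed (use t in simp)
    moreover have "cmod (V t * exp (z * of_real t)) \<le> cmod (V t)"
      using mult_left_mono[OF ez[of t], of "cmod (V t)"] t by (simp add: norm_mult)
    moreover have "cmod (V t * exp (z * of_real t) - V 0 - integral {0..t} (\<lambda>y. V' y * exp (z * of_real y)))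
      \<le> cmod (V t * exp (z * of_real t)) + cmod (V 0) + cmod (integral {0..t} (\<lambda>y. V' y * exp (z * of_real y)))"
      by (meson norm_triangle_ineq4 order_trans add_right_mono)
    moreover have "cmod (V t) + cmod (V 0) + M * t \<le> A" using t M0 unfolding A_def by (simp add: algebra_simps)
    ultimately show ?thesis unfolding parts by simp
  qed
  moreover have "cmod (p * integral {0..t} (\<lambda>y. V y * exp (of_real (- p) * of_real y)) - V 0) \<le> A / p" if p: "p > 0" for p
  proof -
    have r: "(\<lambda>y. exp (of_real (- p) * of_real y) :: complex) = (\<lambda>y. of_real (exp (- p * y)))"
      by (simp only: of_real_mult[symmetric] exp_of_real)
    have "cmod (integral {0..t} (\<lambda>y. V' y * of_real (exp (- p * y)))) \<le> M * exp (- p * 0) / p"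
      using t p M by (intro integral_exp_bound continuous_on_subset[OF V']) auto
    moreover have "exp (- p * t) \<le> 1 / (p * t)"
    proof -
      have "p * t \<le> exp (p * t)" using exp_ge_add_one_self[of "p * t"] by linarith
      moreover have "p * t > 0" using p t by simp
      ultimately show ?thesis by (simp add: exp_minus field_simps)
    qed
    then have "cmod (V t) * exp (- p * t) \<le> cmod (V t) * (1 / (p * t))" by (intro mult_left_mono) auto
    moreover have "p * integral {0..t} (\<lambda>y. V y * exp (of_real (- p) * of_real y)) - V 0
      = - (V t * of_real (exp (- p * t)) - integral {0..t} (\<lambda>y. V' y * of_real (exp (- p * y))))"
    proof -
      have "p * integral {0..t} (\<lambda>y. V y * exp (of_real (- p) * of_real y))
        = - (of_real (- p) * integral {0..t} (\<lambda>y. V y * exp (of_real (- p) * of_real y)))" by simp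
      also have "\<dots> = - (V t * exp (of_real (- p) * of_real t) - V 0 - integral {0..t} (\<lambda>y. V' y * exp (of_real (- p) * of_real y)))"
        unfolding parts ..
      finally show ?thesis unfolding fun_cong[OF r] by (simp only: minus_diff_eq) (simp only: algebra_simps)
    qed
    then have "cmod (p * integral {0..t} (\<lambda>y. V y * exp (of_real (- p) * of_real y)) - V 0)
      \<le> cmod (V t) * exp (- p * t) + cmod (integral {0..t} (\<lambda>y. V' y * of_real (exp (- p * y))))"
      using norm_triangle_ineq4[of "V t * of_real (exp (- p * t))" "integral {0..t} (\<lambda>y. V' y * of_real (exp (- p * y)))"]
      by (simp only: norm_minus_cancel norm_mult norm_of_real abs_exp_cancel)
    ultimately have "cmod (p * integral {0..t} (\<lambda>y. V y * exp (of_real (- p) * of_real y)) - V 0)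
      \<le> cmod (V t) * (1 / (p * t)) + M * exp (- p * 0) / p" by linarith
    also have "\<dots> = (cmod (V t) * (1 / t) + M) / p" using p t by (simp add: field_simps)
    also have "\<dots> \<le> A / p" using p t M0 unfolding A_def by (intro divide_right_mono) (auto simp: algebra_simps)
    finally show ?thesis .
  qed
  moreover have "A > 0" using t M0 unfolding A_def by (intro add_nonneg_pos add_nonneg_nonneg mult_nonneg_nonneg) auto
  ultimately show ?thesis using that[of A] unfolding V_def by simp
qed

end

section \<open>Invariance of the weighted space and the escaping trajectory\<close>

context wave_heat_semigroup
begin

lemma S_restricts_to_V:
  assumes t: "t \<ge> 0" and X: "X \<in> V L c \<beta> T"
  shows "S t X \<in> V L c \<beta> T" "V_norm L c \<beta> T (S t X) \<le> exp (\<bar>c\<bar> * t) * V_norm L c \<beta> T X"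
proof -
  obtain a where a: "X \<in> HH L" "has_expansion L c \<beta> X a" "(\<lambda>j. V_weight L c \<beta> T j * (cmod (a j))\<^sup>2) summable_on modes"
    using X by (auto simp: V_def)
  let ?C = "(exp (\<bar>c\<bar> * t))\<^sup>2"
  note e = SG.S_closed[OF t a(1)] has_expansion_S[OF t a(1,2)]
  have le: "V_weight L c \<beta> T j * (cmod (exp (lam j * of_real t) * a j))\<^sup>2 \<le> ?C * (V_weight L c \<beta> T j * (cmod (a j))\<^sup>2)" for j
  proof -
    have "(cmod (exp (lam j * of_real t) * a j))\<^sup>2 \<le> ?C * (cmod (a j))\<^sup>2"
      unfolding norm_mult power_mult_distrib using exp_lam_bound[OF t, of j] by (intro mult_right_mono power_mono) auto
    then have "V_weight L c \<beta> T j * (cmod (exp (lam j * of_real t) * a j))\<^sup>2 \<le> V_weight L c \<beta> T j * (?C * (cmod (a j))\<^sup>2)"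
      by (rule mult_left_mono) (rule V_weight_nonneg)
    then show ?thesis by (simp only: mult.left_commute)
  qed
  have s: "(\<lambda>j. ?C * (V_weight L c \<beta> T j * (cmod (a j))\<^sup>2)) summable_on modes" by (rule summable_on_cmult_right[OF a(3)])
  have s': "(\<lambda>j. V_weight L c \<beta> T j * (cmod (exp (lam j * of_real t) * a j))\<^sup>2) summable_on modes"
    by (rule summable_on_comparison_test[OF s le]) (simp add: V_weight_nonneg)
  show "S t X \<in> V L c \<beta> T" unfolding V_iff[OF e] by (rule s')
  have "V_norm L c \<beta> T (S t X) \<le> sqrt (?C * (\<Sum>\<^sub>\<infinity>j\<in>modes. V_weight L c \<beta> T j * (cmod (a j))\<^sup>2))"
    unfolding V_norm_eq[OF e] infsum_cmult_right'[symmetric] by (intro real_sqrt_le_mono infsum_mono s s' le)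
  then show "V_norm L c \<beta> T (S t X) \<le> exp (\<bar>c\<bar> * t) * V_norm L c \<beta> T X"
    unfolding V_norm_eq[OF a(1,2)] by (simp add: real_sqrt_mult)
qed

lemma zero_in_V: "0 \<in> V L c \<beta> T"
proof -
  have "has_expansion L c \<beta> 0 (\<lambda>j. 0)" unfolding has_expansion_def by (simp add: SG.sm_0 H.nrm_zero)
  then show ?thesis unfolding V_iff[OF H.zero_closed \<open>has_expansion L c \<beta> 0 (\<lambda>j. 0)\<close>] by simp
qed

text \<open>Two controls with the same effect at time \<open>T\<close> differ by a function orthogonal to every
  \<open>exp (\<lambda>\<^sub>j (T - s))\<close>, in whose closed span the control lies.\<close>

lemma HUM_control_criterion:
  fixes U :: "real \<Rightarrow> complex"
  assumes T: "T > 0" and gam: "\<And>n. n \<ge> 1 \<Longrightarrow> gam L c \<beta> n \<noteq> 0"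
    and U: "continuous_on UNIV U" and N: "N \<ge> 1"
    and anti: "\<And>x. 0 \<le> x \<Longrightarrow> x \<le> T \<Longrightarrow>
       U (x + 2 * L) + of_real (exp (- decay N * (x + 2 * L))) = - (U x + of_real (exp (- decay N * x)))"
    and X: "mild_solution L S 0 (\<lambda>s. U (T - s)) T X"
  shows "HUM_control L S T 0 X (\<lambda>s. U (T - s))"
proof -
  define u where "u s = U (T - s)" for s
  have T0: "T \<ge> 0" using T by simp
  have uc: "continuous_on {0..T} u" unfolding u_def
    by (auto intro!: continuous_intros continuous_on_compose2[OF U])
  have u: "u \<in> L2 T" by (rule L2_continuous[OF uc])
  have "L2_norm T u \<le> L2_norm T v" if v: "v \<in> L2 T" "mild_solution L S 0 v T X" for v
  proof -
    define d where "d s = v s - u s" for s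
    have d: "d \<in> L2 T" unfolding d_def by (rule L2_diff[OF v(1) u])
    have orth: "(LINT s|mI T. d s * exp (lam j * of_real (T - s))) = 0" if j: "j \<in> modes" for j
    proof -
      let ?e = "\<lambda>s. exp (lam j * of_real (T - s))"
      have int: "integrable (mI T) (\<lambda>s. f s * ?e s)" if "f \<in> L2 T" for f
        by (rule L2_mult_integrable[OF that L2_continuous]) (intro continuous_intros)
      have "(LINT s|mI T. v s * (cnj (tr j) * ?e s)) = (LINT s|mI T. u s * (cnj (tr j) * ?e s))"
        using mild_solution_coeff[OF T0 v(2) j] mild_solution_coeff[OF T0 X j] unfolding u_def by (rule trans[OF sym])
      then have "cnj (tr j) * (LINT s|mI T. v s * ?e s) = cnj (tr j) * (LINT s|mI T. u s * ?e s)"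
        by (simp only: mult.left_commute[of _ "cnj (tr j)"] integral_mult_right_zero)
      then have "(LINT s|mI T. v s * ?e s) = (LINT s|mI T. u s * ?e s)" using tr_nonzero[OF gam j] by simp
      then show ?thesis unfolding d_def left_diff_distrib
        using int[OF v(1)] int[OF u] by simp
    qed
    \<comment> \<open>The conjugate, because d is paired with \<open>cnj (u s)\<close>; conjugation
      preserves antiperiodicity, and the subtracted exponential is real.\<close>
    define w where "w x = cnj (U x + of_real (exp (- decay N * x)))" for x
    have dw: "(LINT s|mI T. d s * w (T - s)) = 0"
    proof (rule antiperiodic_orthogonal[OF L L2_integrable[OF d] _ _ _ T0])
      show "continuous_on UNIV w" unfolding w_def by (intro continuous_intros U)
      show "w (x + 2 * L) = - w x" if "0 \<le> x" "x \<le> T" for x unfolding w_def anti[OF that] by simp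
      show "(LINT s|mI T. d s * exp (\<i> * of_real ((2 * real_of_int m + 1) * pi / (2 * L)) * of_real (T - s))) = 0" for m
        using orth[of "Inr m"] by (simp only: lam_Inr om_def Inr_modes)
    qed
    have de: "(LINT s|mI T. d s * of_real (exp (- decay N * (T - s)))) = 0"
      using orth[of "Inl N"] N unfolding lam_Inl by (simp only: of_real_mult[symmetric] exp_of_real Inl_modes)
    have "(LINT s|mI T. d s * cnj (u s)) = (LINT s|mI T. d s * w (T - s) - d s * of_real (exp (- decay N * (T - s))))"
      by (rule Bochner_Integration.integral_cong[OF refl]) (simp add: w_def u_def algebra_simps)
    also have "\<dots> = (LINT s|mI T. d s * w (T - s)) - (LINT s|mI T. d s * of_real (exp (- decay N * (T - s))))"
      by (intro Bochner_Integration.integral_diff L2_mult_integrable[OF d] L2_continuous)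
        (auto simp: w_def intro!: continuous_intros continuous_on_compose2[OF U])
    finally have du: "(LINT s|mI T. d s * cnj (u s)) = 0" unfolding dw de by simp
    have dui: "integrable (mI T) (\<lambda>s. d s * cnj (u s))" by (rule l2ip_integrable[OF d u])
    \<comment> \<open>Pythagoras: after integration the cross term vanishes by \<open>du\<close>, so
      every competitor v has at least the norm of u.\<close>
    have sq: "(cmod (v s))\<^sup>2 = (cmod (u s))\<^sup>2 + (cmod (d s))\<^sup>2 + 2 * Re (d s * cnj (u s))" for s
    proof -
      have "v s = u s + d s" by (simp add: d_def)
      then show ?thesis unfolding cmod_power2 by (simp add: power2_eq_square algebra_simps)
    qed
    note iu = L2_sq_integrable[OF u] and id = L2_sq_integrable[OF d]
    have ire: "integrable (mI T) (\<lambda>s. 2 * Re (d s * cnj (u s)))" using integrable_mult_right[OF integrable_Re[OF dui]] .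
    have "(LINT s|mI T. (cmod (v s))\<^sup>2) = (LINT s|mI T. (cmod (u s))\<^sup>2) + (LINT s|mI T. (cmod (d s))\<^sup>2) + 2 * (LINT s|mI T. Re (d s * cnj (u s)))"
      unfolding sq Bochner_Integration.integral_add[OF Bochner_Integration.integrable_add[OF iu id] ire]
        Bochner_Integration.integral_add[OF iu id] integral_mult_right_zero ..
    also have "(LINT s|mI T. Re (d s * cnj (u s))) = 0" unfolding integral_Re[OF dui] du by simp
    finally have "(LINT s|mI T. (cmod (u s))\<^sup>2) \<le> (LINT s|mI T. (cmod (v s))\<^sup>2)" by (simp add: integral_nonneg_AE)
    then show ?thesis unfolding L2_norm_def by (rule real_sqrt_le_mono)
  qed
  then show ?thesis using u X unfolding HUM_control_def steers_def u_def by blast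
qed

text \<open>The target is not prescribed: it is the state reached from 0 by the constructed control,
  which is optimal for that target. One trajectory is then measured at the times T and t.\<close>

lemma HUM_trajectory_leaves_V:
  assumes gam: "\<And>n. n \<ge> 1 \<Longrightarrow> gam L c \<beta> n \<noteq> 0" and t: "0 < t" "t < T"
  shows "\<exists>X1\<in>V L c \<beta> T. \<exists>Xt. HUM_trajectory_at L S T 0 X1 t Xt \<and> Xt \<notin> V L c \<beta> T"
proof -
  have \<tau>: "0 < T - t" "T - t \<le> T" and T: "T > 0" using t by auto
  obtain U U' N K where U: "\<And>x. (U has_vector_derivative U' x) (at x)" "continuous_on UNIV U'" and N: "N \<ge> 1"
    and anti: "\<And>x. 0 \<le> x \<Longrightarrow> x \<le> T \<Longrightarrow>
       U (x + 2 * L) + of_real (exp (- decay N * (x + 2 * L))) = - (U x + of_real (exp (- decay N * x)))"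
    and U\<tau>: "U (T - t) \<noteq> 0"
    and small: "\<And>n. n \<ge> 1 \<Longrightarrow> decay n > 0 \<Longrightarrow>
       cmod (integral {0..T} (\<lambda>x. U x * of_real (exp (- decay n * x)))) \<le> K * exp (- decay n * T) / decay n"
    apply (rule control_function[OF L \<tau>, where c = c, folded decay_def])
    subgoal premises p for U U' N K by (rule p(1)[OF p(2-)])
    done
  have Uc: "continuous_on UNIV U" by (rule continuous_on_of_vector_derivative) (use U(1) in simp)
  define u where "u s = U (T - s)" for s
  define I where "I r j = integral {0..r} (\<lambda>s. u s * exp (lam j * of_real (r - s)))" for r j
  \<comment> \<open>Reversing time within \<open>{0..r}\<close> makes the moment at time r start at
    the point \<open>T - r\<close> of \<open>U\<close>: at 0 for the final time, at
    \<open>T - t\<close> for the intermediate one.\<close>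
  have I: "I r j = integral {0..r} (\<lambda>y. U (T - r + y) * exp (lam j * of_real y))" for r j
  proof -
    have "I r j = integral {0..r} (\<lambda>s. (\<lambda>y. U (T - r + y) * exp (lam j * of_real y)) (r - s))"
      unfolding I_def u_def by simp
    then show ?thesis by (rule trans) (rule integral_reflect_Icc[where f = "\<lambda>y. U (T - r + y) * exp (lam j * of_real y)"])
  qed
  define a where "a r j = cnj (tr j) * I r j" for r j
  have uc: "continuous_on {0..r} u" for r unfolding u_def
    by (auto intro!: continuous_intros continuous_on_compose2[OF Uc])
  obtain Np where Np: "\<And>n. n \<ge> Np \<Longrightarrow> n \<ge> 1 \<and> decay n \<ge> real n \<and>
    (real n * pi / L)\<^sup>2 \<le> 2 * decay n \<and> decay n \<le> 2 * (real n * pi / L)\<^sup>2" using decay_large by blast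
  \<comment> \<open>Moments are O(1/|lam j|) and traces are bounded, so the coefficients are O(1/n)
    in the parabolic and O(1/|om m|) in the hyperbolic modes; this already defines a state.\<close>
  have square: "(\<lambda>j. (cmod (a r j))\<^sup>2) summable_on modes" if r: "0 < r" for r
  proof -
    obtain A where A: "A > 0" "\<And>z. Re z \<le> 0 \<Longrightarrow> cmod (z * integral {0..r} (\<lambda>y. U (T - r + y) * exp (z * of_real y))) \<le> A"
      "\<And>p. p > 0 \<Longrightarrow> cmod (p * integral {0..r} (\<lambda>y. U (T - r + y) * exp (of_real (- p) * of_real y)) - U (T - r)) \<le> A / p"
      apply (rule moment_bound[OF U r, where r = "T - r"])
      subgoal premises p for A by (rule p(1)[OF p(2-)])
      done
    have lI: "cmod (lam j) * cmod (I r j) \<le> A" if "Re (lam j) \<le> 0" for j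
      using A(2)[OF that] unfolding I norm_mult .
    obtain B where B: "B \<ge> 0" "\<And>n. lam1 L c n \<noteq> 0 \<Longrightarrow> \<bar>gam L c \<beta> n\<bar> \<le> B * cosh (lam1 L c n * L)"
      using gam_bound by blast
    have "(\<lambda>n. (cmod (a r (Inl n)))\<^sup>2) summable_on {1..}"
    proof (rule summable_on_inverse_squares[where N = Np and C = "(sqrt (2 / L) * B * A)\<^sup>2"])
      fix n assume n: "n \<ge> Np"
      have p: "decay n \<ge> real n" "n \<ge> 1" using Np[OF n] by auto
      then have p1: "decay n > 0" "decay n \<ge> 1" "real n > 0" by linarith+
      have "\<bar>gam L c \<beta> n\<bar> \<le> B * cosh (decay n * L)" using B(2)[of n] p1 by (simp add: lam1_decay)
      then have "\<bar>gam L c \<beta> n\<bar> / (decay n * cosh (decay n * L)) \<le> B * cosh (decay n * L) / (1 * cosh (decay n * L))"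
        using p1 B(1) by (intro frac_le mult_right_mono) auto
      then have "sqrt (2 / L) * (\<bar>gam L c \<beta> n\<bar> / (decay n * cosh (decay n * L))) \<le> sqrt (2 / L) * B"
        using L by (intro mult_left_mono) auto
      then have tb: "cmod (tr (Inl n)) \<le> sqrt (2 / L) * B" unfolding cmod_tr_Inl[OF p1(1)] by simp
      have "cmod (lam (Inl n)) * cmod (I r (Inl n)) \<le> A" using p1 by (intro lI) (simp add: lam_Inl)
      then have "cmod (I r (Inl n)) * decay n \<le> A" using p1 by (simp add: lam_Inl mult.commute)
      then have "cmod (I r (Inl n)) \<le> A / decay n" using p1 by (simp add: pos_le_divide_eq)
      also have "\<dots> \<le> A / real n" using p p1 A by (intro divide_left_mono) auto
      finally have "cmod (a r (Inl n)) \<le> sqrt (2 / L) * B * (A / real n)"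
        unfolding a_def norm_mult complex_mod_cnj using tb B(1) L by (intro mult_mono) auto
      then have "(cmod (a r (Inl n)))\<^sup>2 \<le> (sqrt (2 / L) * B * (A / real n))\<^sup>2" by (rule power_mono) simp
      then show "(cmod (a r (Inl n)))\<^sup>2 \<le> (sqrt (2 / L) * B * A)\<^sup>2 / (real n)\<^sup>2" by (simp add: power_mult_distrib power_divide)
    qed simp
    moreover have "(\<lambda>m. (cmod (a r (Inr m)))\<^sup>2) summable_on UNIV"
    proof (rule summable_on_comparison_test[OF summable_on_cmult_right[OF summable_om, of "A\<^sup>2 / L"]])
      fix m
      have "cmod (lam (Inr m)) * cmod (I r (Inr m)) \<le> A" by (intro lI) (simp add: lam_Inr)
      then have "cmod (I r (Inr m)) * \<bar>om m\<bar> \<le> A" by (simp add: lam_Inr norm_mult mult.commute)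
      then have "cmod (I r (Inr m)) \<le> A / \<bar>om m\<bar>" using om_nz[of m] by (simp add: pos_le_divide_eq)
      then have "(cmod (I r (Inr m)))\<^sup>2 \<le> (A / \<bar>om m\<bar>)\<^sup>2" by (rule power_mono) simp
      then have "1 / L * (cmod (I r (Inr m)))\<^sup>2 \<le> 1 / L * (A / \<bar>om m\<bar>)\<^sup>2" using L by (intro mult_left_mono) auto
      then show "(cmod (a r (Inr m)))\<^sup>2 \<le> A\<^sup>2 / L * (1 / (om m)\<^sup>2)"
        unfolding a_def norm_mult complex_mod_cnj cmod_tr_Inr using L by (simp add: power_mult_distrib power_divide)
    qed simp
    ultimately show ?thesis unfolding summable_on_modes_iff by blast
  qed
  have mild: "\<exists>X\<in>HH L. has_expansion L c \<beta> X (a r) \<and> mild_solution L S 0 u r X" if r: "0 < r" for r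
  proof -
    obtain X where X: "X \<in> HH L" "has_expansion L c \<beta> X (a r)" using has_expansion_exists[OF square[OF r]] by blast
    have "mild_solution L S 0 u r X"
      using mild_solution_expansion[OF less_imp_le[OF r] uc X(1)] X(2) unfolding a_def I_def by blast
    then show ?thesis using X by blast
  qed
  obtain X1 where X1: "X1 \<in> HH L" "has_expansion L c \<beta> X1 (a T)" "mild_solution L S 0 u T X1" using mild[OF T] by blast
  obtain Xt where Xt: "Xt \<in> HH L" "has_expansion L c \<beta> Xt (a t)" "mild_solution L S 0 u t Xt" using mild[OF t(1)] by blast
  have "HUM_control L S T 0 X1 u"
    using HUM_control_criterion[OF T gam Uc N anti] X1(3) unfolding u_def by blast
  then have hum: "HUM_trajectory_at L S T 0 X1 t Xt" using Xt(3) unfolding HUM_trajectory_at_def by blast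
  obtain k Nw K' where k: "k > 0" and w: "\<And>n. n \<ge> Nw \<Longrightarrow> n \<ge> 1 \<and> decay n \<ge> real n \<and>
     k * exp (2 * decay n * T) \<le> V_weight L c \<beta> T (Inl n) * (cmod (tr (Inl n)))\<^sup>2 \<and>
     V_weight L c \<beta> T (Inl n) * (cmod (tr (Inl n)))\<^sup>2 \<le> K' * exp (2 * decay n * T)"
    apply (rule weight_tr_bounds[OF gam, where T = T])
    apply assumption
    subgoal premises p for k N K by (rule p(1)[OF p(2-)])
    done
  have split: "V_weight L c \<beta> T (Inl n) * (cmod (a r (Inl n)))\<^sup>2
     = V_weight L c \<beta> T (Inl n) * (cmod (tr (Inl n)))\<^sup>2 * (cmod (I r (Inl n)))\<^sup>2" for r n
    unfolding a_def norm_mult complex_mod_cnj power_mult_distrib by (rule mult.assoc[symmetric])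
  \<comment> \<open>The weighted traces grow like \<open>exp(2 p T)\<close> and the squared moments
    decay like \<open>exp(- 2 p T) / p^2\<close>; the products are O(1/n^2).\<close>
  have "X1 \<in> V L c \<beta> T"
    unfolding V_iff[OF X1(1,2)] summable_on_modes_iff
  proof
    show "(\<lambda>n. V_weight L c \<beta> T (Inl n) * (cmod (a T (Inl n)))\<^sup>2) summable_on {1..}"
    proof (rule summable_on_inverse_squares[where N = Nw and C = "K' * K\<^sup>2"])
      fix n assume n: "n \<ge> Nw"
      have p: "decay n \<ge> real n" "n \<ge> 1" using w[OF n] by auto
      then have p1: "decay n > 0" "real n > 0" by linarith+
      let ?E = "exp (2 * decay n * T)"
      have K'0: "0 \<le> K'"
      proof -
        have "0 \<le> K' * ?E" using w[OF n] k by (meson mult_nonneg_nonneg order_trans exp_ge_zero less_imp_le)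
        then show ?thesis by (simp add: zero_le_mult_iff)
      qed
      have "I T (Inl n) = integral {0..T} (\<lambda>x. U x * of_real (exp (- decay n * x)))"
        unfolding I lam_Inl by (simp only: of_real_mult[symmetric] exp_of_real) simp
      then have "cmod (I T (Inl n)) \<le> K * exp (- decay n * T) / decay n" using small[OF p(2) p1(1)] by simp
      then have IT: "(cmod (I T (Inl n)))\<^sup>2 \<le> (K * exp (- decay n * T) / decay n)\<^sup>2" by (rule power_mono) simp
      have "V_weight L c \<beta> T (Inl n) * (cmod (a T (Inl n)))\<^sup>2 \<le> K' * ?E * (K * exp (- decay n * T) / decay n)\<^sup>2"
        unfolding split
      proof (rule mult_mono)
        show "V_weight L c \<beta> T (Inl n) * (cmod (tr (Inl n)))\<^sup>2 \<le> K' * ?E" using w[OF n] by blast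
      qed (use K'0 IT in auto)
      also have "\<dots> = K' * K\<^sup>2 * (?E * (exp (- decay n * T))\<^sup>2) / (decay n)\<^sup>2" by (simp add: power_mult_distrib power_divide)
      also have "?E * (exp (- decay n * T))\<^sup>2 = 1"
        unfolding exp_double[symmetric] exp_add[symmetric] by (simp add: algebra_simps)
      also have "K' * K\<^sup>2 * 1 / (decay n)\<^sup>2 \<le> K' * K\<^sup>2 / (real n)\<^sup>2"
        using p p1 K'0 by (simp only: mult_1_right) (intro divide_left_mono power_mono mult_pos_pos zero_less_power mult_nonneg_nonneg, auto)
      finally show "V_weight L c \<beta> T (Inl n) * (cmod (a T (Inl n)))\<^sup>2 \<le> K' * K\<^sup>2 / (real n)\<^sup>2" .
    qed (simp add: V_weight_nonneg)
    show "(\<lambda>m. V_weight L c \<beta> T (Inr m) * (cmod (a T (Inr m)))\<^sup>2) summable_on UNIV"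
      using square[OF T] unfolding summable_on_modes_iff by (simp add: V_weight_def)
  qed
  moreover have "Xt \<notin> V L c \<beta> T"
  proof -
    obtain A where A: "A > 0" "\<And>z. Re z \<le> 0 \<Longrightarrow> cmod (z * integral {0..t} (\<lambda>y. U (T - t + y) * exp (z * of_real y))) \<le> A"
      "\<And>p. p > 0 \<Longrightarrow> cmod (p * integral {0..t} (\<lambda>y. U (T - t + y) * exp (of_real (- p) * of_real y)) - U (T - t)) \<le> A / p"
      apply (rule moment_bound[OF U t(1), where r = "T - t"])
      subgoal premises p for A by (rule p(1)[OF p(2-)])
      done
    let ?\<mu> = "cmod (U (T - t))"
    have \<mu>: "?\<mu> > 0" using U\<tau> by simp
    \<comment> \<open>Beyond this index the error \<open>A / p\<close> in the asymptotics of the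
      moment is at most half of the modulus of \<open>U (T - t)\<close>.\<close>
    obtain M :: nat where M: "2 * A / ?\<mu> < real M" using reals_Archimedean2 by blast
    have "\<not> (\<lambda>n. V_weight L c \<beta> T (Inl n) * (cmod (a t (Inl n)))\<^sup>2) summable_on {1..}"
    proof (rule not_summable_on_bounded_below[where N = "max M Nw" and \<kappa> = "k * (T * ?\<mu> / 2)\<^sup>2"])
      show "0 < k * (T * ?\<mu> / 2)\<^sup>2" using k T \<mu> by simp
      fix n assume n: "n \<ge> max M Nw"
      then have wn: "n \<ge> Nw" "real M \<le> real n" by auto
      have p: "decay n \<ge> real n" "n \<ge> 1" using w[OF wn(1)] by auto
      then have p1: "decay n > 0" "real n > 0" by linarith+
      have "2 * A / ?\<mu> \<le> decay n" using M wn(2) p(1) by linarith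
      then have Ap: "A / decay n \<le> ?\<mu> / 2" using \<mu> p1 by (simp add: field_simps)
      have "?\<mu> \<le> cmod (of_real (decay n) * I t (Inl n)) + cmod (of_real (decay n) * I t (Inl n) - U (T - t))"
        using norm_triangle_sub[of "U (T - t)" "of_real (decay n) * I t (Inl n)"] by (simp add: norm_minus_commute)
      also have "\<dots> \<le> cmod (of_real (decay n) * I t (Inl n)) + ?\<mu> / 2"
        using A(3)[OF p1(1)] Ap unfolding I lam_Inl by linarith
      finally have "?\<mu> / 2 \<le> decay n * cmod (I t (Inl n))" using p1 by (simp add: norm_mult)
      then have lo: "?\<mu> / 2 / decay n \<le> cmod (I t (Inl n))" using p1 by (subst pos_divide_le_eq) (simp_all add: mult.commute mult.left_commute)
      \<comment> \<open>Quadratic growth of the weight suffices: it balances the factor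
        \<open>1 / p^2\<close> of the squared moment, so the terms stay above a positive constant
        and cannot be summable.\<close>
      have "decay n * T \<le> exp (decay n * T)" using exp_ge_add_one_self[of "decay n * T"] by linarith
      then have "(decay n * T)\<^sup>2 \<le> (exp (decay n * T))\<^sup>2" using p1 T by (intro power_mono) auto
      then have e: "(decay n * T)\<^sup>2 \<le> exp (2 * decay n * T)" by (simp add: exp_double[symmetric] mult.assoc)
      have "k * (T * ?\<mu> / 2)\<^sup>2 = k * (decay n * T)\<^sup>2 * (?\<mu> / 2 / decay n)\<^sup>2"
        using p1 by (simp add: power_mult_distrib power_divide)
      also have "\<dots> \<le> V_weight L c \<beta> T (Inl n) * (cmod (tr (Inl n)))\<^sup>2 * (cmod (I t (Inl n)))\<^sup>2"
      proof (rule mult_mono)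
        show "k * (decay n * T)\<^sup>2 \<le> V_weight L c \<beta> T (Inl n) * (cmod (tr (Inl n)))\<^sup>2"
          using w[OF wn(1)] mult_left_mono[OF e, of k] k by linarith
        show "(?\<mu> / 2 / decay n)\<^sup>2 \<le> (cmod (I t (Inl n)))\<^sup>2" using lo p1 by (intro power_mono) auto
      qed (auto simp: V_weight_nonneg)
      finally show "k * (T * ?\<mu> / 2)\<^sup>2 \<le> V_weight L c \<beta> T (Inl n) * (cmod (a t (Inl n)))\<^sup>2" unfolding split .
    qed (simp add: V_weight_nonneg)
    then show ?thesis unfolding V_iff[OF Xt(1,2)] summable_on_modes_iff by blast
  qed
  ultimately show ?thesis using hum by blast
qed

end

theorem proposition1:
  fixes L c T :: real
    and \<beta> :: "real \<Rightarrow> real"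
    and T0 :: "real \<Rightarrow> state \<Rightarrow> state"
  assumes L: "L > 0"
    and beta: "\<beta> \<in> Linfty L"
    and T0: "generates L (dom_A L) (op_A L c \<beta>) T0"
    and gamma: "\<forall>n\<ge>1. gam L c \<beta> n \<noteq> 0"
    and T: "T > 2 * L"
  shows "(\<forall>t\<ge>0. (\<forall>X \<in> V L c \<beta> T. T0 t X \<in> V L c \<beta> T) \<and>
            (\<exists>C. \<forall>X \<in> V L c \<beta> T. V_norm L c \<beta> T (T0 t X) \<le> C * V_norm L c \<beta> T X))
       \<and> (\<forall>t. 0 < t \<and> t < T \<longrightarrow>
            (\<exists>X0 \<in> V L c \<beta> T. \<exists>X1 \<in> V L c \<beta> T. \<exists>Xt.
               HUM_trajectory_at L T0 T X0 X1 t Xt \<and> Xt \<notin> V L c \<beta> T))"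
proof -
  interpret wave_heat_semigroup L c \<beta> T0
    by unfold_locales (use L beta T0 in auto)
  show ?thesis
  proof (intro conjI allI impI ballI)
    fix t :: real assume t: "t \<ge> 0"
    show "T0 t X \<in> V L c \<beta> T" if "X \<in> V L c \<beta> T" for X by (rule S_restricts_to_V(1)[OF t that])
    show "\<exists>C. \<forall>X\<in>V L c \<beta> T. V_norm L c \<beta> T (T0 t X) \<le> C * V_norm L c \<beta> T X"
      using S_restricts_to_V(2)[OF t] by blast
  next
    fix t assume t: "0 < t \<and> t < T"
    have "\<exists>X1\<in>V L c \<beta> T. \<exists>Xt. HUM_trajectory_at L T0 T 0 X1 t Xt \<and> Xt \<notin> V L c \<beta> T"
      using gamma t by (intro HUM_trajectory_leaves_V) auto
    then show "\<exists>X0\<in>V L c \<beta> T. \<exists>X1\<in>V L c \<beta> T. \<exists>Xt. HUM_trajectory_at L T0 T X0 X1 t Xt \<and> Xt \<notin> V L c \<beta> T"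
      using zero_in_V by blast
  qed
qed

end
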